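(* Assume that the family of vectors $\widetilde{\mathcal W}$ (defined in the context) is a basis of $\mathbb C^k$. Assume moreover that there is $\lambda\ge 0$ such that for all $\mathsf v\in\mathsf V$ the space $Y_{\mathsf v}$ is a subspace of the nonpositive isotropic cone of the quadratic form associated with $T_{\mathsf v}+Q_{\mathsf v}B_{\mathsf v}+B_{\mathsf v}^*Q_{\mathsf v}-\lambda P^{(d)}_{\mathsf v}Q_{\mathsf v}P^{(d)}_{\mathsf v}$, i.e. $$T_{\mathsf v}\xi\cdot\bar\xi+2\,\mathrm{Re}\,\big(Q_{\mathsf v}B_{\mathsf v}\xi\cdot\bar\xi\big)-\lambda\, Q_{\mathsf v}P^{(d)}_{\mathsf v}\xi\cdot\overline{P^{(d)}_{\mathsf v}\xi}\le 0\qquad\text{for all }\xi\in Y_{\mathsf v},\ \mathsf v\in\mathsf V .$$ Then the operator $\mathbb A$ generates a strongly continuous semigroup on $\mathbf L^2_d(\mathcal G)$.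
   Context: Graph. $\mathsf G=(\mathsf V,\mathsf E)$ is a nonempty finite graph without loops, each edge $\mathsf e$ being oriented (with an initial and a terminal endpoint) and identified with an interval $[0,\ell_{\mathsf e}]$, $\ell_{\mathsf e}>0$, where $0$ corresponds to the initial and $\ell_{\mathsf e}$ to the terminal endpoint. $(k_{\mathsf e})_{\mathsf e\in\mathsf E}$ are positive integers, $\mathsf E_{\mathsf v}$ is the set of edges incident with $\mathsf v$, $k:=\sum_{\mathsf e\in\mathsf E}k_{\mathsf e}$, $k_{\mathsf v}:=\sum_{\mathsf e\in\mathsf E_{\mathsf v}}k_{\mathsf e}$. Let $\iota_{\mathsf v\mathsf e}=1$ if $\mathsf v$ is the terminal endpoint of $\mathsf e$, $-1$ if it is the initial endpoint, and $0$ otherwise. For a function $f$ on $[0,\ell_{\mathsf e}]$, $f(\mathsf v)$ is its value at the endpoint corresponding to $\mathsf v$. Coefficients. For each $\mathsf e$: $M_{\mathsf e}:[0,\ell_{\mathsf e}]\to M_{k_{\mathsf e}}(\mathbb C)$ is Lipschitz continuous with $M_{\mathsf e}(x)$ invertible for every $x$; $N_{\mathsf e}:[0,\ell_{\mathsf e}]\to M_{k_{\mathsf e}}(\mathbb C)$ is of class $L^\infty$; $Q_{\mathsf e}:[0,\ell_{\mathsf e}]\to M_{k_{\mathsf e}}(\mathbb C)$ is Lipschitz continuous, $Q_{\mathsf e}(x)$ and $Q_{\mathsf e}(x)M_{\mathsf e}(x)$ are Hermitian for all $x$, and there is $q>0$ with $Q_{\mathsf e}(x)\xi\cdot\bar\xi\ge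 q\|\xi\|^2$ for all $\xi\in\mathbb C^{k_{\mathsf e}}$ and all $x$. Here $a\cdot b=\sum_i a_ib_i$. Vertex data. For each $\mathsf v\in\mathsf V$: $Y^{(d)}_{\mathsf v}\subset Y_{\mathsf v}$ are subspaces of $\mathbb C^{k_{\mathsf v}}$; $B_{\mathsf v}:Y_{\mathsf v}\to Y^{(d)}_{\mathsf v}$ and $C_{\mathsf v}:Y^{(d)}_{\mathsf v}\to Y^{(d)}_{\mathsf v}$ are linear; $Q_{\mathsf v}$ is a Hermitian positive definite operator on $Y^{(d)}_{\mathsf v}$. Adjoints ($B_{\mathsf v}^*:Y^{(d)}_{\mathsf v}\to Y_{\mathsf v}$) and orthogonality are with respect to the Euclidean inner product. $P^{(d)}_{\mathsf v}$ is the orthogonal projector of $\mathbb C^{k_{\mathsf v}}$ onto $Y^{(d)}_{\mathsf v}$, and $U^\perp$ is the orthogonal complement of $U$ in $\mathbb C^{k_{\mathsf v}}$. Put $\gamma_{\mathsf v}(u):=(u_{\mathsf e}(\mathsf v))_{\mathsf e\in\mathsf E_{\mathsf v}}\in\mathbb C^{k_{\mathsf v}}$ and let $T_{\mathsf v}:=\mathrm{diag}\big(Q_{\mathsf e}(\mathsf v)M_{\mathsf e}(\mathsf v)\iota_{\mathsf v\mathsf e}\big)_{\mathsf e\in\mathsf E_{\mathsf v}}$ (a block diagonal $k_{\mathsf v}\times k_{\mathsf v}$ matrix). Spaces and operator. $\mathbf L^2(\mathcal G):=\bigoplus_{\mathsf e}L^2(0,\ell_{\mathsf e})^{k_{\mathsf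 e}}$, $Y^{(d)}:=\bigoplus_{\mathsf v}Y^{(d)}_{\mathsf v}$, and $\mathbf L^2_d(\mathcal G):=\mathbf L^2(\mathcal G)\oplus Y^{(d)}$ with inner product $\big((u,\mathsf x),(v,\mathsf y)\big)_d=\sum_{\mathsf e}\int_0^{\ell_{\mathsf e}}Q_{\mathsf e}u_{\mathsf e}\cdot\bar v_{\mathsf e}\,dx+\sum_{\mathsf v}Q_{\mathsf v}\mathsf x_{\mathsf v}\cdot\bar{\mathsf y}_{\mathsf v}$. With $D_{\max}:=\bigoplus_{\mathsf e}H^1(0,\ell_{\mathsf e})^{k_{\mathsf e}}$, the operator $\mathbb A$ on $\mathbf L^2_d(\mathcal G)$ has domain $$D(\mathbb A)=\{(u,\mathsf x)\in D_{\max}\oplus Y^{(d)}:\ \gamma_{\mathsf v}(u)\in Y_{\mathsf v}\text{ and }\mathsf x_{\mathsf v}=P^{(d)}_{\mathsf v}\gamma_{\mathsf v}(u)\text{ for all }\mathsf v\in\mathsf V\}$$ and acts as $\mathbb A(u,\mathsf x)=\big((M_{\mathsf e}u_{\mathsf e}'+N_{\mathsf e}u_{\mathsf e})_{\mathsf e\in\mathsf E},\ (B_{\mathsf v}\gamma_{\mathsf v}(u)+C_{\mathsf v}\mathsf x_{\mathsf v})_{\mathsf v\in\mathsf V}\big)$. The family $\widetilde{\mathcal W}$. For each $\mathsf v$ fix bases $\{\mathsf w^{(\mathsf v,i)}\}_i$ of $Y_{\mathsf v}^\perp$, $\{\mathsf y^{(\mathsf v,j)}\}_j$ of $\mathrm{Ran}\,B_{\mathsf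 v}$, and $\{\mathsf w^{(\mathsf v,l)}_{KB^*}\}_l$ of $\mathrm{Ker}\,B_{\mathsf v}^*\subset Y^{(d)}_{\mathsf v}$, and let $\mathsf w^{(\mathsf v,j)}_{RB^*}:=B_{\mathsf v}^*\mathsf y^{(\mathsf v,j)}$. For $\mathsf w\in\mathbb C^{k_{\mathsf v}}$, written as $(\mathsf w_{\mathsf e})_{\mathsf e\in\mathsf E_{\mathsf v}}$, let $\widetilde{\mathsf w}\in\mathbb C^k$ be its extension by $0$ to the components $\mathsf e\notin\mathsf E_{\mathsf v}$. Then $\widetilde{\mathcal W}$ is the family (over all $\mathsf v\in\mathsf V$ and all indices $i,j,l$) of all the vectors $\widetilde{\mathsf w}^{(\mathsf v,i)}$, $\widetilde{\mathsf w}^{(\mathsf v,j)}_{RB^*}$, $\widetilde{\mathsf w}^{(\mathsf v,l)}_{KB^*}$ in $\mathbb C^k$. *)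

theory Defs
  imports
    "HOL-Analysis.Analysis"
    "HOL-Library.Function_Algebras"
    "Jordan_Normal_Form.Schur_Decomposition"
    "Graph_Theory.Digraph"
begin

section \<open>Coordinate spaces and linear algebra on their subspaces\<close>

text \<open>
  For a finite index set \<open>J\<close> the space \<open>C^J\<close> is realised as the space of all complex functions on
  the index type that vanish off \<open>J\<close>. Hence, for \<open>J \<subseteq> J'\<close>, the extension by zero of an element of
  \<open>C^J\<close> to an element of \<open>C^J'\<close> is that same function.
\<close>

definition coord_space :: "'a set \<Rightarrow> ('a \<Rightarrow> complex) set" where
  "coord_space J = {\<xi>. \<forall>j. j \<notin> J \<longrightarrow> \<xi> j = 0}"

definition cfscale :: "complex \<Rightarrow> ('a \<Rightarrow> complex) \<Rightarrow> 'a \<Rightarrow> complex" where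
  "cfscale c \<xi> = (\<lambda>j. c * \<xi> j)"

global_interpretation cvs: vector_space cfscale
  by unfold_locales (auto simp: cfscale_def fun_eq_iff algebra_simps)

definition herm_ip :: "'a set \<Rightarrow> ('a \<Rightarrow> complex) \<Rightarrow> ('a \<Rightarrow> complex) \<Rightarrow> complex" where
  "herm_ip J \<xi> \<eta> = (\<Sum>j\<in>J. \<xi> j * cnj (\<eta> j))"

definition orth_compl :: "'a set \<Rightarrow> ('a \<Rightarrow> complex) set \<Rightarrow> ('a \<Rightarrow> complex) set" where
  "orth_compl J U = {\<xi> \<in> coord_space J. \<forall>\<eta>\<in>U. herm_ip J \<xi> \<eta> = 0}"

definition orth_projector :: "'a set \<Rightarrow> ('a \<Rightarrow> complex) set \<Rightarrow> ('a \<Rightarrow> complex) \<Rightarrow> 'a \<Rightarrow> complex" where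
  "orth_projector J U \<xi> = (THE \<eta>. \<eta> \<in> U \<and> \<xi> - \<eta> \<in> orth_compl J U)"

definition linear_between ::
  "('a \<Rightarrow> complex) set \<Rightarrow> ('a \<Rightarrow> complex) set \<Rightarrow> (('a \<Rightarrow> complex) \<Rightarrow> 'a \<Rightarrow> complex) \<Rightarrow> bool" where
  "linear_between U W F \<longleftrightarrow>
     (\<forall>\<xi>\<in>U. F \<xi> \<in> W) \<and>
     (\<forall>\<xi>\<in>U. \<forall>\<eta>\<in>U. F (\<xi> + \<eta>) = F \<xi> + F \<eta>) \<and>
     (\<forall>c. \<forall>\<xi>\<in>U. F (cfscale c \<xi>) = cfscale c (F \<xi>))"

text \<open>The adjoint \<open>W \<rightarrow> U\<close> of a linear map \<open>F : U \<rightarrow> W\<close> between subspaces of \<open>C^J\<close>.\<close>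

definition adjoint_between ::
  "'a set \<Rightarrow> ('a \<Rightarrow> complex) set \<Rightarrow> (('a \<Rightarrow> complex) \<Rightarrow> 'a \<Rightarrow> complex) \<Rightarrow> ('a \<Rightarrow> complex) \<Rightarrow> 'a \<Rightarrow> complex"
  where
  "adjoint_between J U F \<eta> = (THE \<zeta>. \<zeta> \<in> U \<and> (\<forall>\<xi>\<in>U. herm_ip J (F \<xi>) \<eta> = herm_ip J \<xi> \<zeta>))"

text \<open>
  A basis given as a family; injectivity matters, since a family with a repeated vector is linearly
  dependent.
\<close>

definition basis_family :: "('a \<Rightarrow> complex) set \<Rightarrow> 'i set \<Rightarrow> ('i \<Rightarrow> 'a \<Rightarrow> complex) \<Rightarrow> bool" where
  "basis_family U I b \<longleftrightarrow>
     inj_on b I \<and> \<not> cvs.dependent (b ` I) \<and> cvs.span (b ` I) = U"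


section \<open>Lebesgue and Sobolev spaces on an interval\<close>

text \<open>
  Elements of \<open>L^2\<close> and \<open>H^1\<close> are represented by functions; every notion below is invariant under
  modification on null sets.
\<close>

abbreviation leb :: "real \<Rightarrow> real measure" where
  "leb l \<equiv> lebesgue_on {0<..<l}"

definition L2_space :: "real \<Rightarrow> (real \<Rightarrow> complex) set" where
  "L2_space l = {f \<in> borel_measurable (leb l). integrable (leb l) (\<lambda>x. (cmod (f x))\<^sup>2)}"

definition Linf_space :: "real \<Rightarrow> (real \<Rightarrow> complex) set" where
  "Linf_space l = {f \<in> borel_measurable (leb l). \<exists>K. AE x in leb l. cmod (f x) \<le> K}"

text \<open>Test functions are compactly supported \<open>C^1\<close> functions, as in Brezis' treatment of
  \<open>W^{1,p}(I)\<close>.\<close>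

definition test_functions :: "real \<Rightarrow> (real \<Rightarrow> real) set" where
  "test_functions l = {\<phi>. \<phi> C1_differentiable_on UNIV \<and>
     closure {x. \<phi> x \<noteq> 0} \<subseteq> {0<..<l} \<and> compact (closure {x. \<phi> x \<noteq> 0})}"

definition weak_derivative :: "real \<Rightarrow> (real \<Rightarrow> complex) \<Rightarrow> (real \<Rightarrow> complex) \<Rightarrow> bool" where
  "weak_derivative l f g \<longleftrightarrow>
     (\<forall>\<phi>\<in>test_functions l.
        (LINT x|leb l. f x * of_real (deriv \<phi> x)) = - (LINT x|leb l. g x * of_real (\<phi> x)))"

definition H1_space :: "real \<Rightarrow> (real \<Rightarrow> complex) set" where
  "H1_space l = {f \<in> L2_space l. \<exists>g\<in>L2_space l. weak_derivative l f g}"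

definition wderiv :: "real \<Rightarrow> (real \<Rightarrow> complex) \<Rightarrow> real \<Rightarrow> complex" where
  "wderiv l f = (SOME g. g \<in> L2_space l \<and> weak_derivative l f g)"

text \<open>Point values of an \<open>H^1\<close> function on the closed interval are those of its continuous
  representative, which is unique there.\<close>

definition cont_rep :: "real \<Rightarrow> (real \<Rightarrow> complex) \<Rightarrow> real \<Rightarrow> complex" where
  "cont_rep l f = (SOME h. continuous_on {0..l} h \<and> (AE x in leb l. h x = f x))"


section \<open>Strongly continuous semigroups\<close>

text \<open>
  The underlying Banach space is the quotient of the carrier \<open>X\<close> (a complex vector space with scalar
  multiplication \<open>sc\<close>) by the null space of the seminorm \<open>p\<close>; elements \<open>x, y\<close> with \<open>p (x - y) = 0\<close>
  are identified. Bounded linear operators on the quotient are represented by maps on \<open>X\<close>; that such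
  a map respects the identification follows from linearity and the bound.
\<close>

definition bounded_op ::
  "'x::ab_group_add set \<Rightarrow> (complex \<Rightarrow> 'x \<Rightarrow> 'x) \<Rightarrow> ('x \<Rightarrow> real) \<Rightarrow> ('x \<Rightarrow> 'x) \<Rightarrow> bool" where
  "bounded_op X sc p F \<longleftrightarrow>
     (\<forall>x\<in>X. F x \<in> X) \<and>
     (\<forall>x\<in>X. \<forall>y\<in>X. p (F (x + y) - (F x + F y)) = 0) \<and>
     (\<forall>c. \<forall>x\<in>X. p (F (sc c x) - sc c (F x)) = 0) \<and>
     (\<exists>K. \<forall>x\<in>X. p (F x) \<le> K * p x)"

definition C0_semigroup ::
  "'x::ab_group_add set \<Rightarrow> (complex \<Rightarrow> 'x \<Rightarrow> 'x) \<Rightarrow> ('x \<Rightarrow> real) \<Rightarrow> (real \<Rightarrow> 'x \<Rightarrow> 'x) \<Rightarrow> bool" where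
  "C0_semigroup X sc p T \<longleftrightarrow>
     (\<forall>t\<ge>0. bounded_op X sc p (T t)) \<and>
     (\<forall>x\<in>X. p (T 0 x - x) = 0) \<and>
     (\<forall>s\<ge>0. \<forall>t\<ge>0. \<forall>x\<in>X. p (T (s + t) x - T s (T t x)) = 0) \<and>
     (\<forall>x\<in>X. \<forall>t\<ge>0. ((\<lambda>s. p (T s x - T t x)) \<longlongrightarrow> 0) (at t within {0..}))"

definition generator_graph ::
  "'x::ab_group_add set \<Rightarrow> (complex \<Rightarrow> 'x \<Rightarrow> 'x) \<Rightarrow> ('x \<Rightarrow> real) \<Rightarrow> (real \<Rightarrow> 'x \<Rightarrow> 'x) \<Rightarrow> ('x \<times> 'x) set"
  where
  "generator_graph X sc p T = {(x, y). x \<in> X \<and> y \<in> X \<and>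
     ((\<lambda>h. p (sc (of_real (1 / h)) (T h x - x) - y)) \<longlongrightarrow> 0) (at_right 0)}"

definition generates_C0_semigroup ::
  "'x::ab_group_add set \<Rightarrow> (complex \<Rightarrow> 'x \<Rightarrow> 'x) \<Rightarrow> ('x \<Rightarrow> real) \<Rightarrow> 'x set \<Rightarrow> ('x \<Rightarrow> 'x) \<Rightarrow> bool" where
  "generates_C0_semigroup X sc p D A \<longleftrightarrow>
     (\<exists>T. C0_semigroup X sc p T \<and>
          generator_graph X sc p T = {(x, y). x \<in> D \<and> y \<in> X \<and> p (y - A x) = 0} \<and>
          (\<forall>x\<in>D. A x \<in> X))"


section \<open>Hyperbolic systems on networks\<close>

text \<open>
  The orientation of the edge \<open>e\<close> is from \<open>tail\<close> to \<open>head\<close>, so \<open>tail\<close> sits at \<open>0\<close> and \<open>head\<close> at the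
  length of \<open>e\<close>. An index \<open>(e, i)\<close> with \<open>i < edge_dim S e\<close> stands for the \<open>i\<close>-th component on the
  edge \<open>e\<close>.
\<close>

record ('v, 'e) network =
  net_graph :: "('v, 'e) pre_digraph"
  edge_length :: "'e \<Rightarrow> real"
  edge_dim :: "'e \<Rightarrow> nat"
  coef_M :: "'e \<Rightarrow> real \<Rightarrow> complex mat"
  coef_N :: "'e \<Rightarrow> real \<Rightarrow> complex mat"
  coef_Q :: "'e \<Rightarrow> real \<Rightarrow> complex mat"
  vert_Y :: "'v \<Rightarrow> ('e \<times> nat \<Rightarrow> complex) set"
  vert_Yd :: "'v \<Rightarrow> ('e \<times> nat \<Rightarrow> complex) set"
  vert_B :: "'v \<Rightarrow> ('e \<times> nat \<Rightarrow> complex) \<Rightarrow> 'e \<times> nat \<Rightarrow> complex"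
  vert_C :: "'v \<Rightarrow> ('e \<times> nat \<Rightarrow> complex) \<Rightarrow> 'e \<times> nat \<Rightarrow> complex"
  vert_Q :: "'v \<Rightarrow> ('e \<times> nat \<Rightarrow> complex) \<Rightarrow> 'e \<times> nat \<Rightarrow> complex"

abbreviation net_V :: "('v, 'e) network \<Rightarrow> 'v set" where
  "net_V S \<equiv> verts (net_graph S)"

abbreviation net_E :: "('v, 'e) network \<Rightarrow> 'e set" where
  "net_E S \<equiv> arcs (net_graph S)"

definition incident :: "('v, 'e) network \<Rightarrow> 'v \<Rightarrow> 'e set" where
  "incident S v = {e \<in> net_E S. v = tail (net_graph S) e \<or> v = head (net_graph S) e}"

definition all_idx :: "('v, 'e) network \<Rightarrow> ('e \<times> nat) set" where
  "all_idx S = (SIGMA e:net_E S. {..<edge_dim S e})"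

definition vert_idx :: "('v, 'e) network \<Rightarrow> 'v \<Rightarrow> ('e \<times> nat) set" where
  "vert_idx S v = (SIGMA e:incident S v. {..<edge_dim S e})"

definition incidence :: "('v, 'e) network \<Rightarrow> 'v \<Rightarrow> 'e \<Rightarrow> complex" where
  "incidence S v e =
     (if v = head (net_graph S) e then 1 else if v = tail (net_graph S) e then - 1 else 0)"

text \<open>The point of \<open>[0, l_e]\<close> that corresponds to the endpoint \<open>v\<close> of \<open>e\<close>.\<close>

definition endpoint :: "('v, 'e) network \<Rightarrow> 'v \<Rightarrow> 'e \<Rightarrow> real" where
  "endpoint S v e = (if v = head (net_graph S) e then edge_length S e else 0)"

abbreviation vert_ip ::
  "('v, 'e) network \<Rightarrow> 'v \<Rightarrow> ('e \<times> nat \<Rightarrow> complex) \<Rightarrow> ('e \<times> nat \<Rightarrow> complex) \<Rightarrow> complex" where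
  "vert_ip S v \<equiv> herm_ip (vert_idx S v)"

definition proj_d :: "('v, 'e) network \<Rightarrow> 'v \<Rightarrow> ('e \<times> nat \<Rightarrow> complex) \<Rightarrow> 'e \<times> nat \<Rightarrow> complex" where
  "proj_d S v = orth_projector (vert_idx S v) (vert_Yd S v)"

definition adj_B :: "('v, 'e) network \<Rightarrow> 'v \<Rightarrow> ('e \<times> nat \<Rightarrow> complex) \<Rightarrow> 'e \<times> nat \<Rightarrow> complex" where
  "adj_B S v = adjoint_between (vert_idx S v) (vert_Y S v) (vert_B S v)"

text \<open>The block diagonal matrix \<open>T_v\<close>, acting on \<open>C^{k_v}\<close>.\<close>

definition vert_T :: "('v, 'e) network \<Rightarrow> 'v \<Rightarrow> ('e \<times> nat \<Rightarrow> complex) \<Rightarrow> 'e \<times> nat \<Rightarrow> complex" where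
  "vert_T S v \<xi> = (\<lambda>(e, i). if (e, i) \<in> vert_idx S v
     then \<Sum>j<edge_dim S e.
       (coef_Q S e (endpoint S v e) * coef_M S e (endpoint S v e)) $$ (i, j) * incidence S v e * \<xi> (e, j)
     else 0)"

locale hyperbolic_network =
  fixes S :: "('v, 'e) network"
  assumes finite_graph: "fin_digraph (net_graph S)"
    and no_loops: "loopfree_digraph (net_graph S)"
    and nonempty_graph: "net_V S \<noteq> {}"
    and length_pos: "e \<in> net_E S \<Longrightarrow> 0 < edge_length S e"
    and dim_pos: "e \<in> net_E S \<Longrightarrow> 0 < edge_dim S e"
    and M_carrier: "\<lbrakk>e \<in> net_E S; x \<in> {0..edge_length S e}\<rbrakk> \<Longrightarrow>
          coef_M S e x \<in> carrier_mat (edge_dim S e) (edge_dim S e)"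
    and M_lipschitz: "\<lbrakk>e \<in> net_E S; i < edge_dim S e; j < edge_dim S e\<rbrakk> \<Longrightarrow>
          \<exists>L. L-lipschitz_on {0..edge_length S e} (\<lambda>x. coef_M S e x $$ (i, j))"
    and M_invertible: "\<lbrakk>e \<in> net_E S; x \<in> {0..edge_length S e}\<rbrakk> \<Longrightarrow> invertible_mat (coef_M S e x)"
    and N_carrier: "\<lbrakk>e \<in> net_E S; x \<in> {0..edge_length S e}\<rbrakk> \<Longrightarrow>
          coef_N S e x \<in> carrier_mat (edge_dim S e) (edge_dim S e)"
    and N_Linf: "\<lbrakk>e \<in> net_E S; i < edge_dim S e; j < edge_dim S e\<rbrakk> \<Longrightarrow>
          (\<lambda>x. coef_N S e x $$ (i, j)) \<in> Linf_space (edge_length S e)"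
    and Q_carrier: "\<lbrakk>e \<in> net_E S; x \<in> {0..edge_length S e}\<rbrakk> \<Longrightarrow>
          coef_Q S e x \<in> carrier_mat (edge_dim S e) (edge_dim S e)"
    and Q_lipschitz: "\<lbrakk>e \<in> net_E S; i < edge_dim S e; j < edge_dim S e\<rbrakk> \<Longrightarrow>
          \<exists>L. L-lipschitz_on {0..edge_length S e} (\<lambda>x. coef_Q S e x $$ (i, j))"
    and Q_hermitian: "\<lbrakk>e \<in> net_E S; x \<in> {0..edge_length S e}\<rbrakk> \<Longrightarrow>
          mat_adjoint (coef_Q S e x) = coef_Q S e x"
    and QM_hermitian: "\<lbrakk>e \<in> net_E S; x \<in> {0..edge_length S e}\<rbrakk> \<Longrightarrow>
          mat_adjoint (coef_Q S e x * coef_M S e x) = coef_Q S e x * coef_M S e x"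
    and Q_coercive: "e \<in> net_E S \<Longrightarrow> \<exists>q>0. \<forall>x\<in>{0..edge_length S e}.
          \<forall>\<xi>\<in>carrier_vec (edge_dim S e).
            Re ((coef_Q S e x *\<^sub>v \<xi>) \<bullet>c \<xi>) \<ge> q * Re (\<xi> \<bullet>c \<xi>)"
    and Y_subspace: "v \<in> net_V S \<Longrightarrow>
          cvs.subspace (vert_Y S v) \<and> vert_Y S v \<subseteq> coord_space (vert_idx S v)"
    and Yd_subspace: "v \<in> net_V S \<Longrightarrow> cvs.subspace (vert_Yd S v) \<and> vert_Yd S v \<subseteq> vert_Y S v"
    and B_linear: "v \<in> net_V S \<Longrightarrow> linear_between (vert_Y S v) (vert_Yd S v) (vert_B S v)"
    and C_linear: "v \<in> net_V S \<Longrightarrow> linear_between (vert_Yd S v) (vert_Yd S v) (vert_C S v)"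
    and Qv_linear: "v \<in> net_V S \<Longrightarrow> linear_between (vert_Yd S v) (vert_Yd S v) (vert_Q S v)"
    and Qv_hermitian: "\<lbrakk>v \<in> net_V S; \<xi> \<in> vert_Yd S v; \<eta> \<in> vert_Yd S v\<rbrakk> \<Longrightarrow>
          vert_ip S v (vert_Q S v \<xi>) \<eta> = vert_ip S v \<xi> (vert_Q S v \<eta>)"
    and Qv_pos_def: "\<lbrakk>v \<in> net_V S; \<xi> \<in> vert_Yd S v; \<xi> \<noteq> 0\<rbrakk> \<Longrightarrow>
          0 < Re (vert_ip S v (vert_Q S v \<xi>) \<xi>)"

text \<open>
  Elements of \<open>L^2_d\<close>: only the components \<open>u (e, i)\<close> with \<open>(e, i) \<in> all_idx S\<close> and \<open>x v\<close> with
  \<open>v \<in> net_V S\<close> are relevant; the seminorm below ignores all the others.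
\<close>

type_synonym ('v, 'e) net_state = "('e \<times> nat \<Rightarrow> real \<Rightarrow> complex) \<times> ('v \<Rightarrow> 'e \<times> nat \<Rightarrow> complex)"

definition L2d :: "('v, 'e) network \<Rightarrow> ('v, 'e) net_state set" where
  "L2d S = {(u, x).
     (\<forall>(e, i)\<in>all_idx S. u (e, i) \<in> L2_space (edge_length S e)) \<and>
     (\<forall>v\<in>net_V S. x v \<in> vert_Yd S v)}"

definition scale_d :: "complex \<Rightarrow> ('v, 'e) net_state \<Rightarrow> ('v, 'e) net_state" where
  "scale_d c = (\<lambda>(u, x). (\<lambda>j t. c * u j t, \<lambda>v j. c * x v j))"

definition ip_d :: "('v, 'e) network \<Rightarrow> ('v, 'e) net_state \<Rightarrow> ('v, 'e) net_state \<Rightarrow> complex" where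
  "ip_d S = (\<lambda>(u, x) (w, y).
     (\<Sum>e\<in>net_E S. LINT t|leb (edge_length S e).
        (\<Sum>i<edge_dim S e. (\<Sum>j<edge_dim S e. coef_Q S e t $$ (i, j) * u (e, j) t) * cnj (w (e, i) t))) +
     (\<Sum>v\<in>net_V S. vert_ip S v (vert_Q S v (x v)) (y v)))"

definition norm_d :: "('v, 'e) network \<Rightarrow> ('v, 'e) net_state \<Rightarrow> real" where
  "norm_d S z = sqrt (Re (ip_d S z z))"

definition D_max :: "('v, 'e) network \<Rightarrow> ('e \<times> nat \<Rightarrow> real \<Rightarrow> complex) set" where
  "D_max S = {u. \<forall>(e, i)\<in>all_idx S. u (e, i) \<in> H1_space (edge_length S e)}"

definition vert_trace ::
  "('v, 'e) network \<Rightarrow> 'v \<Rightarrow> ('e \<times> nat \<Rightarrow> real \<Rightarrow> complex) \<Rightarrow> 'e \<times> nat \<Rightarrow> complex" where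
  "vert_trace S v u = (\<lambda>(e, i). if (e, i) \<in> vert_idx S v
     then cont_rep (edge_length S e) (u (e, i)) (endpoint S v e) else 0)"

definition op_dom :: "('v, 'e) network \<Rightarrow> ('v, 'e) net_state set" where
  "op_dom S = {(u, x). u \<in> D_max S \<and> (\<forall>v\<in>net_V S. x v \<in> vert_Yd S v) \<and>
     (\<forall>v\<in>net_V S. vert_trace S v u \<in> vert_Y S v \<and> x v = proj_d S v (vert_trace S v u))}"

definition op_A :: "('v, 'e) network \<Rightarrow> ('v, 'e) net_state \<Rightarrow> ('v, 'e) net_state" where
  "op_A S = (\<lambda>(u, x).
     (\<lambda>(e, i) t. (\<Sum>j<edge_dim S e. coef_M S e t $$ (i, j) * wderiv (edge_length S e) (u (e, j)) t) +
                 (\<Sum>j<edge_dim S e. coef_N S e t $$ (i, j) * u (e, j) t),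
      \<lambda>v. vert_B S v (vert_trace S v u) + vert_C S v (x v)))"


section \<open>The family of boundary vectors\<close>

datatype boundary_index = Perp nat | Ran_adj nat | Ker_adj nat

text \<open>
  At the vertex \<open>v\<close>, the given bases of the orthogonal complement of \<open>Y_v\<close>, of \<open>Ran B_v\<close> and of
  \<open>Ker B_v^*\<close> are \<open>w v i\<close> (\<open>i < a v\<close>), \<open>y v j\<close> (\<open>j < b v\<close>) and \<open>wK v l\<close> (\<open>l < c v\<close>). The extension by
  zero is the identity in the present encoding of the coordinate spaces.
\<close>

definition W_index ::
  "('v, 'e) network \<Rightarrow> ('v \<Rightarrow> nat) \<Rightarrow> ('v \<Rightarrow> nat) \<Rightarrow> ('v \<Rightarrow> nat) \<Rightarrow> ('v \<times> boundary_index) set" where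
  "W_index S a b c =
     (SIGMA v:net_V S. Perp ` {..<a v} \<union> Ran_adj ` {..<b v} \<union> Ker_adj ` {..<c v})"

fun W_family ::
  "('v, 'e) network \<Rightarrow> ('v \<Rightarrow> nat \<Rightarrow> 'e \<times> nat \<Rightarrow> complex) \<Rightarrow> ('v \<Rightarrow> nat \<Rightarrow> 'e \<times> nat \<Rightarrow> complex) \<Rightarrow>
   ('v \<Rightarrow> nat \<Rightarrow> 'e \<times> nat \<Rightarrow> complex) \<Rightarrow> 'v \<times> boundary_index \<Rightarrow> 'e \<times> nat \<Rightarrow> complex" where
  "W_family S w y wK (v, Perp i) = w v i"
| "W_family S w y wK (v, Ran_adj j) = adj_B S v (y v j)"
| "W_family S w y wK (v, Ker_adj l) = wK v l"

end

theory Submission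
  imports Defs "HOL-Probability.Discrete_Topology"
begin

text \<open>
  The idea is to apply the Lumer--Phillips theorem in the energy space \<open>L^2_d\<close>, whose inner product
  is weighted by the symmetrizers \<open>Q_e\<close> and \<open>Q_v\<close>. Two facts are needed: some shift \<open>A - \<omega>\<close> is
  dissipative, and \<open>\<lambda> - A\<close> is onto for \<open>\<lambda> > \<omega>\<close>.

  Dissipativity (\<open>quasi_dissipative\<close>). On an edge, \<open>Q M\<close> is Hermitian and Lipschitz, so integration by
  parts turns \<open>2 Re (\<integral> Q M u' \<bullet> u)\<close> into the difference of the flux \<open>Q M u \<bullet> u\<close> between the two ends,
  up to a multiple of the squared norm of \<open>u\<close> (\<open>flux_estimate\<close>). Sorted by vertices, the fluxes add up
  to the forms of the matrices \<open>T_v\<close> at the vertex values \<open>\<gamma>_v u\<close> (\<open>vertex_flux_sum\<close>). The dynamic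
  boundary condition contributes \<open>2 Re (Q_v B_v \<gamma>_v u \<bullet> \<gamma>_v u)\<close>, because \<open>x_v\<close> is the projection of
  \<open>\<gamma>_v u\<close> and \<open>Q_v B_v\<close> takes values in \<open>Y_v^(d)\<close>. The sum of both is exactly what the cone condition
  bounds by a multiple of the energy, and the remaining terms with \<open>N_e\<close> and \<open>C_v\<close> are bounded
  perturbations.

  Surjectivity (\<open>resolvent_surjective\<close>). Since \<open>M\<close> is invertible, \<open>\<lambda> u - M u' - N u = f\<close> is a linear
  differential equation on each edge; its solutions form an affine space, parametrized by the \<open>k\<close>
  initial values. The vertex conditions say that a linear map of these parameters into the sum over
  \<open>v\<close> of \<open>Y_v^\<bottom> + Y_v^(d)\<close> hits a prescribed value. As \<open>Y_v^(d)\<close> is the orthogonal sum of the range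
  of \<open>B_v\<close> and the kernel of its adjoint, that target is spanned by as many vectors as the boundary
  family has members, and this number is \<open>k\<close> because the family is a basis of \<open>C^k\<close>. A square linear
  system is solvable when it is injective, and injectivity is again dissipativity: a solution of the
  homogeneous problem would be an eigenvector of \<open>A\<close> for the eigenvalue \<open>\<lambda> > \<omega>\<close>.

  The generation theorem itself is obtained by the backward Euler scheme: for the shifted operator
  \<open>G = A - \<omega>\<close>, the powers of order \<open>t N\<close> of \<open>(1 - G / N)^{-1}\<close> converge by the estimate of Crandall--Liggett in the form of
  Kobayashi (\<open>J_pow_estimate\<close>), so no integration of vector-valued functions enters, and everything
  makes sense on a space with a seminorm. Density of the domain follows from dissipativity
  and the range condition (\<open>domain_dense\<close>).
\<close>


section \<open>Contraction semigroups from resolvents\<close>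

text \<open>A complete seminormed space stands for the Banach space obtained from it by identifying points at
  distance zero. Operators are treated as relations that are closed under this identification, since
  a representative of the value need not be singled out.\<close>

locale seminormed_space = vector_space sc
  for sc :: "complex \<Rightarrow> 'x::ab_group_add \<Rightarrow> 'x" +
  fixes X :: "'x set" and p :: "'x \<Rightarrow> real"
  assumes subspace_X: "subspace X"
    and p_triangle: "x \<in> X \<Longrightarrow> y \<in> X \<Longrightarrow> p (x + y) \<le> p x + p y"
    and p_scale: "x \<in> X \<Longrightarrow> p (sc c x) = cmod c * p x"
    and p_complete: "\<lbrakk>\<And>n. f n \<in> X;
        \<And>e. e > 0 \<Longrightarrow> \<exists>N::nat. \<forall>m\<ge>N. \<forall>n\<ge>N. p (f m - f n) < e\<rbrakk>
        \<Longrightarrow> \<exists>l\<in>X. (\<lambda>n. p (f n - l)) \<longlonglongrightarrow> 0"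
begin

lemma X_simps [simp]:
  "0 \<in> X"
  "x \<in> X \<Longrightarrow> y \<in> X \<Longrightarrow> x + y \<in> X"
  "x \<in> X \<Longrightarrow> y \<in> X \<Longrightarrow> x - y \<in> X"
  "x \<in> X \<Longrightarrow> sc c x \<in> X"
  "x \<in> X \<Longrightarrow> - x \<in> X"
  using subspace_X by (auto intro: subspace_0 subspace_add subspace_diff subspace_scale subspace_neg)

lemma p_zero [simp]: "p 0 = 0"
  using p_scale[of 0 0] by simp

lemma p_minus: "x \<in> X \<Longrightarrow> p (- x) = p x"
  using p_scale[of x "-1"] by simp

lemma p_nonneg: "x \<in> X \<Longrightarrow> 0 \<le> p x"
  using p_triangle[of x "- x"] p_minus[of x] by simp

lemma p_commute: "x \<in> X \<Longrightarrow> y \<in> X \<Longrightarrow> p (x - y) = p (y - x)"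
  using p_minus[of "x - y"] by simp

lemma p_tri_diff: "x \<in> X \<Longrightarrow> y \<in> X \<Longrightarrow> z \<in> X \<Longrightarrow> p (x - z) \<le> p (x - y) + p (y - z)"
  using p_triangle[of "x - y" "y - z"] by simp

lemma p_diff_le: "x \<in> X \<Longrightarrow> y \<in> X \<Longrightarrow> p (x - y) \<le> p x + p y"
  using p_triangle[of x "- y"] p_minus[of y] by simp

lemma p_reverse: "x \<in> X \<Longrightarrow> y \<in> X \<Longrightarrow> \<bar>p x - p y\<bar> \<le> p (x - y)"
  using p_triangle[of "x - y" y] p_triangle[of "y - x" x] p_commute[of x y] by simp

lemma p_le_add: "x \<in> X \<Longrightarrow> y \<in> X \<Longrightarrow> p x \<le> p y + p (x - y)"
  using p_reverse[of x y] by simp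

lemma p_quad: "\<lbrakk>a \<in> X; b \<in> X; c \<in> X; d \<in> X\<rbrakk> \<Longrightarrow> p ((a + b) - (c + d)) \<le> p (a - c) + p (b - d)"
  using p_triangle[of "a - c" "b - d"] by (simp add: algebra_simps)

lemma p_eq_lim:
  assumes "\<And>n. f n \<in> X" "l \<in> X" "l' \<in> X" "(\<lambda>n. p (f n - l)) \<longlonglongrightarrow> 0" "(\<lambda>n. p (f n - l')) \<longlonglongrightarrow> 0"
  shows "p (l - l') = 0"
proof -
  have "(\<lambda>n. p (f n - l) + p (f n - l')) \<longlonglongrightarrow> 0 + 0"
    by (intro tendsto_add assms)
  moreover have "p (l - l') \<le> p (f n - l) + p (f n - l')" for n
    using p_tri_diff[of l "f n" l'] p_commute[of l "f n"] assms by simp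
  ultimately have "p (l - l') \<le> 0 + 0" by (intro LIMSEQ_le_const) auto
  then show ?thesis using p_nonneg[of "l - l'"] assms by simp
qed

lemma p_lim:
  assumes "\<And>n. f n \<in> X" "l \<in> X" "(\<lambda>n. p (f n - l)) \<longlonglongrightarrow> 0"
  shows "(\<lambda>n. p (f n)) \<longlonglongrightarrow> p l"
proof (rule LIM_zero_cancel, rule Lim_null_comparison[OF _ assms(3)])
  show "\<forall>\<^sub>F n in sequentially. norm (p (f n) - p l) \<le> p (f n - l)"
    using p_reverse assms by (simp add: eventually_sequentially)
qed

lemma lim_diff:
  assumes "\<And>n. f n \<in> X" "\<And>n. g n \<in> X" "l \<in> X" "m \<in> X"
    "(\<lambda>n. p (f n - l)) \<longlonglongrightarrow> 0" "(\<lambda>n. p (g n - m)) \<longlonglongrightarrow> 0"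
  shows "(\<lambda>n. p ((f n - g n) - (l - m))) \<longlonglongrightarrow> 0"
proof (rule Lim_null_comparison)
  show "(\<lambda>n. p (f n - l) + p (g n - m)) \<longlonglongrightarrow> 0"
    using tendsto_add[OF assms(5,6)] by simp
  show "\<forall>\<^sub>F n in sequentially. norm (p ((f n - g n) - (l - m))) \<le> p (f n - l) + p (g n - m)"
    using p_diff_le[of "f _ - l" "g _ - m"] p_nonneg assms
    by (intro always_eventually) (simp add: algebra_simps abs_of_nonneg)
qed

definition linear_relation :: "('x \<times> 'x) set \<Rightarrow> bool" where
  "linear_relation G \<longleftrightarrow> G \<subseteq> X \<times> X \<and> (0, 0) \<in> G \<and>
     (\<forall>x y x' y'. (x, y) \<in> G \<longrightarrow> (x', y') \<in> G \<longrightarrow> (x + x', y + y') \<in> G) \<and>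
     (\<forall>c x y. (x, y) \<in> G \<longrightarrow> (sc c x, sc c y) \<in> G) \<and>
     (\<forall>x y x' y'. (x, y) \<in> G \<longrightarrow> x' \<in> X \<longrightarrow> y' \<in> X \<longrightarrow> p (x - x') = 0 \<longrightarrow> p (y - y') = 0 \<longrightarrow> (x', y') \<in> G)"

end

text \<open>The inequality says that \<open>(1 - h G)^{-1}\<close> is a contraction wherever it is defined, and the range
  condition that it is defined everywhere.\<close>

locale contraction_resolvents = seminormed_space sc X p
  for sc :: "complex \<Rightarrow> 'x::ab_group_add \<Rightarrow> 'x" and X :: "'x set" and p :: "'x \<Rightarrow> real" +
  fixes G :: "('x \<times> 'x) set"
  assumes linear_G: "linear_relation G"
    and contractive: "(x, y) \<in> G \<Longrightarrow> h > 0 \<Longrightarrow> p x \<le> p (x - sc (of_real h) y)"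
    and range_G: "z \<in> X \<Longrightarrow> h > 0 \<Longrightarrow> \<exists>(x, y)\<in>G. x - sc (of_real h) y = z"
begin

lemma G_X: "(x, y) \<in> G \<Longrightarrow> x \<in> X" "(x, y) \<in> G \<Longrightarrow> y \<in> X"
  using linear_G by (auto simp: linear_relation_def)

lemma G_add: "(x, y) \<in> G \<Longrightarrow> (x', y') \<in> G \<Longrightarrow> (x + x', y + y') \<in> G"
  and G_scale: "(x, y) \<in> G \<Longrightarrow> (sc c x, sc c y) \<in> G"
  and G_null: "(x, y) \<in> G \<Longrightarrow> x' \<in> X \<Longrightarrow> y' \<in> X \<Longrightarrow> p (x - x') = 0 \<Longrightarrow> p (y - y') = 0 \<Longrightarrow> (x', y') \<in> G"
  using linear_G unfolding linear_relation_def by blast+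

lemma G_diff: "(x, y) \<in> G \<Longrightarrow> (x', y') \<in> G \<Longrightarrow> (x - x', y - y') \<in> G"
  using G_add[of x y "- x'" "- y'"] G_scale[of x' y' "-1"] by simp

definition J :: "real \<Rightarrow> 'x \<Rightarrow> 'x" where
  "J h z = (SOME x. \<exists>y. (x, y) \<in> G \<and> x - sc (of_real h) y = z)"

lemma J_G:
  assumes "z \<in> X" "h > 0"
  obtains y where "(J h z, y) \<in> G" "J h z - sc (of_real h) y = z"
proof -
  have "\<exists>x y. (x, y) \<in> G \<and> x - sc (of_real h) y = z"
    using range_G[OF assms] by auto
  then have "\<exists>y. (J h z, y) \<in> G \<and> J h z - sc (of_real h) y = z"
    unfolding J_def by (rule someI_ex)
  then show ?thesis using that by blast
qed

lemma J_X [simp]: "z \<in> X \<Longrightarrow> h > 0 \<Longrightarrow> J h z \<in> X"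
  by (meson J_G G_X)

lemma J_pow_X [simp]: "z \<in> X \<Longrightarrow> h > 0 \<Longrightarrow> (J h ^^ n) z \<in> X"
  by (induction n) auto

lemma J_contraction:
  assumes "z \<in> X" "z' \<in> X" "h > 0"
  shows "p (J h z - J h z') \<le> p (z - z')"
proof -
  obtain y where y: "(J h z, y) \<in> G" "J h z - sc (of_real h) y = z" using J_G assms by metis
  obtain y' where y': "(J h z', y') \<in> G" "J h z' - sc (of_real h) y' = z'" using J_G assms by metis
  have eq: "z - z' = (J h z - J h z') - sc (of_real h) (y - y')"
    by (subst y(2)[symmetric], subst y'(2)[symmetric]) (simp add: scale_right_diff_distrib)
  show ?thesis
    unfolding eq by (rule contractive[OF G_diff[OF y(1) y'(1)] assms(3)])
qed

text \<open>The choice of \<open>J h z\<close> among the solutions is immaterial: by contractivity they are all at distance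
  zero from each other.\<close>

lemma J_unique:
  assumes "(x, y) \<in> G" "h > 0"
  shows "p (J h (x - sc (of_real h) y) - x) = 0"
proof -
  let ?z = "x - sc (of_real h) y"
  have z: "?z \<in> X" using G_X[OF assms(1)] by simp
  obtain y' where y': "(J h ?z, y') \<in> G" "J h ?z - sc (of_real h) y' = ?z"
    using J_G[OF z assms(2)] by metis
  have "(J h ?z - x) - sc (of_real h) (y' - y) = (J h ?z - sc (of_real h) y') - ?z"
    by (simp add: scale_right_diff_distrib)
  also have "\<dots> = 0" using y'(2) by simp
  finally have "p (J h ?z - x) \<le> p 0"
    using contractive[OF G_diff[OF y'(1) assms(1)] assms(2)] by simp
  then show ?thesis using p_nonneg[of "J h ?z - x"] G_X[OF assms(1)] z assms(2) by simp
qed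

lemma J_pow_contraction:
  assumes "z \<in> X" "z' \<in> X" "h > 0"
  shows "p ((J h ^^ n) z - (J h ^^ n) z') \<le> p (z - z')"
proof (induction n)
  case (Suc n)
  show ?case
    using J_contraction[of "(J h ^^ n) z" "(J h ^^ n) z'" h] Suc assms by simp
qed simp

text \<open>For \<open>k = g h / (g + h)\<close> both \<open>J h u\<close> and \<open>J g v\<close> are values of the same resolvent \<open>J k\<close>, namely at
  convex combinations of \<open>u\<close> and \<open>J h u\<close>, and of \<open>v\<close> and \<open>J g v\<close>. Contractivity of \<open>J k\<close> then
  compares schemes with two different step sizes.\<close>

lemma J_resolvent:
  assumes "u \<in> X" "v \<in> X" "h > 0" "g > 0"
  shows "p (J h u - J g v) \<le> g / (g + h) * p (u - J g v) + h / (g + h) * p (J h u - v)"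
proof -
  define k where "k = g * h / (g + h)"
  define a where "a = g / (g + h)"
  define b where "b = h / (g + h)"
  have ab: "a + b = 1" "a \<ge> 0" "b \<ge> 0"
    using assms by (auto simp: a_def b_def add_divide_distrib[symmetric])
  have k: "k > 0" "k = a * h" "k = b * g" using assms by (auto simp: k_def a_def b_def)
  obtain y where y: "(J h u, y) \<in> G" "J h u - sc (of_real h) y = u" using J_G assms by metis
  obtain w where w: "(J g v, w) \<in> G" "J g v - sc (of_real g) w = v" using J_G assms by metis
  let ?u = "J h u - sc (of_real k) y" and ?v = "J g v - sc (of_real k) w"
  have X: "y \<in> X" "w \<in> X" using G_X y w by auto
  have b1: "of_real b = 1 - (of_real a :: complex)" using ab by (metis add_diff_cancel_left' of_real_1 of_real_diff)
  have "sc (of_real a) (J h u - sc (of_real h) y) + sc (of_real b) (J h u) = ?u"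
    by (simp add: k(2) b1 scale_right_diff_distrib scale_left_diff_distrib)
  then have u: "?u = sc (of_real a) u + sc (of_real b) (J h u)" unfolding y(2) by (rule sym)
  have a1: "of_real a = 1 - (of_real b :: complex)" using ab by (metis add_diff_cancel_right' of_real_1 of_real_diff)
  have "sc (of_real b) (J g v - sc (of_real g) w) + sc (of_real a) (J g v) = ?v"
    by (simp add: k(3) a1 scale_right_diff_distrib scale_left_diff_distrib)
  then have v: "?v = sc (of_real b) v + sc (of_real a) (J g v)" unfolding w(2) by (rule sym)
  have uv: "?u - ?v = sc (of_real a) (u - J g v) + sc (of_real b) (J h u - v)"
    unfolding u v by (simp add: scale_right_diff_distrib)
  have "p (J h u - J g v) \<le> p (J h u - J k ?u) + p (J k ?u - J k ?v) + p (J k ?v - J g v)"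
    using p_tri_diff[of "J h u" "J k ?u" "J g v"] p_tri_diff[of "J k ?u" "J k ?v" "J g v"] assms k X
    by simp
  also have "\<dots> = p (J k ?u - J k ?v)"
    using J_unique[OF y(1) k(1)] J_unique[OF w(1) k(1)] p_commute[of "J h u" "J k ?u"] assms k X
    by simp
  also have "\<dots> \<le> p (?u - ?v)" using J_contraction assms k X by simp
  also have "\<dots> \<le> a * p (u - J g v) + b * p (J h u - v)"
    unfolding uv
    using p_triangle[of "sc (of_real a) (u - J g v)" "sc (of_real b) (J h u - v)"] assms ab
    by (simp add: p_scale)
  finally show ?thesis by (simp add: a_def b_def)
qed

lemma J_step:
  assumes "(x, y) \<in> G" "h > 0"
  shows "p (J h x - x) \<le> h * p y"
proof -
  have X: "x \<in> X" "y \<in> X" using G_X assms by auto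
  have "p (J h x - x) \<le> p (J h x - J h (x - sc (of_real h) y)) + p (J h (x - sc (of_real h) y) - x)"
    using p_tri_diff X assms by simp
  also have "\<dots> \<le> p (x - (x - sc (of_real h) y))"
    using J_contraction[of x "x - sc (of_real h) y" h] J_unique[OF assms] X assms by simp
  also have "\<dots> = h * p y" using X assms by (simp add: p_scale)
  finally show ?thesis .
qed

lemma J_pow_step:
  assumes "(x, y) \<in> G" "h > 0"
  shows "p ((J h ^^ n) x - x) \<le> real n * h * p y"
proof (induction n)
  case (Suc n)
  have X: "x \<in> X" "y \<in> X" using G_X assms by auto
  have "p ((J h ^^ Suc n) x - x) \<le> p ((J h ^^ Suc n) x - J h x) + p (J h x - x)"
    using p_tri_diff X assms by simp
  also have "\<dots> \<le> p ((J h ^^ n) x - x) + h * p y"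
    using J_contraction[of "(J h ^^ n) x" x h] J_step[OF assms] X assms by simp
  finally show ?case using Suc by (simp add: algebra_simps)
qed simp

text \<open>Concavity of the square root reduces the claim to an identity: the convex combination of \<open>u\<close> and
  \<open>v\<close> with these weights is \<open>d^2 + s\<close>, as the terms linear in \<open>d\<close> cancel.\<close>

lemma convex_sqrt_step:
  fixes g h d s :: real
  assumes "g > 0" "h > 0" and s: "s \<ge> 0" and u: "u = (d - h)\<^sup>2 + s - h\<^sup>2" "u \<ge> 0"
    and v: "v = (d + g)\<^sup>2 + s - g\<^sup>2" "v \<ge> 0"
  shows "g / (g + h) * sqrt u + h / (g + h) * sqrt v \<le> sqrt (d\<^sup>2 + s)"
proof (rule real_le_rsqrt)
  define a where "a = g / (g + h)"
  define b where "b = h / (g + h)"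
  have ab: "b = 1 - a" "a \<ge> 0" "b \<ge> 0" "a * h = b * g"
    using assms by (auto simp: a_def b_def field_simps)
  have "a * b * (sqrt u - sqrt v)\<^sup>2 \<ge> 0" using ab by simp
  then have "(a * sqrt u + b * sqrt v)\<^sup>2 \<le> a * (sqrt u)\<^sup>2 + b * (sqrt v)\<^sup>2"
    unfolding ab(1) by (simp add: power2_eq_square algebra_simps)
  also have "\<dots> = a * u + b * v" using u v by simp
  also have "\<dots> = (a + b) * (d\<^sup>2 + s) + 2 * d * (b * g - a * h)"
    unfolding u v by (simp add: power2_eq_square algebra_simps)
  also have "\<dots> = d\<^sup>2 + s" using ab by simp
  finally show "(g / (g + h) * sqrt u + h / (g + h) * sqrt v)\<^sup>2 \<le> d\<^sup>2 + s"
    by (simp add: a_def b_def)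
qed

text \<open>Kobayashi's estimate. The recursion in \<open>J_resolvent\<close> relates the pair \<open>(n, m)\<close> to \<open>(n - 1, m)\<close> and
  \<open>(n, m - 1)\<close>; the right-hand side is a supersolution of that recursion by \<open>convex_sqrt_step\<close> and
  dominates the boundary values given by \<open>J_pow_step\<close>.\<close>

lemma J_pow_estimate:
  assumes G: "(x, y) \<in> G" and h: "h > 0" and g: "g > 0"
  shows "p ((J h ^^ n) x - (J g ^^ m) x)
       \<le> sqrt ((real n * h - real m * g)\<^sup>2 + (real n * h\<^sup>2 + real m * g\<^sup>2)) * p y"
proof (induction "n + m" arbitrary: n m rule: less_induct)
  case less
  have X: "x \<in> X" "y \<in> X" using G_X G by auto
  have py: "p y \<ge> 0" using p_nonneg X by simp
  show ?case
  proof (cases "n = 0 \<or> m = 0")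
    case True
    then show ?thesis
    proof
      assume n: "n = 0"
      have "real m * g \<le> sqrt ((real m * g)\<^sup>2 + real m * g\<^sup>2)"
        by (rule real_le_rsqrt) simp
      then have "real m * g * p y \<le> sqrt ((real m * g)\<^sup>2 + real m * g\<^sup>2) * p y"
        using py by (rule mult_right_mono)
      then show ?thesis
        using J_pow_step[OF G g, of m] p_commute[of x "(J g ^^ m) x"] X g n by simp
    next
      assume m: "m = 0"
      have "real n * h \<le> sqrt ((real n * h)\<^sup>2 + real n * h\<^sup>2)"
        by (rule real_le_rsqrt) simp
      then have "real n * h * p y \<le> sqrt ((real n * h)\<^sup>2 + real n * h\<^sup>2) * p y"
        using py by (rule mult_right_mono)
      then show ?thesis
        using J_pow_step[OF G h, of n] m by simp
    qed
  next
    case False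
    then obtain n' m' where nm: "n = Suc n'" "m = Suc m'" by (metis not0_implies_Suc)
    define d where "d = real n * h - real m * g"
    define s where "s = real n * h\<^sup>2 + real m * g\<^sup>2"
    let ?u = "(real n' * h - real m * g)\<^sup>2 + (real n' * h\<^sup>2 + real m * g\<^sup>2)"
    let ?v = "(real n * h - real m' * g)\<^sup>2 + (real n * h\<^sup>2 + real m' * g\<^sup>2)"
    have "p ((J h ^^ n) x - (J g ^^ m) x)
        \<le> g / (g + h) * p ((J h ^^ n') x - (J g ^^ m) x) + h / (g + h) * p ((J h ^^ n) x - (J g ^^ m') x)"
      using J_resolvent[of "(J h ^^ n') x" "(J g ^^ m') x" h g] X h g by (simp add: nm)
    also have "\<dots> \<le> g / (g + h) * (sqrt ?u * p y) + h / (g + h) * (sqrt ?v * p y)"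
      using less[of n' m] less[of n m'] h g nm by (intro add_mono mult_left_mono) auto
    also have "\<dots> = (g / (g + h) * sqrt ?u + h / (g + h) * sqrt ?v) * p y"
      by (simp add: algebra_simps)
    also have "\<dots> \<le> sqrt (d\<^sup>2 + s) * p y"
    proof (intro mult_right_mono convex_sqrt_step g h py)
      show "?u = (d - h)\<^sup>2 + s - h\<^sup>2" "?v = (d + g)\<^sup>2 + s - g\<^sup>2"
        by (simp_all add: d_def s_def nm algebra_simps)
      show "s \<ge> 0" "?u \<ge> 0" "?v \<ge> 0" by (simp_all add: s_def)
    qed
    finally show ?thesis by (simp add: d_def s_def)
  qed
qed

lemma J_add:
  assumes "z \<in> X" "z' \<in> X" "h > 0"
  shows "p (J h (z + z') - (J h z + J h z')) = 0"
proof -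
  obtain y where y: "(J h z, y) \<in> G" "J h z - sc (of_real h) y = z" using J_G assms by metis
  obtain y' where y': "(J h z', y') \<in> G" "J h z' - sc (of_real h) y' = z'" using J_G assms by metis
  have "(J h z + J h z') - sc (of_real h) (y + y') = (J h z - sc (of_real h) y) + (J h z' - sc (of_real h) y')"
    by (simp add: scale_right_distrib)
  also have "\<dots> = z + z'" using y y' by simp
  finally show ?thesis using J_unique[OF G_add[OF y(1) y'(1)] assms(3)] by simp
qed

lemma J_scale:
  assumes "z \<in> X" "h > 0"
  shows "p (J h (sc c z) - sc c (J h z)) = 0"
proof -
  obtain y where y: "(J h z, y) \<in> G" "J h z - sc (of_real h) y = z" using J_G assms by metis
  have "sc c (J h z) - sc (of_real h) (sc c y) = sc c (J h z - sc (of_real h) y)"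
    by (simp add: scale_right_diff_distrib mult.commute)
  also have "\<dots> = sc c z" using y by simp
  finally show ?thesis using J_unique[OF G_scale[OF y(1), of c] assms(2)] by simp
qed

end

locale dense_contraction_resolvents = contraction_resolvents sc X p G
  for sc :: "complex \<Rightarrow> 'x::ab_group_add \<Rightarrow> 'x" and X :: "'x set" and p :: "'x \<Rightarrow> real"
    and G :: "('x \<times> 'x) set" +
  assumes dense_G: "z \<in> X \<Longrightarrow> e > 0 \<Longrightarrow> \<exists>(x, y)\<in>G. p (z - x) < e"
begin

text \<open>The backward Euler approximation at time \<open>t\<close> with step size \<open>1 / (N + 1)\<close>.\<close>

definition euler :: "real \<Rightarrow> nat \<Rightarrow> 'x \<Rightarrow> 'x" where
  "euler t N z = (J (1 / real (Suc N)) ^^ nat \<lfloor>t * real (Suc N)\<rfloor>) z"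

lemma euler_X [simp]: "z \<in> X \<Longrightarrow> euler t N z \<in> X"
  by (simp add: euler_def)

lemma euler_contraction: "z \<in> X \<Longrightarrow> z' \<in> X \<Longrightarrow> p (euler t N z - euler t N z') \<le> p (z - z')"
  unfolding euler_def by (rule J_pow_contraction) auto

lemma euler_floor:
  assumes "t \<ge> 0"
  shows "real (nat \<lfloor>t * real (Suc N)\<rfloor>) * (1 / real (Suc N)) \<le> t"
    "t - 1 / real (Suc N) \<le> real (nat \<lfloor>t * real (Suc N)\<rfloor>) * (1 / real (Suc N))"
proof -
  define M where "M = real (Suc N)"
  define a where "a = real (nat \<lfloor>t * M\<rfloor>)"
  have M: "M > 0" by (simp add: M_def)
  have "a = of_int \<lfloor>t * M\<rfloor>" using assms M by (simp add: a_def)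
  then have "a \<le> t * M" "t * M - 1 \<le> a" by linarith+
  then have "a / M \<le> t" "t - 1 / M \<le> a / M"
    using M divide_right_mono[of "t * M - 1" a M] by (auto simp: pos_divide_le_eq diff_divide_distrib)
  then have "a * (1 / M) \<le> t" "t - 1 / M \<le> a * (1 / M)"
    using M by (auto simp: diff_divide_distrib)
  then show "real (nat \<lfloor>t * real (Suc N)\<rfloor>) * (1 / real (Suc N)) \<le> t"
    "t - 1 / real (Suc N) \<le> real (nat \<lfloor>t * real (Suc N)\<rfloor>) * (1 / real (Suc N))"
    unfolding a_def M_def by auto
qed

lemma euler_estimate:
  assumes G: "(x, y) \<in> G" and t: "t \<ge> 0" "s \<ge> 0"
  shows "p (euler t N x - euler s M x)
     \<le> sqrt ((\<bar>t - s\<bar> + 1 / real (Suc N) + 1 / real (Suc M))\<^sup>2 + (t / real (Suc N) + s / real (Suc M))) * p y"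
proof -
  let ?h = "1 / real (Suc N)" and ?g = "1 / real (Suc M)"
  let ?n = "nat \<lfloor>t * real (Suc N)\<rfloor>" and ?m = "nat \<lfloor>s * real (Suc M)\<rfloor>"
  have X: "y \<in> X" using G_X G by auto
  have "\<bar>real ?n * ?h - real ?m * ?g\<bar> \<le> \<bar>t - s\<bar> + ?h + ?g"
    using euler_floor[of t N] euler_floor[of s M] t by linarith
  then have 1: "(real ?n * ?h - real ?m * ?g)\<^sup>2 \<le> (\<bar>t - s\<bar> + ?h + ?g)\<^sup>2"
    by (metis abs_ge_zero power2_abs power_mono)
  have 2: "real ?n * ?h\<^sup>2 \<le> t * ?h" "real ?m * ?g\<^sup>2 \<le> s * ?g"
    using mult_right_mono[OF euler_floor(1)[of t N], of ?h] mult_right_mono[OF euler_floor(1)[of s M], of ?g] t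
    by (simp_all add: power2_eq_square)
  have "p (euler t N x - euler s M x) \<le> sqrt ((real ?n * ?h - real ?m * ?g)\<^sup>2 + (real ?n * ?h\<^sup>2 + real ?m * ?g\<^sup>2)) * p y"
    unfolding euler_def by (rule J_pow_estimate[OF G]) auto
  also have "\<dots> \<le> sqrt ((\<bar>t - s\<bar> + ?h + ?g)\<^sup>2 + (t * ?h + s * ?g)) * p y"
    using 1 2 p_nonneg[OF X] by (intro mult_right_mono real_sqrt_le_mono) linarith+
  finally show ?thesis by simp
qed

lemma euler_Cauchy:
  assumes z: "z \<in> X" and t: "t \<ge> 0" and e: "e > 0"
  shows "\<exists>N. \<forall>m\<ge>N. \<forall>n\<ge>N. p (euler t m z - euler t n z) < e"
proof -
  obtain x y where G: "(x, y) \<in> G" and x: "p (z - x) < e / 3" using dense_G[OF z, of "e / 3"] e by auto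
  have X: "x \<in> X" "y \<in> X" using G_X G by auto
  have "(\<lambda>N. sqrt ((2 * (1 / real (Suc N)))\<^sup>2 + 2 * t * (1 / real (Suc N))) * p y) \<longlonglongrightarrow> sqrt ((2 * 0)\<^sup>2 + 2 * t * 0) * p y"
    by (intro tendsto_intros LIMSEQ_Suc lim_1_over_n)
  then have "\<forall>\<^sub>F N in sequentially. sqrt ((2 * (1 / real (Suc N)))\<^sup>2 + 2 * t * (1 / real (Suc N))) * p y < e / 3"
    using e by (intro order_tendstoD(2)[where y = 0]) auto
  then obtain N where N: "sqrt ((2 * (1 / real (Suc N)))\<^sup>2 + 2 * t * (1 / real (Suc N))) * p y < e / 3"
    by (auto simp: eventually_sequentially)
  show ?thesis
  proof (intro exI allI impI)
    fix m n assume mn: "N \<le> m" "N \<le> n"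
    have i: "1 / real (Suc m) \<le> 1 / real (Suc N)" "1 / real (Suc n) \<le> 1 / real (Suc N)"
      using mn by (auto intro!: divide_left_mono)
    have 1: "(\<bar>t - t\<bar> + 1 / real (Suc m) + 1 / real (Suc n))\<^sup>2 \<le> (2 * (1 / real (Suc N)))\<^sup>2"
      using i by (intro power_mono) auto
    have 2: "t / real (Suc m) + t / real (Suc n) \<le> 2 * t * (1 / real (Suc N))"
      using mult_left_mono[OF i(1) t] mult_left_mono[OF i(2) t] by simp
    have "p (euler t m x - euler t n x) \<le> sqrt ((2 * (1 / real (Suc N)))\<^sup>2 + 2 * t * (1 / real (Suc N))) * p y"
      using 1 2 p_nonneg[OF X(2)]
      by (intro order_trans[OF euler_estimate[OF G t t]] mult_right_mono real_sqrt_le_mono) linarith+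
    then have 3: "p (euler t m x - euler t n x) < e / 3" using N by simp
    have "p (euler t m z - euler t n z) \<le> p (euler t m z - euler t m x) + p (euler t m x - euler t n x) + p (euler t n x - euler t n z)"
      using p_tri_diff[of "euler t m z" "euler t m x" "euler t n z"] p_tri_diff[of "euler t m x" "euler t n x" "euler t n z"] z X by simp
    also have "\<dots> < e / 3 + e / 3 + e / 3"
      using 3 euler_contraction[of z x t m] euler_contraction[of x z t n] p_commute[of x z] x z X by simp
    finally show "p (euler t m z - euler t n z) < e" by simp
  qed
qed

definition T :: "real \<Rightarrow> 'x \<Rightarrow> 'x" where
  "T t z = (SOME l. l \<in> X \<and> (\<lambda>N. p (euler t N z - l)) \<longlonglongrightarrow> 0)"

lemma T:
  assumes "z \<in> X" "t \<ge> 0"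
  shows T_X: "T t z \<in> X" and euler_T: "(\<lambda>N. p (euler t N z - T t z)) \<longlonglongrightarrow> 0"
proof -
  have "\<exists>l. l \<in> X \<and> (\<lambda>N. p (euler t N z - l)) \<longlonglongrightarrow> 0"
    using p_complete[of "\<lambda>N. euler t N z"] euler_Cauchy[OF assms] assms by auto
  then have "T t z \<in> X \<and> (\<lambda>N. p (euler t N z - T t z)) \<longlonglongrightarrow> 0"
    unfolding T_def by (rule someI_ex)
  then show "T t z \<in> X" "(\<lambda>N. p (euler t N z - T t z)) \<longlonglongrightarrow> 0" by auto
qed

lemma T_eqI:
  assumes "z \<in> X" "t \<ge> 0" "l \<in> X" "(\<lambda>N. p (euler t N z - l)) \<longlonglongrightarrow> 0"
  shows "p (T t z - l) = 0"
  using p_eq_lim[of "\<lambda>N. euler t N z"] T assms by simp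

lemma T_contraction:
  assumes "z \<in> X" "z' \<in> X" "t \<ge> 0"
  shows "p (T t z - T t z') \<le> p (z - z')"
proof (rule LIMSEQ_le_const2)
  show "(\<lambda>N. p (euler t N z - euler t N z')) \<longlonglongrightarrow> p (T t z - T t z')"
    using assms T by (intro p_lim lim_diff) auto
  show "\<exists>N. \<forall>n\<ge>N. p (euler t n z - euler t n z') \<le> p (z - z')"
    using euler_contraction assms by blast
qed

text \<open>In the limit of small steps the square root in \<open>euler_estimate\<close> becomes the distance of the times.\<close>

lemma T_lipschitz:
  assumes G: "(x, y) \<in> G" and t: "t \<ge> 0" "s \<ge> 0"
  shows "p (T t x - T s x) \<le> \<bar>t - s\<bar> * p y"
proof (rule LIMSEQ_le)
  have X: "x \<in> X" "y \<in> X" using G_X G by auto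
  show "(\<lambda>N. p (euler t N x - euler s N x)) \<longlonglongrightarrow> p (T t x - T s x)"
    using X t T by (intro p_lim lim_diff) auto
  have "(\<lambda>N. sqrt ((\<bar>t - s\<bar> + 1 / real (Suc N) + 1 / real (Suc N))\<^sup>2 + (t * (1 / real (Suc N)) + s * (1 / real (Suc N)))) * p y)
     \<longlonglongrightarrow> sqrt ((\<bar>t - s\<bar> + 0 + 0)\<^sup>2 + (t * 0 + s * 0)) * p y"
    by (intro tendsto_intros LIMSEQ_Suc lim_1_over_n)
  then show "(\<lambda>N. sqrt ((\<bar>t - s\<bar> + 1 / real (Suc N) + 1 / real (Suc N))\<^sup>2 + (t / real (Suc N) + s / real (Suc N))) * p y)
     \<longlonglongrightarrow> \<bar>t - s\<bar> * p y" by simp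
  show "\<exists>N. \<forall>n\<ge>N. p (euler t n x - euler s n x)
      \<le> sqrt ((\<bar>t - s\<bar> + 1 / real (Suc n) + 1 / real (Suc n))\<^sup>2 + (t / real (Suc n) + s / real (Suc n))) * p y"
    using euler_estimate[OF G t] by blast
qed

lemma T_0: "z \<in> X \<Longrightarrow> p (T 0 z - z) = 0"
  by (rule T_eqI) (auto simp: euler_def)

lemma J_pow_add:
  assumes "z \<in> X" "z' \<in> X" "h > 0"
  shows "p ((J h ^^ n) (z + z') - ((J h ^^ n) z + (J h ^^ n) z')) = 0"
proof (induction n)
  case (Suc n)
  let ?a = "(J h ^^ n) z" and ?b = "(J h ^^ n) z'" and ?c = "(J h ^^ n) (z + z')"
  have "p (J h ?c - (J h ?a + J h ?b)) \<le> p (J h ?c - J h (?a + ?b)) + p (J h (?a + ?b) - (J h ?a + J h ?b))"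
    using p_tri_diff assms by simp
  also have "\<dots> \<le> 0" using J_contraction[of ?c "?a + ?b" h] Suc J_add[of ?a ?b h] assms by simp
  finally show ?case using p_nonneg[of "J h ?c - (J h ?a + J h ?b)"] assms by simp
qed simp

lemma J_pow_scale:
  assumes "z \<in> X" "h > 0"
  shows "p ((J h ^^ n) (sc c z) - sc c ((J h ^^ n) z)) = 0"
proof (induction n)
  case (Suc n)
  let ?a = "(J h ^^ n) z" and ?c = "(J h ^^ n) (sc c z)"
  have "p (J h ?c - sc c (J h ?a)) \<le> p (J h ?c - J h (sc c ?a)) + p (J h (sc c ?a) - sc c (J h ?a))"
    using p_tri_diff assms by simp
  also have "\<dots> \<le> 0" using J_contraction[of ?c "sc c ?a" h] Suc J_scale[of ?a h c] assms by simp
  finally show ?case using p_nonneg[of "J h ?c - sc c (J h ?a)"] assms by simp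
qed simp

lemma T_add:
  assumes "z \<in> X" "z' \<in> X" "t \<ge> 0"
  shows "p (T t (z + z') - (T t z + T t z')) = 0"
proof (rule T_eqI)
  show "(\<lambda>N. p (euler t N (z + z') - (T t z + T t z'))) \<longlonglongrightarrow> 0"
  proof (rule Lim_null_comparison)
    show "(\<lambda>N. p (euler t N z - T t z) + p (euler t N z' - T t z')) \<longlonglongrightarrow> 0"
      using tendsto_add[OF euler_T[of z t] euler_T[of z' t]] assms by simp
    have "p (euler t N (z + z') - (T t z + T t z')) \<le> p (euler t N z - T t z) + p (euler t N z' - T t z')" for N
    proof -
      have "p (euler t N (z + z') - (T t z + T t z')) \<le> p (euler t N (z + z') - (euler t N z + euler t N z')) + p ((euler t N z + euler t N z') - (T t z + T t z'))"
        using p_tri_diff assms T by simp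
      moreover have "p (euler t N (z + z') - (euler t N z + euler t N z')) = 0"
        unfolding euler_def by (rule J_pow_add) (use assms in auto)
      ultimately show ?thesis
        using p_quad[of "euler t N z" "euler t N z'" "T t z" "T t z'"] assms T by simp
    qed
    then show "\<forall>\<^sub>F N in sequentially. norm (p (euler t N (z + z') - (T t z + T t z'))) \<le> p (euler t N z - T t z) + p (euler t N z' - T t z')"
      using p_nonneg assms T by (intro always_eventually) (simp add: abs_of_nonneg)
  qed
qed (use assms T in auto)

lemma T_scale:
  assumes "z \<in> X" "t \<ge> 0"
  shows "p (T t (sc c z) - sc c (T t z)) = 0"
proof (rule T_eqI)
  show "(\<lambda>N. p (euler t N (sc c z) - sc c (T t z))) \<longlonglongrightarrow> 0"
  proof (rule Lim_null_comparison)
    show "(\<lambda>N. cmod c * p (euler t N z - T t z)) \<longlonglongrightarrow> 0"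
      using tendsto_mult_left[OF euler_T[of z t], of "cmod c"] assms by simp
    have "p (euler t N (sc c z) - sc c (T t z)) \<le> cmod c * p (euler t N z - T t z)" for N
    proof -
      have "p (euler t N (sc c z) - sc c (T t z)) \<le> p (euler t N (sc c z) - sc c (euler t N z)) + p (sc c (euler t N z) - sc c (T t z))"
        using p_tri_diff assms T by simp
      moreover have "p (euler t N (sc c z) - sc c (euler t N z)) = 0"
        unfolding euler_def by (rule J_pow_scale) (use assms in auto)
      ultimately show ?thesis
        using p_scale[of "euler t N z - T t z" c] assms T by (simp add: scale_right_diff_distrib)
    qed
    then show "\<forall>\<^sub>F N in sequentially. norm (p (euler t N (sc c z) - sc c (T t z))) \<le> cmod c * p (euler t N z - T t z)"
      using p_nonneg assms T by (intro always_eventually) (simp add: abs_of_nonneg)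
  qed
qed (use assms T in auto)

lemma nat_floor_add:
  assumes "a \<ge> 0" "b \<ge> (0::real)"
  shows "nat \<lfloor>a + b\<rfloor> = nat \<lfloor>a\<rfloor> + nat \<lfloor>b\<rfloor> \<or> nat \<lfloor>a + b\<rfloor> = Suc (nat \<lfloor>a\<rfloor> + nat \<lfloor>b\<rfloor>)"
  using assms by linarith

text \<open>The integer parts of \<open>s N\<close>, \<open>t N\<close> and \<open>(s + t) N\<close> are additive up to one, so the Euler schemes satisfy
  the semigroup law up to a single step, which moves a point of the domain by \<open>O(1 / N)\<close>.\<close>

lemma T_semigroup_G:
  assumes G: "(x, y) \<in> G" and st: "s \<ge> 0" "t \<ge> 0"
  shows "p (T (s + t) x - T s (T t x)) = 0"
proof (rule T_eqI)
  have X: "x \<in> X" "y \<in> X" using G_X G by auto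
  show "(\<lambda>N. p (euler (s + t) N x - T s (T t x))) \<longlonglongrightarrow> 0"
  proof (rule Lim_null_comparison)
    show "(\<lambda>N. 1 / real (Suc N) * p y + p (euler t N x - T t x) + p (euler s N (T t x) - T s (T t x))) \<longlonglongrightarrow> 0"
      using tendsto_add[OF tendsto_add[OF tendsto_mult_left[OF LIMSEQ_Suc[OF lim_1_over_n], of "p y"] euler_T[of x t]] euler_T[of "T t x" s]]
        X st T by (simp add: mult.commute)
    have "p (euler (s + t) N x - T s (T t x)) \<le> 1 / real (Suc N) * p y + p (euler t N x - T t x) + p (euler s N (T t x) - T s (T t x))" for N
    proof -
      let ?h = "1 / real (Suc N)"
      let ?a = "nat \<lfloor>s * real (Suc N)\<rfloor>" and ?b = "nat \<lfloor>t * real (Suc N)\<rfloor>"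
      have ab: "(J ?h ^^ (?a + ?b)) x = euler s N (euler t N x)"
        by (simp add: euler_def funpow_add)
      have "p (euler (s + t) N x - euler s N (euler t N x)) \<le> ?h * p y"
        using nat_floor_add[of "s * real (Suc N)" "t * real (Suc N)"]
      proof
        assume "nat \<lfloor>s * real (Suc N) + t * real (Suc N)\<rfloor> = ?a + ?b"
        then have "euler (s + t) N x = euler s N (euler t N x)"
          unfolding ab[symmetric] by (simp only: euler_def distrib_right)
        then show ?thesis using p_nonneg X by simp
      next
        assume "nat \<lfloor>s * real (Suc N) + t * real (Suc N)\<rfloor> = Suc (?a + ?b)"
        then have "euler (s + t) N x = (J ?h ^^ (Suc (?a + ?b))) x"
          by (simp only: euler_def distrib_right)
        also have "\<dots> = (J ?h ^^ (?a + ?b)) (J ?h x)" by (simp only: funpow_Suc_right o_def)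
        finally have "p (euler (s + t) N x - euler s N (euler t N x)) \<le> p (J ?h x - x)"
          unfolding ab[symmetric] using J_pow_contraction[of "J ?h x" x ?h "?a + ?b"] X by simp
        also have "\<dots> \<le> ?h * p y" by (rule J_step[OF G]) simp
        finally show ?thesis .
      qed (use st in auto)
      then show ?thesis
        using p_tri_diff[of "euler (s + t) N x" "euler s N (euler t N x)" "T s (T t x)"]
          p_tri_diff[of "euler s N (euler t N x)" "euler s N (T t x)" "T s (T t x)"]
          euler_contraction[of "euler t N x" "T t x" s N] X st T by simp
    qed
    then show "\<forall>\<^sub>F N in sequentially. norm (p (euler (s + t) N x - T s (T t x))) \<le> 1 / real (Suc N) * p y + p (euler t N x - T t x) + p (euler s N (T t x) - T s (T t x))"
      using p_nonneg X st T by (intro always_eventually) (simp add: abs_of_nonneg)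
  qed
qed (use G_X[OF G] st T in auto)

lemma T_semigroup:
  assumes z: "z \<in> X" and st: "s \<ge> 0" "t \<ge> 0"
  shows "p (T (s + t) z - T s (T t z)) = 0"
proof -
  have "p (T (s + t) z - T s (T t z)) \<le> e" if e: "e > 0" for e
  proof -
    obtain x y where G: "(x, y) \<in> G" and x: "p (z - x) < e / 2" using dense_G[OF z, of "e / 2"] e by auto
    have X: "x \<in> X" using G_X G by auto
    have "p (T (s + t) z - T s (T t z)) \<le> p (T (s + t) z - T (s + t) x) + p (T (s + t) x - T s (T t x)) + p (T s (T t x) - T s (T t z))"
      using p_tri_diff[of "T (s + t) z" "T (s + t) x" "T s (T t z)"]
        p_tri_diff[of "T (s + t) x" "T s (T t x)" "T s (T t z)"] z X st T by simp
    also have "\<dots> \<le> p (z - x) + 0 + p (x - z)"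
      using T_contraction[of z x "s + t"] T_semigroup_G[OF G st] T_contraction[of "T t x" "T t z" s]
        T_contraction[of x z t] z X st T by simp
    finally show ?thesis using x p_commute[of x z] z X by simp
  qed
  then have "p (T (s + t) z - T s (T t z)) \<le> 0" using field_le_epsilon[of "p (T (s + t) z - T s (T t z))" 0] by simp
  then show ?thesis using p_nonneg[of "T (s + t) z - T s (T t z)"] z st T by simp
qed

lemma T_continuous:
  assumes z: "z \<in> X" and t: "t \<ge> 0"
  shows "((\<lambda>s. p (T s z - T t z)) \<longlongrightarrow> 0) (at t within {0..})"
proof (rule tendstoI)
  fix e :: real assume e: "e > 0"
  obtain x y where G: "(x, y) \<in> G" and x: "p (z - x) < e / 3" using dense_G[OF z, of "e / 3"] e by auto
  have X: "x \<in> X" "y \<in> X" using G_X G by auto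
  have "((\<lambda>s. \<bar>s - t\<bar> * p y) \<longlongrightarrow> \<bar>t - t\<bar> * p y) (at t within {0..})"
    by (intro tendsto_intros)
  then have "\<forall>\<^sub>F s in at t within {0..}. \<bar>s - t\<bar> * p y < e / 3"
    using e by (intro order_tendstoD(2)[where y = 0]) auto
  moreover have "\<forall>\<^sub>F s in at t within {0..}. s \<ge> 0"
    by (simp add: eventually_at_filter)
  ultimately show "\<forall>\<^sub>F s in at t within {0..}. dist (p (T s z - T t z)) 0 < e"
  proof eventually_elim
    case (elim s)
    have "p (T s z - T t z) \<le> p (T s z - T s x) + p (T s x - T t x) + p (T t x - T t z)"
      using p_tri_diff[of "T s z" "T s x" "T t z"] p_tri_diff[of "T s x" "T t x" "T t z"] z X t elim T by simp
    also have "\<dots> < e / 3 + e / 3 + e / 3"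
      using T_contraction[of z x s] T_contraction[of x z t] T_lipschitz[OF G elim(2) t] elim
        p_commute[of x z] x z X t by simp
    finally show ?case using p_nonneg[of "T s z - T t z"] z t elim T by simp
  qed
qed

text \<open>Each step moves \<open>x\<close> by \<open>h\<close> times a power of the resolvent applied to \<open>y\<close>; hence \<open>J h ^^ n\<close> moves it
  by about \<open>n h y\<close>. Powers of the resolvent are controlled only on the domain, so \<open>y\<close> is compared
  with a point \<open>x'\<close> there, which can later be taken close to \<open>y\<close>.\<close>

lemma J_pow_derivative:
  assumes G: "(x, y) \<in> G" and G': "(x', y') \<in> G" and h: "h > 0"
  shows "p ((J h ^^ n) x - x - sc (of_real (real n * h)) y)
     \<le> real n * h * (2 * p (y - x') + real n * h * p y')"
proof (induction n)
  case (Suc n)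
  have X: "x \<in> X" "y \<in> X" "x' \<in> X" "y' \<in> X" using G_X G G' by auto
  obtain w where w: "(J h x, w) \<in> G" "J h x - sc (of_real h) w = x" using J_G[OF X(1) h] by metis
  have wX: "w \<in> X" using G_X w by auto
  (* J h x = x + h J h y, because x = J h (x - h y) and J h is additive *)
  have Jw: "p (J h x - (x + sc (of_real h) (J h y))) = 0"
  proof -
    have "p (x - J h (x - sc (of_real h) y)) = 0"
      using J_unique[OF G h] p_commute[of x "J h (x - sc (of_real h) y)"] X h by simp
    moreover have "p (J h ((x - sc (of_real h) y) + sc (of_real h) y) - (J h (x - sc (of_real h) y) + J h (sc (of_real h) y))) = 0"
      using J_add[of "x - sc (of_real h) y" "sc (of_real h) y" h] X h by simp
    moreover have "p (J h (sc (of_real h) y) - sc (of_real h) (J h y)) = 0"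
      using J_scale X h by simp
    moreover have "p (J h x - (x + sc (of_real h) (J h y))) \<le>
       p (J h x - (J h (x - sc (of_real h) y) + J h (sc (of_real h) y)))
      + p ((J h (x - sc (of_real h) y) + J h (sc (of_real h) y)) - (x + sc (of_real h) (J h y)))"
      using p_tri_diff X h by simp
    ultimately have "p (J h x - (x + sc (of_real h) (J h y))) \<le> 0"
      using p_quad[of "J h (x - sc (of_real h) y)" "J h (sc (of_real h) y)" x "sc (of_real h) (J h y)"]
        p_commute[of x "J h (x - sc (of_real h) y)"] X h by simp
    then show ?thesis using p_nonneg[of "J h x - (x + sc (of_real h) (J h y))"] X h by simp
  qed
  let ?K = "J h ^^ n"
  have 1: "p (?K (J h x) - (?K x + sc (of_real h) (?K (J h y)))) = 0"
  proof -
    have "p (?K (J h x) - (?K x + sc (of_real h) (?K (J h y)))) \<le>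
       p (?K (J h x) - ?K (x + sc (of_real h) (J h y)))
       + p (?K (x + sc (of_real h) (J h y)) - (?K x + ?K (sc (of_real h) (J h y))))
       + p ((?K x + ?K (sc (of_real h) (J h y))) - (?K x + sc (of_real h) (?K (J h y))))"
      using p_tri_diff[of "?K (J h x)" "?K (x + sc (of_real h) (J h y))" "?K x + sc (of_real h) (?K (J h y))"]
        p_tri_diff[of "?K (x + sc (of_real h) (J h y))" "?K x + ?K (sc (of_real h) (J h y))" "?K x + sc (of_real h) (?K (J h y))"]
        X h by simp
    also have "\<dots> \<le> 0"
      using J_pow_contraction[of "J h x" "x + sc (of_real h) (J h y)" h n] Jw
        J_pow_add[of x "sc (of_real h) (J h y)" h n] J_pow_scale[of "J h y" h n "of_real h"] X h by simp
    finally show ?thesis using p_nonneg[of "?K (J h x) - (?K x + sc (of_real h) (?K (J h y)))"] X h by simp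
  qed
  have 2: "p (?K (J h y) - y) \<le> 2 * p (y - x') + real (Suc n) * h * p y'"
  proof -
    have "p ((J h ^^ Suc n) y - y) \<le> p ((J h ^^ Suc n) y - (J h ^^ Suc n) x') + p ((J h ^^ Suc n) x' - x') + p (x' - y)"
      using p_tri_diff[of "(J h ^^ Suc n) y" "(J h ^^ Suc n) x'" y] p_tri_diff[of "(J h ^^ Suc n) x'" x' y] X h
      by (simp del: funpow.simps)
    also have "\<dots> \<le> 2 * p (y - x') + real (Suc n) * h * p y'"
      using J_pow_contraction[of y x' h "Suc n"] J_pow_step[OF G' h, of "Suc n"] p_commute[of x' y] X h
      by (simp del: funpow.simps)
    finally show ?thesis by (simp add: funpow_swap1)
  qed
  have eq: "(J h ^^ Suc n) x - x - sc (of_real (real (Suc n) * h)) y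
     = (?K (J h x) - (?K x + sc (of_real h) (?K (J h y)))) + (?K x - x - sc (of_real (real n * h)) y) + sc (of_real h) (?K (J h y) - y)"
    by (simp add: funpow_swap1 algebra_simps scale_right_diff_distrib scale_left_distrib)
  have 3: "p (sc (of_real h) (?K (J h y) - y)) \<le> h * (2 * p (y - x') + real (Suc n) * h * p y')"
    using mult_left_mono[OF 2, of h] h X p_scale[of "?K (J h y) - y" "of_real h"] by simp
  have "p ((J h ^^ Suc n) x - x - sc (of_real (real (Suc n) * h)) y) \<le>
     p (?K (J h x) - (?K x + sc (of_real h) (?K (J h y)))) + p (?K x - x - sc (of_real (real n * h)) y) + p (sc (of_real h) (?K (J h y) - y))"
    unfolding eq
    using p_triangle[of "(?K (J h x) - (?K x + sc (of_real h) (?K (J h y)))) + (?K x - x - sc (of_real (real n * h)) y)" "sc (of_real h) (?K (J h y) - y)"]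
      p_triangle[of "?K (J h x) - (?K x + sc (of_real h) (?K (J h y)))" "?K x - x - sc (of_real (real n * h)) y"] X h
    by simp
  also have "\<dots> \<le> real n * h * (2 * p (y - x') + real n * h * p y') + h * (2 * p (y - x') + real (Suc n) * h * p y')"
    using 1 Suc 3 by linarith
  also have "\<dots> \<le> real n * h * (2 * p (y - x') + real (Suc n) * h * p y') + h * (2 * p (y - x') + real (Suc n) * h * p y')"
    using h p_nonneg[OF X(4)] by (intro add_mono mult_left_mono mult_right_mono) auto
  also have "\<dots> = real (Suc n) * h * (2 * p (y - x') + real (Suc n) * h * p y')"
    by (simp add: algebra_simps)
  finally show ?case .
qed simp

lemma T_derivative:
  assumes G: "(x, y) \<in> G" and G': "(x', y') \<in> G" and t: "t \<ge> 0"
  shows "p (T t x - x - sc (of_real t) y) \<le> t * (2 * p (y - x') + t * p y')"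
proof (rule LIMSEQ_le_const2)
  have X: "x \<in> X" "y \<in> X" "x' \<in> X" "y' \<in> X" using G_X G G' by auto
  let ?n = "\<lambda>N. real (nat \<lfloor>t * real (Suc N)\<rfloor>) * (1 / real (Suc N))"
  have lim0: "(\<lambda>N. ?n N - t) \<longlonglongrightarrow> 0"
  proof (rule Lim_null_comparison[OF _ LIMSEQ_Suc[OF lim_1_over_n]])
    show "\<forall>\<^sub>F N in sequentially. norm (?n N - t) \<le> 1 / real (Suc N)"
      using euler_floor[OF t] by (intro always_eventually allI) (smt (verit) real_norm_def)
  qed
  show "(\<lambda>N. p (euler t N x - x - sc (of_real (?n N)) y)) \<longlonglongrightarrow> p (T t x - x - sc (of_real t) y)"
  proof (intro p_lim lim_diff)
    have "p (sc (of_real (?n N)) y - sc (of_real t) y) = \<bar>?n N - t\<bar> * p y" for N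
      using p_scale[OF X(2), of "of_real (?n N - t)"]
      unfolding norm_of_real by (simp only: of_real_diff scale_left_diff_distrib)
    then show "(\<lambda>N. p (sc (of_real (?n N)) y - sc (of_real t) y)) \<longlonglongrightarrow> 0"
      using tendsto_mult_right[OF tendsto_rabs[OF lim0], of "p y"] by simp
  qed (use X t T in auto)
  have "p (euler t N x - x - sc (of_real (?n N)) y) \<le> t * (2 * p (y - x') + t * p y')" for N
  proof -
    have "p (euler t N x - x - sc (of_real (?n N)) y) \<le> ?n N * (2 * p (y - x') + ?n N * p y')"
      unfolding euler_def by (rule J_pow_derivative[OF G G']) simp
    also have "\<dots> \<le> t * (2 * p (y - x') + t * p y')"
      using euler_floor(1)[OF t, of N] t p_nonneg[OF X(4)] p_nonneg[of "y - x'"] X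
      by (intro mult_mono add_mono order_refl) auto
    finally show ?thesis .
  qed
  then show "\<exists>N. \<forall>n\<ge>N. p (euler t n x - x - sc (of_real (?n n)) y) \<le> t * (2 * p (y - x') + t * p y')"
    by blast
qed

lemma C0_semigroup_T: "C0_semigroup X sc p T"
  unfolding C0_semigroup_def bounded_op_def
proof (intro conjI allI ballI impI)
  fix t :: real assume t: "0 \<le> t"
  show "\<exists>K. \<forall>x\<in>X. p (T t x) \<le> K * p x"
  proof (intro exI ballI)
    fix x assume x: "x \<in> X"
    have "p (T t 0) = 0" using p_scale[of "T t 0" 0] T_scale[of 0 t 0] T[of 0 t] t p_minus[of "T t 0"] by simp
    then show "p (T t x) \<le> 1 * p x"
      using T_contraction[OF x _ t, of 0] p_le_add[of "T t x" "T t 0"] x T t by simp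
  qed
qed (use T_X T_add T_scale T_0 T_semigroup T_continuous in auto)

lemma generator_T_superset:
  assumes G: "(x, y) \<in> G"
  shows "((\<lambda>h. p (sc (of_real (1 / h)) (T h x - x) - y)) \<longlongrightarrow> 0) (at_right 0)"
proof (rule tendstoI)
  fix e :: real assume e: "e > 0"
  have X: "x \<in> X" "y \<in> X" using G_X G by auto
  obtain x' y' where G': "(x', y') \<in> G" and x': "p (y - x') < e / 3" using dense_G[OF X(2), of "e / 3"] e by auto
  have X': "x' \<in> X" "y' \<in> X" using G_X G' by auto
  have "((\<lambda>s. s * p y') \<longlongrightarrow> 0 * p y') (at_right 0)"
    by (intro tendsto_intros)
  then have "\<forall>\<^sub>F s in at_right 0. s * p y' < e / 3"
    using e by (intro order_tendstoD(2)[where y = 0]) auto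
  moreover have "\<forall>\<^sub>F s in at_right 0. s > (0::real)"
    by (simp add: eventually_at_filter)
  ultimately show "\<forall>\<^sub>F h in at_right 0. dist (p (sc (of_real (1 / h)) (T h x - x) - y)) 0 < e"
  proof eventually_elim
    case (elim h)
    have eq: "sc (of_real (1 / h)) (T h x - x) - y = sc (of_real (1 / h)) (T h x - x - sc (of_real h) y)"
      using elim by (simp add: scale_right_diff_distrib flip: of_real_mult)
    have "p (sc (of_real (1 / h)) (T h x - x) - y) = p (T h x - x - sc (of_real h) y) / h"
      unfolding eq using p_scale[of "T h x - x - sc (of_real h) y" "of_real (1 / h)"] elim X T_X[of x h]
      by (simp add: norm_divide)
    also have "\<dots> \<le> (h * (2 * p (y - x') + h * p y')) / h"
      using T_derivative[OF G G', of h] elim by (intro divide_right_mono) auto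
    also have "\<dots> = 2 * p (y - x') + h * p y'" using elim by simp
    also have "\<dots> < e" using elim x' by simp
    finally show ?case using p_nonneg[of "sc (of_real (1 / h)) (T h x - x) - y"] elim X T_X[of x h] by simp
  qed
qed

text \<open>A contraction semigroup admits no vector of positive norm that its generator maps to itself: if \<open>T h z\<close> were
  \<open>(1 + h) z\<close> up to terms that are small compared with \<open>h\<close>, its norm would exceed that of \<open>z\<close>.\<close>

lemma generator_T_eigen:
  assumes z: "z \<in> X" and lim: "((\<lambda>h. p (sc (of_real (1 / h)) (T h z - z) - z)) \<longlongrightarrow> 0) (at_right 0)"
  shows "p z = 0"
proof -
  have "p z \<le> 0"
  proof (rule tendsto_lowerbound[OF lim])
    show "\<forall>\<^sub>F h in at_right 0. p z \<le> p (sc (of_real (1 / h)) (T h z - z) - z)"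
      unfolding eventually_at_filter
    proof (intro always_eventually allI impI)
      fix h :: real assume "h \<in> {0<..}"
      then have h: "h > 0" by simp
      have c: "p (T h z) \<le> p z"
        using T_contraction[OF z X_simps(1), of h] T_scale[of 0 h 0] h T[of 0 h] T[of z h] z
          p_le_add[of "T h z" "T h 0"] p_minus[of "T h 0"] by simp
      have "(1 + 1 / h) * p z = p (sc (of_real (1 + 1 / h)) z)"
        using p_scale[OF z, of "of_real (1 + 1 / h)"] h by (simp only: norm_of_real) simp
      also have "sc (of_real (1 + 1 / h)) z = sc (of_real (1 / h)) (T h z) - (sc (of_real (1 / h)) (T h z - z) - z)"
        by (simp add: scale_right_diff_distrib scale_left_distrib)
      also have "p \<dots> \<le> p (sc (of_real (1 / h)) (T h z)) + p (sc (of_real (1 / h)) (T h z - z) - z)"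
        using p_diff_le z T_X h by simp
      also have "p (sc (of_real (1 / h)) (T h z)) \<le> 1 / h * p z"
        using p_scale[of "T h z" "of_real (1 / h)"] z T_X h c by (simp add: norm_divide divide_right_mono)
      finally show "p z \<le> p (sc (of_real (1 / h)) (T h z - z) - z)" by (simp add: algebra_simps)
    qed
  qed simp
  then show ?thesis using p_nonneg[OF z] by simp
qed

text \<open>\<open>G\<close> is contained in the generator by \<open>T_derivative\<close>. It cannot be smaller: a pair \<open>(x, y)\<close> of the
  generator has the same value \<open>x - y\<close> as some pair \<open>(x', y')\<close> of \<open>G\<close>, and then the generator maps
  \<open>x - x'\<close> to itself.\<close>

lemma generator_T: "generator_graph X sc p T = G"
proof (intro equalityI subrelI)
  fix x y assume "(x, y) \<in> G"
  then show "(x, y) \<in> generator_graph X sc p T"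
    using generator_T_superset G_X by (auto simp: generator_graph_def)
next
  fix x y assume "(x, y) \<in> generator_graph X sc p T"
  then have X: "x \<in> X" "y \<in> X" and lim: "((\<lambda>h. p (sc (of_real (1 / h)) (T h x - x) - y)) \<longlongrightarrow> 0) (at_right 0)"
    by (auto simp: generator_graph_def)
  obtain x' y' where G: "(x', y') \<in> G" and eq: "x' - y' = x - y" using range_G[of "x - y" 1] X by auto
  have X': "x' \<in> X" "y' \<in> X" using G_X G by auto
  have d: "y - y' = x - x'" using eq by (simp add: algebra_simps)
  have "((\<lambda>h. p (sc (of_real (1 / h)) (T h (x - x') - (x - x')) - (x - x'))) \<longlongrightarrow> 0) (at_right 0)"
  proof (rule Lim_null_comparison)
    show "((\<lambda>h. p (sc (of_real (1 / h)) (T h x - x) - y) + p (sc (of_real (1 / h)) (T h x' - x') - y')) \<longlongrightarrow> 0) (at_right 0)"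
      using tendsto_add[OF lim generator_T_superset[OF G]] by simp
    show "\<forall>\<^sub>F h in at_right 0. norm (p (sc (of_real (1 / h)) (T h (x - x') - (x - x')) - (x - x')))
       \<le> p (sc (of_real (1 / h)) (T h x - x) - y) + p (sc (of_real (1 / h)) (T h x' - x') - y')"
      unfolding eventually_at_filter
    proof (intro always_eventually allI impI)
      fix h :: real assume "h \<in> {0<..}"
      then have h: "h > 0" by simp
      have TX: "T h x \<in> X" "T h x' \<in> X" "T h (x - x') \<in> X" "T h (- x') \<in> X" using T_X X X' h by auto
      have "p (T h (x - x') - (T h x - T h x')) \<le> p (T h (x + - x') - (T h x + T h (- x'))) + p ((T h x + T h (- x')) - (T h x + - T h x'))"
        using p_tri_diff[of "T h (x + - x')" "T h x + T h (- x')" "T h x + - T h x'"] TX by simp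
      also have "\<dots> = 0" using T_add[of x "- x'" h] T_scale[of x' h "-1"] X X' h by simp
      finally have 0: "p (T h (x - x') - (T h x - T h x')) = 0"
        using p_nonneg[of "T h (x - x') - (T h x - T h x')"] TX by simp
      let ?A = "sc (of_real (1 / h)) (T h x - x) - y" and ?B = "sc (of_real (1 / h)) (T h x' - x') - y'"
      have "sc (of_real (1 / h)) (T h (x - x') - (x - x')) - (y - y')
         = sc (of_real (1 / h)) (T h (x - x') - (T h x - T h x')) + (?A - ?B)"
        by (simp add: scale_right_diff_distrib algebra_simps)
      then have "sc (of_real (1 / h)) (T h (x - x') - (x - x')) - (x - x')
         = sc (of_real (1 / h)) (T h (x - x') - (T h x - T h x')) + (?A - ?B)"
        by (simp only: d)
      then have "p (sc (of_real (1 / h)) (T h (x - x') - (x - x')) - (x - x'))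
          \<le> p (sc (of_real (1 / h)) (T h (x - x') - (T h x - T h x'))) + (p ?A + p ?B)"
        using p_triangle[of "sc (of_real (1 / h)) (T h (x - x') - (T h x - T h x'))" "?A - ?B"] p_diff_le[of ?A ?B] TX X X'
        by simp
      then show "norm (p (sc (of_real (1 / h)) (T h (x - x') - (x - x')) - (x - x'))) \<le> p ?A + p ?B"
        using p_scale[of "T h (x - x') - (T h x - T h x')"] 0 TX X X'
          p_nonneg[of "sc (of_real (1 / h)) (T h (x - x') - (x - x')) - (x - x')"] by simp
    qed
  qed
  then have "p (x - x') = 0" using generator_T_eigen[of "x - x'"] X X' by simp
  moreover from this have "p (y - y') = 0" using d by simp
  ultimately show "(x, y) \<in> G"
    using G_null[OF G X] p_commute[of x x'] p_commute[of y y'] X X' by simp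
qed

end


section \<open>The Lumer--Phillips theorem\<close>

context seminormed_space
begin

lemma C0_semigroup_X: "C0_semigroup X sc p T \<Longrightarrow> t \<ge> 0 \<Longrightarrow> x \<in> X \<Longrightarrow> T t x \<in> X"
  by (auto simp: C0_semigroup_def bounded_op_def)

lemma C0_semigroup_rescale:
  assumes T: "C0_semigroup X sc p T"
  shows "C0_semigroup X sc p (\<lambda>t x. sc (of_real (exp (w * t))) (T t x))"
  unfolding C0_semigroup_def bounded_op_def
proof (intro conjI allI ballI impI)
  note TX = C0_semigroup_X[OF T]
  fix t :: real assume t: "0 \<le> t"
  let ?e = "\<lambda>t. of_real (exp (w * t)) :: complex"
  fix x assume x: "x \<in> X"
  show "sc (?e t) (T t x) \<in> X" using TX x t by simp
  {
    fix y assume y: "y \<in> X"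
    have "sc (?e t) (T t (x + y)) - (sc (?e t) (T t x) + sc (?e t) (T t y)) = sc (?e t) (T t (x + y) - (T t x + T t y))"
      by (simp add: scale_right_distrib scale_right_diff_distrib)
    moreover have "p (T t (x + y) - (T t x + T t y)) = 0"
      using T x y t by (auto simp: C0_semigroup_def bounded_op_def)
    ultimately show "p (sc (?e t) (T t (x + y)) - (sc (?e t) (T t x) + sc (?e t) (T t y))) = 0"
      using p_scale[of "T t (x + y) - (T t x + T t y)" "?e t"] TX x y t by simp
  }
  {
    fix c
    have "sc (?e t) (T t (sc c x)) - sc c (sc (?e t) (T t x)) = sc (?e t) (T t (sc c x) - sc c (T t x))"
      by (simp add: scale_right_diff_distrib mult.commute)
    moreover have "p (T t (sc c x) - sc c (T t x)) = 0"
      using T x t by (auto simp: C0_semigroup_def bounded_op_def)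
    ultimately show "p (sc (?e t) (T t (sc c x)) - sc c (sc (?e t) (T t x))) = 0"
      using p_scale[of "T t (sc c x) - sc c (T t x)" "?e t"] TX x t by simp
  }
  {
    fix s :: real assume s: "0 \<le> s"
    have "p (T s (sc (?e t) (T t x)) - sc (?e t) (T s (T t x))) = 0"
      using T x s t TX by (auto simp: C0_semigroup_def bounded_op_def)
    moreover have "p (T (s + t) x - T s (T t x)) = 0"
      using T x s t by (auto simp: C0_semigroup_def)
    moreover have "sc (?e (s + t)) (T (s + t) x) - sc (?e s) (T s (sc (?e t) (T t x)))
      = sc (?e (s + t)) (T (s + t) x - T s (T t x)) - sc (?e s) (T s (sc (?e t) (T t x)) - sc (?e t) (T s (T t x)))"
      by (simp add: scale_right_diff_distrib distrib_left exp_add)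
    moreover have "p (sc (?e (s + t)) (T (s + t) x - T s (T t x)) - sc (?e s) (T s (sc (?e t) (T t x)) - sc (?e t) (T s (T t x))))
       \<le> p (sc (?e (s + t)) (T (s + t) x - T s (T t x))) + p (sc (?e s) (T s (sc (?e t) (T t x)) - sc (?e t) (T s (T t x))))"
      using TX x s t by (intro p_diff_le) simp_all
    ultimately have "p (sc (?e (s + t)) (T (s + t) x) - sc (?e s) (T s (sc (?e t) (T t x)))) \<le> 0"
      using p_scale[of "T (s + t) x - T s (T t x)" "?e (s + t)"]
        p_scale[of "T s (sc (?e t) (T t x)) - sc (?e t) (T s (T t x))" "?e s"] TX x s t by simp
    then show "p (sc (?e (s + t)) (T (s + t) x) - sc (?e s) (T s (sc (?e t) (T t x)))) = 0"
      using p_nonneg[of "sc (?e (s + t)) (T (s + t) x) - sc (?e s) (T s (sc (?e t) (T t x)))"] TX x s t by simp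
  }
  show "((\<lambda>s. p (sc (?e s) (T s x) - sc (?e t) (T t x))) \<longlongrightarrow> 0) (at t within {0..})"
  proof (rule Lim_null_comparison)
    have 1: "((\<lambda>s. p (T s x - T t x)) \<longlongrightarrow> 0) (at t within {0..})"
      using T x t by (auto simp: C0_semigroup_def)
    have "((\<lambda>s. exp (w * s) * p (T s x - T t x) + \<bar>exp (w * s) - exp (w * t)\<bar> * p (T t x)) \<longlongrightarrow> exp (w * t) * 0 + \<bar>exp (w * t) - exp (w * t)\<bar> * p (T t x)) (at t within {0..})"
      by (intro tendsto_intros 1)
    then show "((\<lambda>s. exp (w * s) * p (T s x - T t x) + \<bar>exp (w * s) - exp (w * t)\<bar> * p (T t x)) \<longlongrightarrow> 0) (at t within {0..})" by simp
    show "\<forall>\<^sub>F s in at t within {0..}. norm (p (sc (?e s) (T s x) - sc (?e t) (T t x))) \<le> exp (w * s) * p (T s x - T t x) + \<bar>exp (w * s) - exp (w * t)\<bar> * p (T t x)"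
      unfolding eventually_at_filter
    proof (intro always_eventually allI impI)
      fix s :: real assume "s \<in> {0..}"
      then have s: "s \<ge> 0" by simp
      have "sc (?e s) (T s x) - sc (?e t) (T t x) = sc (?e s) (T s x - T t x) + sc (of_real (exp (w * s) - exp (w * t))) (T t x)"
        by (simp add: scale_right_diff_distrib scale_left_diff_distrib)
      moreover have "p (sc (?e s) (T s x - T t x)) = exp (w * s) * p (T s x - T t x)"
        using p_scale[of "T s x - T t x" "?e s"] TX x s t by simp
      moreover have "p (sc (of_real (exp (w * s) - exp (w * t))) (T t x)) = \<bar>exp (w * s) - exp (w * t)\<bar> * p (T t x)"
        using p_scale[of "T t x" "of_real (exp (w * s) - exp (w * t))"] TX x t by (simp only: norm_of_real)
      ultimately show "norm (p (sc (?e s) (T s x) - sc (?e t) (T t x))) \<le> exp (w * s) * p (T s x - T t x) + \<bar>exp (w * s) - exp (w * t)\<bar> * p (T t x)"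
        using p_triangle[of "sc (?e s) (T s x - T t x)" "sc (of_real (exp (w * s) - exp (w * t))) (T t x)"]
          p_nonneg[of "sc (?e s) (T s x) - sc (?e t) (T t x)"] TX x s t by simp
    qed
  qed
next
  fix x assume x: "x \<in> X"
  then show "p (sc (of_real (exp (w * 0))) (T 0 x) - x) = 0"
    using T by (auto simp: C0_semigroup_def)
next
  fix t :: real assume t: "0 \<le> t"
  then obtain K where K: "\<forall>x\<in>X. p (T t x) \<le> K * p x"
    using T by (auto simp: C0_semigroup_def bounded_op_def)
  show "\<exists>K. \<forall>x\<in>X. p (sc (of_real (exp (w * t))) (T t x)) \<le> K * p x"
    using K C0_semigroup_X[OF T t] p_scale by (intro exI[of _ "exp (w * t) * K"]) (simp add: mult.assoc)
qed

lemma generator_graph_rescale_subset: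
  assumes T: "C0_semigroup X sc p T" and xy: "(x, y) \<in> generator_graph X sc p T"
  shows "(x, y + sc (of_real w) x) \<in> generator_graph X sc p (\<lambda>t x. sc (of_real (exp (w * t))) (T t x))"
proof -
  note TX = C0_semigroup_X[OF T]
  have X: "x \<in> X" "y \<in> X" and lim: "((\<lambda>h. p (sc (of_real (1 / h)) (T h x - x) - y)) \<longlongrightarrow> 0) (at_right 0)"
    using xy by (auto simp: generator_graph_def)
  let ?r = "\<lambda>h. (exp (w * h) - 1) / h - w"
  have "((\<lambda>h. exp (w * h)) has_real_derivative w) (at 0)"
    by (auto intro!: derivative_eq_intros)
  then have "((\<lambda>h. (exp (w * h) - 1) / h) \<longlongrightarrow> w) (at_right 0)"
    unfolding DERIV_def by (auto intro: tendsto_mono[OF at_le])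
  then have r: "((\<lambda>h. ?r h) \<longlongrightarrow> 0) (at_right 0)" by (simp add: LIM_zero)
  have "((\<lambda>h. exp (w * h) * p (sc (of_real (1 / h)) (T h x - x) - y) + \<bar>exp (w * h) - 1\<bar> * p y + \<bar>?r h\<bar> * p x)
     \<longlongrightarrow> exp (w * 0) * 0 + \<bar>exp (w * 0) - 1\<bar> * p y + \<bar>0\<bar> * p x) (at_right 0)"
    by (intro tendsto_intros lim r)
  then have *: "((\<lambda>h. exp (w * h) * p (sc (of_real (1 / h)) (T h x - x) - y) + \<bar>exp (w * h) - 1\<bar> * p y + \<bar>?r h\<bar> * p x)
     \<longlongrightarrow> 0) (at_right 0)" by simp
  have "((\<lambda>h. p (sc (of_real (1 / h)) (sc (of_real (exp (w * h))) (T h x) - x) - (y + sc (of_real w) x))) \<longlongrightarrow> 0) (at_right 0)"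
  proof (rule Lim_null_comparison[OF _ *], unfold eventually_at_filter, intro always_eventually allI impI)
    fix h :: real assume "h \<in> {0<..}"
    then have h: "h > 0" by simp
    let ?a = "sc (of_real (exp (w * h))) (sc (of_real (1 / h)) (T h x - x) - y)"
    let ?b = "sc (of_real (exp (w * h) - 1)) y" and ?c = "sc (of_real (?r h)) x"
    have ra: "of_real (?r h) = (of_real (exp (w * h)) * of_real (1 / h) - of_real (1 / h) - of_real w :: complex)"
      using h by (simp add: field_simps)
    have eq: "sc (of_real (1 / h)) (sc (of_real (exp (w * h))) (T h x) - x) - (y + sc (of_real w) x) = ?a + ?b + ?c"
      unfolding ra by (simp only: of_real_diff of_real_1 scale_right_diff_distrib scale_left_diff_distrib scale_scale scale_one)
        (simp add: algebra_simps)
    have "p (?a + ?b + ?c) \<le> p ?a + p ?b + p ?c"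
      using p_triangle[of "?a + ?b" ?c] p_triangle[of ?a ?b] X TX h by simp
    also have "p ?a = exp (w * h) * p (sc (of_real (1 / h)) (T h x - x) - y)"
      using p_scale[of "sc (of_real (1 / h)) (T h x - x) - y" "of_real (exp (w * h))"] X TX h by simp
    also have "p ?b = \<bar>exp (w * h) - 1\<bar> * p y"
      using p_scale[of y "of_real (exp (w * h) - 1)"] X by (simp only: norm_of_real)
    also have "p ?c = \<bar>?r h\<bar> * p x"
      using p_scale[of x "of_real (?r h)"] X by (simp only: norm_of_real)
    finally show "norm (p (sc (of_real (1 / h)) (sc (of_real (exp (w * h))) (T h x) - x) - (y + sc (of_real w) x)))
      \<le> exp (w * h) * p (sc (of_real (1 / h)) (T h x - x) - y) + \<bar>exp (w * h) - 1\<bar> * p y + \<bar>?r h\<bar> * p x"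
      using p_nonneg[of "?a + ?b + ?c"] X TX h unfolding eq by simp
  qed
  then show ?thesis using X by (simp add: generator_graph_def)
qed

text \<open>One inclusion suffices, since rescaling with \<open>- w\<close> undoes rescaling with \<open>w\<close>.\<close>

lemma generator_graph_rescale:
  assumes T: "C0_semigroup X sc p T"
  shows "generator_graph X sc p (\<lambda>t x. sc (of_real (exp (w * t))) (T t x))
    = {(x, y). (x, y - sc (of_real w) x) \<in> generator_graph X sc p T}"
proof (intro equalityI subrelI)
  fix x y assume "(x, y) \<in> {(x, y). (x, y - sc (of_real w) x) \<in> generator_graph X sc p T}"
  then show "(x, y) \<in> generator_graph X sc p (\<lambda>t x. sc (of_real (exp (w * t))) (T t x))"
    using generator_graph_rescale_subset[OF T, of x "y - sc (of_real w) x" w] by simp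
next
  fix x y assume *: "(x, y) \<in> generator_graph X sc p (\<lambda>t x. sc (of_real (exp (w * t))) (T t x))"
  have "of_real (exp (- w * t)) * of_real (exp (w * t)) = (1::complex)" for t
    by (simp flip: of_real_mult exp_add)
  then have "(\<lambda>t x. sc (of_real (exp (- w * t))) (sc (of_real (exp (w * t))) (T t x))) = T"
    by (simp add: fun_eq_iff)
  then show "(x, y) \<in> {(x, y). (x, y - sc (of_real w) x) \<in> generator_graph X sc p T}"
    using generator_graph_rescale_subset[OF C0_semigroup_rescale[OF T, of w] *, of "- w"] by simp
qed

end

text \<open>Only the real part \<open>r\<close> of the inner product is kept, as dissipativity is a statement about it.
  Compatibility with complex scalars enters through the seminorm alone.\<close>

locale semi_hilbert_space = vector_space sc
  for sc :: "complex \<Rightarrow> 'x::ab_group_add \<Rightarrow> 'x" +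
  fixes X :: "'x set" and p :: "'x \<Rightarrow> real" and r :: "'x \<Rightarrow> 'x \<Rightarrow> real"
  assumes subspace_carrier: "subspace X"
    and r_add: "x \<in> X \<Longrightarrow> y \<in> X \<Longrightarrow> z \<in> X \<Longrightarrow> r (x + y) z = r x z + r y z"
    and r_scale_real: "x \<in> X \<Longrightarrow> y \<in> X \<Longrightarrow> r (sc (of_real a) x) y = a * r x y"
    and r_sym: "x \<in> X \<Longrightarrow> y \<in> X \<Longrightarrow> r x y = r y x"
    and r_nonneg: "x \<in> X \<Longrightarrow> 0 \<le> r x x"
    and r_scale: "x \<in> X \<Longrightarrow> r (sc c x) (sc c x) = (cmod c)\<^sup>2 * r x x"
    and p_r: "p x = sqrt (r x x)"
    and complete: "\<lbrakk>\<And>n. f n \<in> X;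
        \<And>e. e > 0 \<Longrightarrow> \<exists>N::nat. \<forall>m\<ge>N. \<forall>n\<ge>N. p (f m - f n) < e\<rbrakk>
        \<Longrightarrow> \<exists>l\<in>X. (\<lambda>n. p (f n - l)) \<longlonglongrightarrow> 0"
begin

lemma X_closed:
  "0 \<in> X"
  "x \<in> X \<Longrightarrow> y \<in> X \<Longrightarrow> x + y \<in> X"
  "x \<in> X \<Longrightarrow> y \<in> X \<Longrightarrow> x - y \<in> X"
  "x \<in> X \<Longrightarrow> sc c x \<in> X"
  "x \<in> X \<Longrightarrow> - x \<in> X"
  using subspace_carrier by (auto intro: subspace_0 subspace_add subspace_diff subspace_scale subspace_neg)

lemma r_add_right: "x \<in> X \<Longrightarrow> y \<in> X \<Longrightarrow> z \<in> X \<Longrightarrow> r z (x + y) = r z x + r z y"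
  using r_add[of x y z] r_sym X_closed by metis

lemma r_scale_right: "x \<in> X \<Longrightarrow> y \<in> X \<Longrightarrow> r y (sc (of_real a) x) = a * r y x"
  using r_scale_real[of x y a] r_sym X_closed by metis

lemma r_diff: "x \<in> X \<Longrightarrow> y \<in> X \<Longrightarrow> z \<in> X \<Longrightarrow> r (x - y) z = r x z - r y z"
  using r_add[of x "sc (of_real (-1)) y" z] r_scale_real[of y z "-1"] X_closed(4)[of y "of_real (-1)"] by simp

lemma r_diff_right: "x \<in> X \<Longrightarrow> y \<in> X \<Longrightarrow> z \<in> X \<Longrightarrow> r z (x - y) = r z x - r z y"
  using r_diff[of x y z] r_sym X_closed by metis

lemma p_square: "x \<in> X \<Longrightarrow> (p x)\<^sup>2 = r x x"
  using r_nonneg by (simp add: p_r)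

lemma cauchy_schwarz:
  assumes "x \<in> X" "y \<in> X"
  shows "(r x y)\<^sup>2 \<le> r x x * r y y"
proof -
  have q: "0 \<le> r x x + 2 * t * r x y + t\<^sup>2 * r y y" for t
    using r_nonneg[of "x + sc (of_real t) y"] assms X_closed r_sym[of y x]
    by (simp add: r_add r_add_right r_scale_real r_scale_right algebra_simps power2_eq_square)
  show ?thesis
  proof (cases "r y y = 0")
    case True
    have "r x y = 0"
    proof (rule ccontr)
      assume n: "r x y \<noteq> 0"
      show False using q[of "- (r x x + 1) / (2 * r x y)"] n True by (simp add: field_simps)
    qed
    then show ?thesis using True by simp
  next
    case False
    then have "r y y > 0" using r_nonneg[OF assms(2)] by simp
    then show ?thesis using q[of "- r x y / r y y"]
      by (simp add: field_simps power2_eq_square)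
  qed
qed

sublocale seminormed_space sc X p
proof
  show "subspace X" by (rule subspace_carrier)
  show "p (x + y) \<le> p x + p y" if "x \<in> X" "y \<in> X" for x y
  proof (rule power2_le_imp_le)
    have "\<bar>r x y\<bar> \<le> p x * p y"
      using real_sqrt_le_mono[OF cauchy_schwarz[OF that]] by (simp add: p_r real_sqrt_mult)
    then show "(p (x + y))\<^sup>2 \<le> (p x + p y)\<^sup>2"
      using that X_closed r_sym[of y x] by (simp add: p_square power2_sum r_add r_add_right)
    show "0 \<le> p x + p y" using that r_nonneg by (simp add: p_r)
  qed
  show "p (sc c x) = cmod c * p x" if "x \<in> X" for c x
    using that by (simp add: p_r r_scale real_sqrt_mult)
  show "\<exists>l\<in>X. (\<lambda>n. p (f n - l)) \<longlonglongrightarrow> 0" if "\<And>n. f n \<in> X"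
    "\<And>e. e > 0 \<Longrightarrow> \<exists>N::nat. \<forall>m\<ge>N. \<forall>n\<ge>N. p (f m - f n) < e" for f :: "nat \<Rightarrow> 'x"
    using that by (rule complete)
qed

lemma dissipative_contractive:
  assumes "x \<in> X" "y \<in> X" "r y x \<le> 0" "h > 0"
  shows "p x \<le> p (x - sc (of_real h) y)"
proof -
  have "r (x - sc (of_real h) y) (x - sc (of_real h) y) = r x x - 2 * h * r y x + h\<^sup>2 * r y y"
    using assms r_sym[of x y]
    by (simp add: r_diff r_diff_right r_scale_real r_scale_right power2_eq_square algebra_simps)
  moreover have "h * r y x \<le> 0" using assms by (simp add: mult_nonneg_nonpos)
  moreover have "0 \<le> h\<^sup>2 * r y y" using assms r_nonneg by simp
  ultimately show ?thesis unfolding p_r by (intro real_sqrt_le_mono) linarith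
qed

end

locale m_dissipative = semi_hilbert_space sc X p r
  for sc :: "complex \<Rightarrow> 'x::ab_group_add \<Rightarrow> 'x" and X :: "'x set" and p :: "'x \<Rightarrow> real"
    and r :: "'x \<Rightarrow> 'x \<Rightarrow> real" +
  fixes G :: "('x \<times> 'x) set"
  assumes linear_relation_G: "linear_relation G"
    and dissipative: "(x, y) \<in> G \<Longrightarrow> r y x \<le> 0"
    and single_valued: "(x, y) \<in> G \<Longrightarrow> p x = 0 \<Longrightarrow> p y = 0"
    and maximal: "z \<in> X \<Longrightarrow> h > 0 \<Longrightarrow> \<exists>(x, y)\<in>G. x - sc (of_real h) y = z"
begin

sublocale contraction_resolvents sc X p G
proof
  show "linear_relation G" by (rule linear_relation_G)
  show "p x \<le> p (x - sc (of_real h) y)" if "(x, y) \<in> G" "h > 0" for x y h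
    using that dissipative linear_relation_G by (intro dissipative_contractive) (auto simp: linear_relation_def)
qed (rule maximal)

text \<open>For \<open>g \<le> h\<close> the step \<open>J g z - z\<close> is shorter than \<open>J h z - z\<close>, and the squared distance of the two is
  bounded by the difference of their squared lengths. This is monotonicity of \<open>- G\<close> at the two points
  \<open>J h z\<close> and \<open>J g z\<close>; it makes the steps a Cauchy sequence as \<open>h\<close> decreases to zero.\<close>

lemma defect_decreasing:
  assumes z: "z \<in> X" and gh: "0 < g" "g \<le> h"
  shows "(p ((J h z - z) - (J g z - z)))\<^sup>2 \<le> (p (J h z - z))\<^sup>2 - (p (J g z - z))\<^sup>2"
proof -
  have h: "h > 0" using gh by simp
  obtain y where y: "(J h z, y) \<in> G" "J h z - sc (of_real h) y = z" using J_G z h by metis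
  obtain w where w: "(J g z, w) \<in> G" "J g z - sc (of_real g) w = z" using J_G z gh by metis
  have X: "y \<in> X" "w \<in> X" using G_X y w by auto
  have "J h z - z = J h z - (J h z - sc (of_real h) y)" by (simp only: y(2))
  then have a: "J h z - z = sc (of_real h) y" by simp
  have "J g z - z = J g z - (J g z - sc (of_real g) w)" by (simp only: w(2))
  then have b: "J g z - z = sc (of_real g) w" by simp
  have d: "J h z - J g z = sc (of_real h) y - sc (of_real g) w"
    unfolding a[symmetric] b[symmetric] by simp
  have "r (y - w) (J h z - J g z) \<le> 0" by (rule dissipative[OF G_diff[OF y(1) w(1)]])
  then have "h * r y y - (h + g) * r y w + g * r w w \<le> 0"
    unfolding d using X r_sym[of w y]
    by (simp add: r_diff r_diff_right r_scale_real r_scale_right algebra_simps)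
  then have D: "2 * g * h * (h * r y y - (h + g) * r y w + g * r w w) \<le> 0"
    using gh h by (simp add: mult_nonneg_nonpos)
  define P Q where "P = (p (sc (of_real h) y - sc (of_real g) w))\<^sup>2"
    and "Q = (p (sc (of_real h) y))\<^sup>2 - (p (sc (of_real g) w))\<^sup>2"
  have P: "P = h * h * r y y - 2 * h * g * r y w + g * g * r w w"
    using X r_sym[of w y] by (simp add: P_def p_square r_diff r_diff_right r_scale_real r_scale_right algebra_simps)
  have Q: "Q = h * h * r y y - g * g * r w w"
    using X by (simp add: Q_def p_square r_scale_real r_scale_right)
  have PQ: "(h + g) * P \<le> (h - g) * Q" using D unfolding P Q by (simp add: algebra_simps)
  have "P \<le> Q"
  proof (cases "h = g")
    case True
    then show ?thesis unfolding P_def Q_def a[symmetric] b[symmetric] by simp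
  next
    case False
    then have "h - g > 0" using gh by simp
    moreover have "0 \<le> (h + g) * P" using gh h by (simp add: P_def)
    ultimately have "Q \<ge> 0" using PQ by (metis order_trans zero_le_mult_iff not_less)
    then have "(h - g) * Q \<le> (h + g) * Q" using gh by (intro mult_right_mono) auto
    then have "(h + g) * P \<le> (h + g) * Q" using PQ by simp
    then show ?thesis using gh h by simp
  qed
  then show ?thesis unfolding a b P_def Q_def .
qed

lemma J_domain:
  assumes "(x, y) \<in> G"
  shows "(\<lambda>n. p (J (1 / real (Suc n)) x - x)) \<longlonglongrightarrow> 0"
proof (rule Lim_null_comparison)
  show "(\<lambda>n. 1 / real (Suc n) * p y) \<longlonglongrightarrow> 0"
    using tendsto_mult_left[OF LIMSEQ_Suc[OF lim_1_over_n], of "p y"] by (simp add: mult.commute)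
  have X: "x \<in> X" using G_X assms by auto
  show "\<forall>\<^sub>F n in sequentially. norm (p (J (1 / real (Suc n)) x - x)) \<le> 1 / real (Suc n) * p y"
    using J_step[OF assms, of "1 / real (Suc _)"] p_nonneg X by (intro always_eventually allI) (simp add: abs_of_nonneg)
qed

text \<open>If \<open>J h w\<close> tends to zero, then the steps \<open>J h w - w\<close> have limit length \<open>p w\<close>, so
  \<open>p w \<le> p (J 1 w - w)\<close> by \<open>defect_decreasing\<close>. Together with dissipativity at \<open>J 1 w\<close> this forces
  \<open>J 1 w = 0\<close>, hence \<open>w = 0\<close> since \<open>G\<close> is single-valued.\<close>

lemma J_zero_imp:
  assumes w: "w \<in> X" and lim: "(\<lambda>n. p (J (1 / real (Suc n)) w)) \<longlonglongrightarrow> 0"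
  shows "p w = 0"
proof -
  let ?J = "\<lambda>n. J (1 / real (Suc n)) w"
  have "(\<lambda>n. p (?J n - w)) \<longlonglongrightarrow> p (0 - w)"
  proof (rule p_lim)
    show "(\<lambda>n. p (?J n - w - (0 - w))) \<longlonglongrightarrow> 0" using lim by simp
  qed (use w in auto)
  then have lim': "(\<lambda>n. (p (?J n - w))\<^sup>2) \<longlonglongrightarrow> (p w)\<^sup>2" using w by (intro tendsto_power) (simp add: p_minus)
  have "(p (?J n - w))\<^sup>2 \<le> (p (J 1 w - w))\<^sup>2" for n
  proof -
    have "0 \<le> (p (J 1 w - w))\<^sup>2 - (p (?J n - w))\<^sup>2"
      by (rule order_trans[OF _ defect_decreasing[OF w, of "1 / real (Suc n)" 1]]) auto
    then show ?thesis by simp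
  qed
  then have 1: "(p w)\<^sup>2 \<le> (p (J 1 w - w))\<^sup>2" using lim' by (intro LIMSEQ_le_const2) auto
  obtain y where y: "(J 1 w, y) \<in> G" "J 1 w - sc (of_real 1) y = w" using J_G[OF w, of 1] by auto
  let ?x = "J 1 w"
  have X: "?x \<in> X" "y \<in> X" using G_X y by auto
  have yx: "y = ?x - w" using y(2) by (simp add: algebra_simps)
  have "r ?x ?x \<le> r ?x w" using dissipative[OF y(1)] X w r_sym[of w ?x] unfolding yx by (simp add: r_diff)
  moreover have "2 * r ?x w \<le> r ?x ?x" using 1 X w r_sym[of w ?x] by (simp add: p_square r_diff r_diff_right)
  ultimately have "r ?x ?x \<le> 0" by simp
  then have px: "p ?x = 0" using r_nonneg[OF X(1)] by (simp add: p_r)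
  then have "p y = 0" using single_valued[OF y(1)] by simp
  then show ?thesis using px p_diff_le[of ?x y] p_nonneg[OF w] X y(2) by simp
qed

text \<open>The steps \<open>J h z - z\<close> converge to some \<open>a\<close>, and \<open>z + a\<close> lies in the closure of the domain. On that
  closure \<open>J h\<close> converges to the identity, so \<open>J h a = J h (z + a) - J h z\<close> tends to zero, and
  \<open>a = 0\<close> by \<open>J_zero_imp\<close>.\<close>

lemma domain_dense:
  assumes z: "z \<in> X" and e: "e > 0"
  shows "\<exists>(x, y)\<in>G. p (z - x) < e"
proof -
  let ?h = "\<lambda>n. 1 / real (Suc n)"
  let ?a = "\<lambda>n. J (?h n) z - z"
  define q where "q n = (p (?a n))\<^sup>2" for n
  have dec: "(p (?a m - ?a n))\<^sup>2 \<le> q m - q n" if "m \<le> n" for m n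
    unfolding q_def using that by (intro defect_decreasing z) (auto simp: divide_left_mono)
  have "convergent q"
  proof (rule Bseq_monoseq_convergent)
    have "decseq q"
      unfolding decseq_def using dec by (smt (verit) zero_le_power2)
    then show "monoseq q" by (rule decseq_imp_monoseq)
    have "0 \<le> q n" "q n \<le> q 0" for n using decseqD[OF \<open>decseq q\<close>, of 0 n] by (simp_all add: q_def)
    then have "\<bar>q n\<bar> \<le> q 0" for n by simp
    then show "Bseq q" by (intro BseqI'[of q "q 0"]) simp
  qed
  then have qC: "Cauchy q" by (simp add: convergent_eq_Cauchy convergent_def)
  obtain a where a: "a \<in> X" "(\<lambda>n. p (?a n - a)) \<longlonglongrightarrow> 0"
  proof -
    have "\<exists>N. \<forall>m\<ge>N. \<forall>n\<ge>N. p (?a m - ?a n) < d" if d: "d > 0" for d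
    proof -
      obtain N where N: "\<forall>m\<ge>N. \<forall>n\<ge>N. dist (q m) (q n) < d\<^sup>2"
        using metric_CauchyD[OF qC, of "d\<^sup>2"] d by auto
      have "p (?a m - ?a n) < d" if mn: "m \<ge> N" "n \<ge> N" for m n
      proof (rule power2_less_imp_less)
        have c: "p (?a m - ?a n) = p (?a n - ?a m)" using z by (intro p_commute) auto
        have "\<bar>q m - q n\<bar> < d\<^sup>2" using N mn by (auto simp: dist_real_def)
        then show "(p (?a m - ?a n))\<^sup>2 < d\<^sup>2"
          using dec[of m n] dec[of n m] c by (cases "m \<le> n") auto
      qed (use d in auto)
      then show ?thesis by blast
    qed
    then show ?thesis using complete[of ?a] z that by auto
  qed
  let ?z = "z + a"
  have zX: "?z \<in> X" using z a by simp
  have lim: "(\<lambda>n. p (J (?h n) z - ?z)) \<longlonglongrightarrow> 0" using a(2) by (simp add: algebra_simps)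
  have near: "\<exists>(x, y)\<in>G. p (?z - x) < d" if d: "d > 0" for d
  proof -
    have "\<forall>\<^sub>F n in sequentially. p (J (?h n) z - ?z) < d" using lim d by (rule order_tendstoD)
    then obtain n where n: "p (J (?h n) z - ?z) < d" by (auto simp: eventually_sequentially)
    obtain y where "(J (?h n) z, y) \<in> G" using J_G[OF z, of "?h n"] by auto
    then show ?thesis using n p_commute[of ?z "J (?h n) z"] zX z by force
  qed
  have lim2: "(\<lambda>n. p (J (?h n) ?z - ?z)) \<longlonglongrightarrow> 0"
  proof (rule tendstoI)
    fix d :: real assume d: "d > 0"
    obtain x y where G: "(x, y) \<in> G" and x: "p (?z - x) < d / 3" using near[of "d / 3"] d by auto
    have X: "x \<in> X" using G_X G by auto
    have "\<forall>\<^sub>F n in sequentially. p (J (?h n) x - x) < d / 3"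
      using J_domain[OF G] d by (intro order_tendstoD(2)) auto
    then show "\<forall>\<^sub>F n in sequentially. dist (p (J (?h n) ?z - ?z)) 0 < d"
    proof eventually_elim
      case (elim n)
      have "p (J (?h n) ?z - ?z) \<le> p (J (?h n) ?z - J (?h n) x) + p (J (?h n) x - x) + p (x - ?z)"
        using p_tri_diff[of "J (?h n) ?z" "J (?h n) x" ?z] p_tri_diff[of "J (?h n) x" x ?z] X zX by simp
      also have "\<dots> < d / 3 + d / 3 + d / 3"
        using J_contraction[of ?z x "?h n"] elim x p_commute[of x ?z] X zX by simp
      finally show ?case using p_nonneg[of "J (?h n) ?z - ?z"] zX by simp
    qed
  qed
  have "(\<lambda>n. p (J (?h n) a)) \<longlonglongrightarrow> 0"
  proof (rule Lim_null_comparison)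
    show "(\<lambda>n. p (J (?h n) ?z - ?z) + p (J (?h n) z - ?z)) \<longlonglongrightarrow> 0"
      using tendsto_add[OF lim2 lim] by simp
    have "p (J (?h n) a) \<le> p (J (?h n) ?z - ?z) + p (J (?h n) z - ?z)" for n
    proof -
      let ?b = "J (?h n) ?z - (J (?h n) z + J (?h n) a)"
      have "J (?h n) a = ((J (?h n) ?z - ?z) - (J (?h n) z - ?z)) - ?b" by (simp add: algebra_simps)
      moreover have "p (((J (?h n) ?z - ?z) - (J (?h n) z - ?z)) - ?b) \<le> p ((J (?h n) ?z - ?z) - (J (?h n) z - ?z)) + p ?b"
        using z a zX by (intro p_diff_le) auto
      moreover have "p ((J (?h n) ?z - ?z) - (J (?h n) z - ?z)) \<le> p (J (?h n) ?z - ?z) + p (J (?h n) z - ?z)"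
        using z a zX by (intro p_diff_le) auto
      moreover have "p ?b = 0" using z a by (intro J_add) auto
      ultimately show ?thesis by simp
    qed
    then show "\<forall>\<^sub>F n in sequentially. norm (p (J (?h n) a)) \<le> p (J (?h n) ?z - ?z) + p (J (?h n) z - ?z)"
      using p_nonneg a by (intro always_eventually) (simp add: abs_of_nonneg)
  qed
  then have "p a = 0" using J_zero_imp a by simp
  moreover obtain x y where G: "(x, y) \<in> G" and x: "p (?z - x) < e" using near[OF e] by auto
  moreover have "x \<in> X" using G_X G by auto
  moreover have "p (z - x) \<le> p (?z - x) + p a"
    using p_diff_le[of "?z - x" a] \<open>x \<in> X\<close> z a by (simp add: algebra_simps)
  ultimately show ?thesis by force
qed

sublocale dense_contraction_resolvents sc X p G
  by unfold_locales (rule domain_dense)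

end

context semi_hilbert_space
begin

text \<open>Shifting the operator by \<open>w\<close> makes it dissipative; the semigroup of the shifted operator is then
  rescaled by \<open>exp (w t)\<close>.\<close>

theorem lumer_phillips:
  assumes lin: "linear_relation G"
    and diss: "\<And>x y. (x, y) \<in> G \<Longrightarrow> r y x \<le> w * r x x"
    and single: "\<And>x y. (x, y) \<in> G \<Longrightarrow> p x = 0 \<Longrightarrow> p y = 0"
    and range: "\<And>z l. z \<in> X \<Longrightarrow> l > w \<Longrightarrow> \<exists>(x, y)\<in>G. p (sc (of_real l) x - y - z) = 0"
  shows "\<exists>T. C0_semigroup X sc p T \<and> generator_graph X sc p T = G"
proof -
  define G0 where "G0 = {(x, y). (x, y + sc (of_real w) x) \<in> G}"
  have GX: "x \<in> X" "y \<in> X" if "(x, y) \<in> G" for x y using lin that by (auto simp: linear_relation_def)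
  have G0X: "x \<in> X" "y \<in> X" if "(x, y) \<in> G0" for x y
  proof -
    have *: "x \<in> X" "y + sc (of_real w) x \<in> X" using GX that by (auto simp: G0_def)
    then show "x \<in> X" by simp
    then show "y \<in> X" using X_simps(3)[OF *(2), of "sc (of_real w) x"] by simp
  qed
  interpret m_dissipative sc X p r G0
  proof
    show "linear_relation G0"
      unfolding linear_relation_def
    proof (intro conjI allI impI)
      show "G0 \<subseteq> X \<times> X" using G0X by auto
      show "(0, 0) \<in> G0" using lin by (simp add: G0_def linear_relation_def)
      fix x y assume xy: "(x, y) \<in> G0"
      show "(sc c x, sc c y) \<in> G0" for c
      proof -
        have "(sc c x, sc c (y + sc (of_real w) x)) \<in> G" using lin xy by (simp add: G0_def linear_relation_def)
        then show ?thesis by (simp add: G0_def scale_right_distrib mult.commute)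
      qed
      fix x' y'
      {
        assume xy': "(x', y') \<in> G0"
        have "(x + x', (y + sc (of_real w) x) + (y' + sc (of_real w) x')) \<in> G"
          using lin xy xy' unfolding G0_def linear_relation_def by blast
        then show "(x + x', y + y') \<in> G0" by (simp add: G0_def scale_right_distrib algebra_simps)
      }
      assume *: "x' \<in> X" "y' \<in> X" "p (x - x') = 0" "p (y - y') = 0"
      have "p ((y + sc (of_real w) x) - (y' + sc (of_real w) x')) \<le> p (y - y') + p (sc (of_real w) x - sc (of_real w) x')"
        using G0X[OF xy] * by (intro p_quad) auto
      also have "p (sc (of_real w) x - sc (of_real w) x') = 0"
        using p_scale[of "x - x'" "of_real w"] G0X[OF xy] * by (simp add: scale_right_diff_distrib)
      finally have "p ((y + sc (of_real w) x) - (y' + sc (of_real w) x')) = 0"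
        using p_nonneg[of "(y + sc (of_real w) x) - (y' + sc (of_real w) x')"] G0X[OF xy] * by simp
      moreover have "(x, y + sc (of_real w) x) \<in> G" using xy by (simp add: G0_def)
      ultimately have "(x', y' + sc (of_real w) x') \<in> G"
        using lin * unfolding linear_relation_def by (meson X_simps(2,4))
      then show "(x', y') \<in> G0" by (simp add: G0_def)
    qed
    show "r y x \<le> 0" if "(x, y) \<in> G0" for x y
      using diss[of x "y + sc (of_real w) x"] that G0X[OF that] by (simp add: G0_def r_add r_scale_real)
    show "p y = 0" if *: "(x, y) \<in> G0" "p x = 0" for x y
    proof -
      have "p (y + sc (of_real w) x) = 0" using single * by (simp add: G0_def)
      moreover have "p (sc (of_real w) x) = 0" using p_scale[of x "of_real w"] * G0X[OF *(1)] by simp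
      ultimately show ?thesis
        using p_diff_le[of "y + sc (of_real w) x" "sc (of_real w) x"] p_nonneg[of y] G0X[OF *(1)] by simp
    qed
    show "\<exists>(x, y)\<in>G0. x - sc (of_real h) y = z" if z: "z \<in> X" and h: "h > 0" for z h
    proof -
      have l: "1 / h + w > w" using h by simp
      obtain x y where G: "(x, y) \<in> G" and eq: "p (sc (of_real (1 / h + w)) x - y - sc (of_real (1 / h)) z) = 0"
        using range[OF _ l, of "sc (of_real (1 / h)) z"] z by auto
      note X = GX[OF G]
      let ?y = "sc (of_real (1 / h)) (x - z)"
      have "y - (?y + sc (of_real w) x) = - (sc (of_real (1 / h + w)) x - y - sc (of_real (1 / h)) z)"
        by (simp add: scale_left_distrib scale_right_diff_distrib algebra_simps)
      moreover have "p (- (sc (of_real (1 / h + w)) x - y - sc (of_real (1 / h)) z)) = 0"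
        unfolding eq[symmetric] using X z by (intro p_minus) auto
      ultimately have "p (y - (?y + sc (of_real w) x)) = 0" by (simp only:)
      then have "(x, ?y + sc (of_real w) x) \<in> G"
        using lin G X z unfolding linear_relation_def
        by (metis X_simps(2,3,4) diff_self p_zero)
      then have "(x, ?y) \<in> G0" by (simp add: G0_def)
      moreover have "x - sc (of_real h) ?y = z" using h by (simp add: scale_right_diff_distrib flip: of_real_mult)
      ultimately show ?thesis by blast
    qed
  qed
  have "generator_graph X sc p (\<lambda>t x. sc (of_real (exp (w * t))) (T t x)) = G"
    unfolding generator_graph_rescale[OF C0_semigroup_T] generator_T by (auto simp: G0_def)
  then show ?thesis using C0_semigroup_rescale[OF C0_semigroup_T, of w] by blast
qed

end


section \<open>Integration by parts against a Lipschitz factor\<close>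

lemma integrable_leb_iff:
  fixes f :: "real \<Rightarrow> 'a::euclidean_space"
  shows "integrable (leb l) f \<longleftrightarrow> f absolutely_integrable_on {0..l}"
proof -
  have "integrable (leb l) f \<longleftrightarrow> f absolutely_integrable_on {0<..<l}"
    by (simp add: set_integrable_def integrable_restrict_space)
  also have "\<dots> \<longleftrightarrow> f absolutely_integrable_on {0..l}"
  proof (rule absolutely_integrable_spike_set_eq)
    show "negligible {x \<in> {0<..<l} - {0..l}. f x \<noteq> 0}" by (rule negligible_subset[of "{}"]) auto
    show "negligible {x \<in> {0..l} - {0<..<l}. f x \<noteq> 0}" by (rule negligible_subset[of "{0, l}"]) auto
  qed
  finally show ?thesis .
qed

lemma LINT_leb:
  fixes f :: "real \<Rightarrow> 'a::euclidean_space"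
  assumes "integrable (leb l) f"
  shows "(LINT x|leb l. f x) = integral {0..l} f"
  using lebesgue_integral_eq_integral[OF assms] by (simp add: integral_open_interval_real[symmetric])

lemma integrable_leb_sub:
  fixes f :: "real \<Rightarrow> 'a::euclidean_space"
  assumes "integrable (leb l) f" "0 \<le> a" "b \<le> l"
  shows "f integrable_on {a..b}" "(\<lambda>x. norm (f x)) integrable_on {a..b}"
proof -
  have "f absolutely_integrable_on {a..b}"
    using assms(1)[unfolded integrable_leb_iff]
    by (rule absolutely_integrable_on_subinterval) (use assms in auto)
  then show "f integrable_on {a..b}" "(\<lambda>x. norm (f x)) integrable_on {a..b}"
    by (auto simp: absolutely_integrable_on_def)
qed

lemma integral_leb_diff:
  fixes f :: "real \<Rightarrow> 'a::euclidean_space"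
  assumes "integrable (leb l) f" "0 \<le> a" "a \<le> b" "b \<le> l"
  shows "integral {0..b} f - integral {0..a} f = integral {a..b} f"
  using Henstock_Kurzweil_Integration.integral_combine[OF assms(2,3) integrable_leb_sub(1)[OF assms(1) order_refl assms(4)]]
  by (simp add: algebra_simps)

lemma measurable_leb_continuous:
  fixes f :: "real \<Rightarrow> 'a::euclidean_space"
  assumes "continuous_on {0..l} f"
  shows "f \<in> borel_measurable (leb l)"
  by (rule continuous_imp_measurable_on_sets_lebesgue)
    (auto intro: continuous_on_subset[OF assms])

lemma continuous_interval_bounded:
  fixes f :: "real \<Rightarrow> 'a::real_normed_vector"
  assumes "continuous_on {a..b} f"
  obtains K where "K > 0" "\<And>x. x \<in> {a..b} \<Longrightarrow> norm (f x) \<le> K"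
proof -
  have "bounded (f ` {a..b})" by (intro compact_imp_bounded compact_continuous_image assms) auto
  then show ?thesis using that unfolding bounded_pos by auto
qed

lemma integrable_leb_bounded_mult:
  fixes f g :: "real \<Rightarrow> complex"
  assumes "integrable (leb l) g" "f \<in> borel_measurable (leb l)" "AE x in leb l. cmod (f x) \<le> K"
  shows "integrable (leb l) (\<lambda>x. f x * g x)"
proof (rule Bochner_Integration.integrable_bound)
  show "integrable (leb l) (\<lambda>x. K * norm (g x))" using assms by simp
  show "(\<lambda>x. f x * g x) \<in> borel_measurable (leb l)" using assms by measurable
  show "AE x in leb l. norm (f x * g x) \<le> norm (K * norm (g x))"
    using assms(3) by eventually_elim (auto simp: norm_mult mult_right_mono intro: order_trans[OF _ abs_ge_self])
qed

lemma integrable_leb_cont_mult: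
  fixes f g :: "real \<Rightarrow> complex"
  assumes "integrable (leb l) g" "continuous_on {0..l} f"
  shows "integrable (leb l) (\<lambda>x. f x * g x)"
proof -
  obtain K where K: "\<And>x. x \<in> {0..l} \<Longrightarrow> norm (f x) \<le> K" using continuous_interval_bounded[OF assms(2)] by blast
  show ?thesis
    by (rule integrable_leb_bounded_mult[OF assms(1) measurable_leb_continuous[OF assms(2)], of K])
      (rule AE_I2, use K in \<open>simp add: space_restrict_space\<close>)
qed

lemma integrable_leb_continuous:
  fixes f :: "real \<Rightarrow> 'a::euclidean_space"
  shows "continuous_on {0..l} f \<Longrightarrow> integrable (leb l) f"
  by (simp add: integrable_leb_iff absolutely_integrable_continuous_real)

text \<open>A pointwise derivative of \<open>\<Psi>\<close> need not exist; it is enough that on short intervals the increment of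
  \<open>\<Psi>\<close> is bounded by that of \<open>F\<close> up to a small multiple of the increment of \<open>G\<close>. Summing over a fine
  partition gives the bound on the whole interval.\<close>

lemma increment_bound:
  fixes \<Psi> :: "real \<Rightarrow> 'a::real_normed_vector" and F G :: "real \<Rightarrow> real"
  assumes l: "l > 0"
    and loc: "\<And>\<epsilon>. \<epsilon> > 0 \<Longrightarrow> \<exists>\<delta>>0. \<forall>a b. 0 \<le> a \<longrightarrow> a \<le> b \<longrightarrow> b \<le> l \<longrightarrow> b - a < \<delta> \<longrightarrow>
        norm (\<Psi> b - \<Psi> a) \<le> F b - F a + \<epsilon> * (G b - G a)"
  shows "norm (\<Psi> l - \<Psi> 0) \<le> F l - F 0"
proof -
  have *: "norm (\<Psi> l - \<Psi> 0) \<le> F l - F 0 + \<epsilon> * (G l - G 0)" if e: "\<epsilon> > 0" for \<epsilon>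
  proof -
    obtain \<delta> where d: "\<delta> > 0" and D: "\<And>a b. 0 \<le> a \<Longrightarrow> a \<le> b \<Longrightarrow> b \<le> l \<Longrightarrow> b - a < \<delta> \<Longrightarrow>
        norm (\<Psi> b - \<Psi> a) \<le> F b - F a + \<epsilon> * (G b - G a)" using loc[OF e] by blast
    obtain n :: nat where n: "n > 0" "l / n < \<delta>"
    proof -
      obtain n :: nat where n: "l / \<delta> < real n" using reals_Archimedean2 by blast
      then have "n > 0" using l d by (metis divide_pos_pos less_trans of_nat_0_less_iff)
      then show ?thesis using that[of n] n d by (simp add: field_simps)
    qed
    let ?x = "\<lambda>k. real k * (l / n)"
    have "norm (\<Psi> (?x k) - \<Psi> 0) \<le> F (?x k) - F 0 + \<epsilon> * (G (?x k) - G 0)" if "k \<le> n" for k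
      using that
    proof (induction k)
      case (Suc k)
      have kn: "?x (Suc k) \<le> real n * (l / n)" using Suc.prems l by (intro mult_right_mono) auto
      have "norm (\<Psi> (?x (Suc k)) - \<Psi> (?x k)) \<le> F (?x (Suc k)) - F (?x k) + \<epsilon> * (G (?x (Suc k)) - G (?x k))"
      proof (rule D)
        show "0 \<le> ?x k" using l by simp
        show "?x k \<le> ?x (Suc k)" using l by (intro mult_right_mono) auto
        show "?x (Suc k) \<le> l" using kn n by simp
        show "?x (Suc k) - ?x k < \<delta>" using n by (simp add: algebra_simps add_divide_distrib)
      qed
      moreover have "norm (\<Psi> (?x (Suc k)) - \<Psi> 0) \<le> norm (\<Psi> (?x (Suc k)) - \<Psi> (?x k)) + norm (\<Psi> (?x k) - \<Psi> 0)"
        using norm_triangle_ineq[of "\<Psi> (?x (Suc k)) - \<Psi> (?x k)" "\<Psi> (?x k) - \<Psi> 0"] by simp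
      moreover have "norm (\<Psi> (?x k) - \<Psi> 0) \<le> F (?x k) - F 0 + \<epsilon> * (G (?x k) - G 0)"
        using Suc by simp
      ultimately show ?case by (simp add: algebra_simps)
    qed simp
    from this[of n] show ?thesis using n by simp
  qed
  show ?thesis
  proof (rule field_le_epsilon)
    fix e :: real assume e: "e > 0"
    define \<epsilon> where "\<epsilon> = e / (\<bar>G l - G 0\<bar> + 1)"
    have p: "\<epsilon> > 0" using e by (simp add: \<epsilon>_def)
    have "\<epsilon> * (G l - G 0) \<le> \<epsilon> * (\<bar>G l - G 0\<bar> + 1)" using p by (intro mult_left_mono) auto
    also have "\<dots> = e" by (simp add: \<epsilon>_def)
    finally show "norm (\<Psi> l - \<Psi> 0) \<le> F l - F 0 + e" using *[OF p] by simp
  qed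
qed

text \<open>Absolutely continuous functions, given together with their derivative.\<close>

definition primitive :: "real \<Rightarrow> (real \<Rightarrow> complex) \<Rightarrow> (real \<Rightarrow> complex) \<Rightarrow> bool" where
  "primitive l g h \<longleftrightarrow> integrable (leb l) g \<and> (\<forall>x\<in>{0..l}. h x = h 0 + integral {0..x} g)"

lemma primitive_integrable: "primitive l g h \<Longrightarrow> integrable (leb l) g"
  unfolding primitive_def by (rule conjunct1)

lemma primitive_eq: "primitive l g h \<Longrightarrow> x \<in> {0..l} \<Longrightarrow> h x = h 0 + integral {0..x} g"
  unfolding primitive_def by (erule conjE) (rule bspec)

lemma primitive_increment:
  assumes "primitive l g h" "0 \<le> a" "a \<le> b" "b \<le> l"
  shows "h b - h a = integral {a..b} g"
proof -
  have "h b = h 0 + integral {0..b} g" "h a = h 0 + integral {0..a} g"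
    using primitive_eq[OF assms(1), of a] primitive_eq[OF assms(1), of b] assms(2-4) by auto
  then have "h b - h a = integral {0..b} g - integral {0..a} g"
    by (metis add_diff_cancel_left)
  also have "\<dots> = integral {a..b} g"
    by (rule integral_leb_diff[OF primitive_integrable[OF assms(1)] assms(2-4)])
  finally show ?thesis .
qed

lemma primitive_continuous:
  assumes "primitive l g h"
  shows "continuous_on {0..l} h"
proof (rule continuous_on_eq)
  show "continuous_on {0..l} (\<lambda>x. h 0 + integral {0..x} g)"
    using integrable_leb_sub(1)[OF primitive_integrable[OF assms] order_refl order_refl]
    by (intro continuous_intros indefinite_integral_continuous_1)
  show "h 0 + integral {0..x} g = h x" if "x \<in> {0..l}" for x
    using primitive_eq[OF assms that] by (rule sym)
qed

lemma uniform_osc: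
  fixes f :: "real \<Rightarrow> 'a::real_normed_vector"
  assumes "continuous_on {0..l} f" "e > 0"
  obtains d where "d > 0" "\<And>x y. x \<in> {0..l} \<Longrightarrow> y \<in> {0..l} \<Longrightarrow> \<bar>x - y\<bar> < d \<Longrightarrow> norm (f x - f y) < e"
proof -
  have "uniformly_continuous_on {0..l} f" by (intro compact_uniformly_continuous assms) simp
  then show ?thesis using that assms(2) unfolding uniformly_continuous_on_def dist_norm real_norm_def by metis
qed

text \<open>The error term bounds the integral of \<open>P' h_1 h_2\<close>, but the derivative of \<open>P\<close> is avoided: on a short
  interval \<open>[a, b]\<close> the increment of \<open>P h_1 h_2\<close> is \<open>(P b - P a) h_1 h_2\<close>, which the Lipschitz constant
  controls, plus a term in which \<open>P, h_1, h_2\<close> are frozen at the ends; freezing them costs \<open>\<epsilon>\<close> by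
  uniform continuity. \<open>increment_bound\<close> adds up these local bounds.\<close>

lemma parts_estimate:
  fixes P :: "real \<Rightarrow> complex"
  assumes l: "l > 0" and h1: "primitive l g1 h1" and h2: "primitive l g2 h2"
    and P: "L-lipschitz_on {0..l} P"
  shows "cmod (P l * h1 l * h2 l - P 0 * h1 0 * h2 0 - integral {0..l} (\<lambda>x. P x * (g1 x * h2 x + h1 x * g2 x)))
    \<le> L * integral {0..l} (\<lambda>x. cmod (h1 x) * cmod (h2 x))"
proof -
  note c1 = primitive_continuous[OF h1] and c2 = primitive_continuous[OF h2]
  have cP: "continuous_on {0..l} P" using P by (rule lipschitz_on_continuous_on)
  have L: "L \<ge> 0" using P by (rule lipschitz_on_nonneg)
  have i1: "integrable (leb l) g1" and i2: "integrable (leb l) g2" using h1 h2 by (auto intro: primitive_integrable)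
  obtain K1 where K1: "K1 > 0" "\<And>x. x \<in> {0..l} \<Longrightarrow> cmod (h1 x) \<le> K1" using continuous_interval_bounded[OF c1] by blast
  obtain K2 where K2: "K2 > 0" "\<And>x. x \<in> {0..l} \<Longrightarrow> cmod (h2 x) \<le> K2" using continuous_interval_bounded[OF c2] by blast
  obtain K3 where K3: "K3 > 0" "\<And>x. x \<in> {0..l} \<Longrightarrow> cmod (P x) \<le> K3" using continuous_interval_bounded[OF cP] by blast
  define K where "K = K1 + K2 + K3"
  have K: "K > 0" "\<And>x. x \<in> {0..l} \<Longrightarrow> cmod (h1 x) \<le> K" "\<And>x. x \<in> {0..l} \<Longrightarrow> cmod (h2 x) \<le> K" "\<And>x. x \<in> {0..l} \<Longrightarrow> cmod (P x) \<le> K"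
    unfolding K_def using K1 K2 K3 by (smt (verit))+
  let ?q = "\<lambda>x. P x * (g1 x * h2 x + h1 x * g2 x)"
  have iq: "integrable (leb l) ?q"
  proof -
    have "integrable (leb l) (\<lambda>x. (P x * h2 x) * g1 x + (P x * h1 x) * g2 x)"
      by (intro Bochner_Integration.integrable_add integrable_leb_cont_mult i1 i2 continuous_intros cP c1 c2)
    then show ?thesis by (simp add: algebra_simps)
  qed
  let ?f = "\<lambda>x. cmod (h1 x) * cmod (h2 x)"
  have iF: "integrable (leb l) ?f"
    by (intro integrable_leb_continuous continuous_intros c1 c2)
  let ?g = "\<lambda>x. 2 * K * (L + (cmod (g1 x) + cmod (g2 x)))"
  have iG: "integrable (leb l) ?g"
    by (intro Bochner_Integration.integrable_add integrable_mult_right integrable_norm i1 i2 integrable_leb_continuous continuous_intros)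
  define \<Psi> where "\<Psi> x = P x * h1 x * h2 x - integral {0..x} ?q" for x
  define F where "F x = L * integral {0..x} ?f" for x
  define G where "G x = integral {0..x} ?g" for x
  have "norm (\<Psi> l - \<Psi> 0) \<le> F l - F 0"
  proof (rule increment_bound[OF l, where G = G])
    fix \<epsilon> :: real assume e: "\<epsilon> > 0"
    obtain d1 where d1: "d1 > 0" "\<And>x y. x \<in> {0..l} \<Longrightarrow> y \<in> {0..l} \<Longrightarrow> \<bar>x - y\<bar> < d1 \<Longrightarrow> norm (h1 x - h1 y) < \<epsilon>"
      using uniform_osc[OF c1 e] by metis
    obtain d2 where d2: "d2 > 0" "\<And>x y. x \<in> {0..l} \<Longrightarrow> y \<in> {0..l} \<Longrightarrow> \<bar>x - y\<bar> < d2 \<Longrightarrow> norm (h2 x - h2 y) < \<epsilon>"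
      using uniform_osc[OF c2 e] by metis
    obtain d3 where d3: "d3 > 0" "\<And>x y. x \<in> {0..l} \<Longrightarrow> y \<in> {0..l} \<Longrightarrow> \<bar>x - y\<bar> < d3 \<Longrightarrow> norm (P x - P y) < \<epsilon>"
      using uniform_osc[OF cP e] by metis
    have prod: "cmod (u b * v b - u x * v x) \<le> 2 * K * \<epsilon>"
      if "cmod (u b - u x) < \<epsilon>" "cmod (v b - v x) < \<epsilon>" "cmod (u b) \<le> K" "cmod (v x) \<le> K"
      for u v :: "real \<Rightarrow> complex" and b x
    proof -
      have "u b * v b - u x * v x = u b * (v b - v x) + (u b - u x) * v x" by (simp add: algebra_simps)
      also have "cmod \<dots> \<le> cmod (u b) * cmod (v b - v x) + cmod (u b - u x) * cmod (v x)"
        by (metis norm_triangle_ineq norm_mult)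
      also have "\<dots> \<le> K * \<epsilon> + \<epsilon> * K" using that K e by (intro add_mono mult_mono) auto
      finally show ?thesis by simp
    qed
    show "\<exists>\<delta>>0. \<forall>a b. 0 \<le> a \<longrightarrow> a \<le> b \<longrightarrow> b \<le> l \<longrightarrow> b - a < \<delta> \<longrightarrow> norm (\<Psi> b - \<Psi> a) \<le> F b - F a + \<epsilon> * (G b - G a)"
    proof (intro exI[of _ "min d1 (min d2 d3)"] conjI allI impI)
      fix a b assume ab: "0 \<le> a" "a \<le> b" "b \<le> l" "b - a < min d1 (min d2 d3)"
      have in1: "g1 integrable_on {a..b}" "g2 integrable_on {a..b}" "?q integrable_on {a..b}"
        "?f integrable_on {a..b}" "?g integrable_on {a..b}"
        using i1 i2 iq iF iG ab integrable_leb_sub(1) by blast+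
      (* the error of freezing the continuous factors at the ends of the interval *)
      let ?k = "\<lambda>x. g1 x * (P a * h2 b) + g2 x * (P a * h1 a) - ?q x"
      have ik: "?k integrable_on {a..b}"
        using in1 by (intro integrable_diff integrable_add integrable_on_mult_left) auto
      have "integral {a..b} ?k = integral {a..b} g1 * (P a * h2 b) + integral {a..b} g2 * (P a * h1 a) - integral {a..b} ?q"
        using in1 by (simp add: Henstock_Kurzweil_Integration.integral_diff Henstock_Kurzweil_Integration.integral_add integrable_add integrable_on_mult_left)
      then have eq: "\<Psi> b - \<Psi> a = (P b - P a) * (h1 b * h2 b) + integral {a..b} ?k"
        unfolding \<Psi>_def primitive_increment[OF h1 ab(1-3), symmetric] primitive_increment[OF h2 ab(1-3), symmetric]
          integral_leb_diff[OF iq ab(1-3), symmetric]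
        by (simp add: algebra_simps)
      have near: "cmod (h1 b - h1 x) < \<epsilon>" "cmod (h2 b - h2 x) < \<epsilon>" "cmod (P a - P x) < \<epsilon>" "cmod (h1 a - h1 x) < \<epsilon>"
        if "x \<in> {a..b}" for x
        using that ab by (auto intro!: d1(2) d2(2) d3(2))
      have mixed: "cmod (P a * h2 b - P x * h2 x) \<le> 2 * K * \<epsilon>" if x: "x \<in> {a..b}" for x
      proof -
        have "P a * h2 b - P x * h2 x = P a * (h2 b - h2 x) + (P a - P x) * h2 x" by (simp add: algebra_simps)
        also have "cmod \<dots> \<le> cmod (P a) * cmod (h2 b - h2 x) + cmod (P a - P x) * cmod (h2 x)"
          by (metis norm_triangle_ineq norm_mult)
        also have "\<dots> \<le> K * \<epsilon> + \<epsilon> * K" using near[OF x] K e x ab by (intro add_mono mult_mono) auto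
        finally show ?thesis by simp
      qed
      have mixed2: "cmod (P a * h1 a - P x * h1 x) \<le> 2 * K * \<epsilon>" if x: "x \<in> {a..b}" for x
        using prod[of P a x h1] near[OF x] K x ab by auto
      have "cmod (integral {a..b} ?k) \<le> integral {a..b} (\<lambda>x. 2 * K * \<epsilon> * (cmod (g1 x) + cmod (g2 x)))"
      proof (rule Henstock_Kurzweil_Integration.integral_norm_bound_integral[OF ik])
        have "(\<lambda>x. cmod (g1 x) + cmod (g2 x)) integrable_on {a..b}"
          using integrable_leb_sub(2)[OF i1] integrable_leb_sub(2)[OF i2] ab by (intro integrable_add) auto
        then show "(\<lambda>x. 2 * K * \<epsilon> * (cmod (g1 x) + cmod (g2 x))) integrable_on {a..b}" by (rule integrable_on_mult_right)
        fix x assume x: "x \<in> {a..b}"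
        have "?k x = g1 x * (P a * h2 b - P x * h2 x) + g2 x * (P a * h1 a - P x * h1 x)" by (simp add: algebra_simps)
        also have "cmod \<dots> \<le> cmod (g1 x) * cmod (P a * h2 b - P x * h2 x) + cmod (g2 x) * cmod (P a * h1 a - P x * h1 x)"
          by (metis norm_triangle_ineq norm_mult)
        also have "\<dots> \<le> cmod (g1 x) * (2 * K * \<epsilon>) + cmod (g2 x) * (2 * K * \<epsilon>)"
          using mixed[OF x] mixed2[OF x] by (intro add_mono mult_left_mono) auto
        finally show "cmod (?k x) \<le> 2 * K * \<epsilon> * (cmod (g1 x) + cmod (g2 x))" by (simp add: algebra_simps)
      qed
      moreover have "cmod ((P b - P a) * (h1 b * h2 b)) \<le> integral {a..b} (\<lambda>x. L * (?f x + 2 * K * \<epsilon>))"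
      proof -
        have "cmod ((P b - P a) * (h1 b * h2 b)) \<le> L * (b - a) * cmod (h1 b * h2 b)"
          using lipschitz_onD[OF P, of b a] ab unfolding norm_mult by (intro mult_right_mono) (auto simp: dist_norm)
        also have "\<dots> = integral {a..b} (\<lambda>x. L * cmod (h1 b * h2 b))" using ab by simp
        also have "\<dots> \<le> integral {a..b} (\<lambda>x. L * (?f x + 2 * K * \<epsilon>))"
        proof (rule integral_le)
          show "(\<lambda>x. L * (?f x + 2 * K * \<epsilon>)) integrable_on {a..b}"
            using in1 by (intro integrable_on_mult_right integrable_add) auto
          fix x assume x: "x \<in> {a..b}"
          have "cmod (h1 b * h2 b) \<le> cmod (h1 x * h2 x) + cmod (h1 b * h2 b - h1 x * h2 x)"
            by (metis add.commute diff_add_cancel norm_triangle_ineq)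
          also have "\<dots> \<le> ?f x + 2 * K * \<epsilon>"
            using prod[of h1 b x h2] near[OF x] K x ab by (auto simp: norm_mult)
          finally show "L * cmod (h1 b * h2 b) \<le> L * (?f x + 2 * K * \<epsilon>)" using L by (rule mult_left_mono)
        qed auto
        finally show ?thesis .
      qed
      ultimately have "norm (\<Psi> b - \<Psi> a) \<le> integral {a..b} (\<lambda>x. L * (?f x + 2 * K * \<epsilon>)) + integral {a..b} (\<lambda>x. 2 * K * \<epsilon> * (cmod (g1 x) + cmod (g2 x)))"
        unfolding eq using norm_triangle_ineq by (meson add_mono order_trans)
      also have "\<dots> = integral {a..b} (\<lambda>x. L * ?f x + \<epsilon> * ?g x)"
      proof -
        have j: "(\<lambda>x. cmod (g1 x) + cmod (g2 x)) integrable_on {a..b}"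
          using integrable_leb_sub(2)[OF i1] integrable_leb_sub(2)[OF i2] ab by (intro integrable_add) auto
        have "integral {a..b} (\<lambda>x. L * (?f x + 2 * K * \<epsilon>)) + integral {a..b} (\<lambda>x. 2 * K * \<epsilon> * (cmod (g1 x) + cmod (g2 x)))
          = integral {a..b} (\<lambda>x. L * (?f x + 2 * K * \<epsilon>) + 2 * K * \<epsilon> * (cmod (g1 x) + cmod (g2 x)))"
          by (rule Henstock_Kurzweil_Integration.integral_add[symmetric])
            (intro integrable_on_mult_right integrable_add in1 integrable_const_ivl, rule integrable_on_mult_right[OF j])
        then show ?thesis by (simp add: algebra_simps)
      qed
      also have "\<dots> = L * integral {a..b} ?f + \<epsilon> * integral {a..b} ?g"
        using in1 by (subst Henstock_Kurzweil_Integration.integral_add)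
          (auto intro: integrable_on_mult_right)
      also have "\<dots> = F b - F a + \<epsilon> * (G b - G a)"
        unfolding F_def G_def integral_leb_diff[OF iG ab(1-3)] integral_leb_diff[OF iF ab(1-3), symmetric]
        by (simp add: algebra_simps)
      finally show "norm (\<Psi> b - \<Psi> a) \<le> F b - F a + \<epsilon> * (G b - G a)" .
    qed (use d1 d2 d3 in auto)
  qed
  then show ?thesis by (simp add: \<Psi>_def F_def algebra_simps)
qed

lemma primitive_parts:
  assumes "l > 0" "primitive l g1 h1" "primitive l g2 h2"
  shows "integral {0..l} (\<lambda>x. g1 x * h2 x + h1 x * g2 x) = h1 l * h2 l - h1 0 * h2 0"
proof -
  have "0-lipschitz_on {0..l} (\<lambda>_. 1 :: complex)" by (simp add: lipschitz_on_def)
  from parts_estimate[OF assms this] show ?thesis by simp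
qed


section \<open>The space L2 and weak derivatives on an interval\<close>

lemma finite_measure_leb: "finite_measure (leb l)"
  by (intro finite_measure_lebesgue_on) simp

lemma measure_leb: "l > 0 \<Longrightarrow> measure (leb l) (space (leb l)) = l"
  by (simp add: space_restrict_space measure_restrict_space)

lemma integrable_leb_const: "integrable (leb l) (\<lambda>_. c :: 'a::euclidean_space)"
  by (intro integrable_leb_continuous continuous_intros)

lemma L2_measurable: "f \<in> L2_space l \<Longrightarrow> f \<in> borel_measurable (leb l)"
  and L2_square_integrable: "f \<in> L2_space l \<Longrightarrow> integrable (leb l) (\<lambda>x. (cmod (f x))\<^sup>2)"
  by (auto simp: L2_space_def)

lemma two_mult_le_squares: "2 * (a * b) \<le> a\<^sup>2 + (b::real)\<^sup>2"
  using zero_le_power2[of "a - b"] by (simp add: power2_diff)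

lemma L2_mult_integrable:
  assumes "f \<in> L2_space l" "g \<in> L2_space l"
  shows "integrable (leb l) (\<lambda>x. f x * g x)"
proof (rule Bochner_Integration.integrable_bound)
  note [measurable] = L2_measurable[OF assms(1)] L2_measurable[OF assms(2)]
  show "integrable (leb l) (\<lambda>x. (cmod (f x))\<^sup>2 + (cmod (g x))\<^sup>2)"
    using assms by (intro Bochner_Integration.integrable_add L2_square_integrable)
  show "(\<lambda>x. f x * g x) \<in> borel_measurable (leb l)" by measurable
  have "cmod (f x * g x) \<le> (cmod (f x))\<^sup>2 + (cmod (g x))\<^sup>2" for x
    using two_mult_le_squares[of "cmod (f x)" "cmod (g x)"] mult_nonneg_nonneg[OF norm_ge_zero[of "f x"] norm_ge_zero[of "g x"]]
    unfolding norm_mult by linarith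
  then show "AE x in leb l. norm (f x * g x) \<le> norm ((cmod (f x))\<^sup>2 + (cmod (g x))\<^sup>2)"
    by (intro AE_I2) (auto intro: order_trans)
qed

lemma L2_cnj: "f \<in> L2_space l \<Longrightarrow> (\<lambda>x. cnj (f x)) \<in> L2_space l"
  using measurable_compose[OF _ borel_measurable_continuous_onI[OF continuous_on_cnj[OF continuous_on_id]]]
  by (auto simp: L2_space_def)

lemma L2_bounded:
  assumes "f \<in> borel_measurable (leb l)" "AE x in leb l. cmod (f x) \<le> K"
  shows "f \<in> L2_space l"
proof -
  have "integrable (leb l) (\<lambda>x. (cmod (f x))\<^sup>2)"
  proof (rule Bochner_Integration.integrable_bound)
    show "integrable (leb l) (\<lambda>x. K\<^sup>2)" by (rule integrable_leb_const)
    show "(\<lambda>x. (cmod (f x))\<^sup>2) \<in> borel_measurable (leb l)" using assms by measurable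
    show "AE x in leb l. norm ((cmod (f x))\<^sup>2) \<le> norm (K\<^sup>2)"
      using assms(2) by eventually_elim (simp add: power_mono)
  qed
  then show ?thesis using assms by (simp add: L2_space_def)
qed

lemma L2_continuous: "continuous_on {0..l} f \<Longrightarrow> f \<in> L2_space l"
proof -
  assume f: "continuous_on {0..l} f"
  obtain K where "\<And>x. x \<in> {0..l} \<Longrightarrow> norm (f x) \<le> K" using continuous_interval_bounded[OF f] by blast
  then show ?thesis by (intro L2_bounded[of _ _ K] measurable_leb_continuous f AE_I2) auto
qed

lemma L2_integrable: "f \<in> L2_space l \<Longrightarrow> integrable (leb l) f"
  using L2_mult_integrable[of f l "\<lambda>_. 1"] L2_continuous[of l "\<lambda>_. 1"] by simp

lemma L2_bounded_mult:
  assumes "f \<in> L2_space l" "b \<in> borel_measurable (leb l)" "AE x in leb l. cmod (b x) \<le> K"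
  shows "(\<lambda>x. b x * f x) \<in> L2_space l"
proof -
  note [measurable] = L2_measurable[OF assms(1)] assms(2)
  have "integrable (leb l) (\<lambda>x. (cmod (b x * f x))\<^sup>2)"
  proof (rule Bochner_Integration.integrable_bound)
    show "integrable (leb l) (\<lambda>x. K\<^sup>2 * (cmod (f x))\<^sup>2)"
      using L2_square_integrable[OF assms(1)] by simp
    show "(\<lambda>x. (cmod (b x * f x))\<^sup>2) \<in> borel_measurable (leb l)" by measurable
    show "AE x in leb l. norm ((cmod (b x * f x))\<^sup>2) \<le> norm (K\<^sup>2 * (cmod (f x))\<^sup>2)"
      using assms(3) by eventually_elim (simp add: norm_mult power_mult_distrib mult_right_mono power_mono)
  qed
  then show ?thesis by (simp add: L2_space_def)
qed

lemma L2_cmult: "f \<in> L2_space l \<Longrightarrow> (\<lambda>x. c * f x) \<in> L2_space l"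
  by (rule L2_bounded_mult[where K = "cmod c"]) auto

lemma L2_add:
  assumes "f \<in> L2_space l" "g \<in> L2_space l"
  shows "(\<lambda>x. f x + g x) \<in> L2_space l"
proof -
  note [measurable] = L2_measurable[OF assms(1)] L2_measurable[OF assms(2)]
  have "integrable (leb l) (\<lambda>x. (cmod (f x + g x))\<^sup>2)"
  proof (rule Bochner_Integration.integrable_bound)
    show "integrable (leb l) (\<lambda>x. 2 * (cmod (f x))\<^sup>2 + 2 * (cmod (g x))\<^sup>2)"
      using L2_square_integrable assms by simp
    show "(\<lambda>x. (cmod (f x + g x))\<^sup>2) \<in> borel_measurable (leb l)" by measurable
    have "(cmod (f x + g x))\<^sup>2 \<le> 2 * (cmod (f x))\<^sup>2 + 2 * (cmod (g x))\<^sup>2" for x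
    proof -
      have "(cmod (f x + g x))\<^sup>2 \<le> (cmod (f x) + cmod (g x))\<^sup>2" by (intro power_mono norm_triangle_ineq) simp
      then show ?thesis using two_mult_le_squares[of "cmod (f x)" "cmod (g x)"] by (simp add: power2_sum)
    qed
    then show "AE x in leb l. norm ((cmod (f x + g x))\<^sup>2) \<le> norm (2 * (cmod (f x))\<^sup>2 + 2 * (cmod (g x))\<^sup>2)"
      by (intro AE_I2) simp
  qed
  then show ?thesis by (simp add: L2_space_def)
qed

lemma L2_diff: "f \<in> L2_space l \<Longrightarrow> g \<in> L2_space l \<Longrightarrow> (\<lambda>x. f x - g x) \<in> L2_space l"
  using L2_add[of f l "\<lambda>x. -1 * g x"] L2_cmult[of g l "-1"] by simp

lemma L2_zero: "(\<lambda>x. 0) \<in> L2_space l"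
  by (rule L2_continuous) simp

lemma L2_sum: "(\<And>i. i \<in> I \<Longrightarrow> f i \<in> L2_space l) \<Longrightarrow> (\<lambda>x. \<Sum>i\<in>I. f i x) \<in> L2_space l"
  by (induction I rule: infinite_finite_induct) (auto intro: L2_zero L2_add)

definition L2_sq :: "real \<Rightarrow> (real \<Rightarrow> complex) \<Rightarrow> real" where
  "L2_sq l f = (LINT x|leb l. (cmod (f x))\<^sup>2)"

lemma L2_sq_nonneg: "L2_sq l f \<ge> 0"
  unfolding L2_sq_def by (intro Bochner_Integration.integral_nonneg) simp

lemma L2_sq_zero:
  assumes "f \<in> L2_space l" "L2_sq l f = 0"
  shows "AE x in leb l. f x = 0"
  using integral_nonneg_eq_0_iff_AE[of "leb l" "\<lambda>x. (cmod (f x))\<^sup>2"] L2_square_integrable[OF assms(1)] assms(2)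
  by (simp add: L2_sq_def)

lemma L1_le_L2:
  assumes l: "l > 0" and f: "f \<in> L2_space l" and c: "c > 0" "L2_sq l f \<le> c\<^sup>2"
  shows "(LINT x|leb l. cmod (f x)) \<le> c * (1 + l)"
proof -
  have 1: "2 * c * (LINT x|leb l. cmod (f x)) = (LINT x|leb l. 2 * c * cmod (f x))" by simp
  also have "\<dots> \<le> (LINT x|leb l. (cmod (f x))\<^sup>2 + c\<^sup>2)"
  proof (rule integral_mono)
    show "integrable (leb l) (\<lambda>x. 2 * c * cmod (f x))" using L2_integrable[OF f] by simp
    show "integrable (leb l) (\<lambda>x. (cmod (f x))\<^sup>2 + c\<^sup>2)"
      by (intro Bochner_Integration.integrable_add L2_square_integrable f integrable_leb_const)
    show "2 * c * cmod (f x) \<le> (cmod (f x))\<^sup>2 + c\<^sup>2" for x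
      using two_mult_le_squares[of "cmod (f x)" c] by (simp add: algebra_simps)
  qed
  also have "\<dots> = L2_sq l f + l * c\<^sup>2"
    using measure_leb[OF l] L2_square_integrable[OF f] integrable_leb_const
    by (subst Bochner_Integration.integral_add) (auto simp: L2_sq_def)
  also have "\<dots> \<le> c * (c * (1 + l))" using c by (simp add: algebra_simps power2_eq_square)
  finally have "c * (2 * (LINT x|leb l. cmod (f x))) \<le> c * (c * (1 + l))" by (simp add: algebra_simps)
  then have "2 * (LINT x|leb l. cmod (f x)) \<le> c * (1 + l)" using c by simp
  moreover have "0 \<le> (LINT x|leb l. cmod (f x))" by simp
  ultimately show ?thesis by linarith
qed

text \<open>A subsequence whose consecutive distances decay geometrically converges almost everywhere, because
  the sum of the differences is integrable. Fatou's lemma turns this into convergence in the mean of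
  the whole sequence.\<close>

lemma L2_complete:
  assumes l: "l > 0" and f: "\<And>n. f n \<in> L2_space l"
    and C: "\<And>e. e > 0 \<Longrightarrow> \<exists>N::nat. \<forall>m\<ge>N. \<forall>n\<ge>N. L2_sq l (\<lambda>x. f m x - f n x) < e"
  shows "\<exists>g\<in>L2_space l. (\<lambda>n. L2_sq l (\<lambda>x. f n x - g x)) \<longlonglongrightarrow> 0"
proof -
  have [measurable]: "f n \<in> borel_measurable (leb l)" for n using f by (rule L2_measurable)
  have "\<exists>N. \<forall>k. \<forall>m\<ge>N k. \<forall>n\<ge>N k. L2_sq l (\<lambda>x. f m x - f n x) < ((1/2)^k)\<^sup>2"
    using C by (intro choice allI) simp
  then obtain N where N: "\<And>k m n. m \<ge> N k \<Longrightarrow> n \<ge> N k \<Longrightarrow> L2_sq l (\<lambda>x. f m x - f n x) < ((1/2)^k)\<^sup>2" by blast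
  define s where "s k = k + (\<Sum>i\<le>k. N i)" for k
  have sN: "N k \<le> s k" for k unfolding s_def using member_le_sum[of k "{..k}" N] by simp
  have s_mono: "s k \<le> s (Suc k)" for k by (simp add: s_def)
  have s_ge: "k \<le> s k" for k by (simp add: s_def)
  define d where "d k x = f (s (Suc k)) x - f (s k) x" for k x
  have dL: "d k \<in> L2_space l" for k unfolding d_def by (intro L2_diff f)
  have [measurable]: "d k \<in> borel_measurable (leb l)" for k using dL by (rule L2_measurable)
  have d1: "(LINT x|leb l. cmod (d k x)) \<le> (1/2)^k * (1 + l)" for k
    unfolding d_def using N[of k "s (Suc k)" "s k"] sN s_mono[of k]
    by (intro L1_le_L2 l L2_diff f less_imp_le) (auto intro: order_trans)
  have "AE x in leb l. summable (\<lambda>k. cmod (d k x))"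
  proof -
    have "(\<integral>\<^sup>+x. (\<Sum>k. ennreal (cmod (d k x))) \<partial>leb l) = (\<Sum>k. \<integral>\<^sup>+x. ennreal (cmod (d k x)) \<partial>leb l)"
      by (intro nn_integral_suminf) measurable
    also have "\<dots> = (\<Sum>k. ennreal (LINT x|leb l. cmod (d k x)))"
      using L2_integrable[OF dL] by (intro suminf_cong nn_integral_eq_integral) auto
    also have "\<dots> \<le> (\<Sum>k. ennreal ((1/2)^k * (1 + l)))"
      using d1 by (intro suminf_le ennreal_leI) auto
    also have "\<dots> = ennreal (\<Sum>k. (1/2)^k * (1 + l))"
      using l by (intro suminf_ennreal2 summable_mult2 summable_geometric) auto
    finally have "(\<integral>\<^sup>+x. (\<Sum>k. ennreal (cmod (d k x))) \<partial>leb l) \<noteq> \<infinity>" by (auto simp: top_unique)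
    then have "AE x in leb l. (\<Sum>k. ennreal (cmod (d k x))) \<noteq> \<infinity>"
      by (intro nn_integral_PInf_AE) measurable
    then show ?thesis by eventually_elim (auto intro: summable_suminf_not_top)
  qed
  then have conv: "AE x in leb l. (\<lambda>k. f (s k) x) \<longlonglongrightarrow> lim (\<lambda>k. f (s k) x)"
  proof eventually_elim
    case (elim x)
    then have "summable (\<lambda>k. f (s (Suc k)) x - f (s k) x)" unfolding d_def by (rule summable_norm_cancel)
    then have "convergent (\<lambda>n. f (s n) x - f (s 0) x)"
      using sum_lessThan_telescope[of "\<lambda>k. f (s k) x"] by (simp add: summable_iff_convergent)
    from convergent_add[OF this convergent_const[of "f (s 0) x"]] have "convergent (\<lambda>k. f (s k) x)" by simp
    then show ?case by (simp add: convergent_LIMSEQ_iff)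
  qed
  define g where "g x = lim (\<lambda>k. f (s k) x)" for x
  have [measurable]: "g \<in> borel_measurable (leb l)" unfolding g_def by measurable
  have bound: "(\<integral>\<^sup>+x. ennreal ((cmod (f n x - g x))\<^sup>2) \<partial>leb l) \<le> ennreal (((1/2)^k)\<^sup>2)" if n: "n \<ge> N k" for n k
  proof -
    have "(\<integral>\<^sup>+x. ennreal ((cmod (f n x - g x))\<^sup>2) \<partial>leb l) = (\<integral>\<^sup>+x. liminf (\<lambda>j. ennreal ((cmod (f n x - f (s j) x))\<^sup>2)) \<partial>leb l)"
    proof (intro nn_integral_cong_AE)
      show "AE x in leb l. ennreal ((cmod (f n x - g x))\<^sup>2) = liminf (\<lambda>j. ennreal ((cmod (f n x - f (s j) x))\<^sup>2))"
        using conv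
      proof eventually_elim
        case (elim x)
        have "(\<lambda>j. ennreal ((cmod (f n x - f (s j) x))\<^sup>2)) \<longlonglongrightarrow> ennreal ((cmod (f n x - g x))\<^sup>2)"
          unfolding g_def by (intro tendsto_intros elim tendsto_ennrealI)
        then show ?case by (intro lim_imp_Liminf[symmetric]) auto
      qed
    qed
    also have "\<dots> \<le> liminf (\<lambda>j. \<integral>\<^sup>+x. ennreal ((cmod (f n x - f (s j) x))\<^sup>2) \<partial>leb l)"
      by (intro nn_integral_liminf) measurable
    also have "\<dots> \<le> ennreal (((1/2)^k)\<^sup>2)"
    proof (rule Liminf_le)
      show "\<forall>\<^sub>F j in sequentially. (\<integral>\<^sup>+x. ennreal ((cmod (f n x - f (s j) x))\<^sup>2) \<partial>leb l) \<le> ennreal (((1/2)^k)\<^sup>2)"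
        using eventually_ge_at_top[of "N k"]
      proof eventually_elim
        case (elim j)
        have "(\<integral>\<^sup>+x. ennreal ((cmod (f n x - f (s j) x))\<^sup>2) \<partial>leb l) = ennreal (L2_sq l (\<lambda>x. f n x - f (s j) x))"
          unfolding L2_sq_def by (intro nn_integral_eq_integral L2_square_integrable L2_diff f) auto
        also have "\<dots> \<le> ennreal (((1/2)^k)\<^sup>2)"
          using N[OF n, of "s j"] elim s_ge[of j] by (intro ennreal_leI) auto
        finally show ?case .
      qed
    qed simp
    finally show ?thesis .
  qed
  have dg: "(\<lambda>x. f (N 0) x - g x) \<in> L2_space l"
  proof -
    have "(\<integral>\<^sup>+x. ennreal (norm ((cmod (f (N 0) x - g x))\<^sup>2)) \<partial>leb l) < \<infinity>"
      using bound[of 0 "N 0"] by (simp add: order_le_less_trans)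
    then show ?thesis unfolding L2_space_def by (auto intro!: integrableI_bounded)
  qed
  have gL: "g \<in> L2_space l" using L2_diff[OF f[of "N 0"] dg] by simp
  moreover have "(\<lambda>n. L2_sq l (\<lambda>x. f n x - g x)) \<longlonglongrightarrow> 0"
  proof (rule LIMSEQ_I)
    fix e :: real assume "e > 0"
    then obtain k where k: "((1/2)^k) < e" using real_arch_pow_inv[of e "1/2"] by auto
    have "((1/2)^k)\<^sup>2 \<le> (1/2::real)^k" by (simp add: power2_eq_square mult_left_le_one_le power_le_one)
    then have k2: "((1/2)^k)\<^sup>2 < e" using k by simp
    have "norm (L2_sq l (\<lambda>x. f n x - g x) - 0) < e" if n: "n \<ge> N k" for n
    proof -
      have "ennreal (L2_sq l (\<lambda>x. f n x - g x)) = (\<integral>\<^sup>+x. ennreal ((cmod (f n x - g x))\<^sup>2) \<partial>leb l)"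
        unfolding L2_sq_def by (intro nn_integral_eq_integral[symmetric] L2_square_integrable L2_diff f gL) auto
      also have "\<dots> \<le> ennreal (((1/2)^k)\<^sup>2)" by (rule bound[OF n])
      finally have "L2_sq l (\<lambda>x. f n x - g x) \<le> ((1/2)^k)\<^sup>2" by (simp add: ennreal_le_iff)
      then show ?thesis using k2 L2_sq_nonneg[of l "\<lambda>x. f n x - g x"] by simp
    qed
    then show "\<exists>no. \<forall>n\<ge>no. norm (L2_sq l (\<lambda>x. f n x - g x) - 0) < e" by blast
  qed
  ultimately show ?thesis by blast
qed

text \<open>The sets over which \<open>w\<close> integrates to zero form a Dynkin system that contains the half-lines.\<close>

lemma zero_integrals_AE:
  fixes w :: "real \<Rightarrow> complex"
  assumes w: "integrable (leb l) w" and z: "\<And>a b. 0 \<le> a \<Longrightarrow> a \<le> b \<Longrightarrow> b \<le> l \<Longrightarrow> integral {a..b} w = 0"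
  shows "AE x in leb l. w x = 0"
proof -
  define u where "u = (\<lambda>x. indicator {0<..<l} x *\<^sub>R w x)"
  have u: "integrable lebesgue u" using w by (simp add: u_def integrable_restrict_space)
  have us: "set_integrable lebesgue A u" if "A \<in> sets lebesgue" for A
    unfolding set_integrable_def by (rule integrable_mult_indicator[OF that u])
  have A0: "(LINT x:{..a}|lebesgue. u x) = 0" for a
  proof -
    have "(LINT x:{..a}|lebesgue. u x) = (LINT x|lebesgue. indicator ({0<..<l} \<inter> {..a}) x *\<^sub>R w x)"
      unfolding set_lebesgue_integral_def u_def by (intro Bochner_Integration.integral_cong) (auto simp: indicator_def)
    also have "\<dots> = (LINT x:({0<..<l} \<inter> {..a})|lebesgue. w x)" by (simp add: set_lebesgue_integral_def)
    also have "\<dots> = integral ({0<..<l} \<inter> {..a}) w"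
    proof (rule set_lebesgue_integral_eq_integral)
      have "set_integrable lebesgue {0<..<l} w" using w by (simp add: set_integrable_def integrable_restrict_space)
      then show "set_integrable lebesgue ({0<..<l} \<inter> {..a}) w" by (rule set_integrable_subset) auto
    qed
    also have "\<dots> = integral {0..min a l} w"
    proof (rule integral_spike_set)
      show "negligible {x \<in> {0<..<l} \<inter> {..a} - {0..min a l}. w x \<noteq> 0}" by (rule negligible_subset[of "{}"]) auto
      show "negligible {x \<in> {0..min a l} - {0<..<l} \<inter> {..a}. w x \<noteq> 0}" by (rule negligible_subset[of "{0, l}"]) auto
    qed
    also have "\<dots> = 0" using z[of 0 "min a l"] by (cases "0 \<le> min a l") auto
    finally show ?thesis .
  qed
  have tot: "(LINT x|lebesgue. u x) = 0"
  proof -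
    have "(LINT x|lebesgue. u x) = (LINT x:{..l}|lebesgue. u x)"
      unfolding set_lebesgue_integral_def u_def by (intro Bochner_Integration.integral_cong) (auto simp: indicator_def)
    then show ?thesis using A0 by simp
  qed
  have sb: "sigma_sets UNIV (range (\<lambda>a::real. {..a})) = sets borel"
    by (simp add: borel_eq_atMost sets_measure_of)
  have B0: "(LINT x:A|lebesgue. u x) = 0" if A: "A \<in> sets borel" for A :: "real set"
  proof -
    have "Int_stable (range (\<lambda>a::real. {..a}))" by (auto simp: Int_stable_def)
    moreover have "range (\<lambda>a::real. {..a}) \<subseteq> Pow UNIV" by simp
    moreover have "A \<in> sigma_sets UNIV (range (\<lambda>a::real. {..a}))"
      using A by (simp add: sb)
    ultimately show ?thesis
    proof (induction A rule: sigma_sets_induct_disjoint)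
      case (basic A)
      then show ?case using A0 by auto
    next
      case empty
      show ?case by (simp add: set_lebesgue_integral_def)
    next
      case (compl A)
      have A: "A \<in> sets lebesgue" using compl(1) unfolding sb by (intro sets_completionI_sets) simp
      have "(LINT x:(UNIV - A)|lebesgue. u x) = (LINT x|lebesgue. u x - indicator A x *\<^sub>R u x)"
        unfolding set_lebesgue_integral_def by (intro Bochner_Integration.integral_cong) (auto simp: indicator_def)
      also have "\<dots> = (LINT x|lebesgue. u x) - (LINT x:A|lebesgue. u x)"
        unfolding set_lebesgue_integral_def using us[OF A] u
        by (intro Bochner_Integration.integral_diff) (auto simp: set_integrable_def)
      finally show ?case using tot compl by simp
    next
      case (union A)
      have A: "A i \<in> sets lebesgue" for i using union(2) unfolding sb by (intro sets_completionI_sets) auto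
      have "(LINT x:(\<Union>i. A i)|lebesgue. u x) = (\<Sum>i. (LINT x:(A i)|lebesgue. u x))"
        by (rule lebesgue_integral_countable_add) (use A union in \<open>auto simp: disjoint_family_on_def intro!: us\<close>)
      then show ?case using union by simp
    qed
  qed
  interpret finite_measure "leb l" by (rule finite_measure_leb)
  show ?thesis
  proof (rule density_zero[OF w])
    fix A assume "A \<in> sets (leb l)"
    then have A: "A \<in> sets lebesgue" by (simp add: sets_restrict_space_iff)
    obtain S N N' where S: "A = S \<union> N" "N \<subseteq> N'" "N' \<in> null_sets lborel" "S \<in> sets lborel"
      using sets_completionE[OF A] .
    have "(LINT x:A|leb l. w x) = (LINT x:A|lebesgue. u x)"
      unfolding set_lebesgue_integral_def u_def
      by (subst integral_restrict_space) (auto intro!: Bochner_Integration.integral_cong simp: indicator_def)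
    also have "\<dots> = (LINT x:S|lebesgue. u x)"
    proof (rule set_integral_cong_set)
      show "set_borel_measurable lebesgue A u" "set_borel_measurable lebesgue S u"
        using us[OF A] us[of S] S by (auto simp: set_borel_measurable_def set_integrable_def)
      have "AE x in lebesgue. x \<notin> N'" using S by (intro AE_not_in null_sets_completionI)
      then show "AE x in lebesgue. (x \<in> S) = (x \<in> A)" by eventually_elim (use S in auto)
    qed
    finally show "(LINT x:A|leb l. w x) = 0" using B0[of S] S by simp
  qed
qed

text \<open>A continuous function is the derivative of a test function when its support is compact and its mean
  vanishes: the primitive is constant on both sides of the support, and the mean makes it zero on both.\<close>

lemma zero_mean_primitive_test:
  fixes \<psi> :: "real \<Rightarrow> real"
  assumes l: "l > 0" and c: "continuous_on UNIV \<psi>" and ab: "0 < a" "b < l" and supp: "\<And>x. x \<notin> {a..b} \<Longrightarrow> \<psi> x = 0"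
    and mean: "integral {0..l} \<psi> = 0"
  obtains \<phi> where "\<phi> \<in> test_functions l" "deriv \<phi> = \<psi>"
proof
  define \<phi> where "\<phi> x = integral {0..x} \<psi>" for x
  have small: "\<phi> x = 0" if "x < a" for x
  proof -
    have "\<phi> x = integral {0..x} (\<lambda>_. 0)" unfolding \<phi>_def
      by (rule Henstock_Kurzweil_Integration.integral_cong) (use that supp in auto)
    then show ?thesis by simp
  qed
  have int: "\<psi> integrable_on {u..v}" for u v
    by (intro integrable_continuous_interval continuous_on_subset[OF c]) auto
  have tail: "integral {u..v} \<psi> = 0" if "b < u" for u v
  proof -
    have "integral {u..v} \<psi> = integral {u..v} (\<lambda>_. 0)"
      by (rule Henstock_Kurzweil_Integration.integral_cong) (use that supp in auto)
    then show ?thesis by simp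
  qed
  have large: "\<phi> x = 0" if x: "x > b" for x
  proof (cases "x < a")
    case False
    then have x0: "0 \<le> x" using ab by simp
    show ?thesis
    proof (cases "x \<le> l")
      case True
      then have "\<phi> x + integral {x..l} \<psi> = 0"
        unfolding \<phi>_def using Henstock_Kurzweil_Integration.integral_combine[OF x0 True int] mean by simp
      then show ?thesis using tail[OF x] by simp
    next
      case False
      then have "integral {0..l} \<psi> + integral {l..x} \<psi> = \<phi> x"
        unfolding \<phi>_def using ab Henstock_Kurzweil_Integration.integral_combine[of 0 l x \<psi>] int False l by simp
      then show ?thesis using tail[of l x] mean ab by simp
    qed
  qed (use small in auto)
  have der: "(\<phi> has_real_derivative \<psi> x) (at x)" for x
  proof (cases "x < a")
    case True
    have "((\<lambda>_. 0) has_real_derivative 0) (at x)" by simp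
    then have "(\<phi> has_real_derivative 0) (at x)"
      by (rule has_field_derivative_transform_within_open[where S = "{..<a}"]) (use True small in auto)
    then show ?thesis using supp[of x] True by simp
  next
    case False
    then have x: "0 < x" using ab by simp
    have "(\<phi> has_real_derivative \<psi> x) (at x within {0..x+1})"
      unfolding \<phi>_def using x by (intro integral_has_real_derivative continuous_on_subset[OF c]) auto
    moreover have "at x within {0..x+1} = at x" using x by (intro at_within_interior) simp
    ultimately show ?thesis by simp
  qed
  show d: "deriv \<phi> = \<psi>" using der by (auto intro: DERIV_imp_deriv)
  have "{x. \<phi> x \<noteq> 0} \<subseteq> {a..b}" using small large by force
  then have cl: "closure {x. \<phi> x \<noteq> 0} \<subseteq> {a..b}" by (intro closure_minimal) auto
  moreover have "compact (closure {x. \<phi> x \<noteq> 0})"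
    by (rule compact_closure[THEN iffD2]) (rule bounded_subset[OF bounded_closed_interval \<open>{x. \<phi> x \<noteq> 0} \<subseteq> {a..b}\<close>])
  moreover have "\<phi> C1_differentiable_on UNIV"
    unfolding C1_differentiable_on_def using der c by (auto simp: has_real_derivative_iff_has_vector_derivative)
  ultimately show "\<phi> \<in> test_functions l" using ab by (auto simp: test_functions_def)
qed

lemma test_function_derivative:
  assumes "\<phi> \<in> test_functions l"
  shows "(\<phi> has_real_derivative deriv \<phi> x) (at x)" "continuous_on UNIV (deriv \<phi>)" "\<phi> 0 = 0" "\<phi> l = 0"
proof -
  have \<phi>: "\<phi> C1_differentiable_on UNIV" and s: "closure {x. \<phi> x \<noteq> 0} \<subseteq> {0<..<l}" using assms by (auto simp: test_functions_def)
  obtain D where D: "\<And>x. (\<phi> has_vector_derivative D x) (at x)" "continuous_on UNIV D"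
    using \<phi> unfolding C1_differentiable_on_def by auto
  have "deriv \<phi> = D" using D(1) by (auto intro!: DERIV_imp_deriv simp: has_real_derivative_iff_has_vector_derivative)
  then show "(\<phi> has_real_derivative deriv \<phi> x) (at x)" "continuous_on UNIV (deriv \<phi>)"
    using D by (auto simp: has_real_derivative_iff_has_vector_derivative)
  show "\<phi> 0 = 0" "\<phi> l = 0" using s closure_subset[of "{x. \<phi> x \<noteq> 0}"] by force+
qed

lemma test_function_primitive:
  assumes "\<phi> \<in> test_functions l"
  shows "primitive l (\<lambda>x. of_real (deriv \<phi> x)) (\<lambda>x. of_real (\<phi> x))"
  unfolding primitive_def
proof (intro conjI ballI)
  note \<phi> = test_function_derivative[OF assms]
  have c: "continuous_on S (\<lambda>x. complex_of_real (deriv \<phi> x))" for S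
    by (intro continuous_on_of_real continuous_on_subset[OF \<phi>(2)]) auto
  then show "integrable (leb l) (\<lambda>x. complex_of_real (deriv \<phi> x))" by (intro integrable_leb_continuous)
  fix x assume x: "x \<in> {0..l}"
  have d: "((\<lambda>x. complex_of_real (\<phi> x)) has_vector_derivative of_real (deriv \<phi> y)) (at y within {0..x})" for y
    using \<phi>(1)[of y, THEN has_field_derivative_at_within, of "{0..x}"]
    by (intro bounded_linear.has_vector_derivative[OF bounded_linear_of_real])
      (simp add: has_real_derivative_iff_has_vector_derivative)
  have "((\<lambda>x. complex_of_real (deriv \<phi> x)) has_integral (of_real (\<phi> x) - of_real (\<phi> 0))) {0..x}"
    by (rule fundamental_theorem_of_calculus) (use x d in auto)
  then show "complex_of_real (\<phi> x) = of_real (\<phi> 0) + integral {0..x} (\<lambda>x. of_real (deriv \<phi> x))"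
    by (simp add: integral_unique)
qed

lemma primitive_weak_derivative:
  assumes l: "l > 0" and h: "primitive l g h"
  shows "weak_derivative l h g"
  unfolding weak_derivative_def
proof
  fix \<phi> assume \<phi>: "\<phi> \<in> test_functions l"
  note p = test_function_primitive[OF \<phi>]
  have i1: "integrable (leb l) (\<lambda>x. g x * of_real (\<phi> x))"
    using integrable_leb_cont_mult[OF primitive_integrable[OF h] primitive_continuous[OF p]] by (simp add: mult.commute)
  have i2: "integrable (leb l) (\<lambda>x. h x * of_real (deriv \<phi> x))"
    by (rule integrable_leb_cont_mult[OF primitive_integrable[OF p] primitive_continuous[OF h]])
  have "(LINT x|leb l. g x * of_real (\<phi> x)) + (LINT x|leb l. h x * of_real (deriv \<phi> x))
     = (LINT x|leb l. g x * of_real (\<phi> x) + h x * of_real (deriv \<phi> x))"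
    using i1 i2 by simp
  also have "\<dots> = 0"
    using primitive_parts[OF l h p] test_function_derivative(3,4)[OF \<phi>] i1 i2 by (subst LINT_leb) auto
  finally show "(LINT x|leb l. h x * of_real (deriv \<phi> x)) = - (LINT x|leb l. g x * of_real (\<phi> x))"
    by (simp add: eq_neg_iff_add_eq_0 add.commute)
qed

text \<open>The lemma of du Bois-Reymond. Correcting an arbitrary \<open>\<psi>\<close> by a multiple of a fixed bump \<open>\<psi>0\<close>
  makes its mean zero; so, for the constant \<open>c\<close> determined by \<open>\<psi>0\<close>, \<open>w - c\<close> is orthogonal to all
  continuous \<open>\<psi>\<close> of compact support. Approximating indicators of intervals by such \<open>\<psi>\<close> shows that
  the integrals of \<open>w - c\<close> vanish.\<close>

lemma zero_mean_orthogonal_imp_constant: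
  fixes w :: "real \<Rightarrow> complex"
  assumes l: "l > 0" and w: "integrable (leb l) w"
    and orth: "\<And>(\<psi> :: real \<Rightarrow> real) a b. continuous_on UNIV \<psi> \<Longrightarrow> 0 < a \<Longrightarrow> b < l \<Longrightarrow>
       (\<And>x. x \<notin> {a..b} \<Longrightarrow> \<psi> x = 0) \<Longrightarrow> integral {0..l} \<psi> = 0 \<Longrightarrow> (LINT x|leb l. w x * of_real (\<psi> x)) = 0"
  shows "\<exists>c. AE x in leb l. w x = c"
proof -
  define \<psi>0 :: "real \<Rightarrow> real" where "\<psi>0 x = max 0 (min (x - l/4) (3*l/4 - x))" for x
  have c0: "continuous_on S \<psi>0" for S unfolding \<psi>0_def by (intro continuous_intros)
  have s0: "\<psi>0 x = 0" if "x \<notin> {l/4..3*l/4}" for x using that unfolding \<psi>0_def by auto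
  define I where "I = integral {0..l} \<psi>0"
  have I: "I \<noteq> 0"
  proof
    assume "I = 0"
    then have "\<forall>x\<in>{0..l}. \<psi>0 x = 0" unfolding I_def using l c0
      by (subst (asm) integral_eq_0_iff) (auto simp: \<psi>0_def)
    then have "\<psi>0 (l/2) = 0" using l by simp
    then show False using l by (simp add: \<psi>0_def)
  qed
  define c where "c = (LINT x|leb l. w x * of_real (\<psi>0 x)) / of_real I"
  have wi: "integrable (leb l) (\<lambda>x. w x * of_real (\<psi> x))" if "continuous_on UNIV \<psi>" for \<psi> :: "real \<Rightarrow> real"
    using integrable_leb_cont_mult[OF w, of "\<lambda>x. of_real (\<psi> x)"] continuous_on_subset[OF that, of "{0..l}"]
    by (simp add: mult.commute continuous_on_of_real)
  have test: "(LINT x|leb l. (w x - c) * of_real (\<psi> x)) = 0"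
    if \<psi>: "continuous_on UNIV \<psi>" and ab: "0 < a" "b < l" and s: "\<And>x. x \<notin> {a..b} \<Longrightarrow> \<psi> x = 0" for \<psi> :: "real \<Rightarrow> real" and a b
  proof -
    define m where "m = integral {0..l} \<psi> / I"
    have \<psi>i: "\<psi> integrable_on {0..l}" "\<psi>0 integrable_on {0..l}"
      by (auto intro!: integrable_continuous_interval continuous_on_subset[OF \<psi>] c0)
    have "(LINT x|leb l. w x * of_real (\<psi> x - m * \<psi>0 x)) = 0"
    proof (rule orth[where a = "min a (l/4)" and b = "max b (3*l/4)"])
      show "continuous_on UNIV (\<lambda>x. \<psi> x - m * \<psi>0 x)" by (intro continuous_intros \<psi> c0)
      show "\<psi> x - m * \<psi>0 x = 0" if "x \<notin> {min a (l/4)..max b (3*l/4)}" for x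
      proof -
        have "x \<notin> {a..b}" "x \<notin> {l/4..3*l/4}" using that by auto
        then show ?thesis using s s0 by simp
      qed
      show "integral {0..l} (\<lambda>x. \<psi> x - m * \<psi>0 x) = 0"
        using \<psi>i I by (simp add: Henstock_Kurzweil_Integration.integral_diff integrable_on_mult_right m_def I_def)
    qed (use ab l in auto)
    moreover have "(LINT x|leb l. w x * of_real (\<psi> x - m * \<psi>0 x)) = (LINT x|leb l. w x * of_real (\<psi> x) - of_real m * (w x * of_real (\<psi>0 x)))"
      by (simp add: algebra_simps)
    moreover have "\<dots> = (LINT x|leb l. w x * of_real (\<psi> x)) - of_real m * (LINT x|leb l. w x * of_real (\<psi>0 x))"
      using wi[OF \<psi>] wi[OF c0] by simp
    moreover have "of_real m * (LINT x|leb l. w x * of_real (\<psi>0 x)) = c * of_real (integral {0..l} \<psi>)"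
      by (simp add: m_def c_def)
    moreover have "complex_of_real (integral {0..l} \<psi>) = (LINT x|leb l. of_real (\<psi> x))"
      using LINT_leb[OF integrable_leb_continuous[OF continuous_on_subset[OF \<psi>]], of l] by simp
    moreover have "(LINT x|leb l. (w x - c) * of_real (\<psi> x)) = (LINT x|leb l. w x * of_real (\<psi> x)) - (LINT x|leb l. c * of_real (\<psi> x))"
      unfolding left_diff_distrib
      by (intro Bochner_Integration.integral_diff wi[OF \<psi>] integrable_leb_continuous continuous_intros continuous_on_subset[OF \<psi>]) auto
    ultimately show ?thesis by simp
  qed
  have wc: "integrable (leb l) (\<lambda>x. w x - c)" using w integrable_leb_const by (rule Bochner_Integration.integrable_diff)
  have "AE x in leb l. w x - c = 0"
  proof (rule zero_integrals_AE[OF wc])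
    fix a b assume ab: "0 \<le> a" "a \<le> b" "b \<le> l"
    (* trapezoids supported inside the open interval that increase to its indicator *)
    define t :: "nat \<Rightarrow> real \<Rightarrow> real" where "t k x = max 0 (min 1 (real k * min (x - a - 1 / real (Suc k)) (b - 1 / real (Suc k) - x)))" for k x
    have tc: "continuous_on UNIV (t k)" for k unfolding t_def by (intro continuous_intros)
    have "(\<lambda>k. LINT x|leb l. (w x - c) * of_real (t k x)) \<longlonglongrightarrow> (LINT x|leb l. (w x - c) * of_real (indicator {a<..<b} x))"
    proof (rule integral_dominated_convergence[where w = "\<lambda>x. cmod (w x - c)"])
      show "integrable (leb l) (\<lambda>x. cmod (w x - c))" using wc by simp
      have [measurable]: "(\<lambda>x. w x - c) \<in> borel_measurable (leb l)" using wc by simp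
      have [measurable]: "{a<..<b} \<inter> {0<..<l} \<in> sets (leb l)" by (auto simp: sets_restrict_space_iff)
      have "(\<lambda>x. (w x - c) * of_real (indicator ({a<..<b} \<inter> {0<..<l}) x)) \<in> borel_measurable (leb l)" by measurable
      also have "?this \<longleftrightarrow> (\<lambda>x. (w x - c) * of_real (indicator {a<..<b} x)) \<in> borel_measurable (leb l)"
        by (intro measurable_cong) (auto simp: indicator_def)
      finally show "(\<lambda>x. (w x - c) * of_real (indicator {a<..<b} x)) \<in> borel_measurable (leb l)" .
      show "(\<lambda>x. (w x - c) * of_real (t k x)) \<in> borel_measurable (leb l)" for k
        using measurable_leb_continuous[of l "\<lambda>x. complex_of_real (t k x)"] continuous_on_subset[OF tc, of "{0..l}" k]
        by (intro borel_measurable_times) (auto intro: continuous_on_of_real)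
      show "AE x in leb l. norm ((w x - c) * of_real (t k x)) \<le> cmod (w x - c)" for k
      proof (intro AE_I2)
        fix x
        have "\<bar>t k x\<bar> \<le> 1" by (simp add: t_def)
        then show "norm ((w x - c) * of_real (t k x)) \<le> cmod (w x - c)"
          by (simp add: norm_mult mult_left_le)
      qed
      show "AE x in leb l. (\<lambda>k. (w x - c) * of_real (t k x)) \<longlonglongrightarrow> (w x - c) * of_real (indicator {a<..<b} x)"
      proof (intro AE_I2 tendsto_mult tendsto_const tendsto_of_real)
        fix x
        show "(\<lambda>k. t k x) \<longlonglongrightarrow> indicator {a<..<b} x"
        proof (cases "x \<in> {a<..<b}")
          case False
          have "t k x = 0" for k
          proof -
            have p: "0 < 1 / real (Suc k)" by simp
            have "x \<le> a \<or> b \<le> x" using False by auto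
            then have "x - a - 1 / real (Suc k) \<le> 0 \<or> b - 1 / real (Suc k) - x \<le> 0" using p by linarith
            then have "min (x - a - 1 / real (Suc k)) (b - 1 / real (Suc k) - x) \<le> 0" unfolding min_le_iff_disj .
            then have "real k * min (x - a - 1 / real (Suc k)) (b - 1 / real (Suc k) - x) \<le> 0" by (intro mult_nonneg_nonpos) auto
            then show ?thesis by (simp add: t_def)
          qed
          then show ?thesis using False by simp
        next
          case True
          define d where "d = min (x - a) (b - x)"
          have d: "d > 0" using True by (simp add: d_def)
          obtain K :: nat where K: "2 / d < real K" using reals_Archimedean2 by blast
          have "\<forall>\<^sub>F k in sequentially. t k x = 1"
            using eventually_ge_at_top[of K]
          proof eventually_elim
            case (elim k)
            then have kd: "2 / d < real k" using K by simp
            then have kd2: "2 < real k * d" using d by (simp add: field_simps)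
            have kp: "real k * (1 / real (Suc k)) \<le> 1" by simp
            have m: "min (x - a - 1 / real (Suc k)) (b - 1 / real (Suc k) - x) = d - 1 / real (Suc k)"
              unfolding d_def by (simp add: min_def)
            have "1 \<le> real k * (d - 1 / real (Suc k))"
              unfolding right_diff_distrib using kd2 kp by linarith
            then show ?case unfolding t_def m by simp
          qed
          then show ?thesis using True by (simp add: tendsto_eventually)
        qed
      qed
    qed
    moreover have "(LINT x|leb l. (w x - c) * of_real (t k x)) = 0" for k
    proof (rule test[OF tc, where a = "a + 1 / real (Suc k)" and b = "b - 1 / real (Suc k)"])
      show "0 < a + 1 / real (Suc k)" using ab by (simp add: add_nonneg_pos)
      have "0 < 1 / real (Suc k)" by simp
      then show "b - 1 / real (Suc k) < l" using ab by linarith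
      fix x assume "x \<notin> {a + 1 / real (Suc k)..b - 1 / real (Suc k)}"
      then have "x - a - 1 / real (Suc k) \<le> 0 \<or> b - 1 / real (Suc k) - x \<le> 0"
        unfolding atLeastAtMost_iff by linarith
      then have "min (x - a - 1 / real (Suc k)) (b - 1 / real (Suc k) - x) \<le> 0" unfolding min_le_iff_disj .
      then have "real k * min (x - a - 1 / real (Suc k)) (b - 1 / real (Suc k) - x) \<le> 0" by (intro mult_nonneg_nonpos) auto
      then show "t k x = 0" by (simp add: t_def)
    qed
    ultimately have 0: "(LINT x|leb l. (w x - c) * of_real (indicator {a<..<b} x)) = 0"
      by (simp add: LIMSEQ_const_iff)
    have "integral {a..b} (\<lambda>x. w x - c) = integral {a<..<b} (\<lambda>x. w x - c)" by (simp add: integral_open_interval_real)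
    also have "\<dots> = (LINT x:{a<..<b}|lebesgue. w x - c)"
    proof (rule set_lebesgue_integral_eq_integral(2)[symmetric])
      have "set_integrable lebesgue {0<..<l} (\<lambda>x. w x - c)" using wc by (simp add: set_integrable_def integrable_restrict_space)
      then show "set_integrable lebesgue {a<..<b} (\<lambda>x. w x - c)" by (rule set_integrable_subset) (use ab in auto)
    qed
    also have "\<dots> = (LINT x|leb l. (w x - c) * of_real (indicator {a<..<b} x))"
      unfolding set_lebesgue_integral_def using ab
      by (subst integral_restrict_space) (auto intro!: Bochner_Integration.integral_cong simp: indicator_def)
    finally show "integral {a..b} (\<lambda>x. w x - c) = 0" using 0 by simp
  qed
  then show ?thesis by auto
qed

text \<open>The difference of \<open>f\<close> and the primitive of \<open>g\<close> has weak derivative zero, so it is constant.\<close>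

lemma H1_primitive:
  assumes l: "l > 0" and f: "f \<in> L2_space l" and g: "g \<in> L2_space l" and wd: "weak_derivative l f g"
  shows "\<exists>h. primitive l g h \<and> (AE x in leb l. h x = f x)"
proof -
  define k where "k x = integral {0..x} g" for x
  have k: "primitive l g k" using L2_integrable[OF g] by (simp add: primitive_def k_def)
  have fi: "integrable (leb l) f" and ki: "integrable (leb l) k"
    using L2_integrable[OF f] integrable_leb_continuous[OF primitive_continuous[OF k]] by auto
  have "\<exists>c. AE x in leb l. f x - k x = c"
  proof (rule zero_mean_orthogonal_imp_constant[OF l])
    show "integrable (leb l) (\<lambda>x. f x - k x)" using fi ki by simp
    fix \<psi> :: "real \<Rightarrow> real" and a b
    assume \<psi>: "continuous_on UNIV \<psi>" "0 < a" "b < l" "\<And>x. x \<notin> {a..b} \<Longrightarrow> \<psi> x = 0" "integral {0..l} \<psi> = 0"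
    obtain \<phi> where \<phi>: "\<phi> \<in> test_functions l" "deriv \<phi> = \<psi>" using zero_mean_primitive_test[OF l \<psi>] by metis
    have c: "continuous_on {0..l} (\<lambda>x. complex_of_real (\<psi> x))"
      by (intro continuous_on_of_real continuous_on_subset[OF \<psi>(1)]) auto
    have "(LINT x|leb l. f x * of_real (\<psi> x)) = (LINT x|leb l. k x * of_real (\<psi> x))"
      using wd primitive_weak_derivative[OF l k] \<phi> unfolding weak_derivative_def by metis
    then show "(LINT x|leb l. (f x - k x) * of_real (\<psi> x)) = 0"
      unfolding left_diff_distrib
      using integrable_leb_cont_mult[OF fi c] integrable_leb_cont_mult[OF ki c]
      by (subst Bochner_Integration.integral_diff) (auto simp: mult.commute)
  qed
  then obtain c where c: "AE x in leb l. f x - k x = c" by blast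
  have "primitive l g (\<lambda>x. k x + c)"
    unfolding primitive_def
  proof (intro conjI ballI)
    show "integrable (leb l) g" by (rule L2_integrable[OF g])
    show "k x + c = k 0 + c + integral {0..x} g" if "x \<in> {0..l}" for x
      by (simp add: k_def)
  qed
  moreover have "AE x in leb l. k x + c = f x" using c by eventually_elim auto
  ultimately show ?thesis by blast
qed

text \<open>Includes the end points of the interval, which is where the vertex values are taken.\<close>

lemma continuous_AE_eq:
  fixes h k :: "real \<Rightarrow> complex"
  assumes l: "l > 0" and h: "continuous_on {0..l} h" and k: "continuous_on {0..l} k"
    and ae: "AE x in leb l. h x = k x" and x: "x \<in> {0..l}"
  shows "h x = k x"
proof -
  have c: "continuous_on {0..l} (\<lambda>x. cmod (h x - k x))" by (intro continuous_intros h k)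
  have "(LINT x|leb l. cmod (h x - k x)) = (LINT x|leb l. 0)"
  proof (rule integral_cong_AE)
    show "(\<lambda>x. cmod (h x - k x)) \<in> borel_measurable (leb l)" by (rule measurable_leb_continuous[OF c])
    show "AE x in leb l. cmod (h x - k x) = 0" using ae by eventually_elim simp
  qed simp
  then have "integral {0..l} (\<lambda>x. cmod (h x - k x)) = 0"
    using LINT_leb[OF integrable_leb_continuous[OF c]] by simp
  then have "\<forall>x\<in>{0..l}. cmod (h x - k x) = 0"
    using integral_eq_0_iff[OF c l] by simp
  then show ?thesis using x by simp
qed

lemma cont_rep_eq:
  assumes l: "l > 0" and h: "continuous_on {0..l} h" and ae: "AE x in leb l. h x = f x" and x: "x \<in> {0..l}"
  shows "cont_rep l f x = h x"
proof -
  have "continuous_on {0..l} (cont_rep l f) \<and> (AE x in leb l. cont_rep l f x = f x)"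
    unfolding cont_rep_def by (rule someI[of _ h]) (use h ae in simp)
  then show ?thesis using ae by (intro continuous_AE_eq[OF l _ h _ x]) auto
qed

lemma wderiv:
  assumes "f \<in> H1_space l"
  shows wderiv_L2: "wderiv l f \<in> L2_space l" and wderiv_weak: "weak_derivative l f (wderiv l f)"
proof -
  have "\<exists>g. g \<in> L2_space l \<and> weak_derivative l f g" using assms by (auto simp: H1_space_def)
  then have "wderiv l f \<in> L2_space l \<and> weak_derivative l f (wderiv l f)"
    unfolding wderiv_def by (rule someI_ex)
  then show "wderiv l f \<in> L2_space l" "weak_derivative l f (wderiv l f)" by auto
qed

lemma H1_cont_rep:
  assumes l: "l > 0" and f: "f \<in> H1_space l"
  shows "primitive l (wderiv l f) (cont_rep l f)" "AE x in leb l. cont_rep l f x = f x"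
proof -
  have fL: "f \<in> L2_space l" using f by (simp add: H1_space_def)
  obtain h where h: "primitive l (wderiv l f) h" "AE x in leb l. h x = f x"
    using H1_primitive[OF l fL wderiv[OF f]] by blast
  have eq: "cont_rep l f x = h x" if "x \<in> {0..l}" for x
    by (rule cont_rep_eq[OF l primitive_continuous[OF h(1)] h(2) that])
  show "primitive l (wderiv l f) (cont_rep l f)"
    unfolding primitive_def
  proof (intro conjI ballI)
    show "integrable (leb l) (wderiv l f)" by (rule primitive_integrable[OF h(1)])
    show "cont_rep l f x = cont_rep l f 0 + integral {0..x} (wderiv l f)" if "x \<in> {0..l}" for x
      using primitive_eq[OF h(1) that] eq[OF that] eq[of 0] l by simp
  qed
  show "AE x in leb l. cont_rep l f x = f x"
    using h(2) AE_space by eventually_elim (use eq in auto)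
qed

lemma weak_derivative_unique:
  assumes l: "l > 0" and f: "f \<in> L2_space l" and g: "g \<in> L2_space l" "weak_derivative l f g"
    and g': "g' \<in> L2_space l" "weak_derivative l f g'"
  shows "AE x in leb l. g x = g' x"
proof -
  obtain h where h: "primitive l g h" "AE x in leb l. h x = f x" using H1_primitive[OF l f g] by blast
  obtain k where k: "primitive l g' k" "AE x in leb l. k x = f x" using H1_primitive[OF l f g'] by blast
  have eq: "h x = k x" if "x \<in> {0..l}" for x
    using h(2) k(2) by (intro continuous_AE_eq[OF l primitive_continuous[OF h(1)] primitive_continuous[OF k(1)] _ that]) auto
  have "AE x in leb l. g x - g' x = 0"
  proof (rule zero_integrals_AE)
    show "integrable (leb l) (\<lambda>x. g x - g' x)" using L2_integrable g g' by simp
    fix a b assume ab: "0 \<le> a" "a \<le> b" "b \<le> l"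
    have "integral {a..b} (\<lambda>x. g x - g' x) = integral {a..b} g - integral {a..b} g'"
      using integrable_leb_sub(1)[OF L2_integrable[OF g(1)]] integrable_leb_sub(1)[OF L2_integrable[OF g'(1)]] ab
      by (intro Henstock_Kurzweil_Integration.integral_diff) auto
    also have "\<dots> = (h b - h a) - (k b - k a)"
      using primitive_increment[OF h(1) ab] primitive_increment[OF k(1) ab] by simp
    also have "\<dots> = 0" using eq ab by simp
    finally show "integral {a..b} (\<lambda>x. g x - g' x) = 0" .
  qed
  then show ?thesis by eventually_elim simp
qed


section \<open>Linear algebra on subspaces of coordinate spaces\<close>

lemma cfscale_apply [simp]: "cfscale c \<xi> j = c * \<xi> j"
  by (simp add: cfscale_def)

lemma coord_space_subspace: "cvs.subspace (coord_space J)"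
  by (auto simp: cvs.subspace_def coord_space_def)

lemma sum_fun_apply: "(\<Sum>i\<in>I. f i) j = (\<Sum>i\<in>I. f i j)" for f :: "'i \<Rightarrow> 'a \<Rightarrow> complex"
  by (induction I rule: infinite_finite_induct) auto

definition unit_fun :: "'a \<Rightarrow> 'a \<Rightarrow> complex" where
  "unit_fun i = (\<lambda>j. if j = i then 1 else 0)"

lemma unit_fun_coord: "i \<in> J \<Longrightarrow> unit_fun i \<in> coord_space J"
  by (auto simp: unit_fun_def coord_space_def)

lemma inj_unit_fun: "inj unit_fun"
  by (rule injI) (metis unit_fun_def zero_neq_one)

lemma coord_space_expansion:
  assumes "finite J" "\<xi> \<in> coord_space J"
  shows "\<xi> = (\<Sum>i\<in>J. cfscale (\<xi> i) (unit_fun i))"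
proof
  fix j
  have "(\<Sum>i\<in>J. cfscale (\<xi> i) (unit_fun i)) j = (\<Sum>i\<in>J. if j = i then \<xi> i else 0)"
    unfolding sum_fun_apply by (intro sum.cong) (auto simp: unit_fun_def)
  also have "\<dots> = \<xi> j" using assms by (auto simp: coord_space_def sum.delta)
  finally show "\<xi> j = (\<Sum>i\<in>J. cfscale (\<xi> i) (unit_fun i)) j" ..
qed

lemma coord_space_span:
  assumes "finite J"
  shows "cvs.span (unit_fun ` J) = coord_space J"
proof
  show "cvs.span (unit_fun ` J) \<subseteq> coord_space J"
    by (rule cvs.span_minimal) (auto intro: unit_fun_coord coord_space_subspace)
  show "coord_space J \<subseteq> cvs.span (unit_fun ` J)"
  proof
    fix \<xi> :: "'a \<Rightarrow> complex" assume \<xi>: "\<xi> \<in> coord_space J"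
    have "(\<Sum>i\<in>J. cfscale (\<xi> i) (unit_fun i)) \<in> cvs.span (unit_fun ` J)"
      by (intro cvs.span_sum cvs.span_scale cvs.span_base) auto
    then show "\<xi> \<in> cvs.span (unit_fun ` J)"
      unfolding coord_space_expansion[OF assms \<xi>, symmetric] .
  qed
qed

lemma independent_coord_card:
  assumes "finite J" "\<not> cvs.dependent A" "A \<subseteq> coord_space J"
  shows "finite A \<and> card A \<le> card J"
proof -
  have "A \<subseteq> cvs.span (unit_fun ` J)" using assms coord_space_span by blast
  then have "finite A \<and> card A \<le> card (unit_fun ` J)"
    using assms by (intro cvs.independent_span_bound) auto
  then show ?thesis using card_image_le[of J unit_fun] assms by auto
qed

lemma independent_unit_fun:
  assumes "finite J"
  shows "\<not> cvs.dependent (unit_fun ` J)"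
proof
  assume "cvs.dependent (unit_fun ` J)"
  then obtain u where u: "(\<Sum>v\<in>unit_fun ` J. cfscale (u v) v) = 0" "\<exists>v\<in>unit_fun ` J. u v \<noteq> 0"
    using cvs.dependent_finite[of "unit_fun ` J"] assms by auto
  then obtain i where i: "i \<in> J" "u (unit_fun i) \<noteq> 0" by auto
  have "(\<Sum>v\<in>unit_fun ` J. cfscale (u v) v) = (\<Sum>k\<in>J. cfscale (u (unit_fun k)) (unit_fun k))"
    by (rule sum.reindex_cong[of unit_fun]) (rule inj_on_subset[OF inj_unit_fun subset_UNIV], rule refl, rule refl)
  then have "(\<Sum>k\<in>J. cfscale (u (unit_fun k)) (unit_fun k)) i = 0" using u by simp
  moreover have "(\<Sum>k\<in>J. cfscale (u (unit_fun k)) (unit_fun k)) i = (\<Sum>k\<in>J. if i = k then u (unit_fun k) else 0)"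
    unfolding sum_fun_apply by (intro sum.cong) (auto simp: unit_fun_def)
  ultimately show False using i assms by (simp add: sum.delta)
qed

lemma basis_family_card:
  assumes "finite I" "finite J" "basis_family (coord_space J) I b"
  shows "card I = card J"
proof -
  have b: "inj_on b I" "\<not> cvs.dependent (b ` I)" "cvs.span (b ` I) = coord_space J"
    using assms by (auto simp: basis_family_def)
  have "b ` I \<subseteq> coord_space J" using b(3) cvs.span_superset by metis
  then have "card (b ` I) \<le> card J" using independent_coord_card[OF assms(2) b(2)] by blast
  moreover have "finite (unit_fun ` J) \<and> card (unit_fun ` J) \<le> card (b ` I)"
    using independent_unit_fun[OF assms(2)] unit_fun_coord b(3) assms
    by (intro cvs.independent_span_bound) auto
  moreover have "card (unit_fun ` J) = card J" by (intro card_image inj_on_subset[OF inj_unit_fun]) simp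
  ultimately show ?thesis using card_image[OF b(1)] by simp
qed

lemma linear_sum_cfscale:
  fixes L :: "('a \<Rightarrow> complex) \<Rightarrow> 'b \<Rightarrow> complex"
  assumes U: "cvs.subspace U" and add: "\<And>x y. x \<in> U \<Longrightarrow> y \<in> U \<Longrightarrow> L (x + y) = L x + L y"
    and scale: "\<And>c x. x \<in> U \<Longrightarrow> L (cfscale c x) = cfscale c (L x)" and f: "\<And>i. i \<in> I \<Longrightarrow> f i \<in> U"
  shows "L (\<Sum>i\<in>I. cfscale (u i) (f i)) = (\<Sum>i\<in>I. cfscale (u i) (L (f i)))"
proof -
  have L0: "L 0 = 0"
    using scale[OF cvs.subspace_0[OF U], of 0] unfolding cvs.scale_zero_left .
  show ?thesis
    using f
  proof (induction I rule: infinite_finite_induct)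
    case (insert x F)
    have F: "(\<Sum>i\<in>F. cfscale (u i) (f i)) \<in> U"
      by (intro cvs.subspace_sum cvs.subspace_scale U insert.prems insertI2)
    have x: "f x \<in> U" by (rule insert.prems) simp
    have IH: "L (\<Sum>i\<in>F. cfscale (u i) (f i)) = (\<Sum>i\<in>F. cfscale (u i) (L (f i)))"
      by (rule insert.IH) (use insert.prems in blast)
    show ?case
      unfolding sum.insert[OF insert.hyps] add[OF cvs.subspace_scale[OF U x] F] scale[OF x] IH ..
  qed (simp_all only: sum.infinite sum.empty L0 not_False_eq_True)
qed

lemma linear_between_mem: "linear_between U W F \<Longrightarrow> x \<in> U \<Longrightarrow> F x \<in> W"
  and linear_between_add: "linear_between U W F \<Longrightarrow> x \<in> U \<Longrightarrow> y \<in> U \<Longrightarrow> F (x + y) = F x + F y"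
  and linear_between_scale: "linear_between U W F \<Longrightarrow> x \<in> U \<Longrightarrow> F (cfscale c x) = cfscale c (F x)"
  unfolding linear_between_def by blast+

text \<open>Were \<open>w\<close> not a value of \<open>L\<close>, then \<open>w\<close> and the images of the unit vectors would be more than
  \<open>card t\<close> linearly independent vectors in the span of \<open>t\<close>. The target is described by a spanning set
  rather than by its dimension, which spares showing that this set is independent.\<close>

lemma injective_linear_onto:
  fixes L :: "('a \<Rightarrow> complex) \<Rightarrow> 'b \<Rightarrow> complex"
  assumes I: "finite I" and add: "\<And>x y. x \<in> coord_space I \<Longrightarrow> y \<in> coord_space I \<Longrightarrow> L (x + y) = L x + L y"
    and scale: "\<And>c x. x \<in> coord_space I \<Longrightarrow> L (cfscale c x) = cfscale c (L x)"
    and inj: "\<And>x. x \<in> coord_space I \<Longrightarrow> L x = 0 \<Longrightarrow> x = 0"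
    and range: "\<And>x. x \<in> coord_space I \<Longrightarrow> L x \<in> W"
    and t: "finite t" "card t \<le> card I" "W \<subseteq> cvs.span t" and w: "w \<in> W"
  shows "\<exists>x\<in>coord_space I. L x = w"
proof (rule ccontr)
  assume no: "\<not> (\<exists>x\<in>coord_space I. L x = w)"
  note sub = coord_space_subspace[of I]
  let ?e = "\<lambda>i. L (unit_fun i)"
  have comb: "(\<Sum>i\<in>I. cfscale (u i) (?e i)) = L (\<Sum>i\<in>I. cfscale (u i) (unit_fun i))" for u
    by (rule linear_sum_cfscale[OF sub add scale unit_fun_coord, symmetric])
  have mem: "(\<Sum>i\<in>I. cfscale (u i) (unit_fun i)) \<in> coord_space I" for u
    by (intro cvs.subspace_sum cvs.subspace_scale sub unit_fun_coord)
  have val: "(\<Sum>i\<in>I. cfscale (u i) (unit_fun i)) j = u j" if "j \<in> I" for u j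
  proof -
    have "(\<Sum>i\<in>I. cfscale (u i) (unit_fun i)) j = (\<Sum>i\<in>I. if j = i then u i else 0)"
      unfolding sum_fun_apply by (intro sum.cong) (auto simp: unit_fun_def)
    then show ?thesis using that I by (simp add: sum.delta)
  qed
  have inje: "inj_on ?e I"
  proof (rule inj_onI)
    fix i j assume ij: "i \<in> I" "j \<in> I" "?e i = ?e j"
    have c: "unit_fun i \<in> coord_space I" "cfscale (-1) (unit_fun j) \<in> coord_space I"
      by (rule unit_fun_coord[OF ij(1)], rule cvs.subspace_scale[OF sub unit_fun_coord[OF ij(2)]])
    have "L (unit_fun i + cfscale (-1) (unit_fun j)) = L (unit_fun i) + cfscale (-1) (L (unit_fun j))"
      unfolding add[OF c] scale[OF unit_fun_coord[OF ij(2)]] ..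
    also have "\<dots> = 0" unfolding ij(3) by (rule ext) simp
    finally have "unit_fun i + cfscale (-1) (unit_fun j) = 0"
      using inj cvs.subspace_add[OF sub c] by blast
    then have "(unit_fun i + cfscale (-1) (unit_fun j)) i = 0" by simp
    then show "i = j" by (auto simp: unit_fun_def split: if_splits)
  qed
  have indep: "\<not> cvs.dependent (?e ` I)"
  proof
    assume "cvs.dependent (?e ` I)"
    then obtain u where u: "(\<Sum>v\<in>?e ` I. cfscale (u v) v) = 0" "\<exists>v\<in>?e ` I. u v \<noteq> 0"
      using cvs.dependent_finite[of "?e ` I"] I by auto
    then obtain i where i: "i \<in> I" "u (?e i) \<noteq> 0" by auto
    have "(\<Sum>v\<in>?e ` I. cfscale (u v) v) = (\<Sum>k\<in>I. cfscale (u (?e k)) (?e k))"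
      by (rule sum.reindex_cong[OF inje]) auto
    then have "L (\<Sum>k\<in>I. cfscale (u (?e k)) (unit_fun k)) = 0" using u comb by simp
    then have "(\<Sum>k\<in>I. cfscale (u (?e k)) (unit_fun k)) = 0" by (rule inj[OF mem])
    then show False using val[OF i(1), of "\<lambda>k. u (?e k)"] i by simp
  qed
  have "w \<notin> cvs.span (?e ` I)"
  proof
    assume "w \<in> cvs.span (?e ` I)"
    then obtain u where "w = (\<Sum>v\<in>?e ` I. cfscale (u v) v)"
      using cvs.span_finite[of "?e ` I"] I by auto
    also have "\<dots> = (\<Sum>k\<in>I. cfscale (u (?e k)) (?e k))"
      by (rule sum.reindex_cong[OF inje]) auto
    also have "\<dots> = L (\<Sum>k\<in>I. cfscale (u (?e k)) (unit_fun k))" by (rule comb)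
    finally have "L (\<Sum>k\<in>I. cfscale (u (?e k)) (unit_fun k)) = w" by (rule sym)
    then have "\<exists>x\<in>coord_space I. L x = w" by (rule bexI[where P = "\<lambda>x. L x = w", OF _ mem])
    then show False using no by contradiction
  qed
  then have "\<not> cvs.dependent (insert w (?e ` I))" using indep by (rule cvs.independent_insertI)
  moreover have "insert w (?e ` I) \<subseteq> cvs.span t"
    using w t(3) range[OF unit_fun_coord] by (auto simp del: cvs.span_breakdown_eq)
  ultimately have "card (insert w (?e ` I)) \<le> card t"
    using cvs.independent_span_bound[OF t(1)] by blast
  moreover have "w \<notin> ?e ` I" using no unit_fun_coord by (metis imageE)
  ultimately show False using card_image[OF inje] I t(2) by simp
qed

lemma herm_ip_add_left: "herm_ip J (x + y) z = herm_ip J x z + herm_ip J y z"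
  and herm_ip_diff_left: "herm_ip J (x - y) z = herm_ip J x z - herm_ip J y z"
  and herm_ip_diff_right: "herm_ip J z (x - y) = herm_ip J z x - herm_ip J z y"
  and herm_ip_scale_left: "herm_ip J (cfscale c x) z = c * herm_ip J x z"
  and herm_ip_cnj: "herm_ip J y x = cnj (herm_ip J x y)"
  by (simp_all add: herm_ip_def algebra_simps sum.distrib sum_subtractf sum_distrib_left)

lemma herm_ip_zero [simp]: "herm_ip J 0 z = 0" "herm_ip J z 0 = 0"
  by (simp_all add: herm_ip_def)

lemma herm_ip_self: "herm_ip J x x = of_real (\<Sum>j\<in>J. (cmod (x j))\<^sup>2)"
  unfolding herm_ip_def of_real_sum complex_norm_square ..

lemma herm_ip_sum_left: "herm_ip J (\<Sum>e\<in>I. cfscale (u e) (f e)) w = (\<Sum>e\<in>I. u e * herm_ip J (f e) w)"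
  unfolding herm_ip_def sum_fun_apply cfscale_apply sum_distrib_right sum_distrib_left
  by (subst sum.swap) (simp add: mult.assoc)

lemma herm_ip_pos:
  assumes "finite J" "x \<in> coord_space J" "x \<noteq> 0"
  shows "0 < Re (herm_ip J x x)"
proof -
  obtain j where j: "x j \<noteq> 0" using assms by (auto simp: fun_eq_iff)
  then have "j \<in> J" using assms by (auto simp: coord_space_def)
  then show ?thesis unfolding herm_ip_self using j assms(1)
    by (simp only: Re_complex_of_real) (rule sum_pos2, auto)
qed

text \<open>Covers the Euclidean inner product on a subspace as well as its weighted version on \<open>Y_v^(d)\<close>.\<close>

locale herm_form =
  fixes J :: "'a set" and U :: "('a \<Rightarrow> complex) set" and b :: "('a \<Rightarrow> complex) \<Rightarrow> ('a \<Rightarrow> complex) \<Rightarrow> complex"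
  assumes fin: "finite J" and sub: "cvs.subspace U" and UJ: "U \<subseteq> coord_space J"
    and b_add: "x \<in> U \<Longrightarrow> y \<in> U \<Longrightarrow> z \<in> U \<Longrightarrow> b (x + y) z = b x z + b y z"
    and b_scale: "x \<in> U \<Longrightarrow> z \<in> U \<Longrightarrow> b (cfscale c x) z = c * b x z"
    and b_cnj: "x \<in> U \<Longrightarrow> y \<in> U \<Longrightarrow> b y x = cnj (b x y)"
    and b_pos: "x \<in> U \<Longrightarrow> x \<noteq> 0 \<Longrightarrow> 0 < Re (b x x)"
begin

lemmas U_closed = cvs.subspace_0[OF sub] cvs.subspace_add[OF sub] cvs.subspace_diff[OF sub] cvs.subspace_scale[OF sub]

lemma b_scale_right: "x \<in> U \<Longrightarrow> z \<in> U \<Longrightarrow> b z (cfscale c x) = cnj c * b z x"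
  using b_cnj[of "cfscale c x" z] b_cnj[of x z] b_scale[of x z c] U_closed by simp

lemma b_diff: "x \<in> U \<Longrightarrow> y \<in> U \<Longrightarrow> z \<in> U \<Longrightarrow> b (x - y) z = b x z - b y z"
  using b_add[of "x - y" y z] U_closed(3)[of x y] by simp

lemma b_sum: "(\<And>i. i \<in> I \<Longrightarrow> f i \<in> U) \<Longrightarrow> z \<in> U \<Longrightarrow> b (\<Sum>i\<in>I. cfscale (u i) (f i)) z = (\<Sum>i\<in>I. u i * b (f i) z)"
proof (induction I rule: infinite_finite_induct)
  case (insert x F)
  have F: "(\<Sum>i\<in>F. cfscale (u i) (f i)) \<in> U"
    by (intro cvs.subspace_sum sub U_closed(4) insert.prems(1) insertI2)
  have x: "f x \<in> U" by (rule insert.prems(1)) simp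
  have IH: "b (\<Sum>i\<in>F. cfscale (u i) (f i)) z = (\<Sum>i\<in>F. u i * b (f i) z)"
    by (rule insert.IH) (use insert.prems in auto)
  show ?case
    unfolding sum.insert[OF insert.hyps] b_add[OF U_closed(4)[OF x] F insert.prems(2)] b_scale[OF x insert.prems(2)] IH ..
qed (use b_scale[of 0 z 0] U_closed(1) in \<open>simp_all only: sum.infinite sum.empty cvs.scale_zero_left mult_zero_left not_False_eq_True\<close>)

lemma b_self: "x \<in> U \<Longrightarrow> b x x = of_real (Re (b x x))"
  using b_cnj[of x x] by (simp add: complex_eq_iff)

definition orthonormal :: "('a \<Rightarrow> complex) set \<Rightarrow> bool" where
  "orthonormal E \<longleftrightarrow> E \<subseteq> U \<and> (\<forall>e\<in>E. \<forall>e'\<in>E. b e e' = (if e = e' then 1 else 0))"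

lemma orthonormal_independent:
  assumes "orthonormal E"
  shows "\<not> cvs.dependent E"
proof
  assume "cvs.dependent E"
  then obtain t u where t: "finite t" "t \<subseteq> E" "(\<Sum>v\<in>t. cfscale (u v) v) = 0" "\<exists>v\<in>t. u v \<noteq> 0"
    unfolding cvs.dependent_explicit by blast
  then obtain v where v: "v \<in> t" "u v \<noteq> 0" by blast
  have tU: "t \<subseteq> U" using t assms by (auto simp: orthonormal_def)
  have "0 = b (\<Sum>v\<in>t. cfscale (u v) v) v"
    unfolding t(3) using b_scale[of 0 v 0] U_closed(1) v(1) tU unfolding cvs.scale_zero_left by auto
  also have "\<dots> = (\<Sum>e\<in>t. u e * b e v)" using tU v by (intro b_sum) auto
  also have "\<dots> = (\<Sum>e\<in>t. if v = e then u e else 0)"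
  proof (intro sum.cong refl)
    fix e assume "e \<in> t"
    then have "b e v = (if e = v then 1 else 0)" using assms t(2) v(1) unfolding orthonormal_def by blast
    then show "u e * b e v = (if v = e then u e else 0)" by simp
  qed
  also have "\<dots> = u v" using t v by (simp add: sum.delta)
  finally show False using v by simp
qed

text \<open>Orthonormal sets are independent, so their size is bounded and there is a largest one; a vector
  outside its span would enlarge it after projection and normalization.\<close>

lemma orthonormal_basis_exists:
  "\<exists>E. finite E \<and> orthonormal E \<and> (\<forall>x\<in>U. x = (\<Sum>e\<in>E. cfscale (b x e) e))"
proof -
  have bound: "finite E \<and> card E \<le> card J" if "orthonormal E" for E
    using independent_coord_card[OF fin orthonormal_independent[OF that]] that UJ by (auto simp: orthonormal_def)
  have ex: "orthonormal {}" by (simp add: orthonormal_def)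
  obtain E where E: "orthonormal E" and max: "\<And>E'. orthonormal E' \<Longrightarrow> card E' \<le> card E"
    using ex_has_greatest_nat[of orthonormal "{}" card "Suc (card J)"] ex bound by (metis le_imp_less_Suc)
  have EU: "E \<subseteq> U" using E by (simp add: orthonormal_def)
  have finE: "finite E" using bound E by blast
  have "x = (\<Sum>e\<in>E. cfscale (b x e) e)" if x: "x \<in> U" for x
  proof (rule ccontr)
    assume ne: "x \<noteq> (\<Sum>e\<in>E. cfscale (b x e) e)"
    define s where "s = (\<Sum>e\<in>E. cfscale (b x e) e)"
    have sU: "s \<in> U" unfolding s_def by (intro cvs.subspace_sum sub U_closed) (use EU in auto)
    define d where "d = x - s"
    have dU: "d \<in> U" and d0: "d \<noteq> 0" using x sU ne U_closed by (auto simp: d_def s_def)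
    have orth: "b d e = 0" if e: "e \<in> E" for e
    proof -
      have "b s e = (\<Sum>e'\<in>E. b x e' * b e' e)" unfolding s_def using EU e by (intro b_sum) auto
      also have "\<dots> = (\<Sum>e'\<in>E. if e = e' then b x e' else 0)"
      proof (intro sum.cong refl)
        fix e' assume "e' \<in> E"
        then have "b e' e = (if e' = e then 1 else 0)" using E e unfolding orthonormal_def by blast
        then show "b x e' * b e' e = (if e = e' then b x e' else 0)" by simp
      qed
      also have "\<dots> = b x e" using finE e by (simp add: sum.delta)
      finally show ?thesis unfolding d_def using x sU e EU by (subst b_diff) auto
    qed
    define c where "c = 1 / sqrt (Re (b d d))"
    define n where "n = cfscale (of_real c) d"
    have pos: "Re (b d d) > 0" by (rule b_pos[OF dU d0])
    have c2: "c * c * Re (b d d) = 1" using pos by (simp add: c_def)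
    have nU: "n \<in> U" using dU U_closed by (simp add: n_def)
    have nn: "b n n = 1"
      using dU nU b_self[OF dU] c2 unfolding n_def
      by (simp add: b_scale b_scale_right U_closed(4)) (metis mult.assoc of_real_1 of_real_mult)
    have ne: "b n e = 0" "b e n = 0" if e: "e \<in> E" for e
      using orth[OF e] dU e EU b_cnj[of d e] unfolding n_def by (auto simp: b_scale b_scale_right)
    have "n \<notin> E" using nn ne by force
    have "orthonormal (insert n E)" using E nU nn ne by (auto simp: orthonormal_def)
    from max[OF this] show False using \<open>n \<notin> E\<close> finE by simp
  qed
  then show ?thesis using E finE by blast
qed

lemma parseval:
  assumes "finite E" "orthonormal E" "x = (\<Sum>e\<in>E. cfscale (u e) e)"
  shows "x \<in> U" "Re (b x x) = (\<Sum>e\<in>E. (cmod (u e))\<^sup>2)" "\<And>e. e \<in> E \<Longrightarrow> b x e = u e"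
proof -
  have EU: "E \<subseteq> U" using assms by (simp add: orthonormal_def)
  show xU: "x \<in> U" unfolding assms(3) by (intro cvs.subspace_sum sub U_closed) (use EU in auto)
  show u: "b x e = u e" if e: "e \<in> E" for e
  proof -
    have "b x e = (\<Sum>e'\<in>E. u e' * b e' e)" unfolding assms(3) using EU e by (intro b_sum) auto
    also have "\<dots> = (\<Sum>e'\<in>E. if e = e' then u e' else 0)"
    proof (intro sum.cong refl)
      fix e' assume "e' \<in> E"
      then have "b e' e = (if e' = e then 1 else 0)" using assms(2) e unfolding orthonormal_def by blast
      then show "u e' * b e' e = (if e = e' then u e' else 0)" by simp
    qed
    also have "\<dots> = u e" using assms(1) e by (simp add: sum.delta)
    finally show ?thesis .
  qed
  have "b x x = (\<Sum>e\<in>E. u e * b e x)"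
    using b_sum[of E "\<lambda>e. e" x u] EU xU unfolding assms(3)[symmetric] by blast
  also have "\<dots> = (\<Sum>e\<in>E. of_real ((cmod (u e))\<^sup>2))"
  proof (intro sum.cong refl)
    fix e assume "e \<in> E"
    then have "b e x = cnj (u e)" using b_cnj[of x e] u xU EU by auto
    then show "u e * b e x = of_real ((cmod (u e))\<^sup>2)" unfolding complex_norm_square by simp
  qed
  finally show "Re (b x x) = (\<Sum>e\<in>E. (cmod (u e))\<^sup>2)" by simp
qed

lemma b_nonneg: "x \<in> U \<Longrightarrow> 0 \<le> Re (b x x)"
  using b_pos[of x] b_scale[of 0 0 0] U_closed by (cases "x = 0") (auto simp: cvs.scale_zero_right)

lemma b_complete:
  assumes f: "\<And>n. f n \<in> U"
    and C: "\<And>e. e > 0 \<Longrightarrow> \<exists>N::nat. \<forall>m\<ge>N. \<forall>n\<ge>N. Re (b (f m - f n) (f m - f n)) < e"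
  shows "\<exists>x\<in>U. (\<lambda>n. Re (b (f n - x) (f n - x))) \<longlonglongrightarrow> 0"
proof -
  obtain E where E: "finite E" "orthonormal E" "\<And>x. x \<in> U \<Longrightarrow> x = (\<Sum>e\<in>E. cfscale (b x e) e)"
    using orthonormal_basis_exists by blast
  have EU: "E \<subseteq> U" using E by (simp add: orthonormal_def)
  have sq: "Re (b x x) = (\<Sum>e\<in>E. (cmod (b x e))\<^sup>2)" if "x \<in> U" for x
    by (rule parseval(2)[OF E(1,2) E(3)[OF that]])
  have "Cauchy (\<lambda>n. b (f n) e)" if e: "e \<in> E" for e
  proof (rule metric_CauchyI)
    fix d :: real assume d: "d > 0"
    obtain N where N: "\<forall>m\<ge>N. \<forall>n\<ge>N. Re (b (f m - f n) (f m - f n)) < d\<^sup>2" using C[of "d\<^sup>2"] d by auto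
    have "dist (b (f m) e) (b (f n) e) < d" if mn: "m \<ge> N" "n \<ge> N" for m n
    proof (rule power2_less_imp_less)
      have fU: "f m - f n \<in> U" using f U_closed by blast
      have "(dist (b (f m) e) (b (f n) e))\<^sup>2 = (cmod (b (f m - f n) e))\<^sup>2"
        using b_diff[OF f f, of e m n] e EU by (auto simp: dist_norm)
      also have "\<dots> \<le> (\<Sum>e\<in>E. (cmod (b (f m - f n) e))\<^sup>2)"
        using e E(1) by (intro member_le_sum) auto
      also have "\<dots> < d\<^sup>2" unfolding sq[OF fU, symmetric] using N mn by blast
      finally show "(dist (b (f m) e) (b (f n) e))\<^sup>2 < d\<^sup>2" .
    qed (use d in simp)
    then show "\<exists>M. \<forall>m\<ge>M. \<forall>n\<ge>M. dist (b (f m) e) (b (f n) e) < d" by blast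
  qed
  then have "\<forall>e\<in>E. \<exists>c. (\<lambda>n. b (f n) e) \<longlonglongrightarrow> c"
    using Cauchy_convergent convergent_def by metis
  then obtain c where c: "\<And>e. e \<in> E \<Longrightarrow> (\<lambda>n. b (f n) e) \<longlonglongrightarrow> c e" by metis
  define x where "x = (\<Sum>e\<in>E. cfscale (c e) e)"
  note x = parseval[OF E(1,2) x_def]
  have "(\<lambda>n. \<Sum>e\<in>E. (cmod (b (f n) e - c e))\<^sup>2) \<longlonglongrightarrow> (\<Sum>e\<in>E. (cmod (c e - c e))\<^sup>2)"
    by (intro tendsto_intros c)
  moreover have "Re (b (f n - x) (f n - x)) = (\<Sum>e\<in>E. (cmod (b (f n) e - c e))\<^sup>2)" for n
  proof -
    have "f n - x \<in> U" using f x(1) U_closed by blast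
    moreover have "b (f n - x) e = b (f n) e - c e" if "e \<in> E" for e
      using b_diff[OF f x(1), of e n] x(3)[OF that] that EU by auto
    ultimately show ?thesis using sq[of "f n - x"] by simp
  qed
  ultimately have "(\<lambda>n. Re (b (f n - x) (f n - x))) \<longlonglongrightarrow> 0" by simp
  then show ?thesis using x(1) by blast
qed

lemma linear_form_bound:
  assumes F: "linear_between U U F"
  shows "\<exists>K\<ge>0. \<forall>x\<in>U. cmod (b (F x) x) \<le> K * Re (b x x)"
proof -
  obtain E where E: "finite E" "orthonormal E" "\<And>x. x \<in> U \<Longrightarrow> x = (\<Sum>e\<in>E. cfscale (b x e) e)"
    using orthonormal_basis_exists by blast
  have EU: "E \<subseteq> U" using E by (simp add: orthonormal_def)
  have sq: "Re (b x x) = (\<Sum>e\<in>E. (cmod (b x e))\<^sup>2)" if "x \<in> U" for x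
    by (rule parseval(2)[OF E(1,2) E(3)[OF that]])
  have FU: "F x \<in> U" if "x \<in> U" for x using F that by (auto simp: linear_between_def)
  define M where "M = (\<Sum>e\<in>E. \<Sum>e'\<in>E. cmod (b (F e) e'))"
  have M0: "M \<ge> 0" unfolding M_def by (intro sum_nonneg) auto
  have "cmod (b (F x) x) \<le> M * Re (b x x)" if x: "x \<in> U" for x
  proof -
    have "F x = F (\<Sum>e\<in>E. cfscale (b x e) e)" by (rule arg_cong[OF E(3)[OF x]])
    also have "\<dots> = (\<Sum>e\<in>E. cfscale (b x e) (F e))"
      by (rule linear_sum_cfscale[OF sub linear_between_add[OF F] linear_between_scale[OF F]]) (use EU in blast)+
    finally have Fx: "F x = (\<Sum>e\<in>E. cfscale (b x e) (F e))" .
    have "b (F x) x = (\<Sum>e\<in>E. b x e * b (F e) x)"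
      unfolding Fx using FU EU x by (intro b_sum) auto
    also have "\<dots> = (\<Sum>e\<in>E. \<Sum>e'\<in>E. b x e * (cnj (b x e') * b (F e) e'))"
    proof (intro sum.cong refl)
      fix e assume e: "e \<in> E"
      have "b (F e) x = cnj (b x (F e))" using b_cnj[of x "F e"] x FU e EU by auto
      also have "b x (F e) = (\<Sum>e'\<in>E. b x e' * b e' (F e))"
        using b_sum[of E "\<lambda>e. e" "F e" "b x"] EU FU e unfolding E(3)[OF x, symmetric] by blast
      also have "cnj \<dots> = (\<Sum>e'\<in>E. cnj (b x e') * b (F e) e')"
        unfolding cnj_sum
      proof (intro sum.cong refl)
        fix e' assume "e' \<in> E"
        then have "b e' (F e) = cnj (b (F e) e')" using b_cnj[of "F e" e'] FU e EU by blast
        then show "cnj (b x e' * b e' (F e)) = cnj (b x e') * b (F e) e'" by simp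
      qed
      finally show "b x e * b (F e) x = (\<Sum>e'\<in>E. b x e * (cnj (b x e') * b (F e) e'))"
        by (simp add: sum_distrib_left)
    qed
    also have "cmod \<dots> \<le> (\<Sum>e\<in>E. \<Sum>e'\<in>E. Re (b x x) * cmod (b (F e) e'))"
    proof (intro sum_norm_le)
      fix e e' assume e: "e \<in> E" "e' \<in> E"
      have 1: "(cmod (b x e))\<^sup>2 \<le> Re (b x x)" "(cmod (b x e'))\<^sup>2 \<le> Re (b x x)"
        unfolding sq[OF x] using e E(1) by (auto intro!: member_le_sum)
      have "2 * (cmod (b x e) * cmod (b x e')) \<le> (cmod (b x e))\<^sup>2 + (cmod (b x e'))\<^sup>2"
        using zero_le_power2[of "cmod (b x e) - cmod (b x e')"] by (simp add: power2_diff)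
      then have "cmod (b x e) * cmod (b x e') \<le> Re (b x x)" using 1 by simp
      then show "cmod (b x e * (cnj (b x e') * b (F e) e')) \<le> Re (b x x) * cmod (b (F e) e')"
        by (simp add: norm_mult mult_right_mono flip: mult.assoc)
    qed
    also have "\<dots> = M * Re (b x x)" by (simp add: M_def sum_distrib_left mult.commute)
    finally show ?thesis .
  qed
  then show ?thesis using M0 by blast
qed

end

lemma herm_form_herm_ip:
  assumes "finite J" "cvs.subspace U" "U \<subseteq> coord_space J"
  shows "herm_form J U (herm_ip J)"
proof
  show "0 < Re (herm_ip J x x)" if "x \<in> U" "x \<noteq> 0" for x
    using herm_ip_pos[OF assms(1)] assms(3) that by blast
qed (use assms in \<open>auto simp: herm_ip_add_left herm_ip_scale_left intro: herm_ip_cnj\<close>)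

lemma orth_projector:
  assumes J: "finite J" and U: "cvs.subspace U" "U \<subseteq> coord_space J" and x: "x \<in> coord_space J"
  shows orth_projector_in: "orth_projector J U x \<in> U"
    and orth_projector_diff: "x - orth_projector J U x \<in> orth_compl J U"
    and orth_projector_unique: "\<And>y. y \<in> U \<Longrightarrow> x - y \<in> orth_compl J U \<Longrightarrow> orth_projector J U x = y"
proof -
  interpret herm_form J U "herm_ip J" by (rule herm_form_herm_ip[OF J U])
  obtain E where E: "finite E" "orthonormal E" "\<And>x. x \<in> U \<Longrightarrow> x = (\<Sum>e\<in>E. cfscale (herm_ip J x e) e)"
    using orthonormal_basis_exists by blast
  have EU: "E \<subseteq> U" using E by (simp add: orthonormal_def)
  define y where "y = (\<Sum>e\<in>E. cfscale (herm_ip J x e) e)"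
  note y = parseval[OF E(1,2) y_def]
  have xy: "x - y \<in> coord_space J" using x y(1) U(2) cvs.subspace_diff[OF coord_space_subspace] by blast
  have 0: "herm_ip J (x - y) e = 0" if "e \<in> E" for e using y(3)[OF that] by (simp add: herm_ip_diff_left)
  have "herm_ip J (x - y) z = 0" if z: "z \<in> U" for z
  proof -
    have "herm_ip J z (x - y) = (\<Sum>e\<in>E. herm_ip J z e * herm_ip J e (x - y))"
      using herm_ip_sum_left[of J "herm_ip J z" "\<lambda>e. e" E "x - y"] unfolding E(3)[OF z, symmetric] .
    also have "\<dots> = 0" using 0 herm_ip_cnj[of J _ "x - y"] by (intro sum.neutral) (metis complex_cnj_zero mult_zero_right)
    finally show ?thesis using herm_ip_cnj[of J "x - y" z] by simp
  qed
  then have ex: "y \<in> U \<and> x - y \<in> orth_compl J U" using y(1) xy by (simp add: orth_compl_def)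
  have uniq: "z = w" if z: "z \<in> U \<and> x - z \<in> orth_compl J U" and w: "w \<in> U \<and> x - w \<in> orth_compl J U" for z w
  proof (rule ccontr)
    assume "z \<noteq> w"
    then have "z - w \<noteq> 0" by simp
    moreover have zw: "z - w \<in> U" using z w U_closed by blast
    moreover have "herm_ip J (z - w) (z - w) = herm_ip J (x - w) (z - w) - herm_ip J (x - z) (z - w)"
      by (simp add: herm_ip_diff_left)
    moreover have "\<dots> = 0" using z w zw by (simp add: orth_compl_def)
    ultimately show False using b_pos[of "z - w"] by simp
  qed
  have the: "orth_projector J U x = y"
    unfolding orth_projector_def by (rule the_equality) (use ex uniq in blast)+
  show "orth_projector J U x \<in> U" "x - orth_projector J U x \<in> orth_compl J U" using ex the by auto
  show "orth_projector J U x = z" if "z \<in> U" "x - z \<in> orth_compl J U" for z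
    using the uniq ex that by blast
qed

lemma orth_compl_subspace: "cvs.subspace (orth_compl J U)"
  by (rule cvs.subspaceI)
    (auto simp: orth_compl_def herm_ip_add_left herm_ip_scale_left cvs.subspace_0[OF coord_space_subspace]
      cvs.subspace_add[OF coord_space_subspace] cvs.subspace_scale[OF coord_space_subspace])

lemma orth_projector_add:
  assumes "finite J" "cvs.subspace U" "U \<subseteq> coord_space J" "x \<in> coord_space J" "y \<in> coord_space J"
  shows "orth_projector J U (x + y) = orth_projector J U x + orth_projector J U y"
proof (rule orth_projector_unique[OF assms(1-3)])
  show "x + y \<in> coord_space J" using assms cvs.subspace_add[OF coord_space_subspace] by blast
  show "orth_projector J U x + orth_projector J U y \<in> U"
    using assms by (intro cvs.subspace_add orth_projector_in)
  have "x + y - (orth_projector J U x + orth_projector J U y) = (x - orth_projector J U x) + (y - orth_projector J U y)" by simp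
  also have "\<dots> \<in> orth_compl J U"
    using assms by (intro cvs.subspace_add orth_compl_subspace orth_projector_diff)
  finally show "x + y - (orth_projector J U x + orth_projector J U y) \<in> orth_compl J U" .
qed

lemma orth_projector_scale:
  assumes "finite J" "cvs.subspace U" "U \<subseteq> coord_space J" "x \<in> coord_space J"
  shows "orth_projector J U (cfscale c x) = cfscale c (orth_projector J U x)"
proof (rule orth_projector_unique[OF assms(1-3)])
  show "cfscale c x \<in> coord_space J" using assms cvs.subspace_scale[OF coord_space_subspace] by blast
  show "cfscale c (orth_projector J U x) \<in> U"
    using assms by (intro cvs.subspace_scale orth_projector_in)
  have "cfscale c x - cfscale c (orth_projector J U x) = cfscale c (x - orth_projector J U x)"
    by (simp add: fun_eq_iff right_diff_distrib)
  also have "\<dots> \<in> orth_compl J U"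
    using assms by (intro cvs.subspace_scale orth_compl_subspace orth_projector_diff)
  finally show "cfscale c x - cfscale c (orth_projector J U x) \<in> orth_compl J U" .
qed

lemma orth_projector_ident:
  assumes "finite J" "cvs.subspace U" "U \<subseteq> coord_space J" "x \<in> U"
  shows "orth_projector J U x = x"
  using assms by (intro orth_projector_unique) (auto simp: cvs.subspace_0[OF orth_compl_subspace])

lemma orth_projector_herm_ip:
  assumes "finite J" "cvs.subspace U" "U \<subseteq> coord_space J" "x \<in> coord_space J" "y \<in> U"
  shows "herm_ip J y (orth_projector J U x) = herm_ip J y x"
proof -
  have "herm_ip J (x - orth_projector J U x) y = 0"
    using orth_projector_diff[OF assms(1-4)] assms(5) by (simp add: orth_compl_def)
  then have "herm_ip J y (x - orth_projector J U x) = 0" using herm_ip_cnj[of J y "x - orth_projector J U x"] by simp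
  then show ?thesis by (simp add: herm_ip_diff_right)
qed

text \<open>The adjoint is defined by a description; the expansion in an orthonormal basis shows that the
  described vector exists.\<close>

lemma adjoint_between:
  assumes J: "finite J" and U: "cvs.subspace U" "U \<subseteq> coord_space J" and F: "linear_between U W F"
  shows "adjoint_between J U F y \<in> U"
    "\<And>x. x \<in> U \<Longrightarrow> herm_ip J (F x) y = herm_ip J x (adjoint_between J U F y)"
proof -
  interpret herm_form J U "herm_ip J" by (rule herm_form_herm_ip[OF J U])
  obtain E where E: "finite E" "orthonormal E" "\<And>x. x \<in> U \<Longrightarrow> x = (\<Sum>e\<in>E. cfscale (herm_ip J x e) e)"
    using orthonormal_basis_exists by blast
  have EU: "E \<subseteq> U" using E by (simp add: orthonormal_def)
  define z where "z = (\<Sum>e\<in>E. cfscale (cnj (herm_ip J (F e) y)) e)"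
  note z = parseval[OF E(1,2) z_def]
  have zF: "herm_ip J (F x) y = herm_ip J x z" if x: "x \<in> U" for x
  proof -
    have "F x = F (\<Sum>e\<in>E. cfscale (herm_ip J x e) e)" by (rule arg_cong[OF E(3)[OF x]])
    also have "\<dots> = (\<Sum>e\<in>E. cfscale (herm_ip J x e) (F e))"
      by (rule linear_sum_cfscale[OF sub linear_between_add[OF F] linear_between_scale[OF F]]) (use EU in blast)+
    finally have "herm_ip J (F x) y = (\<Sum>e\<in>E. herm_ip J x e * herm_ip J (F e) y)" by (simp only: herm_ip_sum_left)
    also have "\<dots> = (\<Sum>e\<in>E. herm_ip J x e * herm_ip J e z)"
    proof (intro sum.cong refl)
      fix e assume "e \<in> E"
      then have "herm_ip J z e = cnj (herm_ip J (F e) y)" by (rule z(3))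
      then have "herm_ip J e z = herm_ip J (F e) y" using herm_ip_cnj[of J e z] by simp
      then show "herm_ip J x e * herm_ip J (F e) y = herm_ip J x e * herm_ip J e z" by simp
    qed
    also have "\<dots> = herm_ip J (\<Sum>e\<in>E. cfscale (herm_ip J x e) e) z" by (simp only: herm_ip_sum_left)
    also have "\<dots> = herm_ip J x z" unfolding E(3)[OF x, symmetric] ..
    finally show ?thesis .
  qed
  have "adjoint_between J U F y = z"
    unfolding adjoint_between_def
  proof (rule the_equality)
    show "z \<in> U \<and> (\<forall>x\<in>U. herm_ip J (F x) y = herm_ip J x z)" using z(1) zF by blast
    fix w assume w: "w \<in> U \<and> (\<forall>x\<in>U. herm_ip J (F x) y = herm_ip J x w)"
    show "w = z"
    proof (rule ccontr)
      assume "w \<noteq> z"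
      moreover have wz: "w - z \<in> U" using w z(1) U_closed by blast
      moreover have "herm_ip J (w - z) (w - z) = 0"
        using w zF wz by (simp add: herm_ip_diff_right)
      ultimately show False using b_pos[of "w - z"] by simp
    qed
  qed
  then show "adjoint_between J U F y \<in> U"
    "\<And>x. x \<in> U \<Longrightarrow> herm_ip J (F x) y = herm_ip J x (adjoint_between J U F y)"
    using z(1) zF by auto
qed

text \<open>The part of \<open>y\<close> orthogonal to the range of \<open>F\<close> is in the kernel of the adjoint.\<close>

lemma range_kernel_adjoint_decomposition:
  assumes J: "finite J" and U: "cvs.subspace U" "U \<subseteq> coord_space J"
    and W: "cvs.subspace W" "W \<subseteq> coord_space J" and F: "linear_between U W F" and y: "y \<in> W"
  shows "\<exists>r\<in>F ` U. \<exists>k\<in>W. adjoint_between J U F k = 0 \<and> y = r + k"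
proof -
  have FU: "F x \<in> W" if "x \<in> U" for x using F that by (simp add: linear_between_def)
  have R: "cvs.subspace (F ` U)"
  proof (rule cvs.subspaceI)
    have "F 0 = 0"
      using linear_between_scale[OF F cvs.subspace_0[OF U(1)], of 0] unfolding cvs.scale_zero_left .
    then show "0 \<in> F ` U" using cvs.subspace_0[OF U(1)] by (metis image_eqI)
    show "x + y \<in> F ` U" if x: "x \<in> F ` U" and y: "y \<in> F ` U" for x y
    proof -
      obtain a b where ab: "a \<in> U" "x = F a" "b \<in> U" "y = F b" using x y by (auto elim!: imageE)
      show ?thesis
        unfolding ab(2,4) linear_between_add[OF F ab(1,3), symmetric]
        by (rule imageI) (rule cvs.subspace_add[OF U(1) ab(1,3)])
    qed
    show "cfscale c x \<in> F ` U" if x: "x \<in> F ` U" for c x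
    proof -
      obtain a where a: "a \<in> U" "x = F a" using x by (auto elim!: imageE)
      show ?thesis
        unfolding a(2) linear_between_scale[OF F a(1), symmetric]
        by (rule imageI) (rule cvs.subspace_scale[OF U(1) a(1)])
    qed
  qed
  have RJ: "F ` U \<subseteq> coord_space J" using FU W(2) by blast
  have yJ: "y \<in> coord_space J" using y W by blast
  let ?r = "orth_projector J (F ` U) y"
  have r: "?r \<in> F ` U" and d: "y - ?r \<in> orth_compl J (F ` U)"
    by (rule orth_projector_in[OF J R RJ yJ], rule orth_projector_diff[OF J R RJ yJ])
  have rW: "?r \<in> W" by (rule subsetD[OF image_subsetI r]) (rule FU)
  have k: "y - ?r \<in> W" by (rule cvs.subspace_diff[OF W(1) y rW])
  let ?a = "adjoint_between J U F (y - ?r)"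
  have a: "?a \<in> U" by (rule adjoint_between(1)[OF J U F])
  have e1: "herm_ip J ?a ?a = herm_ip J (F ?a) (y - ?r)" by (rule adjoint_between(2)[OF J U F a, symmetric])
  have "F ?a \<in> F ` U" by (rule imageI[OF a])
  then have e2: "herm_ip J (y - ?r) (F ?a) = 0"
    using d unfolding orth_compl_def by blast
  have "herm_ip J ?a ?a = cnj (herm_ip J (y - ?r) (F ?a))" by (rule trans[OF e1 herm_ip_cnj])
  then have a0: "herm_ip J ?a ?a = 0" unfolding e2 complex_cnj_zero .
  have "?a = 0"
  proof (rule ccontr)
    assume "?a \<noteq> 0"
    then have "0 < Re (herm_ip J ?a ?a)" by (rule herm_ip_pos[OF J subsetD[OF U(2) a]])
    then show False using a0 by simp
  qed
  moreover have "y = ?r + (y - ?r)" by simp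
  ultimately show ?thesis using r k by metis
qed


section \<open>Operations on absolutely continuous functions\<close>

lemma AE_leb_negligible:
  assumes "AE x in leb l. P x"
  shows "negligible {x \<in> {0..l}. \<not> P x}"
proof -
  have "AE x in lebesgue. x \<in> {0<..<l} \<longrightarrow> P x" using assms by (simp add: AE_restrict_space_iff)
  then obtain N where N: "{x \<in> space lebesgue. \<not> (x \<in> {0<..<l} \<longrightarrow> P x)} \<subseteq> N" "emeasure lebesgue N = 0" "N \<in> sets lebesgue"
    by (rule AE_E)
  have "negligible (N \<union> {0, l})"
    using null_setsI[OF N(2,3)] by (intro negligible_Un) (simp_all add: negligible_iff_null_sets)
  moreover have "{x \<in> {0..l}. \<not> P x} \<subseteq> N \<union> {0, l}"
  proof
    fix x assume x: "x \<in> {x \<in> {0..l}. \<not> P x}"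
    show "x \<in> N \<union> {0, l}"
    proof (cases "x = 0 \<or> x = l")
      case False
      then have "x \<in> {x \<in> space lebesgue. \<not> (x \<in> {0<..<l} \<longrightarrow> P x)}" using x by simp
      then show ?thesis using N(1) by blast
    qed auto
  qed
  ultimately show ?thesis by (rule negligible_subset)
qed

lemma primitive_cong_AE:
  assumes "primitive l g h" "g' \<in> borel_measurable (leb l)" "AE x in leb l. g x = g' x"
  shows "primitive l g' h"
  unfolding primitive_def
proof (intro conjI ballI)
  note i = primitive_integrable[OF assms(1)]
  show "integrable (leb l) g'"
    using integrable_cong_AE[OF borel_measurable_integrable[OF i] assms(2,3)] i by simp
  fix x assume x: "x \<in> {0..l}"
  have "integral {0..x} g = integral {0..x} g'"
  proof (rule integral_spike)
    show "negligible {x \<in> {0..l}. \<not> g x = g' x}" by (rule AE_leb_negligible[OF assms(3)])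
    show "g' y = g y" if "y \<in> {0..x} - {x \<in> {0..l}. \<not> g x = g' x}" for y
      using that x by auto
  qed
  then show "h x = h 0 + integral {0..x} g'" using primitive_eq[OF assms(1) x] by simp
qed

lemma primitive_add:
  assumes "primitive l g h" "primitive l g' h'"
  shows "primitive l (\<lambda>x. g x + g' x) (\<lambda>x. h x + h' x)"
  unfolding primitive_def
proof (intro conjI ballI)
  note i = primitive_integrable[OF assms(1)] primitive_integrable[OF assms(2)]
  show "integrable (leb l) (\<lambda>x. g x + g' x)" using i by simp
  fix x assume x: "x \<in> {0..l}"
  have "integral {0..x} (\<lambda>x. g x + g' x) = integral {0..x} g + integral {0..x} g'"
    by (rule Henstock_Kurzweil_Integration.integral_add) (use integrable_leb_sub(1)[OF i(1)] integrable_leb_sub(1)[OF i(2)] x in auto)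
  then show "h x + h' x = h 0 + h' 0 + integral {0..x} (\<lambda>x. g x + g' x)"
    using primitive_eq[OF assms(1) x] primitive_eq[OF assms(2) x] by (simp only: ac_simps)
qed

lemma primitive_cmult:
  assumes "primitive l g h"
  shows "primitive l (\<lambda>x. c * g x) (\<lambda>x. c * h x)"
  unfolding primitive_def
proof (intro conjI ballI)
  note i = primitive_integrable[OF assms(1)]
  show "integrable (leb l) (\<lambda>x. c * g x)" using i by simp
  fix x assume x: "x \<in> {0..l}"
  show "c * h x = c * h 0 + integral {0..x} (\<lambda>x. c * g x)"
    by (subst primitive_eq[OF assms(1) x]) (simp add: distrib_left)
qed

lemma primitive_zero: "primitive l (\<lambda>x. 0) (\<lambda>x. 0)"
  by (simp add: primitive_def)

lemma primitive_sum:
  "(\<And>i. i \<in> I \<Longrightarrow> primitive l (g i) (h i)) \<Longrightarrow> primitive l (\<lambda>x. \<Sum>i\<in>I. g i x) (\<lambda>x. \<Sum>i\<in>I. h i x)"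
  by (induction I rule: infinite_finite_induct) (auto intro: primitive_zero primitive_add)

lemma primitive_cnj:
  assumes "primitive l g h"
  shows "primitive l (\<lambda>x. cnj (g x)) (\<lambda>x. cnj (h x))"
  unfolding primitive_def
proof (intro conjI ballI)
  note i = primitive_integrable[OF assms(1)]
  show "integrable (leb l) (\<lambda>x. cnj (g x))" using i by simp
  fix x assume x: "x \<in> {0..l}"
  have "integral {0..x} (\<lambda>x. cnj (g x)) = cnj (integral {0..x} g)"
    using integral_linear[OF integrable_leb_sub(1)[OF i, of 0 x] bounded_linear_cnj] x by (simp add: o_def)
  then show "cnj (h x) = cnj (h 0) + integral {0..x} (\<lambda>x. cnj (g x))"
    by (subst primitive_eq[OF assms(1) x]) simp
qed

lemma primitive_L2: "primitive l g h \<Longrightarrow> h \<in> L2_space l"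
  by (rule L2_continuous[OF primitive_continuous])

section \<open>Linear differential equations\<close>

lemma integral_exp_scaled:
  fixes \<mu> x :: real
  assumes "\<mu> > 0" "x \<ge> 0"
  shows "((\<lambda>s. exp (\<mu> * s)) has_integral ((exp (\<mu> * x) - 1) / \<mu>)) {0..x}"
proof -
  have "((\<lambda>s. exp (\<mu> * s)) has_integral (exp (\<mu> * x) / \<mu> - exp (\<mu> * 0) / \<mu>)) {0..x}"
    using assms by (intro fundamental_theorem_of_calculus)
      (auto intro!: derivative_eq_intros simp flip: has_real_derivative_iff_has_vector_derivative)
  then show ?thesis by (simp add: diff_divide_distrib)
qed

text \<open>Banach's fixed point theorem for the integral equation, in the norm weighted by \<open>exp (- \<mu> x)\<close> that
  makes the integral operator a contraction on the whole interval at once. The unknown is the weighted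
  function itself: a bounded continuous function of the component index and the position, with the
  discrete topology on the indices, so that a single scalar function encodes the vector. Beyond the
  interval it is continued by its values at the ends.\<close>

lemma linear_ode_bounded:
  fixes A :: "nat \<Rightarrow> nat \<Rightarrow> real \<Rightarrow> complex"
  assumes l: "l > 0"
    and A: "\<And>i j. i < n \<Longrightarrow> j < n \<Longrightarrow> A i j \<in> borel_measurable (leb l)"
    and a: "a \<ge> 0" "\<And>i j x. i < n \<Longrightarrow> j < n \<Longrightarrow> cmod (A i j x) \<le> a"
    and g: "\<And>i. i < n \<Longrightarrow> integrable (leb l) (g i)"
  shows "\<exists>u. \<forall>i<n. primitive l (\<lambda>x. (\<Sum>j<n. A i j x * u j x) + g i x) (u i) \<and> u i 0 = K i"
proof -
  (* the integral operator has norm at most n a / \<mu>, which this choice makes at most 1/2 *)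
  define \<mu> where "\<mu> = 2 * real n * a + 1"
  have \<mu>: "\<mu> > 0" using a by (simp add: \<mu>_def add_nonneg_pos)
  define cl where "cl x = max 0 (min l x)" for x
  have cl: "cl x \<in> {0..l}" for x using l by (auto simp: cl_def)
  have cl_id: "x \<in> {0..l} \<Longrightarrow> cl x = x" for x by (auto simp: cl_def)
  have cl_cont: "continuous_on UNIV cl" unfolding cl_def by (intro continuous_intros)
  let ?e = "\<lambda>x. complex_of_real (exp (\<mu> * x))"
  define q where "q v i s = (\<Sum>j<n. A i j s * (?e s * v (discrete j, s))) + g i s" for v :: "nat discrete \<times> real \<Rightarrow> complex" and i s
  define h where "h v i x = K i + integral {0..x} (q v i)" for v i x
  define \<Phi>0 where "\<Phi>0 v = (\<lambda>(i, x). if of_discrete i < n then complex_of_real (exp (- \<mu> * cl x)) * h v (of_discrete i) (cl x) else 0)" for v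
  have slice: "continuous_on S (\<lambda>x. apply_bcontfun v (j, x))" for v :: "(nat discrete \<times> real) \<Rightarrow>\<^sub>C complex" and j S
    by (intro continuous_on_compose2[OF continuous_on_apply_bcontfun[of UNIV v]] continuous_intros) auto
  have qi: "integrable (leb l) (q (apply_bcontfun v) i)" if i: "i < n" for v i
    unfolding q_def
  proof (intro Bochner_Integration.integrable_add Bochner_Integration.integrable_sum g i)
    fix j assume "j \<in> {..<n}"
    then have j: "j < n" by simp
    have "integrable (leb l) (\<lambda>s. ?e s * apply_bcontfun v (discrete j, s))"
      by (intro integrable_leb_continuous continuous_intros slice)
    then show "integrable (leb l) (\<lambda>s. A i j s * (?e s * apply_bcontfun v (discrete j, s)))"
      by (rule integrable_leb_bounded_mult[OF _ A[OF i j], of _ a]) (use a(2)[OF i j] in simp)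
  qed
  have hprim: "primitive l (q (apply_bcontfun v) i) (h (apply_bcontfun v) i)" if "i < n" for v i
    unfolding primitive_def by (intro conjI qi that ballI) (simp add: h_def)
  have hc: "continuous_on {0..l} (h (apply_bcontfun v) i)" if "i < n" for v i
    by (rule primitive_continuous[OF hprim[OF that]])
  have \<Phi>b: "\<Phi>0 (apply_bcontfun v) \<in> bcontfun" for v
  proof -
    let ?f = "\<Phi>0 (apply_bcontfun v)"
    have c: "continuous_on UNIV (\<lambda>x. ?f (i, x))" for i
    proof (cases "of_discrete i < n")
      case True
      have "continuous_on UNIV (\<lambda>x. h (apply_bcontfun v) (of_discrete i) (cl x))"
        by (rule continuous_on_compose2[OF hc[OF True] cl_cont]) (use cl in auto)
      then have "continuous_on UNIV (\<lambda>x. complex_of_real (exp (- \<mu> * cl x)) * h (apply_bcontfun v) (of_discrete i) (cl x))"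
        by (intro continuous_intros cl_cont)
      then show ?thesis using True by (simp add: \<Phi>0_def)
    qed (simp add: \<Phi>0_def)
    have "\<forall>i. \<exists>B. \<forall>x. norm (?f (i, x)) \<le> B"
    proof
      fix i
      show "\<exists>B. \<forall>x. norm (?f (i, x)) \<le> B"
      proof (cases "of_discrete i < n")
        case True
        obtain B where B: "B > 0" "\<And>x. x \<in> {0..l} \<Longrightarrow> norm (h (apply_bcontfun v) (of_discrete i) x) \<le> B"
          using continuous_interval_bounded[OF hc[OF True]] by blast
        have "norm (?f (i, x)) \<le> 1 * B" for x
          unfolding \<Phi>0_def using True B cl[of x] \<mu>
          by (simp only: prod.case if_True norm_mult norm_of_real)
            (intro mult_mono, auto intro!: B(2) simp: mult_nonneg_nonneg)
        then show ?thesis by blast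
      qed (auto simp: \<Phi>0_def)
    qed
    then obtain B where B: "\<And>i x. norm (?f (i, x)) \<le> B i" by metis
    have "continuous_on (\<Union>i. {i} \<times> UNIV) ?f"
    proof (rule continuous_on_open_UN)
      show "open ({i} \<times> (UNIV :: real set))" for i :: "nat discrete" by (intro open_Times open_discrete) auto
      show "continuous_on ({i} \<times> UNIV) ?f" for i
      proof -
        have "continuous_on ({i} \<times> UNIV) (\<lambda>z. ?f (i, snd z))"
          by (rule continuous_on_compose2[OF c]) (auto intro: continuous_intros)
        then show ?thesis by (rule continuous_on_eq) auto
      qed
    qed
    moreover have "(\<Union>i. {i} \<times> UNIV) = (UNIV :: (nat discrete \<times> real) set)"
    proof (intro equalityI subsetI UNIV_I)
      fix z :: "nat discrete \<times> real"
      have "z \<in> {fst z} \<times> UNIV" by (cases z) simp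
      then show "z \<in> (\<Union>i. {i} \<times> UNIV)" by (rule UN_I[OF UNIV_I])
    qed
    ultimately have "continuous_on UNIV ?f" by (simp only:)
    moreover have "norm (?f z) \<le> (\<Sum>i<n. \<bar>B (discrete i)\<bar>)" for z
    proof (cases "of_discrete (fst z) < n")
      case True
      have "norm (?f z) \<le> \<bar>B (fst z)\<bar>" using B[of "fst z" "snd z"] by simp
      also have "\<dots> = \<bar>B (discrete (of_discrete (fst z)))\<bar>" by (simp only: of_discrete_inverse)
      also have "\<dots> \<le> (\<Sum>i<n. \<bar>B (discrete i)\<bar>)"
        using True by (intro member_le_sum[of "of_discrete (fst z)" "{..<n}" "\<lambda>i. \<bar>B (discrete i)\<bar>"]) auto
      finally show ?thesis .
    next
      case False
      then show ?thesis by (cases z) (simp add: \<Phi>0_def sum_nonneg)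
    qed
    ultimately show ?thesis by (intro bcontfun_normI[where b = "\<Sum>i<n. \<bar>B (discrete i)\<bar>"])
  qed
  define \<Phi> where "\<Phi> v = Bcontfun (\<Phi>0 (apply_bcontfun v))" for v :: "(nat discrete \<times> real) \<Rightarrow>\<^sub>C complex"
  have \<Phi>: "apply_bcontfun (\<Phi> v) = \<Phi>0 (apply_bcontfun v)" for v
    unfolding \<Phi>_def by (rule Bcontfun_inverse[OF \<Phi>b])
  have contr: "dist (\<Phi> v) (\<Phi> w) \<le> 1 / 2 * dist v w" for v w
  proof (rule dist_bound)
    fix z :: "nat discrete \<times> real"
    obtain i x where z: "z = (discrete i, x)" by (cases z) (metis of_discrete_inverse)
    show "dist (apply_bcontfun (\<Phi> v) z) (apply_bcontfun (\<Phi> w) z) \<le> 1 / 2 * dist v w"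
    proof (cases "i < n")
      case True
      define y where "y = cl x"
      have y: "0 \<le> y" "y \<le> l" using cl[of x] by (auto simp: y_def)
      let ?v = "apply_bcontfun v" and ?w = "apply_bcontfun w"
      have int: "q ?v i integrable_on {0..y}" "q ?w i integrable_on {0..y}"
        using integrable_leb_sub(1)[OF qi[OF True]] y by auto
      define C where "C = real n * a * dist v w"
      have C: "C \<ge> 0" using a by (simp add: C_def)
      have E: "((\<lambda>s. C * exp (\<mu> * s)) has_integral (C * ((exp (\<mu> * y) - 1) / \<mu>))) {0..y}"
        by (intro has_integral_mult_right integral_exp_scaled \<mu> y)
      have "cmod (h ?v i y - h ?w i y) = cmod (integral {0..y} (\<lambda>s. q ?v i s - q ?w i s))"
        using int by (simp add: h_def Henstock_Kurzweil_Integration.integral_diff)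
      also have "\<dots> \<le> integral {0..y} (\<lambda>s. C * exp (\<mu> * s))"
      proof (rule Henstock_Kurzweil_Integration.integral_norm_bound_integral)
        show "(\<lambda>s. q ?v i s - q ?w i s) integrable_on {0..y}" using int by (rule integrable_diff)
        show "(\<lambda>s. C * exp (\<mu> * s)) integrable_on {0..y}" using E by blast
        fix s
        have "q ?v i s - q ?w i s = (\<Sum>j<n. A i j s * (?e s * (?v (discrete j, s) - ?w (discrete j, s))))"
          by (simp add: q_def sum_subtractf[symmetric] algebra_simps)
        also have "cmod \<dots> \<le> (\<Sum>j<n. a * (exp (\<mu> * s) * dist v w))"
        proof (intro sum_norm_le)
          fix j assume "j \<in> {..<n}"
          then show "cmod (A i j s * (?e s * (?v (discrete j, s) - ?w (discrete j, s)))) \<le> a * (exp (\<mu> * s) * dist v w)"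
            unfolding norm_mult using a(2)[OF True, of j s] a(1) dist_bounded[of v "(discrete j, s)" w]
            by (intro mult_mono) (auto simp: dist_norm)
        qed
        also have "\<dots> = C * exp (\<mu> * s)" by (simp add: C_def)
        finally show "cmod (q ?v i s - q ?w i s) \<le> C * exp (\<mu> * s)" .
      qed
      also have "\<dots> = C * ((exp (\<mu> * y) - 1) / \<mu>)" using E by (rule integral_unique)
      also have "\<dots> \<le> C * (exp (\<mu> * y) / \<mu>)" using C \<mu> by (intro mult_left_mono divide_right_mono) auto
      finally have hb: "cmod (h ?v i y - h ?w i y) \<le> C * (exp (\<mu> * y) / \<mu>)" .
      have "dist (apply_bcontfun (\<Phi> v) z) (apply_bcontfun (\<Phi> w) z) = cmod (complex_of_real (exp (- \<mu> * y)) * (h ?v i y - h ?w i y))"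
        using True by (simp add: z \<Phi> \<Phi>0_def dist_norm y_def right_diff_distrib discrete_inverse)
      also have "\<dots> = exp (- \<mu> * y) * cmod (h ?v i y - h ?w i y)" by (simp only: norm_mult norm_of_real abs_exp_cancel)
      also have "\<dots> \<le> exp (- \<mu> * y) * (C * (exp (\<mu> * y) / \<mu>))" using hb by (intro mult_left_mono) auto
      also have "\<dots> = C / \<mu>" by (simp add: exp_minus field_simps)
      also have "\<dots> \<le> 1 / 2 * dist v w"
      proof -
        have "2 * C \<le> \<mu> * dist v w" by (simp add: C_def \<mu>_def algebra_simps)
        then show ?thesis using \<mu> by (simp add: field_simps)
      qed
      finally show ?thesis .
    qed (simp add: z \<Phi> \<Phi>0_def discrete_inverse)
  qed
  obtain v where v: "\<Phi> v = v"
    using banach_fix_type[of "1/2" \<Phi>] contr by auto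
  define u where "u i x = ?e x * apply_bcontfun v (discrete i, x)" for i x
  have ue: "u i x = h (apply_bcontfun v) i x" if "i < n" "x \<in> {0..l}" for i x
  proof -
    have "apply_bcontfun v = \<Phi>0 (apply_bcontfun v)" using \<Phi>[of v] unfolding v .
    then have "apply_bcontfun v (discrete i, x) = \<Phi>0 (apply_bcontfun v) (discrete i, x)" by (rule fun_cong)
    also have "\<dots> = complex_of_real (exp (- \<mu> * x)) * h (apply_bcontfun v) i x"
      using that cl_id by (simp add: \<Phi>0_def discrete_inverse)
    finally have "apply_bcontfun v (discrete i, x) = complex_of_real (exp (- \<mu> * x)) * h (apply_bcontfun v) i x" .
    moreover have "?e x * complex_of_real (exp (- \<mu> * x)) = 1" by (simp flip: of_real_mult exp_add)
    ultimately show ?thesis by (simp add: u_def flip: mult.assoc)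
  qed
  have "primitive l (\<lambda>x. (\<Sum>j<n. A i j x * u j x) + g i x) (u i) \<and> u i 0 = K i" if i: "i < n" for i
  proof
    have qu: "q (apply_bcontfun v) i = (\<lambda>x. (\<Sum>j<n. A i j x * u j x) + g i x)" by (simp add: q_def u_def fun_eq_iff)
    have u0: "u i 0 = K i" using ue[OF i, of 0] l by (simp add: h_def)
    then show "u i 0 = K i" .
    show "primitive l (\<lambda>x. (\<Sum>j<n. A i j x * u j x) + g i x) (u i)"
      unfolding primitive_def
    proof (intro conjI ballI)
      show "integrable (leb l) (\<lambda>x. (\<Sum>j<n. A i j x * u j x) + g i x)" using qi[OF i, of v] unfolding qu .
      fix x assume "x \<in> {0..l}"
      then show "u i x = u i 0 + integral {0..x} (\<lambda>x. (\<Sum>j<n. A i j x * u j x) + g i x)"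
        unfolding u0 qu[symmetric] using ue[OF i] by (simp add: h_def)
    qed
  qed
  then show ?thesis by blast
qed

text \<open>Cutting off the coefficients on a null set makes the bound hold everywhere and does not affect the
  integral equation.\<close>

lemma linear_ode:
  fixes A :: "nat \<Rightarrow> nat \<Rightarrow> real \<Rightarrow> complex"
  assumes l: "l > 0"
    and A: "\<And>i j. i < n \<Longrightarrow> j < n \<Longrightarrow> A i j \<in> borel_measurable (leb l)"
    and a: "\<And>i j. i < n \<Longrightarrow> j < n \<Longrightarrow> AE x in leb l. cmod (A i j x) \<le> a"
    and g: "\<And>i. i < n \<Longrightarrow> integrable (leb l) (g i)"
  shows "\<exists>u. \<forall>i<n. primitive l (\<lambda>x. (\<Sum>j<n. A i j x * u j x) + g i x) (u i) \<and> u i 0 = K i"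
proof -
  define A' where "A' i j x = (if cmod (A i j x) \<le> \<bar>a\<bar> then A i j x else 0)" for i j x
  have A': "A' i j \<in> borel_measurable (leb l)" if "i < n" "j < n" for i j
  proof -
    note [measurable] = A[OF that]
    show ?thesis unfolding A'_def[abs_def] by measurable
  qed
  have b': "cmod (A' i j x) \<le> \<bar>a\<bar>" for i j x by (simp add: A'_def)
  have "\<exists>u. \<forall>i<n. primitive l (\<lambda>x. (\<Sum>j<n. A' i j x * u j x) + g i x) (u i) \<and> u i 0 = K i"
    by (rule linear_ode_bounded[where a = "\<bar>a\<bar>"]) (simp_all add: l A' b' g)
  then obtain u where U: "\<forall>i<n. primitive l (\<lambda>x. (\<Sum>j<n. A' i j x * u j x) + g i x) (u i) \<and> u i 0 = K i" ..
  have u: "primitive l (\<lambda>x. (\<Sum>j<n. A' i j x * u j x) + g i x) (u i)" "u i 0 = K i" if "i < n" for i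
    using U[rule_format, OF that] by simp_all
  have um: "u j \<in> borel_measurable (leb l)" if "j < n" for j
    by (rule measurable_leb_continuous[OF primitive_continuous[OF u(1)[OF that]]])
  have "primitive l (\<lambda>x. (\<Sum>j<n. A i j x * u j x) + g i x) (u i)" if i: "i < n" for i
  proof (rule primitive_cong_AE[OF u(1)[OF i]])
    show "(\<lambda>x. (\<Sum>j<n. A i j x * u j x) + g i x) \<in> borel_measurable (leb l)"
      using A[OF i] um g[OF i] by (intro borel_measurable_add borel_measurable_sum borel_measurable_times) auto
    have "AE x in leb l. \<forall>j\<in>{..<n}. cmod (A i j x) \<le> a"
      using a[OF i] by (intro AE_finite_allI) auto
    then show "AE x in leb l. (\<Sum>j<n. A' i j x * u j x) + g i x = (\<Sum>j<n. A i j x * u j x) + g i x"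
    proof eventually_elim
      case (elim x)
      have "A' i j x = A i j x" if "j < n" for j
      proof -
        have "cmod (A i j x) \<le> \<bar>a\<bar>" using elim that abs_ge_self[of a] by (meson lessThan_iff order_trans)
        then show ?thesis by (simp add: A'_def)
      qed
      then show ?case by simp
    qed
  qed
  then show ?thesis using u(2) by blast
qed

section \<open>Continuity of the inverse matrix\<close>

lemma continuous_on_det:
  fixes B :: "real \<Rightarrow> complex mat"
  assumes "\<And>x. x \<in> S \<Longrightarrow> B x \<in> carrier_mat n n"
    and c: "\<And>i j. i < n \<Longrightarrow> j < n \<Longrightarrow> continuous_on S (\<lambda>x. B x $$ (i, j))"
  shows "continuous_on S (\<lambda>x. Determinant.det (B x))"
proof (rule continuous_on_eq)
  show "continuous_on S (\<lambda>x. \<Sum>p\<in>{p. p permutes {0..<n}}. signof p * (\<Prod>i = 0..<n. B x $$ (i, p i)))"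
  proof (intro continuous_on_sum continuous_on_mult continuous_on_const continuous_on_prod)
    fix p i assume "p \<in> {p. p permutes {0..<n}}" "i \<in> {0..<n}"
    then show "continuous_on S (\<lambda>x. B x $$ (i, p i))"
      using permutes_in_image[of p "{0..<n}" i] by (intro c) auto
  qed
  show "(\<Sum>p\<in>{p. p permutes {0..<n}}. signof p * (\<Prod>i = 0..<n. B x $$ (i, p i))) = Determinant.det (B x)" if "x \<in> S" for x
    by (rule Determinant.det_def'[OF assms(1)[OF that], symmetric])
qed

lemma invertible_mat_det_nonzero:
  assumes A: "A \<in> carrier_mat n n" and inv: "invertible_mat (A :: complex mat)"
  shows "Determinant.det A \<noteq> 0"
proof -
  obtain B where B: "A * B = 1\<^sub>m n" "B * A = 1\<^sub>m (dim_row B)"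
    using inv A by (auto simp: invertible_mat_def inverts_mat_def)
  have "dim_col (A * B) = n" "dim_col (B * A) = dim_row B" using B by auto
  then have "B \<in> carrier_mat n n" using A by (auto intro!: carrier_matI)
  then have "Determinant.det A * Determinant.det B = 1" using Determinant.det_mult[OF A, of B] B(1) by simp
  then show ?thesis by auto
qed

text \<open>By Cramer's rule the entries of the inverse are rational in those of the matrix.\<close>

lemma continuous_inverse_mat:
  fixes M :: "real \<Rightarrow> complex mat"
  assumes M: "\<And>x. x \<in> S \<Longrightarrow> M x \<in> carrier_mat n n" "\<And>x. x \<in> S \<Longrightarrow> invertible_mat (M x)"
    and c: "\<And>i j. i < n \<Longrightarrow> j < n \<Longrightarrow> continuous_on S (\<lambda>x. M x $$ (i, j))"
  obtains R :: "nat \<Rightarrow> nat \<Rightarrow> real \<Rightarrow> complex"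
  where "\<And>i j. i < n \<Longrightarrow> j < n \<Longrightarrow> continuous_on S (R i j)"
    and "\<And>i j x. i < n \<Longrightarrow> j < n \<Longrightarrow> x \<in> S \<Longrightarrow> (\<Sum>k<n. M x $$ (i, k) * R k j x) = (if i = j then 1 else 0)"
proof -
  define R where "R i j x = adj_mat (M x) $$ (i, j) / Determinant.det (M x)" for i j x
  have d: "Determinant.det (M x) \<noteq> 0" if "x \<in> S" for x
    by (rule invertible_mat_det_nonzero[OF M(1)[OF that] M(2)[OF that]])
  note a = adj_mat[OF M(1)]
  have 1: "continuous_on S (R i j)" if ij: "i < n" "j < n" for i j
  proof -
    have "continuous_on S (\<lambda>x. Determinant.det (mat_delete (M x) j i))"
    proof (rule continuous_on_det)
      show "mat_delete (M x) j i \<in> carrier_mat (n - 1) (n - 1)" if "x \<in> S" for x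
        by (rule mat_delete_carrier[OF M(1)[OF that]])
      fix k k' assume k: "k < n - 1" "k' < n - 1"
      let ?k = "if k < j then k else Suc k" and ?k' = "if k' < i then k' else Suc k'"
      have "continuous_on S (\<lambda>x. M x $$ (?k, ?k'))" using k by (intro c) auto
      moreover have "M x $$ (?k, ?k') = mat_delete (M x) j i $$ (k, k')" if "x \<in> S" for x
        using k M(1)[OF that] by (simp add: mat_delete_def)
      ultimately show "continuous_on S (\<lambda>x. mat_delete (M x) j i $$ (k, k'))"
        by (rule continuous_on_eq)
    qed
    then have "continuous_on S (\<lambda>x. (-1) ^ (j + i) * Determinant.det (mat_delete (M x) j i) / Determinant.det (M x))"
      using d by (intro continuous_intros continuous_on_det[OF M(1) c]) auto
    then show ?thesis
    proof (rule continuous_on_eq)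
      fix x assume "x \<in> S"
      then show "(-1) ^ (j + i) * Determinant.det (mat_delete (M x) j i) / Determinant.det (M x) = R i j x"
        using M(1)[of x] ij by (simp add: R_def adj_mat_def cofactor_def)
    qed
  qed
  have 2: "(\<Sum>k<n. M x $$ (i, k) * R k j x) = (if i = j then 1 else 0)" if "i < n" "j < n" "x \<in> S" for i j x
  proof -
    have "(M x * adj_mat (M x)) $$ (i, j) = (\<Sum>k<n. M x $$ (i, k) * adj_mat (M x) $$ (k, j))"
      using that M(1)[OF that(3)] a(1)[OF that(3)] by (auto simp: scalar_prod_def lessThan_atLeast0)
    then have "(\<Sum>k<n. M x $$ (i, k) * adj_mat (M x) $$ (k, j)) = (Determinant.det (M x) \<cdot>\<^sub>m 1\<^sub>m n) $$ (i, j)"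
      by (simp only: a(2)[OF that(3)])
    also have "\<dots> = (if i = j then Determinant.det (M x) else 0)" using that by simp
    finally have "(\<Sum>k<n. M x $$ (i, k) * adj_mat (M x) $$ (k, j)) = (if i = j then Determinant.det (M x) else 0)" .
    then show ?thesis unfolding R_def times_divide_eq_right times_divide_eq_left sum_divide_distrib[symmetric]
      using d[OF that(3)] by simp
  qed
  show thesis by (rule that[of R]) (fact 1 2)+
qed


section \<open>The energy space of a network\<close>

lemma L2_plus: "f \<in> L2_space l \<Longrightarrow> g \<in> L2_space l \<Longrightarrow> f + g \<in> L2_space l"
  and L2_minus: "f \<in> L2_space l \<Longrightarrow> g \<in> L2_space l \<Longrightarrow> f - g \<in> L2_space l"
  unfolding plus_fun_def fun_diff_def by (rule L2_add L2_diff; assumption)+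

lemma matrix_form_bound:
  fixes a :: "nat \<Rightarrow> nat \<Rightarrow> complex" and \<xi> :: "nat \<Rightarrow> complex"
  assumes K: "\<And>i j. i < n \<Longrightarrow> j < n \<Longrightarrow> cmod (a i j) \<le> K" and "K \<ge> 0"
  shows "cmod (\<Sum>i<n. (\<Sum>j<n. a i j * \<xi> j) * cnj (\<xi> i)) \<le> K * real n * (\<Sum>i<n. (cmod (\<xi> i))\<^sup>2)"
proof -
  have "cmod (\<Sum>i<n. (\<Sum>j<n. a i j * \<xi> j) * cnj (\<xi> i)) \<le> (\<Sum>i<n. \<Sum>j<n. K * (((cmod (\<xi> j))\<^sup>2 + (cmod (\<xi> i))\<^sup>2) / 2))"
    unfolding sum_distrib_right
  proof (intro sum_norm_le)
    fix i j assume "i \<in> {..<n}" "j \<in> {..<n}"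
    then have "cmod (a i j) \<le> K" using K by simp
    moreover have "cmod (\<xi> j) * cmod (\<xi> i) \<le> ((cmod (\<xi> j))\<^sup>2 + (cmod (\<xi> i))\<^sup>2) / 2"
      using two_mult_le_squares[of "cmod (\<xi> j)" "cmod (\<xi> i)"] by simp
    ultimately have "cmod (a i j) * (cmod (\<xi> j) * cmod (\<xi> i)) \<le> K * (((cmod (\<xi> j))\<^sup>2 + (cmod (\<xi> i))\<^sup>2) / 2)"
      using assms(2) by (intro mult_mono) auto
    then show "cmod (a i j * \<xi> j * cnj (\<xi> i)) \<le> K * (((cmod (\<xi> j))\<^sup>2 + (cmod (\<xi> i))\<^sup>2) / 2)"
      by (simp only: norm_mult complex_mod_cnj mult.assoc)
  qed
  also have "\<dots> = K * ((\<Sum>i<n. \<Sum>j<n. (cmod (\<xi> j))\<^sup>2) + (\<Sum>i<n. \<Sum>j<n. (cmod (\<xi> i))\<^sup>2)) / 2"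
    by (simp only: sum_distrib_left[symmetric] sum_divide_distrib[symmetric] sum.distrib times_divide_eq_right)
  also have "\<dots> = K * real n * (\<Sum>i<n. (cmod (\<xi> i))\<^sup>2)"
    by (simp add: sum_distrib_left[symmetric])
  finally show ?thesis .
qed

text \<open>Used to choose one constant for all edges, vertices or matrix entries.\<close>

lemma finite_uniform_bound:
  fixes P :: "'i \<Rightarrow> real \<Rightarrow> bool"
  assumes "finite I" "\<And>i. i \<in> I \<Longrightarrow> \<exists>K. P i K" and mono: "\<And>i K K'. i \<in> I \<Longrightarrow> P i K \<Longrightarrow> K \<le> K' \<Longrightarrow> P i K'"
  shows "\<exists>K\<ge>0. \<forall>i\<in>I. P i K"
proof -
  obtain k where k: "\<And>i. i \<in> I \<Longrightarrow> P i (k i)" using assms(2) by metis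
  have "P i (\<Sum>i\<in>I. \<bar>k i\<bar>)" if i: "i \<in> I" for i
  proof (rule mono[OF i k[OF i]])
    have "\<bar>k i\<bar> \<le> (\<Sum>i\<in>I. \<bar>k i\<bar>)" using assms(1) i by (intro member_le_sum) auto
    then show "k i \<le> (\<Sum>i\<in>I. \<bar>k i\<bar>)" by linarith
  qed
  then show ?thesis by (intro exI[of _ "\<Sum>i\<in>I. \<bar>k i\<bar>"]) (auto intro: sum_nonneg)
qed

lemma mat_adjoint_index:
  fixes A :: "complex mat"
  assumes "A \<in> carrier_mat n n" "i < n" "j < n"
  shows "mat_adjoint A $$ (i, j) = cnj (A $$ (j, i))"
  using assms unfolding mat_adjoint_def by (simp add: mat_of_rows_def conjugate_complex_def)

lemma vector_space_scale_d: "vector_space (scale_d :: complex \<Rightarrow> ('v, 'e) net_state \<Rightarrow> ('v, 'e) net_state)"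
  by unfold_locales (auto simp: scale_d_def fun_eq_iff algebra_simps)

lemma fst_scale_d: "fst (scale_d c z) j = (\<lambda>t. c * fst z j t)"
  and snd_scale_d: "snd (scale_d c z) v = cfscale c (snd z v)"
  by (simp_all add: scale_d_def split_beta cfscale_def)

context hyperbolic_network
begin

interpretation digraph: fin_digraph "net_graph S" by (rule finite_graph)
interpretation digraph: loopfree_digraph "net_graph S" by (rule no_loops)

lemma finite_E: "finite (net_E S)" and finite_V: "finite (net_V S)" by auto

lemma ends_in_V: "e \<in> net_E S \<Longrightarrow> tail (net_graph S) e \<in> net_V S" "e \<in> net_E S \<Longrightarrow> head (net_graph S) e \<in> net_V S"
  by auto

lemma ends_distinct: "e \<in> net_E S \<Longrightarrow> tail (net_graph S) e \<noteq> head (net_graph S) e"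
  by (rule digraph.no_loops)

lemma finite_all_idx: "finite (all_idx S)"
  unfolding all_idx_def by (intro finite_SigmaI finite_E) auto

lemma finite_vert_idx: "finite (vert_idx S v)"
  unfolding vert_idx_def incident_def using finite_E by (intro finite_SigmaI) auto

lemma all_idx_iff: "(e, i) \<in> all_idx S \<longleftrightarrow> e \<in> net_E S \<and> i < edge_dim S e"
  by (simp add: all_idx_def)

lemma M_continuous: "e \<in> net_E S \<Longrightarrow> i < edge_dim S e \<Longrightarrow> j < edge_dim S e \<Longrightarrow>
    continuous_on {0..edge_length S e} (\<lambda>x. coef_M S e x $$ (i, j))"
  using M_lipschitz lipschitz_on_continuous_on by blast

lemma Q_continuous: "e \<in> net_E S \<Longrightarrow> i < edge_dim S e \<Longrightarrow> j < edge_dim S e \<Longrightarrow>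
    continuous_on {0..edge_length S e} (\<lambda>x. coef_Q S e x $$ (i, j))"
  using Q_lipschitz lipschitz_on_continuous_on by blast

lemma uniform_entry_bound:
  fixes P :: "'e \<Rightarrow> nat \<Rightarrow> nat \<Rightarrow> real \<Rightarrow> bool"
  assumes "\<And>e i j. e \<in> net_E S \<Longrightarrow> i < edge_dim S e \<Longrightarrow> j < edge_dim S e \<Longrightarrow> \<exists>K. P e i j K"
    and mono: "\<And>e i j K K'. P e i j K \<Longrightarrow> K \<le> K' \<Longrightarrow> P e i j K'"
  shows "\<exists>K\<ge>0. \<forall>e\<in>net_E S. \<forall>i<edge_dim S e. \<forall>j<edge_dim S e. P e i j K"
proof -
  let ?I = "SIGMA e:net_E S. {..<edge_dim S e} \<times> {..<edge_dim S e}"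
  have "\<exists>K\<ge>0. \<forall>z\<in>?I. P (fst z) (fst (snd z)) (snd (snd z)) K"
  proof (rule finite_uniform_bound)
    show "finite ?I" using finite_E by auto
    show "\<exists>K. P (fst z) (fst (snd z)) (snd (snd z)) K" if "z \<in> ?I" for z
      using assms(1)[of "fst z" "fst (snd z)" "snd (snd z)"] that by (cases z) simp
  qed (rule mono)
  then obtain K where K: "K \<ge> 0" "\<And>z. z \<in> ?I \<Longrightarrow> P (fst z) (fst (snd z)) (snd (snd z)) K" by blast
  have "P e i j K" if "e \<in> net_E S" "i < edge_dim S e" "j < edge_dim S e" for e i j
    using K(2)[of "(e, i, j)"] that by simp
  then show ?thesis using K(1) by blast
qed

lemma Q_bounded:
  "\<exists>K\<ge>0. \<forall>e\<in>net_E S. \<forall>i<edge_dim S e. \<forall>j<edge_dim S e. \<forall>x\<in>{0..edge_length S e}. cmod (coef_Q S e x $$ (i, j)) \<le> K"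
proof (rule uniform_entry_bound)
  fix e i j assume "e \<in> net_E S" "i < edge_dim S e" "j < edge_dim S e"
  from continuous_interval_bounded[OF Q_continuous[OF this]]
  show "\<exists>K. \<forall>x\<in>{0..edge_length S e}. cmod (coef_Q S e x $$ (i, j)) \<le> K" by metis
qed (auto intro: order_trans)

definition qform :: "'e \<Rightarrow> real \<Rightarrow> (nat \<Rightarrow> complex) \<Rightarrow> (nat \<Rightarrow> complex) \<Rightarrow> complex" where
  "qform e t \<xi> \<eta> = (\<Sum>i<edge_dim S e. (\<Sum>j<edge_dim S e. coef_Q S e t $$ (i, j) * \<xi> j) * cnj (\<eta> i))"

lemma qform_add: "qform e t (\<lambda>j. \<xi> j + \<xi>' j) \<eta> = qform e t \<xi> \<eta> + qform e t \<xi>' \<eta>"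
  and qform_scale: "qform e t (\<lambda>j. c * \<xi> j) \<eta> = c * qform e t \<xi> \<eta>"
  by (simp_all add: qform_def algebra_simps sum.distrib sum_distrib_left)

lemma qform_herm:
  assumes e: "e \<in> net_E S" and t: "t \<in> {0..edge_length S e}"
  shows "qform e t \<eta> \<xi> = cnj (qform e t \<xi> \<eta>)"
proof -
  have Q: "cnj (coef_Q S e t $$ (i, j)) = coef_Q S e t $$ (j, i)" if "i < edge_dim S e" "j < edge_dim S e" for i j
    using mat_adjoint_index[OF Q_carrier[OF e t] that(2,1)] Q_hermitian[OF e t] by simp
  have "cnj (qform e t \<xi> \<eta>) = (\<Sum>i<edge_dim S e. \<Sum>j<edge_dim S e. coef_Q S e t $$ (j, i) * \<eta> i * cnj (\<xi> j))"
    unfolding qform_def sum_distrib_right cnj_sum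
  proof (intro sum.cong refl)
    fix i j assume "i \<in> {..<edge_dim S e}" "j \<in> {..<edge_dim S e}"
    then show "cnj (coef_Q S e t $$ (i, j) * \<xi> j * cnj (\<eta> i)) = coef_Q S e t $$ (j, i) * \<eta> i * cnj (\<xi> j)"
      using Q[of i j] by simp
  qed
  also have "\<dots> = (\<Sum>j<edge_dim S e. \<Sum>i<edge_dim S e. coef_Q S e t $$ (j, i) * \<eta> i * cnj (\<xi> j))"
    by (rule sum.swap)
  also have "\<dots> = qform e t \<eta> \<xi>" by (simp add: qform_def sum_distrib_right)
  finally show ?thesis by simp
qed

text \<open>The smallest of finitely many coercivity constants; passing to their inverses makes it an instance of
  \<open>finite_uniform_bound\<close>.\<close>

lemma qform_lower: "\<exists>q>0. \<forall>e\<in>net_E S. \<forall>t\<in>{0..edge_length S e}. \<forall>\<xi>. q * (\<Sum>i<edge_dim S e. (cmod (\<xi> i))\<^sup>2) \<le> Re (qform e t \<xi> \<xi>)"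
proof -
  have "\<exists>K\<ge>0. \<forall>e\<in>net_E S. \<forall>t\<in>{0..edge_length S e}. \<forall>\<xi>. (\<Sum>i<edge_dim S e. (cmod (\<xi> i))\<^sup>2) \<le> K * Re (qform e t \<xi> \<xi>) \<and> 0 \<le> Re (qform e t \<xi> \<xi>)"
  proof (rule finite_uniform_bound[OF finite_E])
    fix e assume e: "e \<in> net_E S"
    obtain q where q: "q > 0" "\<And>x \<xi>. x \<in> {0..edge_length S e} \<Longrightarrow> \<xi> \<in> carrier_vec (edge_dim S e) \<Longrightarrow>
            Re ((coef_Q S e x *\<^sub>v \<xi>) \<bullet>c \<xi>) \<ge> q * Re (\<xi> \<bullet>c \<xi>)"
      using Q_coercive[OF e] by blast
    have main: "q * (\<Sum>i<edge_dim S e. (cmod (\<xi> i))\<^sup>2) \<le> Re (qform e t \<xi> \<xi>)" if t: "t \<in> {0..edge_length S e}" for t \<xi>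
    proof -
      let ?n = "edge_dim S e" let ?x = "vec ?n \<xi>"
      note Q = Q_carrier[OF e t]
      have 1: "(coef_Q S e t *\<^sub>v ?x) \<bullet>c ?x = qform e t \<xi> \<xi>"
        using Q by (simp add: qform_def scalar_prod_def lessThan_atLeast0)
      have 2: "?x \<bullet>c ?x = of_real (\<Sum>i<?n. (cmod (\<xi> i))\<^sup>2)"
        unfolding of_real_sum complex_norm_square by (simp add: scalar_prod_def lessThan_atLeast0)
      show ?thesis using q(2)[OF t, of ?x] unfolding 1 2 by simp
    qed
    have "(\<Sum>i<edge_dim S e. (cmod (\<xi> i))\<^sup>2) \<le> (1 / q) * Re (qform e t \<xi> \<xi>) \<and> 0 \<le> Re (qform e t \<xi> \<xi>)" if "t \<in> {0..edge_length S e}" for t \<xi>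
    proof
      show "(\<Sum>i<edge_dim S e. (cmod (\<xi> i))\<^sup>2) \<le> (1 / q) * Re (qform e t \<xi> \<xi>)"
        using main[OF that, of \<xi>] q(1) by (simp add: field_simps)
      have "0 \<le> q * (\<Sum>i<edge_dim S e. (cmod (\<xi> i))\<^sup>2)" using q(1) by (intro mult_nonneg_nonneg sum_nonneg) auto
      then show "0 \<le> Re (qform e t \<xi> \<xi>)" using main[OF that, of \<xi>] by linarith
    qed
    then show "\<exists>K. \<forall>t\<in>{0..edge_length S e}. \<forall>\<xi>. (\<Sum>i<edge_dim S e. (cmod (\<xi> i))\<^sup>2) \<le> K * Re (qform e t \<xi> \<xi>) \<and> 0 \<le> Re (qform e t \<xi> \<xi>)"
      by blast
  next
    fix e K K' assume "\<forall>t\<in>{0..edge_length S e}. \<forall>\<xi>. (\<Sum>i<edge_dim S e. (cmod (\<xi> i))\<^sup>2) \<le> K * Re (qform e t \<xi> \<xi>) \<and> 0 \<le> Re (qform e t \<xi> \<xi>)"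
      and "K \<le> (K' :: real)"
    then show "\<forall>t\<in>{0..edge_length S e}. \<forall>\<xi>. (\<Sum>i<edge_dim S e. (cmod (\<xi> i))\<^sup>2) \<le> K' * Re (qform e t \<xi> \<xi>) \<and> 0 \<le> Re (qform e t \<xi> \<xi>)"
      by (meson mult_right_mono order_trans)
  qed
  then obtain K where K: "K \<ge> 0" "\<And>e t \<xi>. e \<in> net_E S \<Longrightarrow> t \<in> {0..edge_length S e} \<Longrightarrow>
      (\<Sum>i<edge_dim S e. (cmod (\<xi> i))\<^sup>2) \<le> K * Re (qform e t \<xi> \<xi>) \<and> 0 \<le> Re (qform e t \<xi> \<xi>)" by blast
  show ?thesis
  proof (intro exI[of _ "1 / (K + 1)"] conjI ballI allI)
    show "0 < 1 / (K + 1)" using K by simp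
    fix e t \<xi> assume "e \<in> net_E S" "t \<in> {0..edge_length S e}"
    from K(2)[OF this, of \<xi>] have "(\<Sum>i<edge_dim S e. (cmod (\<xi> i))\<^sup>2) \<le> (K + 1) * Re (qform e t \<xi> \<xi>)"
      by (simp add: distrib_right)
    then show "1 / (K + 1) * (\<Sum>i<edge_dim S e. (cmod (\<xi> i))\<^sup>2) \<le> Re (qform e t \<xi> \<xi>)"
      using K(1) by (simp add: field_simps)
  qed
qed

lemma qform_upper: "\<exists>K\<ge>0. \<forall>e\<in>net_E S. \<forall>t\<in>{0..edge_length S e}. \<forall>\<xi>. Re (qform e t \<xi> \<xi>) \<le> K * (\<Sum>i<edge_dim S e. (cmod (\<xi> i))\<^sup>2)"
proof -
  obtain K where K: "K \<ge> 0" "\<And>e i j x. e \<in> net_E S \<Longrightarrow> i < edge_dim S e \<Longrightarrow> j < edge_dim S e \<Longrightarrow> x \<in> {0..edge_length S e} \<Longrightarrow> cmod (coef_Q S e x $$ (i, j)) \<le> K"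
    using Q_bounded by blast
  have "\<exists>K\<ge>0. \<forall>e\<in>net_E S. \<forall>t\<in>{0..edge_length S e}. \<forall>\<xi>. Re (qform e t \<xi> \<xi>) \<le> K * (\<Sum>i<edge_dim S e. (cmod (\<xi> i))\<^sup>2)"
  proof (rule finite_uniform_bound[OF finite_E])
    fix e assume e: "e \<in> net_E S"
    have "Re (qform e t \<xi> \<xi>) \<le> K * real (edge_dim S e) * (\<Sum>i<edge_dim S e. (cmod (\<xi> i))\<^sup>2)" if t: "t \<in> {0..edge_length S e}" for t \<xi>
      using complex_Re_le_cmod[of "qform e t \<xi> \<xi>"] unfolding qform_def
      by (rule order_trans) (rule matrix_form_bound[OF K(2)[OF e _ _ t] K(1)])
    then show "\<exists>K. \<forall>t\<in>{0..edge_length S e}. \<forall>\<xi>. Re (qform e t \<xi> \<xi>) \<le> K * (\<Sum>i<edge_dim S e. (cmod (\<xi> i))\<^sup>2)" by blast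
  next
    fix e K K' assume "\<forall>t\<in>{0..edge_length S e}. \<forall>\<xi>. Re (qform e t \<xi> \<xi>) \<le> K * (\<Sum>i<edge_dim S e. (cmod (\<xi> i))\<^sup>2)"
      and "K \<le> (K' :: real)"
    then show "\<forall>t\<in>{0..edge_length S e}. \<forall>\<xi>. Re (qform e t \<xi> \<xi>) \<le> K' * (\<Sum>i<edge_dim S e. (cmod (\<xi> i))\<^sup>2)"
      by (meson mult_right_mono order_trans sum_nonneg zero_le_power2)
  qed
  then show ?thesis .
qed

lemma Q_mult_L2:
  assumes e: "e \<in> net_E S" "i < edge_dim S e" "j < edge_dim S e" and f: "f \<in> L2_space (edge_length S e)"
  shows "(\<lambda>t. coef_Q S e t $$ (i, j) * f t) \<in> L2_space (edge_length S e)"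
proof -
  obtain K where "\<And>x. x \<in> {0..edge_length S e} \<Longrightarrow> norm (coef_Q S e x $$ (i, j)) \<le> K"
    using continuous_interval_bounded[OF Q_continuous[OF e]] by blast
  then show ?thesis
    by (intro L2_bounded_mult[OF f measurable_leb_continuous[OF Q_continuous[OF e]], of K] AE_I2) auto
qed

lemma qform_integrable:
  assumes e: "e \<in> net_E S" and u: "\<And>i. i < edge_dim S e \<Longrightarrow> u i \<in> L2_space (edge_length S e)"
    and w: "\<And>i. i < edge_dim S e \<Longrightarrow> w i \<in> L2_space (edge_length S e)"
  shows "integrable (leb (edge_length S e)) (\<lambda>t. qform e t (\<lambda>j. u j t) (\<lambda>i. w i t))"
  unfolding qform_def
proof (rule Bochner_Integration.integrable_sum)
  fix i assume "i \<in> {..<edge_dim S e}"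
  then have i: "i < edge_dim S e" by simp
  have "(\<lambda>t. \<Sum>j<edge_dim S e. coef_Q S e t $$ (i, j) * u j t) \<in> L2_space (edge_length S e)"
    by (intro L2_sum Q_mult_L2 e i u) auto
  then show "integrable (leb (edge_length S e)) (\<lambda>t. (\<Sum>j<edge_dim S e. coef_Q S e t $$ (i, j) * u j t) * cnj (w i t))"
    by (rule L2_mult_integrable) (intro L2_cnj w i)
qed

text \<open>The inner product of \<open>Y_v^(d)\<close> in the energy space.\<close>

definition vb :: "'v \<Rightarrow> ('e \<times> nat \<Rightarrow> complex) \<Rightarrow> ('e \<times> nat \<Rightarrow> complex) \<Rightarrow> complex" where
  "vb v x y = vert_ip S v (vert_Q S v x) y"

lemma Y_sub: "v \<in> net_V S \<Longrightarrow> cvs.subspace (vert_Y S v)" and Y_coord: "v \<in> net_V S \<Longrightarrow> vert_Y S v \<subseteq> coord_space (vert_idx S v)"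
  and Yd_sub: "v \<in> net_V S \<Longrightarrow> cvs.subspace (vert_Yd S v)" and Yd_Y: "v \<in> net_V S \<Longrightarrow> vert_Yd S v \<subseteq> vert_Y S v"
  using Y_subspace Yd_subspace by auto

lemma Yd_coord: "v \<in> net_V S \<Longrightarrow> vert_Yd S v \<subseteq> coord_space (vert_idx S v)"
  using Y_coord Yd_Y by blast

lemma vb_herm_form: "v \<in> net_V S \<Longrightarrow> herm_form (vert_idx S v) (vert_Yd S v) (vb v)"
proof
  assume v: "v \<in> net_V S"
  note Q = Qv_linear[OF v]
  show "finite (vert_idx S v)" by (rule finite_vert_idx)
  show "cvs.subspace (vert_Yd S v)" by (rule Yd_sub[OF v])
  show "vert_Yd S v \<subseteq> coord_space (vert_idx S v)" by (rule Yd_coord[OF v])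
  fix x assume x: "x \<in> vert_Yd S v"
  show "0 < Re (vb v x x)" if "x \<noteq> 0" unfolding vb_def by (rule Qv_pos_def[OF v x that])
  fix z assume z: "z \<in> vert_Yd S v"
  show "vb v (cfscale c x) z = c * vb v x z" for c
    unfolding vb_def linear_between_scale[OF Q x] herm_ip_scale_left ..
  show "vb v z x = cnj (vb v x z)"
    unfolding vb_def Qv_hermitian[OF v z x] by (rule herm_ip_cnj)
  show "vb v (x + z) y = vb v x y + vb v z y" for y
    unfolding vb_def linear_between_add[OF Q x z] herm_ip_add_left ..
qed

lemma L2d_fst: "z \<in> L2d S \<Longrightarrow> e \<in> net_E S \<Longrightarrow> i < edge_dim S e \<Longrightarrow> fst z (e, i) \<in> L2_space (edge_length S e)"
  and L2d_snd: "z \<in> L2d S \<Longrightarrow> v \<in> net_V S \<Longrightarrow> snd z v \<in> vert_Yd S v"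
  by (auto simp: L2d_def all_idx_def split_beta)

lemma L2dI: "(\<And>e i. e \<in> net_E S \<Longrightarrow> i < edge_dim S e \<Longrightarrow> fst z (e, i) \<in> L2_space (edge_length S e)) \<Longrightarrow>
    (\<And>v. v \<in> net_V S \<Longrightarrow> snd z v \<in> vert_Yd S v) \<Longrightarrow> z \<in> L2d S"
  by (cases z) (auto simp: L2d_def all_idx_def)

lemma L2d_add: "z \<in> L2d S \<Longrightarrow> z' \<in> L2d S \<Longrightarrow> z + z' \<in> L2d S"
  by (rule L2dI) (auto intro!: L2_plus cvs.subspace_add Yd_sub dest: L2d_fst L2d_snd)

lemma L2d_scale: "z \<in> L2d S \<Longrightarrow> scale_d c z \<in> L2d S"
  by (rule L2dI) (auto simp: fst_scale_d snd_scale_d intro!: L2_cmult cvs.subspace_scale Yd_sub dest: L2d_fst L2d_snd)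

lemma L2d_zero: "0 \<in> L2d S"
  by (rule L2dI) (auto simp: zero_fun_def[symmetric] intro!: cvs.subspace_0 Yd_sub L2_zero[unfolded zero_fun_def[symmetric]])

lemma ip_d_eq: "ip_d S z w = (\<Sum>e\<in>net_E S. LINT t|leb (edge_length S e). qform e t (\<lambda>j. fst z (e, j) t) (\<lambda>i. fst w (e, i) t))
    + (\<Sum>v\<in>net_V S. vb v (snd z v) (snd w v))"
  by (simp add: ip_d_def split_beta qform_def vb_def)

lemma qform_L2d_integrable:
  "z \<in> L2d S \<Longrightarrow> w \<in> L2d S \<Longrightarrow> e \<in> net_E S \<Longrightarrow>
   integrable (leb (edge_length S e)) (\<lambda>t. qform e t (\<lambda>j. fst z (e, j) t) (\<lambda>i. fst w (e, i) t))"
  by (intro qform_integrable L2d_fst)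

lemma ip_d_add:
  assumes "z \<in> L2d S" "z' \<in> L2d S" "w \<in> L2d S"
  shows "ip_d S (z + z') w = ip_d S z w + ip_d S z' w"
proof -
  have "(LINT t|leb (edge_length S e). qform e t (\<lambda>j. fst (z + z') (e, j) t) (\<lambda>i. fst w (e, i) t))
     = (LINT t|leb (edge_length S e). qform e t (\<lambda>j. fst z (e, j) t) (\<lambda>i. fst w (e, i) t))
     + (LINT t|leb (edge_length S e). qform e t (\<lambda>j. fst z' (e, j) t) (\<lambda>i. fst w (e, i) t))" if e: "e \<in> net_E S" for e
    using qform_L2d_integrable[OF assms(1,3) e] qform_L2d_integrable[OF assms(2,3) e]
    by (simp add: qform_add)
  moreover have "vb v (snd (z + z') v) (snd w v) = vb v (snd z v) (snd w v) + vb v (snd z' v) (snd w v)" if v: "v \<in> net_V S" for v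
    using herm_form.b_add[OF vb_herm_form[OF v] L2d_snd[OF assms(1) v] L2d_snd[OF assms(2) v] L2d_snd[OF assms(3) v]]
    by (simp only: snd_add plus_fun_apply)
  ultimately show ?thesis unfolding ip_d_eq
    by (simp add: sum.distrib algebra_simps del: fst_add snd_add)
qed

lemma ip_d_scale:
  assumes "z \<in> L2d S" "w \<in> L2d S"
  shows "ip_d S (scale_d c z) w = c * ip_d S z w"
proof -
  have "(LINT t|leb (edge_length S e). qform e t (\<lambda>j. fst (scale_d c z) (e, j) t) (\<lambda>i. fst w (e, i) t))
     = c * (LINT t|leb (edge_length S e). qform e t (\<lambda>j. fst z (e, j) t) (\<lambda>i. fst w (e, i) t))" for e
    unfolding fst_scale_d qform_scale by simp
  moreover have "vb v (snd (scale_d c z) v) (snd w v) = c * vb v (snd z v) (snd w v)" if v: "v \<in> net_V S" for v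
    unfolding snd_scale_d by (rule herm_form.b_scale[OF vb_herm_form[OF v] L2d_snd[OF assms(1) v] L2d_snd[OF assms(2) v]])
  ultimately show ?thesis unfolding ip_d_eq
    by (simp add: sum_distrib_left distrib_left)
qed

lemma ip_d_cnj:
  assumes "z \<in> L2d S" "w \<in> L2d S"
  shows "ip_d S w z = cnj (ip_d S z w)"
proof -
  have "(LINT t|leb (edge_length S e). qform e t (\<lambda>j. fst w (e, j) t) (\<lambda>i. fst z (e, i) t))
     = cnj (LINT t|leb (edge_length S e). qform e t (\<lambda>j. fst z (e, j) t) (\<lambda>i. fst w (e, i) t))" if e: "e \<in> net_E S" for e
  proof -
    have "(LINT t|leb (edge_length S e). qform e t (\<lambda>j. fst w (e, j) t) (\<lambda>i. fst z (e, i) t))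
     = (LINT t|leb (edge_length S e). cnj (qform e t (\<lambda>j. fst z (e, j) t) (\<lambda>i. fst w (e, i) t)))"
      by (intro Bochner_Integration.integral_cong refl qform_herm[OF e]) auto
    then show ?thesis by simp
  qed
  moreover have "vb v (snd w v) (snd z v) = cnj (vb v (snd z v) (snd w v))" if v: "v \<in> net_V S" for v
    by (rule herm_form.b_cnj[OF vb_herm_form[OF v] L2d_snd[OF assms(1) v] L2d_snd[OF assms(2) v]])
  ultimately show ?thesis unfolding ip_d_eq by (simp add: cnj_sum)
qed

definition edge_sq :: "('v, 'e) net_state \<Rightarrow> real" where
  "edge_sq z = (\<Sum>e\<in>net_E S. \<Sum>i<edge_dim S e. L2_sq (edge_length S e) (fst z (e, i)))"

definition vert_sq :: "('v, 'e) net_state \<Rightarrow> real" where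
  "vert_sq z = (\<Sum>v\<in>net_V S. Re (vb v (snd z v) (snd z v)))"

lemma edge_sq_nonneg: "edge_sq z \<ge> 0"
  unfolding edge_sq_def by (intro sum_nonneg L2_sq_nonneg)

lemma vert_sq_nonneg: "z \<in> L2d S \<Longrightarrow> vert_sq z \<ge> 0"
  unfolding vert_sq_def by (intro sum_nonneg herm_form.b_nonneg[OF vb_herm_form] L2d_snd)

lemma integral_sum_squares:
  assumes z: "z \<in> L2d S" and e: "e \<in> net_E S"
  shows "integrable (leb (edge_length S e)) (\<lambda>t. \<Sum>i<edge_dim S e. (cmod (fst z (e, i) t))\<^sup>2)"
    "(LINT t|leb (edge_length S e). (\<Sum>i<edge_dim S e. (cmod (fst z (e, i) t))\<^sup>2)) = (\<Sum>i<edge_dim S e. L2_sq (edge_length S e) (fst z (e, i)))"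
  using L2_square_integrable[OF L2d_fst[OF z e]] by (auto simp: L2_sq_def)

lemma Re_ip_d:
  assumes z: "z \<in> L2d S" and w: "w \<in> L2d S"
  shows "Re (ip_d S z w) = (\<Sum>e\<in>net_E S. LINT t|leb (edge_length S e). Re (qform e t (\<lambda>j. fst z (e, j) t) (\<lambda>i. fst w (e, i) t)))
    + (\<Sum>v\<in>net_V S. Re (vb v (snd z v) (snd w v)))"
  unfolding ip_d_eq plus_complex.sel Re_sum
  using integral_Re[OF qform_L2d_integrable[OF z w]] by simp

lemma norm_lower: "\<exists>q>0. \<forall>z\<in>L2d S. q * edge_sq z + vert_sq z \<le> Re (ip_d S z z)"
proof -
  obtain q where q: "q > 0" "\<And>e t \<xi>. e \<in> net_E S \<Longrightarrow> t \<in> {0..edge_length S e} \<Longrightarrow> q * (\<Sum>i<edge_dim S e. (cmod (\<xi> i))\<^sup>2) \<le> Re (qform e t \<xi> \<xi>)"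
    using qform_lower by blast
  have "q * edge_sq z + vert_sq z \<le> Re (ip_d S z z)" if z: "z \<in> L2d S" for z
  proof -
    have "q * (\<Sum>i<edge_dim S e. L2_sq (edge_length S e) (fst z (e, i))) \<le> (LINT t|leb (edge_length S e). Re (qform e t (\<lambda>j. fst z (e, j) t) (\<lambda>i. fst z (e, i) t)))"
      if e: "e \<in> net_E S" for e
    proof -
      have "q * (\<Sum>i<edge_dim S e. L2_sq (edge_length S e) (fst z (e, i))) = (LINT t|leb (edge_length S e). q * (\<Sum>i<edge_dim S e. (cmod (fst z (e, i) t))\<^sup>2))"
        unfolding integral_sum_squares(2)[OF z e, symmetric] by simp
      also have "\<dots> \<le> (LINT t|leb (edge_length S e). Re (qform e t (\<lambda>j. fst z (e, j) t) (\<lambda>i. fst z (e, i) t)))"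
        by (intro integral_mono integrable_mult_right integral_sum_squares(1)[OF z e] integrable_Re qform_L2d_integrable z e q(2)) auto
      finally show ?thesis .
    qed
    then show ?thesis unfolding Re_ip_d[OF z z] edge_sq_def vert_sq_def sum_distrib_left
      by (intro add_mono sum_mono order_refl) (simp add: sum_distrib_left)
  qed
  then show ?thesis using q(1) by blast
qed

lemma norm_upper: "\<exists>K\<ge>0. \<forall>z\<in>L2d S. Re (ip_d S z z) \<le> K * edge_sq z + vert_sq z"
proof -
  obtain K where K: "K \<ge> 0" "\<And>e t \<xi>. e \<in> net_E S \<Longrightarrow> t \<in> {0..edge_length S e} \<Longrightarrow> Re (qform e t \<xi> \<xi>) \<le> K * (\<Sum>i<edge_dim S e. (cmod (\<xi> i))\<^sup>2)"
    using qform_upper by blast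
  have "Re (ip_d S z z) \<le> K * edge_sq z + vert_sq z" if z: "z \<in> L2d S" for z
  proof -
    have "(LINT t|leb (edge_length S e). Re (qform e t (\<lambda>j. fst z (e, j) t) (\<lambda>i. fst z (e, i) t))) \<le> K * (\<Sum>i<edge_dim S e. L2_sq (edge_length S e) (fst z (e, i)))"
      if e: "e \<in> net_E S" for e
    proof -
      have "(LINT t|leb (edge_length S e). Re (qform e t (\<lambda>j. fst z (e, j) t) (\<lambda>i. fst z (e, i) t))) \<le> (LINT t|leb (edge_length S e). K * (\<Sum>i<edge_dim S e. (cmod (fst z (e, i) t))\<^sup>2))"
        by (intro integral_mono integrable_mult_right integral_sum_squares(1)[OF z e] integrable_Re qform_L2d_integrable z e K(2)) auto
      also have "\<dots> = K * (\<Sum>i<edge_dim S e. L2_sq (edge_length S e) (fst z (e, i)))"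
        unfolding integral_sum_squares(2)[OF z e, symmetric] by simp
      finally show ?thesis .
    qed
    then show ?thesis unfolding Re_ip_d[OF z z] edge_sq_def vert_sq_def sum_distrib_left
      by (intro add_mono sum_mono order_refl) (simp add: sum_distrib_left)
  qed
  then show ?thesis using K(1) by blast
qed

lemma norm_d_square: "z \<in> L2d S \<Longrightarrow> (norm_d S z)\<^sup>2 = Re (ip_d S z z)"
proof -
  assume z: "z \<in> L2d S"
  obtain q where "q > 0" "q * edge_sq z + vert_sq z \<le> Re (ip_d S z z)" using norm_lower z by blast
  then have "0 \<le> Re (ip_d S z z)" using mult_nonneg_nonneg[of q "edge_sq z"] edge_sq_nonneg[of z] vert_sq_nonneg[OF z] by linarith
  then show ?thesis by (simp add: norm_d_def)
qed

lemma Re_ip_d_nonneg: "z \<in> L2d S \<Longrightarrow> 0 \<le> Re (ip_d S z z)"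
  using norm_d_square[of z] zero_le_power2[of "norm_d S z"] by simp

lemma L2d_minus: "z \<in> L2d S \<Longrightarrow> z' \<in> L2d S \<Longrightarrow> z - z' \<in> L2d S"
  by (rule L2dI) (auto intro!: L2_minus cvs.subspace_diff Yd_sub dest: L2d_fst L2d_snd)

text \<open>The energy seminorm identifies exactly the states that agree almost everywhere on the edges and agree
  at the vertices, since it is equivalent to the unweighted one (\<open>norm_lower\<close>, \<open>norm_upper\<close>).\<close>

lemma norm_d_null_iff:
  assumes z: "z \<in> L2d S"
  shows "norm_d S z = 0 \<longleftrightarrow> (\<forall>e\<in>net_E S. \<forall>i<edge_dim S e. AE t in leb (edge_length S e). fst z (e, i) t = 0) \<and> (\<forall>v\<in>net_V S. snd z v = 0)"
proof
  obtain q where q: "q > 0" "q * edge_sq z + vert_sq z \<le> Re (ip_d S z z)" using norm_lower z by blast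
  assume "norm_d S z = 0"
  then have "Re (ip_d S z z) = 0" using norm_d_square[OF z] by simp
  then have "q * edge_sq z + vert_sq z \<le> 0" using q by simp
  moreover have "0 \<le> q * edge_sq z" using q edge_sq_nonneg by simp
  ultimately have "q * edge_sq z = 0" and v0: "vert_sq z = 0" using vert_sq_nonneg[OF z] by linarith+
  then have e0: "edge_sq z = 0" using q by simp
  show "(\<forall>e\<in>net_E S. \<forall>i<edge_dim S e. AE t in leb (edge_length S e). fst z (e, i) t = 0) \<and> (\<forall>v\<in>net_V S. snd z v = 0)"
  proof (intro conjI ballI allI impI)
    fix e i assume e: "e \<in> net_E S" and i: "i < edge_dim S e"
    have "(\<Sum>i<edge_dim S e. L2_sq (edge_length S e) (fst z (e, i))) = 0"
      using e0 e finite_E unfolding edge_sq_def by (subst (asm) sum_nonneg_eq_0_iff) (auto intro: sum_nonneg L2_sq_nonneg)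
    then have "L2_sq (edge_length S e) (fst z (e, i)) = 0"
      using i by (subst (asm) sum_nonneg_eq_0_iff) (auto intro: L2_sq_nonneg)
    then show "AE t in leb (edge_length S e). fst z (e, i) t = 0"
      by (rule L2_sq_zero[OF L2d_fst[OF z e i]])
  next
    fix v assume v: "v \<in> net_V S"
    interpret herm_form "vert_idx S v" "vert_Yd S v" "vb v" by (rule vb_herm_form[OF v])
    have "Re (vb v (snd z v) (snd z v)) = 0"
      using v0 v finite_V unfolding vert_sq_def
      by (subst (asm) sum_nonneg_eq_0_iff) (auto intro: herm_form.b_nonneg[OF vb_herm_form] L2d_snd[OF z])
    then show "snd z v = 0" using b_pos[OF L2d_snd[OF z v]] by (cases "snd z v = 0") auto
  qed
next
  assume *: "(\<forall>e\<in>net_E S. \<forall>i<edge_dim S e. AE t in leb (edge_length S e). fst z (e, i) t = 0) \<and> (\<forall>v\<in>net_V S. snd z v = 0)"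
  obtain K where K: "K \<ge> 0" "Re (ip_d S z z) \<le> K * edge_sq z + vert_sq z" using norm_upper z by blast
  have "L2_sq (edge_length S e) (fst z (e, i)) = 0" if "e \<in> net_E S" "i < edge_dim S e" for e i
  proof -
    have "AE t in leb (edge_length S e). (cmod (fst z (e, i) t))\<^sup>2 = 0" using * that by (auto elim: eventually_mono)
    then show ?thesis unfolding L2_sq_def by (rule integral_eq_zero_AE)
  qed
  then have "edge_sq z = 0" by (simp add: edge_sq_def)
  moreover have "vert_sq z = 0"
    unfolding vert_sq_def
  proof (intro sum.neutral ballI)
    fix v assume v: "v \<in> net_V S"
    show "Re (vb v (snd z v) (snd z v)) = 0"
      using * v herm_form.b_scale[OF vb_herm_form[OF v] cvs.subspace_0[OF Yd_sub[OF v]] cvs.subspace_0[OF Yd_sub[OF v]], of 0]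
      unfolding cvs.scale_zero_left by auto
  qed
  ultimately have "Re (ip_d S z z) = 0" using K Re_ip_d_nonneg[OF z] by simp
  then show "norm_d S z = 0" by (simp add: norm_d_def)
qed

text \<open>Completeness is inherited from the components by the two-sided estimate of the energy.\<close>

lemma L2d_complete:
  assumes f: "\<And>n. f n \<in> L2d S" and C: "\<And>\<epsilon>. \<epsilon> > 0 \<Longrightarrow> \<exists>N::nat. \<forall>m\<ge>N. \<forall>n\<ge>N. norm_d S (f m - f n) < \<epsilon>"
  shows "\<exists>z\<in>L2d S. (\<lambda>n. norm_d S (f n - z)) \<longlonglongrightarrow> 0"
proof -
  obtain q where q: "q > 0" "\<And>z. z \<in> L2d S \<Longrightarrow> q * edge_sq z + vert_sq z \<le> Re (ip_d S z z)" using norm_lower by blast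
  obtain K where K: "K \<ge> 0" "\<And>z. z \<in> L2d S \<Longrightarrow> Re (ip_d S z z) \<le> K * edge_sq z + vert_sq z" using norm_upper by blast
  have C2: "\<exists>N. \<forall>m\<ge>N. \<forall>n\<ge>N. Re (ip_d S (f m - f n) (f m - f n)) < \<epsilon>" if e: "\<epsilon> > 0" for \<epsilon>
  proof -
    obtain N where N: "\<forall>m\<ge>N. \<forall>n\<ge>N. norm_d S (f m - f n) < sqrt \<epsilon>" using C[of "sqrt \<epsilon>"] e by auto
    have "Re (ip_d S (f m - f n) (f m - f n)) < \<epsilon>" if "m \<ge> N" "n \<ge> N" for m n
    proof -
      have "norm_d S (f m - f n) < sqrt \<epsilon>" using N that by blast
      then show ?thesis by (simp add: norm_d_def)
    qed
    then show ?thesis by blast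
  qed
  have comp: "\<exists>g. g \<in> L2_space (edge_length S e) \<and> (\<lambda>n. L2_sq (edge_length S e) (\<lambda>x. fst (f n) (e, i) x - g x)) \<longlonglongrightarrow> 0"
    if e: "e \<in> net_E S" and i: "i < edge_dim S e" for e i
  proof -
    have "\<exists>g\<in>L2_space (edge_length S e). (\<lambda>n. L2_sq (edge_length S e) (\<lambda>x. fst (f n) (e, i) x - g x)) \<longlonglongrightarrow> 0"
    proof (rule L2_complete[OF length_pos[OF e] L2d_fst[OF f e i]])
      fix \<epsilon> :: real assume "\<epsilon> > 0"
      then obtain N where N: "\<forall>m\<ge>N. \<forall>n\<ge>N. Re (ip_d S (f m - f n) (f m - f n)) < q * \<epsilon>" using C2[of "q * \<epsilon>"] q(1) by auto
      have "L2_sq (edge_length S e) (\<lambda>x. fst (f m) (e, i) x - fst (f n) (e, i) x) < \<epsilon>" if mn: "m \<ge> N" "n \<ge> N" for m n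
      proof -
        have z: "f m - f n \<in> L2d S" by (intro L2d_minus f)
        have "L2_sq (edge_length S e) (\<lambda>x. fst (f m) (e, i) x - fst (f n) (e, i) x) = L2_sq (edge_length S e) (fst (f m - f n) (e, i))"
          by (simp add: fun_diff_def)
        also have "\<dots> \<le> (\<Sum>i<edge_dim S e. L2_sq (edge_length S e) (fst (f m - f n) (e, i)))"
          using i by (intro member_le_sum[where f = "\<lambda>i. L2_sq (edge_length S e) (fst (f m - f n) (e, i))"]) (auto intro: L2_sq_nonneg)
        also have "\<dots> \<le> edge_sq (f m - f n)"
          unfolding edge_sq_def using e finite_E
          by (intro member_le_sum[where f = "\<lambda>e. \<Sum>i<edge_dim S e. L2_sq (edge_length S e) (fst (f m - f n) (e, i))"]) (auto intro!: sum_nonneg L2_sq_nonneg)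
        finally have "q * L2_sq (edge_length S e) (\<lambda>x. fst (f m) (e, i) x - fst (f n) (e, i) x) \<le> q * edge_sq (f m - f n)"
          using q(1) by simp
        also have "\<dots> < q * \<epsilon>" using q(2)[OF z] N[rule_format, OF mn] vert_sq_nonneg[OF z] by linarith
        finally show ?thesis using q(1) by simp
      qed
      then show "\<exists>N. \<forall>m\<ge>N. \<forall>n\<ge>N. L2_sq (edge_length S e) (\<lambda>x. fst (f m) (e, i) x - fst (f n) (e, i) x) < \<epsilon>" by blast
    qed
    then show ?thesis by blast
  qed
  define g where "g = (\<lambda>(e, i). SOME g. g \<in> L2_space (edge_length S e) \<and> (\<lambda>n. L2_sq (edge_length S e) (\<lambda>x. fst (f n) (e, i) x - g x)) \<longlonglongrightarrow> 0)"
  have g: "g (e, i) \<in> L2_space (edge_length S e)" "(\<lambda>n. L2_sq (edge_length S e) (\<lambda>x. fst (f n) (e, i) x - g (e, i) x)) \<longlonglongrightarrow> 0"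
    if "e \<in> net_E S" "i < edge_dim S e" for e i
    using someI_ex[OF comp[OF that]] unfolding g_def by auto
  have vcomp: "\<exists>x\<in>vert_Yd S v. (\<lambda>n. Re (vb v (snd (f n) v - x) (snd (f n) v - x))) \<longlonglongrightarrow> 0" if v: "v \<in> net_V S" for v
  proof (rule herm_form.b_complete[OF vb_herm_form[OF v] L2d_snd[OF f v]])
    fix \<epsilon> :: real assume "\<epsilon> > 0"
    then obtain N where N: "\<forall>m\<ge>N. \<forall>n\<ge>N. Re (ip_d S (f m - f n) (f m - f n)) < \<epsilon>" using C2 by blast
    have "Re (vb v (snd (f m) v - snd (f n) v) (snd (f m) v - snd (f n) v)) < \<epsilon>" if mn: "m \<ge> N" "n \<ge> N" for m n
    proof -
      have z: "f m - f n \<in> L2d S" by (intro L2d_minus f)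
      have "Re (vb v (snd (f m) v - snd (f n) v) (snd (f m) v - snd (f n) v)) = Re (vb v (snd (f m - f n) v) (snd (f m - f n) v))"
        by (simp only: snd_diff fun_diff_def)
      also have "\<dots> \<le> vert_sq (f m - f n)"
        unfolding vert_sq_def using v finite_V
        by (intro member_le_sum[where f = "\<lambda>v. Re (vb v (snd (f m - f n) v) (snd (f m - f n) v))"])
          (auto intro: herm_form.b_nonneg[OF vb_herm_form] L2d_snd[OF z] simp del: snd_diff)
      also have "\<dots> < \<epsilon>" using q(2)[OF z] N[rule_format, OF mn] mult_nonneg_nonneg[OF less_imp_le[OF q(1)] edge_sq_nonneg[of "f m - f n"]] by linarith
      finally show ?thesis .
    qed
    then show "\<exists>N. \<forall>m\<ge>N. \<forall>n\<ge>N. Re (vb v (snd (f m) v - snd (f n) v) (snd (f m) v - snd (f n) v)) < \<epsilon>" by blast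
  qed
  define x where "x v = (SOME x. x \<in> vert_Yd S v \<and> (\<lambda>n. Re (vb v (snd (f n) v - x) (snd (f n) v - x))) \<longlonglongrightarrow> 0)" for v
  have x: "x v \<in> vert_Yd S v" "(\<lambda>n. Re (vb v (snd (f n) v - x v) (snd (f n) v - x v))) \<longlonglongrightarrow> 0" if "v \<in> net_V S" for v
    using someI_ex[OF vcomp[OF that, unfolded Bex_def]] unfolding x_def by auto
  define z where "z = (g, x)"
  have z: "z \<in> L2d S" by (rule L2dI) (auto simp: z_def g x)
  have e: "edge_sq (f n - z) = (\<Sum>e\<in>net_E S. \<Sum>i<edge_dim S e. L2_sq (edge_length S e) (\<lambda>x. fst (f n) (e, i) x - g (e, i) x))" for n
    by (simp add: edge_sq_def z_def fun_diff_def)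
  have v: "vert_sq (f n - z) = (\<Sum>v\<in>net_V S. Re (vb v (snd (f n) v - x v) (snd (f n) v - x v)))" for n
    by (simp add: vert_sq_def z_def)
  have "(\<lambda>n. edge_sq (f n - z)) \<longlonglongrightarrow> (\<Sum>e\<in>net_E S. \<Sum>i<edge_dim S e. 0)"
    unfolding e by (intro tendsto_sum g) auto
  moreover have "(\<lambda>n. vert_sq (f n - z)) \<longlonglongrightarrow> (\<Sum>v\<in>net_V S. 0)"
    unfolding v by (intro tendsto_sum x)
  ultimately have "(\<lambda>n. K * edge_sq (f n - z) + vert_sq (f n - z)) \<longlonglongrightarrow> K * (\<Sum>e\<in>net_E S. \<Sum>i<edge_dim S e. 0) + (\<Sum>v\<in>net_V S. 0)"
    by (intro tendsto_intros)
  then have lim: "(\<lambda>n. K * edge_sq (f n - z) + vert_sq (f n - z)) \<longlonglongrightarrow> 0" by simp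
  have "(\<lambda>n. Re (ip_d S (f n - z) (f n - z))) \<longlonglongrightarrow> 0"
    by (rule tendsto_sandwich[OF _ _ tendsto_const lim])
      (use K(2) Re_ip_d_nonneg L2d_minus[OF f z] in \<open>auto intro!: always_eventually\<close>)
  then have "(\<lambda>n. norm_d S (f n - z)) \<longlonglongrightarrow> sqrt 0" unfolding norm_d_def by (rule tendsto_real_sqrt)
  then show ?thesis using z by auto
qed

lemma semi_hilbert_L2d: "semi_hilbert_space scale_d (L2d S) (norm_d S) (\<lambda>z w. Re (ip_d S z w))"
proof (intro semi_hilbert_space.intro semi_hilbert_space_axioms.intro)
  show vs: "vector_space (scale_d :: complex \<Rightarrow> ('v, 'e) net_state \<Rightarrow> ('v, 'e) net_state)" by (rule vector_space_scale_d)
  show "module.subspace scale_d (L2d S)"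
  proof -
    interpret V: vector_space "scale_d :: complex \<Rightarrow> ('v, 'e) net_state \<Rightarrow> ('v, 'e) net_state" by (rule vs)
    show ?thesis by (rule V.subspaceI) (auto intro: L2d_zero L2d_add L2d_scale)
  qed
next
  fix z w y :: "('v, 'e) net_state" and a :: real and c :: complex
  assume z: "z \<in> L2d S"
  show "0 \<le> Re (ip_d S z z)" by (rule Re_ip_d_nonneg[OF z])
  show "Re (ip_d S (scale_d c z) (scale_d c z)) = (cmod c)\<^sup>2 * Re (ip_d S z z)"
  proof -
    have "ip_d S (scale_d c z) (scale_d c z) = c * cnj (c * ip_d S z z)"
      using ip_d_scale[OF z L2d_scale[OF z], of c c] ip_d_cnj[OF L2d_scale[OF z] z, of c] ip_d_scale[OF z z, of c]
      by simp
    also have "\<dots> = (c * cnj c) * ip_d S z z" using ip_d_cnj[OF z z] by simp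
    also have "\<dots> = of_real ((cmod c)\<^sup>2) * ip_d S z z" unfolding complex_norm_square ..
    finally show ?thesis by simp
  qed
  assume w: "w \<in> L2d S"
  show "Re (ip_d S (scale_d (of_real a) z) w) = a * Re (ip_d S z w)"
    using ip_d_scale[OF z w, of "of_real a"] by simp
  show "Re (ip_d S z w) = Re (ip_d S w z)" using ip_d_cnj[OF z w] by simp
  assume y: "y \<in> L2d S"
  show "Re (ip_d S (z + w) y) = Re (ip_d S z y) + Re (ip_d S w y)"
    using ip_d_add[OF z w y] by simp
next
  show "norm_d S x = sqrt (Re (ip_d S x x))" for x by (simp add: norm_d_def)
qed (rule L2d_complete)

end


section \<open>The operator as a relation\<close>

lemma lipschitz_on_mult_bounded:
  fixes f g :: "real \<Rightarrow> complex"
  assumes f: "L-lipschitz_on {a..b} f" and g: "L'-lipschitz_on {a..b} g"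
  shows "\<exists>C. C-lipschitz_on {a..b} (\<lambda>x. f x * g x)"
proof -
  obtain K where K: "K > 0" "\<And>x. x \<in> {a..b} \<Longrightarrow> cmod (f x) \<le> K"
    using continuous_interval_bounded[OF lipschitz_on_continuous_on[OF f]] by blast
  obtain K' where K': "K' > 0" "\<And>x. x \<in> {a..b} \<Longrightarrow> cmod (g x) \<le> K'"
    using continuous_interval_bounded[OF lipschitz_on_continuous_on[OF g]] by blast
  have L: "L \<ge> 0" "L' \<ge> 0" using f g by (auto intro: lipschitz_on_nonneg)
  have "(K * L' + L * K')-lipschitz_on {a..b} (\<lambda>x. f x * g x)"
  proof (rule lipschitz_onI)
    fix x y assume xy: "x \<in> {a..b}" "y \<in> {a..b}"
    have "f x * g x - f y * g y = f x * (g x - g y) + (f x - f y) * g y" by (simp add: algebra_simps)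
    also have "cmod \<dots> \<le> cmod (f x) * cmod (g x - g y) + cmod (f x - f y) * cmod (g y)"
      by (metis norm_triangle_ineq norm_mult)
    also have "\<dots> \<le> K * (L' * dist x y) + (L * dist x y) * K'"
      using lipschitz_onD[OF f xy] lipschitz_onD[OF g xy] K K' xy L
      by (intro add_mono mult_mono) (auto simp: dist_norm)
    finally show "dist (f x * g x) (f y * g y) \<le> (K * L' + L * K') * dist x y"
      by (simp add: dist_norm algebra_simps)
  qed (use K K' L in auto)
  then show ?thesis by blast
qed

lemma lipschitz_on_sum_ex:
  fixes f :: "'i \<Rightarrow> real \<Rightarrow> complex"
  assumes "finite I" "\<And>i. i \<in> I \<Longrightarrow> \<exists>C. C-lipschitz_on S (f i)"
  shows "\<exists>C. C-lipschitz_on S (\<lambda>x. \<Sum>i\<in>I. f i x)"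
  using assms
proof (induction I rule: finite_induct)
  case empty
  show ?case by (intro exI[of _ 0]) (simp add: lipschitz_on_def)
next
  case (insert i I)
  then obtain C D where "C-lipschitz_on S (f i)" "D-lipschitz_on S (\<lambda>x. \<Sum>i\<in>I. f i x)" by blast
  from lipschitz_on_add[OF this] show ?case using insert by auto
qed

lemma weak_derivative_cong_AE:
  assumes f: "f \<in> L2_space l" and f': "f' \<in> L2_space l" and ae: "AE x in leb l. f x = f' x" and w: "weak_derivative l f g"
  shows "weak_derivative l f' g"
  unfolding weak_derivative_def
proof
  fix \<phi> assume \<phi>: "\<phi> \<in> test_functions l"
  have m: "(\<lambda>x. complex_of_real (deriv \<phi> x)) \<in> borel_measurable (leb l)"
    by (rule borel_measurable_integrable[OF primitive_integrable[OF test_function_primitive[OF \<phi>]]])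
  have "(LINT x|leb l. f' x * of_real (deriv \<phi> x)) = (LINT x|leb l. f x * of_real (deriv \<phi> x))"
    by (rule integral_cong_AE)
      (use L2_measurable[OF f] L2_measurable[OF f'] m ae in \<open>auto intro!: borel_measurable_times elim: eventually_mono\<close>)
  also have "\<dots> = - (LINT x|leb l. g x * of_real (\<phi> x))" using w \<phi> by (simp add: weak_derivative_def)
  finally show "(LINT x|leb l. f' x * of_real (deriv \<phi> x)) = - (LINT x|leb l. g x * of_real (\<phi> x))" .
qed

lemma L2_sq_cong_AE:
  assumes "f \<in> L2_space l" "f' \<in> L2_space l" "AE x in leb l. f x = f' x"
  shows "L2_sq l f = L2_sq l f'"
proof -
  note [measurable] = L2_measurable[OF assms(1)] L2_measurable[OF assms(2)]
  show ?thesis unfolding L2_sq_def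
    by (rule integral_cong_AE) (use assms(3) in \<open>auto elim: eventually_mono\<close>)
qed

context hyperbolic_network
begin

lemma N_measurable: "e \<in> net_E S \<Longrightarrow> i < edge_dim S e \<Longrightarrow> j < edge_dim S e \<Longrightarrow>
    (\<lambda>x. coef_N S e x $$ (i, j)) \<in> borel_measurable (leb (edge_length S e))"
  using N_Linf by (auto simp: Linf_space_def)

lemma N_bounded:
  "\<exists>K\<ge>0. \<forall>e\<in>net_E S. \<forall>i<edge_dim S e. \<forall>j<edge_dim S e. AE x in leb (edge_length S e). cmod (coef_N S e x $$ (i, j)) \<le> K"
proof (rule uniform_entry_bound)
  fix e i j assume "e \<in> net_E S" "i < edge_dim S e" "j < edge_dim S e"
  from N_Linf[OF this] show "\<exists>K. AE x in leb (edge_length S e). cmod (coef_N S e x $$ (i, j)) \<le> K"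
    by (simp add: Linf_space_def)
qed (auto elim!: eventually_mono)

text \<open>The entries of the Hermitian matrix \<open>Q_e M_e\<close> that governs the energy flux.\<close>

definition pmat :: "'e \<Rightarrow> nat \<Rightarrow> nat \<Rightarrow> real \<Rightarrow> complex" where
  "pmat e i k t = (\<Sum>j<edge_dim S e. coef_Q S e t $$ (i, j) * coef_M S e t $$ (j, k))"

lemma pmat_eq:
  assumes "e \<in> net_E S" "t \<in> {0..edge_length S e}" "i < edge_dim S e" "k < edge_dim S e"
  shows "(coef_Q S e t * coef_M S e t) $$ (i, k) = pmat e i k t"
  using Q_carrier[OF assms(1,2)] M_carrier[OF assms(1,2)] assms(3,4)
  by (simp add: pmat_def scalar_prod_def lessThan_atLeast0)

lemma pmat_herm:
  assumes "e \<in> net_E S" "t \<in> {0..edge_length S e}" "i < edge_dim S e" "k < edge_dim S e"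
  shows "cnj (pmat e i k t) = pmat e k i t"
  using mat_adjoint_index[OF mult_carrier_mat[OF Q_carrier[OF assms(1,2)] M_carrier[OF assms(1,2)]] assms(4,3)]
    QM_hermitian[OF assms(1,2)] pmat_eq[OF assms] pmat_eq[OF assms(1,2,4,3)] by simp

lemma pmat_lipschitz:
  "\<exists>L\<ge>0. \<forall>e\<in>net_E S. \<forall>i<edge_dim S e. \<forall>k<edge_dim S e. L-lipschitz_on {0..edge_length S e} (pmat e i k)"
proof (rule uniform_entry_bound)
  fix e i k assume e: "e \<in> net_E S" "i < edge_dim S e" "k < edge_dim S e"
  show "\<exists>L. L-lipschitz_on {0..edge_length S e} (pmat e i k)"
    unfolding pmat_def[abs_def]
  proof (rule lipschitz_on_sum_ex)
    fix j assume "j \<in> {..<edge_dim S e}"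
    then have j: "j < edge_dim S e" by simp
    obtain L L' where "L-lipschitz_on {0..edge_length S e} (\<lambda>x. coef_Q S e x $$ (i, j))"
      "L'-lipschitz_on {0..edge_length S e} (\<lambda>x. coef_M S e x $$ (j, k))"
      using Q_lipschitz[OF e(1,2) j] M_lipschitz[OF e(1) j e(3)] by blast
    then show "\<exists>C. C-lipschitz_on {0..edge_length S e} (\<lambda>t. coef_Q S e t $$ (i, j) * coef_M S e t $$ (j, k))"
      by (rule lipschitz_on_mult_bounded)
  qed simp
qed (rule lipschitz_on_le)

lemma M_mult_L2:
  assumes e: "e \<in> net_E S" "i < edge_dim S e" "j < edge_dim S e" and f: "f \<in> L2_space (edge_length S e)"
  shows "(\<lambda>t. coef_M S e t $$ (i, j) * f t) \<in> L2_space (edge_length S e)"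
proof -
  obtain K where "\<And>x. x \<in> {0..edge_length S e} \<Longrightarrow> norm (coef_M S e x $$ (i, j)) \<le> K"
    using continuous_interval_bounded[OF M_continuous[OF e]] by blast
  then show ?thesis
    by (intro L2_bounded_mult[OF f measurable_leb_continuous[OF M_continuous[OF e]], of K] AE_I2) auto
qed

lemma N_mult_L2:
  assumes e: "e \<in> net_E S" "i < edge_dim S e" "j < edge_dim S e" and f: "f \<in> L2_space (edge_length S e)"
  shows "(\<lambda>t. coef_N S e t $$ (i, j) * f t) \<in> L2_space (edge_length S e)"
proof -
  obtain K where "AE x in leb (edge_length S e). cmod (coef_N S e x $$ (i, j)) \<le> K"
    using N_Linf[OF e] by (auto simp: Linf_space_def)
  then show ?thesis by (rule L2_bounded_mult[OF f N_measurable[OF e]])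
qed

definition trace_of :: "'v \<Rightarrow> ('e \<times> nat \<Rightarrow> real \<Rightarrow> complex) \<Rightarrow> 'e \<times> nat \<Rightarrow> complex" where
  "trace_of v h = (\<lambda>(e, i). if (e, i) \<in> vert_idx S v then h (e, i) (endpoint S v e) else 0)"

lemma trace_of_coord: "trace_of v h \<in> coord_space (vert_idx S v)"
  by (auto simp: trace_of_def coord_space_def)

lemma trace_of_add: "trace_of v (h + h') = trace_of v h + trace_of v h'"
  and trace_of_scale: "trace_of v (\<lambda>j t. c * h j t) = cfscale c (trace_of v h)"
  by (auto simp: trace_of_def fun_eq_iff)

lemma endpoint_range: "e \<in> net_E S \<Longrightarrow> endpoint S v e \<in> {0..edge_length S e}"
  using length_pos[of e] by (auto simp: endpoint_def)

lemma incident_E: "e \<in> incident S v \<Longrightarrow> e \<in> net_E S"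
  by (simp add: incident_def)

text \<open>The equation \<open>A z = y\<close>, with the continuous representatives \<open>h\<close> of the edge components of \<open>z\<close> and
  their derivatives \<open>d\<close> made explicit. In this form it is visibly linear, invariant under changes on
  null sets, and accessible to integration by parts and to differential equations.\<close>

definition solves :: "('e \<times> nat \<Rightarrow> real \<Rightarrow> complex) \<Rightarrow> ('e \<times> nat \<Rightarrow> real \<Rightarrow> complex) \<Rightarrow>
    ('v, 'e) net_state \<Rightarrow> ('v, 'e) net_state \<Rightarrow> bool" where
  "solves h d z y \<longleftrightarrow> z \<in> L2d S \<and> y \<in> L2d S \<and>
    (\<forall>e\<in>net_E S. \<forall>i<edge_dim S e. primitive (edge_length S e) (d (e, i)) (h (e, i)) \<and> d (e, i) \<in> L2_space (edge_length S e) \<and>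
       (AE t in leb (edge_length S e). h (e, i) t = fst z (e, i) t) \<and>
       (AE t in leb (edge_length S e). fst y (e, i) t =
          (\<Sum>j<edge_dim S e. coef_M S e t $$ (i, j) * d (e, j) t) + (\<Sum>j<edge_dim S e. coef_N S e t $$ (i, j) * fst z (e, j) t))) \<and>
    (\<forall>v\<in>net_V S. trace_of v h \<in> vert_Y S v \<and> snd z v = proj_d S v (trace_of v h) \<and>
       snd y v = vert_B S v (trace_of v h) + vert_C S v (snd z v))"

lemma solvesD:
  assumes "solves h d z y"
  shows "z \<in> L2d S" "y \<in> L2d S"
    "\<And>e i. e \<in> net_E S \<Longrightarrow> i < edge_dim S e \<Longrightarrow> primitive (edge_length S e) (d (e, i)) (h (e, i))"
    "\<And>e i. e \<in> net_E S \<Longrightarrow> i < edge_dim S e \<Longrightarrow> d (e, i) \<in> L2_space (edge_length S e)"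
    "\<And>e i. e \<in> net_E S \<Longrightarrow> i < edge_dim S e \<Longrightarrow> AE t in leb (edge_length S e). h (e, i) t = fst z (e, i) t"
    "\<And>e i. e \<in> net_E S \<Longrightarrow> i < edge_dim S e \<Longrightarrow> AE t in leb (edge_length S e). fst y (e, i) t =
          (\<Sum>j<edge_dim S e. coef_M S e t $$ (i, j) * d (e, j) t) + (\<Sum>j<edge_dim S e. coef_N S e t $$ (i, j) * fst z (e, j) t)"
    "\<And>v. v \<in> net_V S \<Longrightarrow> trace_of v h \<in> vert_Y S v"
    "\<And>v. v \<in> net_V S \<Longrightarrow> snd z v = proj_d S v (trace_of v h)"
    "\<And>v. v \<in> net_V S \<Longrightarrow> snd y v = vert_B S v (trace_of v h) + vert_C S v (snd z v)"
  using assms unfolding solves_def by blast+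

lemma solvesI:
  assumes "z \<in> L2d S" "y \<in> L2d S"
    "\<And>e i. e \<in> net_E S \<Longrightarrow> i < edge_dim S e \<Longrightarrow> primitive (edge_length S e) (d (e, i)) (h (e, i))"
    "\<And>e i. e \<in> net_E S \<Longrightarrow> i < edge_dim S e \<Longrightarrow> d (e, i) \<in> L2_space (edge_length S e)"
    "\<And>e i. e \<in> net_E S \<Longrightarrow> i < edge_dim S e \<Longrightarrow> AE t in leb (edge_length S e). h (e, i) t = fst z (e, i) t"
    "\<And>e i. e \<in> net_E S \<Longrightarrow> i < edge_dim S e \<Longrightarrow> AE t in leb (edge_length S e). fst y (e, i) t =
          (\<Sum>j<edge_dim S e. coef_M S e t $$ (i, j) * d (e, j) t) + (\<Sum>j<edge_dim S e. coef_N S e t $$ (i, j) * fst z (e, j) t)"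
    "\<And>v. v \<in> net_V S \<Longrightarrow> trace_of v h \<in> vert_Y S v"
    "\<And>v. v \<in> net_V S \<Longrightarrow> snd z v = proj_d S v (trace_of v h)"
    "\<And>v. v \<in> net_V S \<Longrightarrow> snd y v = vert_B S v (trace_of v h) + vert_C S v (snd z v)"
  shows "solves h d z y"
  using assms unfolding solves_def by blast

lemma proj_d_in: "v \<in> net_V S \<Longrightarrow> x \<in> coord_space (vert_idx S v) \<Longrightarrow> proj_d S v x \<in> vert_Yd S v"
  unfolding proj_d_def by (rule orth_projector_in[OF finite_vert_idx Yd_sub Yd_coord])

lemma proj_d_add: "v \<in> net_V S \<Longrightarrow> x \<in> coord_space (vert_idx S v) \<Longrightarrow> y \<in> coord_space (vert_idx S v) \<Longrightarrow>
    proj_d S v (x + y) = proj_d S v x + proj_d S v y"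
  unfolding proj_d_def by (rule orth_projector_add[OF finite_vert_idx Yd_sub Yd_coord])

lemma proj_d_scale: "v \<in> net_V S \<Longrightarrow> x \<in> coord_space (vert_idx S v) \<Longrightarrow> proj_d S v (cfscale c x) = cfscale c (proj_d S v x)"
  unfolding proj_d_def by (rule orth_projector_scale[OF finite_vert_idx Yd_sub Yd_coord])

lemma solves_add:
  assumes 1: "solves h d z y" and 2: "solves h' d' z' y'"
  shows "solves (h + h') (d + d') (z + z') (y + y')"
proof (rule solvesI)
  note a = solvesD[OF 1] and b = solvesD[OF 2]
  show "z + z' \<in> L2d S" "y + y' \<in> L2d S" using a b by (auto intro: L2d_add)
  {
    fix e i assume e: "e \<in> net_E S" "i < edge_dim S e"
    show "primitive (edge_length S e) ((d + d') (e, i)) ((h + h') (e, i))"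
      using primitive_add[OF a(3)[OF e] b(3)[OF e]] by (simp add: plus_fun_def)
    show "(d + d') (e, i) \<in> L2_space (edge_length S e)"
      unfolding plus_fun_apply by (rule L2_add[OF a(4)[OF e] b(4)[OF e]])
    show "AE t in leb (edge_length S e). (h + h') (e, i) t = fst (z + z') (e, i) t"
      using a(5)[OF e] b(5)[OF e] by eventually_elim simp
    show "AE t in leb (edge_length S e). fst (y + y') (e, i) t =
          (\<Sum>j<edge_dim S e. coef_M S e t $$ (i, j) * (d + d') (e, j) t) + (\<Sum>j<edge_dim S e. coef_N S e t $$ (i, j) * fst (z + z') (e, j) t)"
      using a(6)[OF e] b(6)[OF e] by eventually_elim (simp add: distrib_left sum.distrib)
  next
    fix v assume v: "v \<in> net_V S"
    show "trace_of v (h + h') \<in> vert_Y S v"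
      unfolding trace_of_add by (rule cvs.subspace_add[OF Y_sub[OF v] a(7)[OF v] b(7)[OF v]])
    show "snd (z + z') v = proj_d S v (trace_of v (h + h'))"
      unfolding trace_of_add proj_d_add[OF v trace_of_coord trace_of_coord] by (simp add: a(8)[OF v] b(8)[OF v])
    have "vert_C S v (snd z v + snd z' v) = vert_C S v (snd z v) + vert_C S v (snd z' v)"
      by (rule linear_between_add[OF C_linear[OF v] L2d_snd[OF a(1) v] L2d_snd[OF b(1) v]])
    then show "snd (y + y') v = vert_B S v (trace_of v (h + h')) + vert_C S v (snd (z + z') v)"
      unfolding trace_of_add linear_between_add[OF B_linear[OF v] a(7)[OF v] b(7)[OF v]]
      by (simp add: a(9)[OF v] b(9)[OF v])
  }
qed

lemma solves_scale:
  assumes 1: "solves h d z y"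
  shows "solves (\<lambda>j t. c * h j t) (\<lambda>j t. c * d j t) (scale_d c z) (scale_d c y)"
proof (rule solvesI)
  note a = solvesD[OF 1]
  show "scale_d c z \<in> L2d S" "scale_d c y \<in> L2d S" using a by (auto intro: L2d_scale)
  {
    fix e i assume e: "e \<in> net_E S" "i < edge_dim S e"
    show "primitive (edge_length S e) (\<lambda>t. c * d (e, i) t) (\<lambda>t. c * h (e, i) t)"
      by (rule primitive_cmult[OF a(3)[OF e]])
    show "(\<lambda>t. c * d (e, i) t) \<in> L2_space (edge_length S e)" by (rule L2_cmult[OF a(4)[OF e]])
    show "AE t in leb (edge_length S e). c * h (e, i) t = fst (scale_d c z) (e, i) t"
      using a(5)[OF e] by eventually_elim (simp add: fst_scale_d)
    show "AE t in leb (edge_length S e). fst (scale_d c y) (e, i) t =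
          (\<Sum>j<edge_dim S e. coef_M S e t $$ (i, j) * (c * d (e, j) t)) + (\<Sum>j<edge_dim S e. coef_N S e t $$ (i, j) * fst (scale_d c z) (e, j) t)"
      using a(6)[OF e] by eventually_elim (simp add: fst_scale_d distrib_left sum_distrib_left mult.left_commute)
  next
    fix v assume v: "v \<in> net_V S"
    show "trace_of v (\<lambda>j t. c * h j t) \<in> vert_Y S v"
      unfolding trace_of_scale by (rule cvs.subspace_scale[OF Y_sub[OF v] a(7)[OF v]])
    show "snd (scale_d c z) v = proj_d S v (trace_of v (\<lambda>j t. c * h j t))"
      unfolding trace_of_scale proj_d_scale[OF v trace_of_coord] snd_scale_d a(8)[OF v] ..
    have "vert_C S v (cfscale c (snd z v)) = cfscale c (vert_C S v (snd z v))"
      by (rule linear_between_scale[OF C_linear[OF v] L2d_snd[OF a(1) v]])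
    then show "snd (scale_d c y) v = vert_B S v (trace_of v (\<lambda>j t. c * h j t)) + vert_C S v (snd (scale_d c z) v)"
      unfolding trace_of_scale linear_between_scale[OF B_linear[OF v] a(7)[OF v]] snd_scale_d a(9)[OF v]
      by (simp add: cvs.scale_right_distrib)
  }
qed

lemma null_diff_fst:
  assumes "z \<in> L2d S" "z' \<in> L2d S" "norm_d S (z - z') = 0"
  shows "e \<in> net_E S \<Longrightarrow> i < edge_dim S e \<Longrightarrow> AE t in leb (edge_length S e). fst z (e, i) t = fst z' (e, i) t"
    "v \<in> net_V S \<Longrightarrow> snd z v = snd z' v"
  using norm_d_null_iff[OF L2d_minus[OF assms(1,2)]] assms(3) by auto

lemma solves_null:
  assumes 1: "solves h d z y" and z': "z' \<in> L2d S" "norm_d S (z - z') = 0" and y': "y' \<in> L2d S" "norm_d S (y - y') = 0"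
  shows "solves h d z' y'"
proof (rule solvesI)
  note a = solvesD[OF 1]
  note zz = null_diff_fst[OF a(1) z'] and yy = null_diff_fst[OF a(2) y']
  show "z' \<in> L2d S" "y' \<in> L2d S" by fact+
  {
    fix e i assume e: "e \<in> net_E S" "i < edge_dim S e"
    show "primitive (edge_length S e) (d (e, i)) (h (e, i))" "d (e, i) \<in> L2_space (edge_length S e)"
      by (rule a(3)[OF e], rule a(4)[OF e])
    show "AE t in leb (edge_length S e). h (e, i) t = fst z' (e, i) t"
      using a(5)[OF e] zz(1)[OF e] by eventually_elim simp
    have "AE t in leb (edge_length S e). \<forall>j\<in>{..<edge_dim S e}. fst z (e, j) t = fst z' (e, j) t"
      using zz(1)[OF e(1)] by (intro AE_finite_allI) auto
    then show "AE t in leb (edge_length S e). fst y' (e, i) t =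
          (\<Sum>j<edge_dim S e. coef_M S e t $$ (i, j) * d (e, j) t) + (\<Sum>j<edge_dim S e. coef_N S e t $$ (i, j) * fst z' (e, j) t)"
      using a(6)[OF e] yy(1)[OF e] by eventually_elim simp
  next
    fix v assume v: "v \<in> net_V S"
    show "trace_of v h \<in> vert_Y S v" by (rule a(7)[OF v])
    show "snd z' v = proj_d S v (trace_of v h)" unfolding zz(2)[OF v, symmetric] by (rule a(8)[OF v])
    show "snd y' v = vert_B S v (trace_of v h) + vert_C S v (snd z' v)"
      unfolding zz(2)[OF v, symmetric] yy(2)[OF v, symmetric] by (rule a(9)[OF v])
  }
qed

lemma linear_between_zero: "cvs.subspace U \<Longrightarrow> linear_between U W F \<Longrightarrow> F 0 = 0"
  using linear_between_scale[of U W F 0 0] cvs.subspace_0[of U] unfolding cvs.scale_zero_left by blast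

lemma solves_zero: "solves 0 0 0 0"
proof (rule solvesI)
  have t: "trace_of v 0 = 0" for v by (auto simp: trace_of_def fun_eq_iff)
  show "(0 :: ('v, 'e) net_state) \<in> L2d S" "(0 :: ('v, 'e) net_state) \<in> L2d S" by (rule L2d_zero)+
  {
    fix v assume v: "v \<in> net_V S"
    show "trace_of v 0 \<in> vert_Y S v" unfolding t by (rule cvs.subspace_0[OF Y_sub[OF v]])
    have p: "proj_d S v 0 = 0" unfolding proj_d_def
      by (rule orth_projector_ident[OF finite_vert_idx Yd_sub[OF v] Yd_coord[OF v] cvs.subspace_0[OF Yd_sub[OF v]]])
    show "snd 0 v = proj_d S v (trace_of v 0)" unfolding t p by simp
    show "snd 0 v = vert_B S v (trace_of v 0) + vert_C S v (snd (0 :: ('v, 'e) net_state) v)"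
      unfolding t using linear_between_zero[OF Y_sub[OF v] B_linear[OF v]] linear_between_zero[OF Yd_sub[OF v] C_linear[OF v]]
      by simp
  }
qed (use primitive_zero L2_zero in \<open>simp_all add: zero_fun_def\<close>)

definition net_relation :: "(('v, 'e) net_state \<times> ('v, 'e) net_state) set" where
  "net_relation = {(z, y). \<exists>h d. solves h d z y}"

lemma op_dom_L2d: "z \<in> op_dom S \<Longrightarrow> z \<in> L2d S"
  by (rule L2dI) (auto simp: op_dom_def D_max_def H1_space_def all_idx_def split_beta)

lemma op_dom_H1: "z \<in> op_dom S \<Longrightarrow> e \<in> net_E S \<Longrightarrow> i < edge_dim S e \<Longrightarrow> fst z (e, i) \<in> H1_space (edge_length S e)"
  by (auto simp: op_dom_def D_max_def all_idx_def split_beta)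

lemma op_A_fst: "fst (op_A S z) (e, i) t = (\<Sum>j<edge_dim S e. coef_M S e t $$ (i, j) * wderiv (edge_length S e) (fst z (e, j)) t) +
                 (\<Sum>j<edge_dim S e. coef_N S e t $$ (i, j) * fst z (e, j) t)"
  and op_A_snd: "snd (op_A S z) v = vert_B S v (vert_trace S v (fst z)) + vert_C S v (snd z v)"
  by (simp_all add: op_A_def split_beta)

lemma op_A_L2d:
  assumes z: "z \<in> op_dom S"
  shows "op_A S z \<in> L2d S"
proof (rule L2dI)
  fix e i assume e: "e \<in> net_E S" "i < edge_dim S e"
  have "(\<lambda>t. fst (op_A S z) (e, i) t) \<in> L2_space (edge_length S e)"
    unfolding op_A_fst
    by (intro L2_add L2_sum M_mult_L2 N_mult_L2 e wderiv_L2 op_dom_H1[OF z] L2d_fst[OF op_dom_L2d[OF z]]) auto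
  then show "fst (op_A S z) (e, i) \<in> L2_space (edge_length S e)" by simp
next
  fix v assume v: "v \<in> net_V S"
  have "vert_trace S v (fst z) \<in> vert_Y S v" "snd z v \<in> vert_Yd S v"
    using z v by (auto simp: op_dom_def split_beta)
  then show "snd (op_A S z) v \<in> vert_Yd S v"
    unfolding op_A_snd
    by (intro cvs.subspace_add[OF Yd_sub[OF v]] linear_between_mem[OF B_linear[OF v]] linear_between_mem[OF C_linear[OF v]])
qed

text \<open>A function of class \<open>H^1\<close> is, up to a null set, the primitive of its weak derivative, and conversely;
  both the weak derivative and the continuous representative are unique.\<close>

lemma graph_eq_net_relation: "{(z, y). z \<in> op_dom S \<and> y \<in> L2d S \<and> norm_d S (y - op_A S z) = 0} = net_relation"
proof (intro equalityI subrelI)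
  fix z y assume "(z, y) \<in> {(z, y). z \<in> op_dom S \<and> y \<in> L2d S \<and> norm_d S (y - op_A S z) = 0}"
  then have z: "z \<in> op_dom S" and y: "y \<in> L2d S" and n: "norm_d S (y - op_A S z) = 0" by auto
  note eq = null_diff_fst[OF y op_A_L2d[OF z] n]
  let ?h = "\<lambda>(e, i). cont_rep (edge_length S e) (fst z (e, i))" and ?d = "\<lambda>(e, i). wderiv (edge_length S e) (fst z (e, i))"
  have t: "trace_of v ?h = vert_trace S v (fst z)" for v
    by (auto simp: trace_of_def vert_trace_def fun_eq_iff)
  have "solves ?h ?d z y"
  proof (rule solvesI)
    show "z \<in> L2d S" by (rule op_dom_L2d[OF z])
    {
      fix e i assume e: "e \<in> net_E S" "i < edge_dim S e"
      show "primitive (edge_length S e) (?d (e, i)) (?h (e, i))" "AE t in leb (edge_length S e). ?h (e, i) t = fst z (e, i) t"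
        using H1_cont_rep[OF length_pos[OF e(1)] op_dom_H1[OF z e]] by auto
      show "?d (e, i) \<in> L2_space (edge_length S e)" using wderiv_L2[OF op_dom_H1[OF z e]] by simp
      show "AE t in leb (edge_length S e). fst y (e, i) t = (\<Sum>j<edge_dim S e. coef_M S e t $$ (i, j) * ?d (e, j) t) + (\<Sum>j<edge_dim S e. coef_N S e t $$ (i, j) * fst z (e, j) t)"
        using eq(1)[OF e] by (simp add: op_A_fst)
    next
      fix v assume v: "v \<in> net_V S"
      show "trace_of v ?h \<in> vert_Y S v" "snd z v = proj_d S v (trace_of v ?h)"
        unfolding t using z v by (auto simp: op_dom_def split_beta)
      show "snd y v = vert_B S v (trace_of v ?h) + vert_C S v (snd z v)"
        unfolding t eq(2)[OF v] op_A_snd ..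
    }
  qed (rule y)
  then show "(z, y) \<in> net_relation" by (auto simp: net_relation_def)
next
  fix z y assume "(z, y) \<in> net_relation"
  then obtain h d where s: "solves h d z y" by (auto simp: net_relation_def)
  note a = solvesD[OF s]
  have H1: "fst z (e, i) \<in> H1_space (edge_length S e)" "AE t in leb (edge_length S e). wderiv (edge_length S e) (fst z (e, i)) t = d (e, i) t"
    "\<And>t. t \<in> {0..edge_length S e} \<Longrightarrow> cont_rep (edge_length S e) (fst z (e, i)) t = h (e, i) t"
    if e: "e \<in> net_E S" "i < edge_dim S e" for e i
  proof -
    note l = length_pos[OF e(1)] and zL = L2d_fst[OF a(1) e]
    have "weak_derivative (edge_length S e) (fst z (e, i)) (d (e, i))"
      by (rule weak_derivative_cong_AE[OF primitive_L2[OF a(3)[OF e]] zL a(5)[OF e] primitive_weak_derivative[OF l a(3)[OF e]]])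
    note wd = this
    show H: "fst z (e, i) \<in> H1_space (edge_length S e)" using zL a(4)[OF e] wd by (auto simp: H1_space_def)
    show "AE t in leb (edge_length S e). wderiv (edge_length S e) (fst z (e, i)) t = d (e, i) t"
      by (rule weak_derivative_unique[OF l zL wderiv_L2[OF H] wderiv_weak[OF H] a(4)[OF e] wd])
    show "cont_rep (edge_length S e) (fst z (e, i)) t = h (e, i) t" if "t \<in> {0..edge_length S e}" for t
      by (rule cont_rep_eq[OF l primitive_continuous[OF a(3)[OF e]] a(5)[OF e] that])
  qed
  have t: "vert_trace S v (fst z) = trace_of v h" for v
    using H1(3) endpoint_range incident_E by (auto simp: trace_of_def vert_trace_def fun_eq_iff vert_idx_def)
  have z: "z \<in> op_dom S"
    unfolding op_dom_def mem_Collect_eq case_prod_beta t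
    using H1(1) a(7,8) L2d_snd[OF a(1)] by (auto simp: D_max_def all_idx_def)
  have "norm_d S (y - op_A S z) = 0"
    unfolding norm_d_null_iff[OF L2d_minus[OF a(2) op_A_L2d[OF z]]]
  proof (intro conjI ballI allI impI)
    fix e i assume e: "e \<in> net_E S" "i < edge_dim S e"
    have "AE t in leb (edge_length S e). \<forall>j\<in>{..<edge_dim S e}. wderiv (edge_length S e) (fst z (e, j)) t = d (e, j) t"
      using H1(2)[OF e(1)] by (intro AE_finite_allI) auto
    then show "AE t in leb (edge_length S e). fst (y - op_A S z) (e, i) t = 0"
      using a(6)[OF e] by eventually_elim (simp add: op_A_fst)
  next
    fix v assume v: "v \<in> net_V S"
    show "snd (y - op_A S z) v = 0" by (simp add: op_A_snd t a(9)[OF v])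
  qed
  then show "(z, y) \<in> {(z, y). z \<in> op_dom S \<and> y \<in> L2d S \<and> norm_d S (y - op_A S z) = 0}" using z a(2) by simp
qed

lemma net_relation_linear: "seminormed_space.linear_relation scale_d (L2d S) (norm_d S) net_relation"
proof -
  interpret semi_hilbert_space scale_d "L2d S" "norm_d S" "\<lambda>z w. Re (ip_d S z w)" by (rule semi_hilbert_L2d)
  show ?thesis
    unfolding linear_relation_def
  proof (intro conjI allI impI subsetI)
    fix p assume "p \<in> net_relation"
    then show "p \<in> L2d S \<times> L2d S" unfolding net_relation_def using solvesD(1,2) by (cases p) blast
  next
    show "(0, 0) \<in> net_relation" unfolding net_relation_def using solves_zero by blast
  next
    fix z y z' y' assume "(z, y) \<in> net_relation" "(z', y') \<in> net_relation"
    then obtain h d h' d' where "solves h d z y" "solves h' d' z' y'" unfolding net_relation_def by blast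
    from solves_add[OF this] show "(z + z', y + y') \<in> net_relation" unfolding net_relation_def by blast
  next
    fix c z y assume "(z, y) \<in> net_relation"
    then obtain h d where "solves h d z y" unfolding net_relation_def by blast
    from solves_scale[OF this, of c] show "(scale_d c z, scale_d c y) \<in> net_relation" unfolding net_relation_def by blast
  next
    fix z y z' y' assume "(z, y) \<in> net_relation" and n: "z' \<in> L2d S" "y' \<in> L2d S" "norm_d S (z - z') = 0" "norm_d S (y - y') = 0"
    then obtain h d where "solves h d z y" unfolding net_relation_def by blast
    from solves_null[OF this n(1,3,2,4)] show "(z', y') \<in> net_relation" unfolding net_relation_def by blast
  qed
qed

section \<open>Energy estimate on the edges\<close>

definition edge_flux :: "'e \<Rightarrow> ('e \<times> nat \<Rightarrow> real \<Rightarrow> complex) \<Rightarrow> real \<Rightarrow> complex" where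
  "edge_flux e h t = (\<Sum>i<edge_dim S e. \<Sum>k<edge_dim S e. pmat e i k t * h (e, k) t * cnj (h (e, i) t))"

text \<open>As \<open>Q M\<close> is Hermitian, twice the real part of \<open>Q M u' \<bullet> u\<close> is \<open>Q M u' \<bullet> u + Q M u \<bullet> u'\<close>, to which
  \<open>parts_estimate\<close> applies entry by entry.\<close>

lemma flux_estimate:
  assumes L: "\<And>i k. i < edge_dim S e \<Longrightarrow> k < edge_dim S e \<Longrightarrow> L-lipschitz_on {0..edge_length S e} (pmat e i k)" "L \<ge> 0"
    and e: "e \<in> net_E S"
    and h: "\<And>i. i < edge_dim S e \<Longrightarrow> primitive (edge_length S e) (d (e, i)) (h (e, i))"
    and d: "\<And>i. i < edge_dim S e \<Longrightarrow> d (e, i) \<in> L2_space (edge_length S e)"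
  shows "2 * Re (LINT t|leb (edge_length S e). (\<Sum>i<edge_dim S e. \<Sum>k<edge_dim S e. pmat e i k t * d (e, k) t * cnj (h (e, i) t)))
    \<le> Re (edge_flux e h (edge_length S e) - edge_flux e h 0) + L * real (edge_dim S e) * (\<Sum>i<edge_dim S e. L2_sq (edge_length S e) (h (e, i)))"
    "integrable (leb (edge_length S e)) (\<lambda>t. \<Sum>i<edge_dim S e. \<Sum>k<edge_dim S e. pmat e i k t * d (e, k) t * cnj (h (e, i) t))"
proof -
  let ?l = "edge_length S e" and ?n = "edge_dim S e"
  note l = length_pos[OF e]
  have pc: "continuous_on {0..?l} (pmat e i k)" if "i < ?n" "k < ?n" for i k
    by (rule lipschitz_on_continuous_on[OF L(1)[OF that]])
  have hL: "h (e, i) \<in> L2_space ?l" if "i < ?n" for i by (rule primitive_L2[OF h[OF that]])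
  have int1: "integrable (leb ?l) (\<lambda>t. pmat e i k t * (d (e, k) t * cnj (h (e, i) t)))" if ik: "i < ?n" "k < ?n" for i k
    by (intro integrable_leb_cont_mult pc ik L2_mult_integrable d L2_cnj hL)
  have int2: "integrable (leb ?l) (\<lambda>t. pmat e i k t * (h (e, k) t * cnj (d (e, i) t)))" if ik: "i < ?n" "k < ?n" for i k
    by (intro integrable_leb_cont_mult pc ik L2_mult_integrable d L2_cnj hL)
  have inth: "integrable (leb ?l) (\<lambda>t. cmod (h (e, k) t) * cmod (cnj (h (e, i) t)))" if ik: "i < ?n" "k < ?n" for i k
    using integrable_norm[OF L2_mult_integrable[OF hL[OF ik(2)] L2_cnj[OF hL[OF ik(1)]]]] by (simp add: norm_mult)
  show "integrable (leb ?l) (\<lambda>t. \<Sum>i<?n. \<Sum>k<?n. pmat e i k t * d (e, k) t * cnj (h (e, i) t))"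
    using int1 by (intro Bochner_Integration.integrable_sum) (auto simp: mult.assoc)
  (* the two halves of the product rule; Hermitian symmetry makes them conjugate *)
  define X where "X i k = (LINT t|leb ?l. pmat e i k t * (d (e, k) t * cnj (h (e, i) t)))" for i k
  define Y where "Y i k = (LINT t|leb ?l. pmat e i k t * (h (e, k) t * cnj (d (e, i) t)))" for i k
  have "(LINT t|leb ?l. (\<Sum>i<?n. \<Sum>k<?n. pmat e i k t * d (e, k) t * cnj (h (e, i) t))) = (LINT t|leb ?l. (\<Sum>i<?n. \<Sum>k<?n. pmat e i k t * (d (e, k) t * cnj (h (e, i) t))))"
    by (simp add: mult.assoc)
  also have "\<dots> = (\<Sum>i<?n. \<Sum>k<?n. X i k)"
  proof -
    have "(LINT t|leb ?l. (\<Sum>i<?n. \<Sum>k<?n. pmat e i k t * (d (e, k) t * cnj (h (e, i) t))))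
        = (\<Sum>i<?n. LINT t|leb ?l. (\<Sum>k<?n. pmat e i k t * (d (e, k) t * cnj (h (e, i) t))))"
      by (rule Bochner_Integration.integral_sum) (auto intro!: Bochner_Integration.integrable_sum int1)
    also have "\<dots> = (\<Sum>i<?n. \<Sum>k<?n. X i k)"
      unfolding X_def by (intro sum.cong refl Bochner_Integration.integral_sum int1) auto
    finally show ?thesis .
  qed
  finally have I: "(LINT t|leb ?l. (\<Sum>i<?n. \<Sum>k<?n. pmat e i k t * d (e, k) t * cnj (h (e, i) t))) = (\<Sum>i<?n. \<Sum>k<?n. X i k)" .
  have cnjI: "(LINT t|leb ?l. cnj (f t)) = cnj (LINT t|leb ?l. f t)" for f :: "real \<Rightarrow> complex"
    by simp
  have "cnj (X i k) = Y k i" if ik: "i < ?n" "k < ?n" for i k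
  proof -
    have "cnj (X i k) = (LINT t|leb ?l. cnj (pmat e i k t * (d (e, k) t * cnj (h (e, i) t))))"
      unfolding X_def by (rule cnjI[symmetric])
    also have "\<dots> = Y k i" unfolding Y_def
    proof (rule Bochner_Integration.integral_cong[OF refl])
      fix t assume "t \<in> space (leb ?l)"
      then have "t \<in> {0..?l}" by simp
      then show "cnj (pmat e i k t * (d (e, k) t * cnj (h (e, i) t))) = pmat e k i t * (h (e, i) t * cnj (d (e, k) t))"
        using pmat_herm[OF e _ ik] by simp
    qed
    finally show ?thesis .
  qed
  then have "cnj (\<Sum>i<?n. \<Sum>k<?n. X i k) = (\<Sum>i<?n. \<Sum>k<?n. Y k i)" by (simp add: cnj_sum)
  also have "\<dots> = (\<Sum>i<?n. \<Sum>k<?n. Y i k)" by (rule sum.swap)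
  finally have "(\<Sum>i<?n. \<Sum>k<?n. X i k) + cnj (\<Sum>i<?n. \<Sum>k<?n. X i k) = (\<Sum>i<?n. \<Sum>k<?n. X i k + Y i k)"
    by (simp add: sum.distrib)
  then have "2 * Re (\<Sum>i<?n. \<Sum>k<?n. X i k) = Re (\<Sum>i<?n. \<Sum>k<?n. X i k + Y i k)"
    by (metis complex_add_cnj Re_complex_of_real)
  moreover have "Re (X i k + Y i k) \<le> Re (pmat e i k ?l * h (e, k) ?l * cnj (h (e, i) ?l) - pmat e i k 0 * h (e, k) 0 * cnj (h (e, i) 0))
      + L * ((L2_sq ?l (h (e, k)) + L2_sq ?l (h (e, i))) / 2)" if ik: "i < ?n" "k < ?n" for i k
  proof -
    let ?B = "pmat e i k ?l * h (e, k) ?l * cnj (h (e, i) ?l) - pmat e i k 0 * h (e, k) 0 * cnj (h (e, i) 0)"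
    have "X i k + Y i k = (LINT t|leb ?l. pmat e i k t * (d (e, k) t * cnj (h (e, i) t)) + pmat e i k t * (h (e, k) t * cnj (d (e, i) t)))"
      unfolding X_def Y_def using int1[OF ik] int2[OF ik] by simp
    also have "\<dots> = integral {0..?l} (\<lambda>t. pmat e i k t * (d (e, k) t * cnj (h (e, i) t)) + pmat e i k t * (h (e, k) t * cnj (d (e, i) t)))"
      by (intro LINT_leb Bochner_Integration.integrable_add int1 int2 ik)
    also have "\<dots> = integral {0..?l} (\<lambda>t. pmat e i k t * (d (e, k) t * cnj (h (e, i) t) + h (e, k) t * cnj (d (e, i) t)))"
      by (simp add: distrib_left)
    finally have XY: "X i k + Y i k = integral {0..?l} (\<lambda>t. pmat e i k t * (d (e, k) t * cnj (h (e, i) t) + h (e, k) t * cnj (d (e, i) t)))" .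
    have "cmod (?B - (X i k + Y i k)) \<le> L * integral {0..?l} (\<lambda>t. cmod (h (e, k) t) * cmod (cnj (h (e, i) t)))"
      unfolding XY by (rule parts_estimate[OF l h[OF ik(2)] primitive_cnj[OF h[OF ik(1)]] L(1)[OF ik]])
    also have "\<dots> = L * (LINT t|leb ?l. cmod (h (e, k) t) * cmod (cnj (h (e, i) t)))"
      by (simp only: LINT_leb[OF inth[OF ik]])
    also have "\<dots> \<le> L * ((L2_sq ?l (h (e, k)) + L2_sq ?l (h (e, i))) / 2)"
    proof (rule mult_left_mono[OF _ L(2)])
      have "(LINT t|leb ?l. cmod (h (e, k) t) * cmod (cnj (h (e, i) t))) \<le> (LINT t|leb ?l. ((cmod (h (e, k) t))\<^sup>2 + (cmod (h (e, i) t))\<^sup>2) / 2)"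
      proof (rule integral_mono[OF inth[OF ik]])
        show "integrable (leb ?l) (\<lambda>t. ((cmod (h (e, k) t))\<^sup>2 + (cmod (h (e, i) t))\<^sup>2) / 2)"
          using L2_square_integrable[OF hL] ik by (intro integrable_divide Bochner_Integration.integrable_add) auto
        show "cmod (h (e, k) t) * cmod (cnj (h (e, i) t)) \<le> ((cmod (h (e, k) t))\<^sup>2 + (cmod (h (e, i) t))\<^sup>2) / 2" for t
          using two_mult_le_squares[of "cmod (h (e, k) t)" "cmod (h (e, i) t)"] by simp
      qed
      also have "\<dots> = (L2_sq ?l (h (e, k)) + L2_sq ?l (h (e, i))) / 2"
        unfolding L2_sq_def using L2_square_integrable[OF hL] ik by simp
      finally show "(LINT t|leb ?l. cmod (h (e, k) t) * cmod (cnj (h (e, i) t))) \<le> (L2_sq ?l (h (e, k)) + L2_sq ?l (h (e, i))) / 2" .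
    qed
    finally have "cmod (?B - (X i k + Y i k)) \<le> L * ((L2_sq ?l (h (e, k)) + L2_sq ?l (h (e, i))) / 2)" .
    moreover have "- Re (?B - (X i k + Y i k)) \<le> cmod (?B - (X i k + Y i k))"
      using abs_Re_le_cmod[of "?B - (X i k + Y i k)"] by linarith
    ultimately show ?thesis by simp
  qed
  then have "Re (\<Sum>i<?n. \<Sum>k<?n. X i k + Y i k) \<le> (\<Sum>i<?n. \<Sum>k<?n. Re (pmat e i k ?l * h (e, k) ?l * cnj (h (e, i) ?l) - pmat e i k 0 * h (e, k) 0 * cnj (h (e, i) 0))
      + L * ((L2_sq ?l (h (e, k)) + L2_sq ?l (h (e, i))) / 2))"
    unfolding Re_sum by (intro sum_mono) auto
  moreover have "(\<Sum>i<?n. \<Sum>k<?n. Re (pmat e i k ?l * h (e, k) ?l * cnj (h (e, i) ?l) - pmat e i k 0 * h (e, k) 0 * cnj (h (e, i) 0))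
      + L * ((L2_sq ?l (h (e, k)) + L2_sq ?l (h (e, i))) / 2))
     = Re (edge_flux e h ?l - edge_flux e h 0) + (\<Sum>i<?n. \<Sum>k<?n. L * ((L2_sq ?l (h (e, k)) + L2_sq ?l (h (e, i))) / 2))"
    unfolding edge_flux_def sum_subtractf[symmetric] Re_sum sum.distrib ..
  moreover have "(\<Sum>i<?n. \<Sum>k<?n. L * ((L2_sq ?l (h (e, k)) + L2_sq ?l (h (e, i))) / 2))
      = L * ((\<Sum>i<?n. \<Sum>k<?n. L2_sq ?l (h (e, k))) + (\<Sum>i<?n. \<Sum>k<?n. L2_sq ?l (h (e, i)))) / 2"
    by (simp only: sum_distrib_left[symmetric] sum_divide_distrib[symmetric] sum.distrib times_divide_eq_right)
  moreover have "\<dots> = L * real ?n * (\<Sum>i<?n. L2_sq ?l (h (e, i)))"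
    by (simp add: sum_distrib_left[symmetric])
  ultimately show "2 * Re (LINT t|leb ?l. (\<Sum>i<?n. \<Sum>k<?n. pmat e i k t * d (e, k) t * cnj (h (e, i) t)))
    \<le> Re (edge_flux e h ?l - edge_flux e h 0) + L * real ?n * (\<Sum>i<?n. L2_sq ?l (h (e, i)))"
    unfolding I by linarith
qed

end


context hyperbolic_network
begin

text \<open>Every edge contributes to its two end vertices with opposite signs of the incidence number; absence
  of loops makes the two ends distinct.\<close>

lemma vertex_flux_sum:
  "(\<Sum>v\<in>net_V S. Re (vert_ip S v (vert_T S v (trace_of v h)) (trace_of v h)))
   = (\<Sum>e\<in>net_E S. Re (edge_flux e h (edge_length S e) - edge_flux e h 0))"
proof -
  have 1: "vert_ip S v (vert_T S v (trace_of v h)) (trace_of v h)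
      = (\<Sum>e\<in>incident S v. incidence S v e * edge_flux e h (endpoint S v e))" for v
  proof -
    have "vert_ip S v (vert_T S v (trace_of v h)) (trace_of v h)
      = (\<Sum>(e, i)\<in>vert_idx S v. vert_T S v (trace_of v h) (e, i) * cnj (trace_of v h (e, i)))"
      by (simp add: herm_ip_def split_beta)
    also have "\<dots> = (\<Sum>e\<in>incident S v. \<Sum>i<edge_dim S e. vert_T S v (trace_of v h) (e, i) * cnj (trace_of v h (e, i)))"
      unfolding vert_idx_def incident_def using finite_E by (intro sum.Sigma[symmetric]) auto
    also have "\<dots> = (\<Sum>e\<in>incident S v. incidence S v e * edge_flux e h (endpoint S v e))"
    proof (rule sum.cong[OF refl])
      fix e assume e: "e \<in> incident S v"
      note eE = incident_E[OF e]
      let ?t = "endpoint S v e"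
      have idx: "(e, i) \<in> vert_idx S v" if "i < edge_dim S e" for i using e that by (simp add: vert_idx_def)
      have "(\<Sum>i<edge_dim S e. vert_T S v (trace_of v h) (e, i) * cnj (trace_of v h (e, i)))
         = (\<Sum>i<edge_dim S e. \<Sum>k<edge_dim S e. incidence S v e * (pmat e i k ?t * h (e, k) ?t * cnj (h (e, i) ?t)))"
      proof (rule sum.cong[OF refl])
        fix i assume "i \<in> {..<edge_dim S e}"
        then have i: "i < edge_dim S e" by simp
        have "vert_T S v (trace_of v h) (e, i) = (\<Sum>k<edge_dim S e. incidence S v e * (pmat e i k ?t * h (e, k) ?t))"
          unfolding vert_T_def using idx[OF i]
        proof (simp, intro sum.cong refl)
          fix k assume "k \<in> {..<edge_dim S e}"
          then have k: "k < edge_dim S e" by simp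
          show "(coef_Q S e ?t * coef_M S e ?t) $$ (i, k) * incidence S v e * trace_of v h (e, k) = incidence S v e * (pmat e i k ?t * h (e, k) ?t)"
            using pmat_eq[OF eE endpoint_range[OF eE] i k, of v] idx[OF k] by (simp add: trace_of_def)
        qed
        then show "vert_T S v (trace_of v h) (e, i) * cnj (trace_of v h (e, i)) = (\<Sum>k<edge_dim S e. incidence S v e * (pmat e i k ?t * h (e, k) ?t * cnj (h (e, i) ?t)))"
          using idx[OF i] by (simp add: trace_of_def sum_distrib_right mult.assoc)
      qed
      then show "(\<Sum>i<edge_dim S e. vert_T S v (trace_of v h) (e, i) * cnj (trace_of v h (e, i))) = incidence S v e * edge_flux e h ?t"
        by (simp add: edge_flux_def sum_distrib_left)
    qed
    finally show ?thesis .
  qed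
  let ?F = "\<lambda>v e. Re (incidence S v e * edge_flux e h (endpoint S v e))"
  have "(\<Sum>v\<in>net_V S. Re (vert_ip S v (vert_T S v (trace_of v h)) (trace_of v h))) = (\<Sum>v\<in>net_V S. \<Sum>e\<in>{e \<in> net_E S. v = tail (net_graph S) e \<or> v = head (net_graph S) e}. ?F v e)"
    unfolding 1 Re_sum incident_def ..
  also have "\<dots> = (\<Sum>e\<in>net_E S. \<Sum>v\<in>{v \<in> net_V S. v = tail (net_graph S) e \<or> v = head (net_graph S) e}. ?F v e)"
    by (rule sum.swap_restrict[OF finite_V finite_E])
  also have "\<dots> = (\<Sum>e\<in>net_E S. Re (edge_flux e h (edge_length S e) - edge_flux e h 0))"
  proof (rule sum.cong[OF refl])
    fix e assume e: "e \<in> net_E S"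
    have "{v \<in> net_V S. v = tail (net_graph S) e \<or> v = head (net_graph S) e} = {tail (net_graph S) e, head (net_graph S) e}"
      using ends_in_V[OF e] by auto
    then have "(\<Sum>v\<in>{v \<in> net_V S. v = tail (net_graph S) e \<or> v = head (net_graph S) e}. ?F v e) = ?F (tail (net_graph S) e) e + ?F (head (net_graph S) e) e"
      using ends_distinct[OF e] by simp
    also have "\<dots> = Re (edge_flux e h (edge_length S e) - edge_flux e h 0)"
      using ends_distinct[OF e] by (simp add: incidence_def endpoint_def)
    finally show "(\<Sum>v\<in>{v \<in> net_V S. v = tail (net_graph S) e \<or> v = head (net_graph S) e}. ?F v e) = Re (edge_flux e h (edge_length S e) - edge_flux e h 0)" .
  qed
  finally show ?thesis .
qed

text \<open>The zeroth order term \<open>N u\<close> and the error in \<open>flux_estimate\<close> are both of the size of the squared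
  norm of \<open>u\<close>.\<close>

lemma edge_energy:
  "\<exists>C\<ge>0. \<forall>e\<in>net_E S. \<forall>h d z y. solves h d z y \<longrightarrow>
     (LINT t|leb (edge_length S e). Re (qform e t (\<lambda>j. fst y (e, j) t) (\<lambda>i. fst z (e, i) t)))
     \<le> Re (edge_flux e h (edge_length S e) - edge_flux e h 0) / 2 + C * (\<Sum>i<edge_dim S e. L2_sq (edge_length S e) (fst z (e, i)))"
  (is "\<exists>C\<ge>0. \<forall>e\<in>net_E S. ?P e C")
proof (rule finite_uniform_bound[OF finite_E])
  fix e assume e: "e \<in> net_E S"
  let ?l = "edge_length S e" and ?n = "edge_dim S e"
  obtain L where L: "L \<ge> 0" "\<And>i k. i < ?n \<Longrightarrow> k < ?n \<Longrightarrow> L-lipschitz_on {0..?l} (pmat e i k)"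
    using pmat_lipschitz e by blast
  obtain KQ where KQ: "KQ \<ge> 0" "\<And>i j x. i < ?n \<Longrightarrow> j < ?n \<Longrightarrow> x \<in> {0..?l} \<Longrightarrow> cmod (coef_Q S e x $$ (i, j)) \<le> KQ"
    using Q_bounded e by blast
  obtain KN where KN: "KN \<ge> 0" "\<And>i j. i < ?n \<Longrightarrow> j < ?n \<Longrightarrow> AE x in leb ?l. cmod (coef_N S e x $$ (i, j)) \<le> KN"
    using N_bounded e by blast
  define K where "K = real ?n * (KQ * KN)"
  have K: "K \<ge> 0" using KQ(1) KN(1) by (simp add: K_def)
  have "(LINT t|leb ?l. Re (qform e t (\<lambda>j. fst y (e, j) t) (\<lambda>i. fst z (e, i) t)))
     \<le> Re (edge_flux e h ?l - edge_flux e h 0) / 2 + (L * real ?n / 2 + K * real ?n) * (\<Sum>i<?n. L2_sq ?l (fst z (e, i)))"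
    if s: "solves h d z y" for h d z y
  proof -
    note a = solvesD[OF s]
    let ?S1 = "\<lambda>t. \<Sum>i<?n. \<Sum>k<?n. pmat e i k t * d (e, k) t * cnj (h (e, i) t)"
    let ?q = "\<lambda>t. qform e t (\<lambda>j. fst y (e, j) t) (\<lambda>i. fst z (e, i) t)"
    have hL: "h (e, i) \<in> L2_space ?l" if "i < ?n" for i
      by (rule primitive_L2[OF a(3)[OF e that]])
    note fl = flux_estimate[where e = e and h = h and d = d and L = L, OF L(2,1) e a(3)[OF e] a(4)[OF e]]
    have iq: "integrable (leb ?l) ?q" by (rule qform_L2d_integrable[OF a(2,1) e])
    have Nae: "AE t in leb ?l. \<forall>j\<in>{..<?n}. \<forall>k\<in>{..<?n}. cmod (coef_N S e t $$ (j, k)) \<le> KN"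
      using KN(2) by (intro AE_finite_allI) auto
    have hae: "AE t in leb ?l. \<forall>i\<in>{..<?n}. h (e, i) t = fst z (e, i) t"
      using a(5)[OF e] by (intro AE_finite_allI) auto
    have yae: "AE t in leb ?l. \<forall>i\<in>{..<?n}. fst y (e, i) t =
          (\<Sum>j<?n. coef_M S e t $$ (i, j) * d (e, j) t) + (\<Sum>j<?n. coef_N S e t $$ (i, j) * fst z (e, j) t)"
      using a(6)[OF e] by (intro AE_finite_allI) auto
    have "AE t in leb ?l. Re (?q t - ?S1 t) \<le> K * real ?n * (\<Sum>i<?n. (cmod (fst z (e, i) t))\<^sup>2)"
      using Nae hae yae AE_space
    proof eventually_elim
      case (elim t)
      then have t: "t \<in> {0..?l}" by simp
      define A where "A i k = (\<Sum>j<?n. coef_Q S e t $$ (i, j) * coef_N S e t $$ (j, k))" for i k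
      have swap: "(\<Sum>j<?n. coef_Q S e t $$ (i, j) * (\<Sum>k<?n. X j k * \<xi> k)) = (\<Sum>k<?n. (\<Sum>j<?n. coef_Q S e t $$ (i, j) * X j k) * \<xi> k)"
        for i and X :: "nat \<Rightarrow> nat \<Rightarrow> complex" and \<xi>
        unfolding sum_distrib_left sum_distrib_right by (subst sum.swap) (simp add: mult.assoc)
      have "?q t = (\<Sum>i<?n. (\<Sum>j<?n. coef_Q S e t $$ (i, j) * ((\<Sum>k<?n. coef_M S e t $$ (j, k) * d (e, k) t) + (\<Sum>k<?n. coef_N S e t $$ (j, k) * fst z (e, k) t))) * cnj (fst z (e, i) t))"
        unfolding qform_def using elim(3) by (intro sum.cong refl arg_cong2[where f = "(*)"]) auto
      also have "\<dots> = (\<Sum>i<?n. ((\<Sum>k<?n. pmat e i k t * d (e, k) t) + (\<Sum>k<?n. A i k * fst z (e, k) t)) * cnj (fst z (e, i) t))"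
        unfolding distrib_left sum.distrib swap pmat_def A_def ..
      also have "\<dots> = (\<Sum>i<?n. (\<Sum>k<?n. pmat e i k t * d (e, k) t) * cnj (fst z (e, i) t)) + (\<Sum>i<?n. (\<Sum>k<?n. A i k * fst z (e, k) t) * cnj (fst z (e, i) t))"
        by (simp only: distrib_right sum.distrib)
      also have "(\<Sum>i<?n. (\<Sum>k<?n. pmat e i k t * d (e, k) t) * cnj (fst z (e, i) t)) = ?S1 t"
        unfolding sum_distrib_right using elim(2) by (intro sum.cong refl) auto
      finally have "?q t - ?S1 t = (\<Sum>i<?n. (\<Sum>k<?n. A i k * fst z (e, k) t) * cnj (fst z (e, i) t))" by simp
      moreover have "cmod \<dots> \<le> K * real ?n * (\<Sum>i<?n. (cmod (fst z (e, i) t))\<^sup>2)"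
      proof (rule matrix_form_bound[OF _ K])
        fix i k assume ik: "i < ?n" "k < ?n"
        have "cmod (A i k) \<le> (\<Sum>j<?n. KQ * KN)"
          unfolding A_def
        proof (intro sum_norm_le)
          fix j assume "j \<in> {..<?n}"
          then show "cmod (coef_Q S e t $$ (i, j) * coef_N S e t $$ (j, k)) \<le> KQ * KN"
            unfolding norm_mult using KQ(2)[OF ik(1) _ t, of j] elim(1) ik KQ(1) by (intro mult_mono) auto
        qed
        then show "cmod (A i k) \<le> K" by (simp add: K_def)
      qed
      ultimately show ?case using complex_Re_le_cmod[of "?q t - ?S1 t"] by simp
    qed
    then have "(LINT t|leb ?l. Re (?q t - ?S1 t)) \<le> (LINT t|leb ?l. K * real ?n * (\<Sum>i<?n. (cmod (fst z (e, i) t))\<^sup>2))"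
      by (intro integral_mono_AE integrable_Re Bochner_Integration.integrable_diff iq fl(2) integrable_mult_right integral_sum_squares(1)[OF a(1) e])
    also have "\<dots> = K * real ?n * (\<Sum>i<?n. L2_sq ?l (fst z (e, i)))"
      unfolding integral_sum_squares(2)[OF a(1) e, symmetric] by simp
    finally have 1: "(LINT t|leb ?l. Re (?q t - ?S1 t)) \<le> K * real ?n * (\<Sum>i<?n. L2_sq ?l (fst z (e, i)))" .
    have "(\<Sum>i<?n. L2_sq ?l (h (e, i))) = (\<Sum>i<?n. L2_sq ?l (fst z (e, i)))"
      using L2_sq_cong_AE[OF hL L2d_fst[OF a(1) e] a(5)[OF e]] by (intro sum.cong refl) auto
    then have 2: "2 * Re (LINT t|leb ?l. ?S1 t) \<le> Re (edge_flux e h ?l - edge_flux e h 0) + L * real ?n * (\<Sum>i<?n. L2_sq ?l (fst z (e, i)))"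
      using fl(1) by simp
    have "(LINT t|leb ?l. Re (?q t)) = (LINT t|leb ?l. Re (?q t - ?S1 t)) + Re (LINT t|leb ?l. ?S1 t)"
    proof -
      have "(LINT t|leb ?l. Re (?q t)) = (LINT t|leb ?l. Re (?q t - ?S1 t) + Re (?S1 t))"
        by (simp only: minus_complex.sel diff_add_cancel)
      also have "\<dots> = (LINT t|leb ?l. Re (?q t - ?S1 t)) + (LINT t|leb ?l. Re (?S1 t))"
        by (intro Bochner_Integration.integral_add integrable_Re Bochner_Integration.integrable_diff iq fl(2))
      also have "(LINT t|leb ?l. Re (?S1 t)) = Re (LINT t|leb ?l. ?S1 t)" by (rule integral_Re[OF fl(2)])
      finally show ?thesis .
    qed
    moreover have "(L * real ?n / 2 + K * real ?n) * (\<Sum>i<?n. L2_sq ?l (fst z (e, i)))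
        = (L * real ?n * (\<Sum>i<?n. L2_sq ?l (fst z (e, i)))) / 2 + K * real ?n * (\<Sum>i<?n. L2_sq ?l (fst z (e, i)))"
      by (simp add: algebra_simps)
    ultimately show ?thesis using 1 2 by linarith
  qed
  then show "\<exists>C. ?P e C" by blast
next
  fix e :: 'e and C C' :: real
  assume *: "?P e C" and "C \<le> C'"
  show "?P e C'"
  proof (intro allI impI)
    fix h d z y assume s: "solves h d z y"
    have "C * (\<Sum>i<edge_dim S e. L2_sq (edge_length S e) (fst z (e, i))) \<le> C' * (\<Sum>i<edge_dim S e. L2_sq (edge_length S e) (fst z (e, i)))"
      using \<open>C \<le> C'\<close> by (intro mult_right_mono sum_nonneg L2_sq_nonneg)
    then show "(LINT t|leb (edge_length S e). Re (qform e t (\<lambda>j. fst y (e, j) t) (\<lambda>i. fst z (e, i) t)))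
     \<le> Re (edge_flux e h (edge_length S e) - edge_flux e h 0) / 2 + C' * (\<Sum>i<edge_dim S e. L2_sq (edge_length S e) (fst z (e, i)))"
      using *[rule_format, OF s] by linarith
  qed
qed

lemma vert_C_bound: "\<exists>K\<ge>0. \<forall>v\<in>net_V S. \<forall>x\<in>vert_Yd S v. Re (vb v (vert_C S v x) x) \<le> K * Re (vb v x x)"
proof (rule finite_uniform_bound[OF finite_V])
  fix v assume v: "v \<in> net_V S"
  obtain K where "\<forall>x\<in>vert_Yd S v. cmod (vb v (vert_C S v x) x) \<le> K * Re (vb v x x)"
    using herm_form.linear_form_bound[OF vb_herm_form[OF v] C_linear[OF v]] by blast
  then show "\<exists>K. \<forall>x\<in>vert_Yd S v. Re (vb v (vert_C S v x) x) \<le> K * Re (vb v x x)"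
    using complex_Re_le_cmod order_trans by blast
next
  fix v K K' assume v: "v \<in> net_V S" and *: "\<forall>x\<in>vert_Yd S v. Re (vb v (vert_C S v x) x) \<le> K * Re (vb v x x)" and "K \<le> (K' :: real)"
  show "\<forall>x\<in>vert_Yd S v. Re (vb v (vert_C S v x) x) \<le> K' * Re (vb v x x)"
  proof
    fix x assume x: "x \<in> vert_Yd S v"
    have "K * Re (vb v x x) \<le> K' * Re (vb v x x)"
      using \<open>K \<le> K'\<close> herm_form.b_nonneg[OF vb_herm_form[OF v] x] by (rule mult_right_mono)
    then show "Re (vb v (vert_C S v x) x) \<le> K' * Re (vb v x x)" using * x by fastforce
  qed
qed

text \<open>The edge fluxes reassemble into the forms of \<open>T_v\<close>, and half of the cone condition cancels them
  against the vertex terms. What remains is bounded by a multiple of the energy.\<close>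

lemma quasi_dissipative:
  assumes cone: "\<And>v \<xi>. v \<in> net_V S \<Longrightarrow> \<xi> \<in> vert_Y S v \<Longrightarrow>
     Re (vert_ip S v (vert_T S v \<xi>) \<xi>) + 2 * Re (vert_ip S v (vert_Q S v (vert_B S v \<xi>)) \<xi>)
             - \<Lambda> * Re (vert_ip S v (vert_Q S v (proj_d S v \<xi>)) (proj_d S v \<xi>)) \<le> 0" and "\<Lambda> \<ge> 0"
  shows "\<exists>w. \<forall>h d z y. solves h d z y \<longrightarrow> Re (ip_d S y z) \<le> w * Re (ip_d S z z)"
proof -
  obtain C where C: "C \<ge> 0" "\<And>e h d z y. e \<in> net_E S \<Longrightarrow> solves h d z y \<Longrightarrow>
     (LINT t|leb (edge_length S e). Re (qform e t (\<lambda>j. fst y (e, j) t) (\<lambda>i. fst z (e, i) t)))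
     \<le> Re (edge_flux e h (edge_length S e) - edge_flux e h 0) / 2 + C * (\<Sum>i<edge_dim S e. L2_sq (edge_length S e) (fst z (e, i)))"
    using edge_energy by blast
  obtain K where K: "K \<ge> 0" "\<And>v x. v \<in> net_V S \<Longrightarrow> x \<in> vert_Yd S v \<Longrightarrow> Re (vb v (vert_C S v x) x) \<le> K * Re (vb v x x)"
    using vert_C_bound by blast
  obtain q where q: "q > 0" "\<And>z. z \<in> L2d S \<Longrightarrow> q * edge_sq z + vert_sq z \<le> Re (ip_d S z z)" using norm_lower by blast
  (* C / q pays for the edge terms, the other summand for the vertex terms *)
  define w where "w = C / q + (\<Lambda> / 2 + K)"
  have "Re (ip_d S y z) \<le> w * Re (ip_d S z z)" if s: "solves h d z y" for h d z y
  proof -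
    note a = solvesD[OF s]
    let ?T = "\<lambda>v. Re (vert_ip S v (vert_T S v (trace_of v h)) (trace_of v h))"
    have vert: "Re (vb v (snd y v) (snd z v)) \<le> (\<Lambda> / 2 + K) * Re (vb v (snd z v) (snd z v)) - ?T v / 2" if v: "v \<in> net_V S" for v
    proof -
      let ?g = "trace_of v h" and ?x = "snd z v"
      have x: "?x \<in> vert_Yd S v" by (rule L2d_snd[OF a(1) v])
      have B: "vert_B S v ?g \<in> vert_Yd S v" by (rule linear_between_mem[OF B_linear[OF v] a(7)[OF v]])
      have Cx: "vert_C S v ?x \<in> vert_Yd S v" by (rule linear_between_mem[OF C_linear[OF v] x])
      have QB: "vert_Q S v (vert_B S v ?g) \<in> vert_Yd S v" by (rule linear_between_mem[OF Qv_linear[OF v] B])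
      have "vb v (vert_B S v ?g) ?x = vert_ip S v (vert_Q S v (vert_B S v ?g)) ?g"
        unfolding vb_def a(8)[OF v] proj_d_def
        by (rule orth_projector_herm_ip[OF finite_vert_idx Yd_sub[OF v] Yd_coord[OF v] trace_of_coord QB])
      moreover have "vb v (snd y v) ?x = vb v (vert_B S v ?g) ?x + vb v (vert_C S v ?x) ?x"
        unfolding a(9)[OF v] by (rule herm_form.b_add[OF vb_herm_form[OF v] B Cx x])
      moreover have "Re (vert_ip S v (vert_Q S v (vert_B S v ?g)) ?g) \<le> \<Lambda> / 2 * Re (vb v ?x ?x) - ?T v / 2"
        using cone[OF v a(7)[OF v]] unfolding vb_def a(8)[OF v] by simp
      ultimately show ?thesis using K(2)[OF v x] by (simp add: algebra_simps)
    qed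
    have "Re (ip_d S y z) \<le> (\<Sum>e\<in>net_E S. Re (edge_flux e h (edge_length S e) - edge_flux e h 0) / 2 + C * (\<Sum>i<edge_dim S e. L2_sq (edge_length S e) (fst z (e, i))))
       + (\<Sum>v\<in>net_V S. (\<Lambda> / 2 + K) * Re (vb v (snd z v) (snd z v)) - ?T v / 2)"
      unfolding Re_ip_d[OF a(2,1)] by (intro add_mono sum_mono C(2)[OF _ s] vert)
    also have "\<dots> = (\<Sum>e\<in>net_E S. Re (edge_flux e h (edge_length S e) - edge_flux e h 0)) / 2 + C * edge_sq z
       + ((\<Lambda> / 2 + K) * vert_sq z - (\<Sum>v\<in>net_V S. ?T v) / 2)"
      by (simp only: sum.distrib sum_subtractf sum_distrib_left[symmetric] sum_divide_distrib[symmetric] edge_sq_def vert_sq_def)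
    also have "\<dots> = C * edge_sq z + (\<Lambda> / 2 + K) * vert_sq z" unfolding vertex_flux_sum by simp
    also have "\<dots> \<le> w * (q * edge_sq z + vert_sq z)"
    proof -
      have "w * (q * edge_sq z + vert_sq z) = C * edge_sq z + (\<Lambda> / 2 + K) * vert_sq z + ((\<Lambda> / 2 + K) * (q * edge_sq z) + C / q * vert_sq z)"
        using q(1) by (simp add: w_def field_simps)
      moreover have "0 \<le> (\<Lambda> / 2 + K) * (q * edge_sq z)" "0 \<le> C / q * vert_sq z"
        using q(1) K(1) C(1) \<open>\<Lambda> \<ge> 0\<close> edge_sq_nonneg[of z] vert_sq_nonneg[OF a(1)] by auto
      ultimately show ?thesis by linarith
    qed
    also have "\<dots> \<le> w * Re (ip_d S z z)"
      using q K(1) C(1) \<open>\<Lambda> \<ge> 0\<close> a(1) by (intro mult_left_mono) (auto simp: w_def)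
    finally show ?thesis .
  qed
  then show ?thesis by blast
qed

section \<open>The resolvent equation\<close>

text \<open>Multiplication by the inverse of \<open>M\<close> gives a linear differential equation with bounded measurable
  coefficients.\<close>

lemma edge_resolvent_equation:
  fixes l :: complex
  assumes e: "e \<in> net_E S" and f: "\<And>i. i < edge_dim S e \<Longrightarrow> f i \<in> L2_space (edge_length S e)"
  shows "\<exists>u d. \<forall>i<edge_dim S e. primitive (edge_length S e) (d i) (u i) \<and> d i \<in> L2_space (edge_length S e) \<and> u i 0 = K i \<and>
     (\<forall>t\<in>{0..edge_length S e}. (\<Sum>j<edge_dim S e. coef_M S e t $$ (i, j) * d j t) + (\<Sum>j<edge_dim S e. coef_N S e t $$ (i, j) * u j t) = l * u i t - f i t)"
proof -
  let ?l = "edge_length S e" and ?n = "edge_dim S e"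
  obtain R :: "nat \<Rightarrow> nat \<Rightarrow> real \<Rightarrow> complex" where R: "\<And>i j. i < ?n \<Longrightarrow> j < ?n \<Longrightarrow> continuous_on {0..?l} (R i j)"
    "\<And>i j x. i < ?n \<Longrightarrow> j < ?n \<Longrightarrow> x \<in> {0..?l} \<Longrightarrow> (\<Sum>k<?n. coef_M S e x $$ (i, k) * R k j x) = (if i = j then 1 else 0)"
    by (rule continuous_inverse_mat[of "{0..?l}" "coef_M S e" ?n]) (use M_carrier[OF e] M_invertible[OF e] M_continuous[OF e] in auto)
  obtain KN where KN: "KN \<ge> 0" "\<And>i j. i < ?n \<Longrightarrow> j < ?n \<Longrightarrow> AE x in leb ?l. cmod (coef_N S e x $$ (i, j)) \<le> KN"
    using N_bounded e by blast
  have Rb: "\<exists>K\<ge>0. \<forall>z\<in>{..<?n} \<times> {..<?n}. \<forall>x\<in>{0..?l}. cmod (R (fst z) (snd z) x) \<le> K"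
  proof (rule finite_uniform_bound)
    fix z assume "z \<in> {..<?n} \<times> {..<?n}"
    then have "continuous_on {0..?l} (R (fst z) (snd z))" by (intro R(1)) auto
    then show "\<exists>K. \<forall>x\<in>{0..?l}. cmod (R (fst z) (snd z) x) \<le> K" using continuous_interval_bounded by metis
  qed (auto intro: order_trans)
  then obtain KR where KR: "KR \<ge> 0" "\<And>i j x. i < ?n \<Longrightarrow> j < ?n \<Longrightarrow> x \<in> {0..?l} \<Longrightarrow> cmod (R i j x) \<le> KR" by auto
  define \<delta> :: "nat \<Rightarrow> nat \<Rightarrow> complex" where "\<delta> k j = (if k = j then l else 0)" for k j
  define A where "A i j t = (\<Sum>k<?n. R i k t * (\<delta> k j - coef_N S e t $$ (k, j)))" for i j t
  define g where "g i t = - (\<Sum>k<?n. R i k t * f k t)" for i t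
  have Rm: "R i k \<in> borel_measurable (leb ?l)" if "i < ?n" "k < ?n" for i k
    by (rule measurable_leb_continuous[OF R(1)[OF that]])
  have Am: "A i j \<in> borel_measurable (leb ?l)" if ij: "i < ?n" "j < ?n" for i j
    unfolding A_def[abs_def] using Rm[OF ij(1)] N_measurable[OF e _ ij(2)]
    by (intro borel_measurable_sum borel_measurable_times borel_measurable_diff borel_measurable_const) auto
  have Ab: "AE t in leb ?l. cmod (A i j t) \<le> real ?n * (KR * (cmod l + KN))" if ij: "i < ?n" "j < ?n" for i j
  proof -
    have "AE t in leb ?l. \<forall>k\<in>{..<?n}. cmod (coef_N S e t $$ (k, j)) \<le> KN"
      using KN(2) ij by (intro AE_finite_allI) auto
    then show ?thesis using AE_space
    proof eventually_elim
      case (elim t)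
      have "cmod (A i j t) \<le> (\<Sum>k<?n. KR * (cmod l + KN))"
        unfolding A_def
      proof (intro sum_norm_le)
        fix k assume k: "k \<in> {..<?n}"
        have "cmod (\<delta> k j - coef_N S e t $$ (k, j)) \<le> cmod (\<delta> k j) + cmod (coef_N S e t $$ (k, j))" by (rule norm_triangle_ineq4)
        also have "\<dots> \<le> cmod l + KN" using elim k by (intro add_mono) (auto simp: \<delta>_def)
        finally show "cmod (R i k t * (\<delta> k j - coef_N S e t $$ (k, j))) \<le> KR * (cmod l + KN)"
          unfolding norm_mult using KR ij k elim by (intro mult_mono) auto
      qed
      then show ?case by simp
    qed
  qed
  have gL: "g i \<in> L2_space ?l" if i: "i < ?n" for i
  proof -
    have "(\<lambda>t. -1 * (\<Sum>k<?n. R i k t * f k t)) \<in> L2_space ?l"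
    proof (intro L2_cmult L2_sum)
      fix k assume "k \<in> {..<?n}"
      then show "(\<lambda>t. R i k t * f k t) \<in> L2_space ?l"
        using KR(2)[OF i] by (intro L2_bounded_mult[OF f Rm[OF i], of _ _ KR] AE_I2) auto
    qed
    then show ?thesis by (simp add: g_def[abs_def])
  qed
  have "\<exists>u. \<forall>i<?n. primitive ?l (\<lambda>x. (\<Sum>j<?n. A i j x * u j x) + g i x) (u i) \<and> u i 0 = K i"
    by (rule linear_ode[OF length_pos[OF e] Am Ab L2_integrable[OF gL]])
  then obtain u where u: "\<And>i. i < ?n \<Longrightarrow> primitive ?l (\<lambda>x. (\<Sum>j<?n. A i j x * u j x) + g i x) (u i)" "\<And>i. i < ?n \<Longrightarrow> u i 0 = K i"
    by blast
  define d where "d i x = (\<Sum>j<?n. A i j x * u j x) + g i x" for i x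
  have uL: "u j \<in> L2_space ?l" if "j < ?n" for j by (rule primitive_L2[OF u(1)[OF that]])
  have "primitive ?l (d i) (u i) \<and> d i \<in> L2_space ?l \<and> u i 0 = K i \<and>
     (\<forall>t\<in>{0..?l}. (\<Sum>j<?n. coef_M S e t $$ (i, j) * d j t) + (\<Sum>j<?n. coef_N S e t $$ (i, j) * u j t) = l * u i t - f i t)" if i: "i < ?n" for i
  proof (intro conjI ballI)
    show "primitive ?l (d i) (u i)" unfolding d_def[abs_def] by (rule u(1)[OF i])
    show "d i \<in> L2_space ?l" unfolding d_def[abs_def]
      by (intro L2_add L2_sum gL i L2_bounded_mult[OF uL Am[OF i] Ab[OF i]]) auto
    show "u i 0 = K i" by (rule u(2)[OF i])
    fix t assume t: "t \<in> {0..?l}"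
    define W where "W k = l * u k t - (\<Sum>j<?n. coef_N S e t $$ (k, j) * u j t) - f k t" for k
    have dW: "d j t = (\<Sum>k<?n. R j k t * W k)" if j: "j < ?n" for j
    proof -
      have "(\<Sum>m<?n. A j m t * u m t) = (\<Sum>m<?n. \<Sum>k<?n. R j k t * ((\<delta> k m - coef_N S e t $$ (k, m)) * u m t))"
        by (simp add: A_def sum_distrib_right mult.assoc)
      also have "\<dots> = (\<Sum>k<?n. R j k t * (\<Sum>m<?n. (\<delta> k m - coef_N S e t $$ (k, m)) * u m t))"
        by (subst sum.swap) (simp add: sum_distrib_left)
      also have "\<dots> = (\<Sum>k<?n. R j k t * (l * u k t - (\<Sum>m<?n. coef_N S e t $$ (k, m) * u m t)))"
      proof (intro sum.cong refl)
        fix k assume k: "k \<in> {..<?n}"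
        have "(\<Sum>m<?n. \<delta> k m * u m t) = (\<Sum>m<?n. if k = m then l * u m t else 0)"
          by (intro sum.cong) (auto simp: \<delta>_def)
        then have "(\<Sum>m<?n. \<delta> k m * u m t) = l * u k t" using k by (simp add: sum.delta)
        then show "R j k t * (\<Sum>m<?n. (\<delta> k m - coef_N S e t $$ (k, m)) * u m t) = R j k t * (l * u k t - (\<Sum>m<?n. coef_N S e t $$ (k, m) * u m t))"
          by (simp add: left_diff_distrib sum_subtractf)
      qed
      finally show ?thesis unfolding d_def g_def W_def by (simp add: right_diff_distrib sum_subtractf)
    qed
    have "(\<Sum>j<?n. coef_M S e t $$ (i, j) * d j t) = (\<Sum>j<?n. coef_M S e t $$ (i, j) * (\<Sum>k<?n. R j k t * W k))"
      using dW by (intro sum.cong refl) auto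
    also have "\<dots> = (\<Sum>k<?n. (\<Sum>j<?n. coef_M S e t $$ (i, j) * R j k t) * W k)"
      unfolding sum_distrib_left sum_distrib_right by (subst sum.swap) (simp add: mult.assoc)
    also have "\<dots> = (\<Sum>k<?n. if i = k then W k else 0)"
      using R(2)[OF i _ t] by (intro sum.cong refl) auto
    also have "\<dots> = W i" using i by (simp add: sum.delta)
    finally show "(\<Sum>j<?n. coef_M S e t $$ (i, j) * d j t) + (\<Sum>j<?n. coef_N S e t $$ (i, j) * u j t) = l * u i t - f i t"
      by (simp add: W_def)
  qed
  then show ?thesis by blast
qed

definition proj_Y :: "'v \<Rightarrow> ('e \<times> nat \<Rightarrow> complex) \<Rightarrow> 'e \<times> nat \<Rightarrow> complex" where
  "proj_Y v = orth_projector (vert_idx S v) (vert_Y S v)"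

text \<open>All vertex conditions in one vector: for \<open>g\<close> in \<open>Y_v^(d)\<close>, the equation \<open>boundary_op l v \<xi> = g\<close> says
  that \<open>\<xi>\<close> lies in \<open>Y_v\<close> and that \<open>l P^(d) \<xi> - B \<xi> - C P^(d) \<xi> = g\<close>. The projection in front of \<open>B\<close>
  makes the operator linear on all vertex values.\<close>

definition boundary_op :: "complex \<Rightarrow> 'v \<Rightarrow> ('e \<times> nat \<Rightarrow> complex) \<Rightarrow> 'e \<times> nat \<Rightarrow> complex" where
  "boundary_op l v \<xi> = (\<xi> - proj_Y v \<xi>) + (cfscale l (proj_d S v \<xi>) - vert_B S v (proj_Y v \<xi>) - vert_C S v (proj_d S v \<xi>))"

lemma proj_Y:
  assumes "v \<in> net_V S" "\<xi> \<in> coord_space (vert_idx S v)"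
  shows "proj_Y v \<xi> \<in> vert_Y S v" "\<xi> - proj_Y v \<xi> \<in> orth_compl (vert_idx S v) (vert_Y S v)"
  unfolding proj_Y_def by (intro orth_projector_in orth_projector_diff finite_vert_idx Y_sub Y_coord assms)+

lemma boundary_rest_in:
  assumes v: "v \<in> net_V S" and \<xi>: "\<xi> \<in> coord_space (vert_idx S v)"
  shows "cfscale l (proj_d S v \<xi>) - vert_B S v (proj_Y v \<xi>) - vert_C S v (proj_d S v \<xi>) \<in> vert_Yd S v"
  by (intro cvs.subspace_diff[OF Yd_sub[OF v]] cvs.subspace_scale[OF Yd_sub[OF v]] proj_d_in[OF v \<xi>]
      linear_between_mem[OF B_linear[OF v] proj_Y(1)[OF v \<xi>]] linear_between_mem[OF C_linear[OF v] proj_d_in[OF v \<xi>]])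

lemma boundary_op_add:
  assumes v: "v \<in> net_V S" and x: "x \<in> coord_space (vert_idx S v)" and y: "y \<in> coord_space (vert_idx S v)"
  shows "boundary_op l v (x + y) = boundary_op l v x + boundary_op l v y"
proof -
  have PY: "proj_Y v (x + y) = proj_Y v x + proj_Y v y"
    unfolding proj_Y_def by (rule orth_projector_add[OF finite_vert_idx Y_sub[OF v] Y_coord[OF v] x y])
  show ?thesis
    unfolding boundary_op_def PY proj_d_add[OF v x y]
      linear_between_add[OF B_linear[OF v] proj_Y(1)[OF v x] proj_Y(1)[OF v y]]
      linear_between_add[OF C_linear[OF v] proj_d_in[OF v x] proj_d_in[OF v y]] cvs.scale_right_distrib
    by (simp add: algebra_simps)
qed

lemma boundary_op_scale:
  assumes v: "v \<in> net_V S" and x: "x \<in> coord_space (vert_idx S v)"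
  shows "boundary_op l v (cfscale c x) = cfscale c (boundary_op l v x)"
proof -
  have PY: "proj_Y v (cfscale c x) = cfscale c (proj_Y v x)"
    unfolding proj_Y_def by (rule orth_projector_scale[OF finite_vert_idx Y_sub[OF v] Y_coord[OF v] x])
  show ?thesis
    unfolding boundary_op_def PY proj_d_scale[OF v x]
      linear_between_scale[OF B_linear[OF v] proj_Y(1)[OF v x]]
      linear_between_scale[OF C_linear[OF v] proj_d_in[OF v x]] cvs.scale_right_distrib cvs.scale_right_diff_distrib cvs.scale_left_commute[of l c] ..
qed

text \<open>The component of \<open>\<xi>\<close> orthogonal to \<open>Y_v\<close> equals a vector of \<open>Y_v^(d)\<close>, a subspace of \<open>Y_v\<close>; so it is
  orthogonal to itself.\<close>

lemma boundary_op_solution: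
  assumes v: "v \<in> net_V S" and \<xi>: "\<xi> \<in> coord_space (vert_idx S v)" and g: "g \<in> vert_Yd S v" and eq: "boundary_op l v \<xi> = g"
  shows "\<xi> \<in> vert_Y S v" "cfscale l (proj_d S v \<xi>) - g = vert_B S v \<xi> + vert_C S v (proj_d S v \<xi>)"
proof -
  let ?r = "cfscale l (proj_d S v \<xi>) - vert_B S v (proj_Y v \<xi>) - vert_C S v (proj_d S v \<xi>)"
  let ?d = "\<xi> - proj_Y v \<xi>"
  have r: "?r \<in> vert_Yd S v" by (rule boundary_rest_in[OF v \<xi>])
  have dg: "?d = g - ?r" using eq unfolding boundary_op_def by (metis add_diff_cancel_right')
  have dY: "?d \<in> vert_Y S v" unfolding dg by (rule subsetD[OF Yd_Y[OF v] cvs.subspace_diff[OF Yd_sub[OF v] g r]])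
  have "herm_ip (vert_idx S v) ?d ?d = 0" using proj_Y(2)[OF v \<xi>] dY by (simp add: orth_compl_def)
  then have d0: "?d = 0"
    using herm_ip_pos[OF finite_vert_idx subsetD[OF Y_coord[OF v] dY]] by (cases "?d = 0") auto
  then have P: "proj_Y v \<xi> = \<xi>" by simp
  show "\<xi> \<in> vert_Y S v" using proj_Y(1)[OF v \<xi>] unfolding P .
  have "g = ?r" using dg d0 by simp
  then show "cfscale l (proj_d S v \<xi>) - g = vert_B S v \<xi> + vert_C S v (proj_d S v \<xi>)" unfolding P by simp
qed

lemma resolvent_solves:
  assumes Z: "Z \<in> L2d S"
    and h: "\<And>e i. e \<in> net_E S \<Longrightarrow> i < edge_dim S e \<Longrightarrow> primitive (edge_length S e) (d (e, i)) (h (e, i))"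
    and d: "\<And>e i. e \<in> net_E S \<Longrightarrow> i < edge_dim S e \<Longrightarrow> d (e, i) \<in> L2_space (edge_length S e)"
    and eq: "\<And>e i t. e \<in> net_E S \<Longrightarrow> i < edge_dim S e \<Longrightarrow> t \<in> {0..edge_length S e} \<Longrightarrow>
      (\<Sum>j<edge_dim S e. coef_M S e t $$ (i, j) * d (e, j) t) + (\<Sum>j<edge_dim S e. coef_N S e t $$ (i, j) * h (e, j) t) = l * h (e, i) t - fst Z (e, i) t"
    and b: "\<And>v. v \<in> net_V S \<Longrightarrow> boundary_op l v (trace_of v h) = snd Z v"
  shows "solves h d (h, \<lambda>v. proj_d S v (trace_of v h)) (scale_d l (h, \<lambda>v. proj_d S v (trace_of v h)) - Z)"
proof (rule solvesI)
  let ?z = "(h, \<lambda>v. proj_d S v (trace_of v h))"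
  show z: "?z \<in> L2d S"
    by (rule L2dI) (auto intro: proj_d_in trace_of_coord primitive_L2[OF h])
  show "scale_d l ?z - Z \<in> L2d S" by (intro L2d_minus L2d_scale z Z)
  {
    fix e i assume e: "e \<in> net_E S" "i < edge_dim S e"
    show "primitive (edge_length S e) (d (e, i)) (h (e, i))" "d (e, i) \<in> L2_space (edge_length S e)"
      by (rule h[OF e], rule d[OF e])
    show "AE t in leb (edge_length S e). h (e, i) t = fst ?z (e, i) t" by simp
    show "AE t in leb (edge_length S e). fst (scale_d l ?z - Z) (e, i) t =
       (\<Sum>j<edge_dim S e. coef_M S e t $$ (i, j) * d (e, j) t) + (\<Sum>j<edge_dim S e. coef_N S e t $$ (i, j) * fst ?z (e, j) t)"
    proof (rule AE_I2)
      fix t assume "t \<in> space (leb (edge_length S e))"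
      then have t: "t \<in> {0..edge_length S e}" by simp
      show "fst (scale_d l ?z - Z) (e, i) t =
       (\<Sum>j<edge_dim S e. coef_M S e t $$ (i, j) * d (e, j) t) + (\<Sum>j<edge_dim S e. coef_N S e t $$ (i, j) * fst ?z (e, j) t)"
        using eq[OF e t] by (simp add: fst_scale_d)
    qed
  next
    fix v assume v: "v \<in> net_V S"
    note B = boundary_op_solution[OF v trace_of_coord L2d_snd[OF Z v] b[OF v]]
    show "trace_of v h \<in> vert_Y S v" by (rule B(1))
    show "snd ?z v = proj_d S v (trace_of v h)" by simp
    show "snd (scale_d l ?z - Z) v = vert_B S v (trace_of v h) + vert_C S v (snd ?z v)"
      using B(2) by (simp only: snd_diff fun_diff_def snd_scale_d snd_conv)
  }
qed

end

text \<open>The boundary data of different vertices live in coordinate spaces that overlap; tagging them with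
  the vertex makes the sum over the vertices direct.\<close>

definition at_vertex :: "'v \<Rightarrow> ('b \<Rightarrow> complex) \<Rightarrow> 'v \<times> 'b \<Rightarrow> complex" where
  "at_vertex v \<xi> = (\<lambda>(v', j). if v' = v then \<xi> j else 0)"

lemma at_vertex_span:
  assumes "\<xi> \<in> cvs.span s" "at_vertex v ` s \<subseteq> cvs.span t"
  shows "at_vertex v \<xi> \<in> cvs.span t"
proof -
  have "cvs.subspace {\<xi>. at_vertex v \<xi> \<in> cvs.span t}"
  proof (rule cvs.subspaceI)
    have z: "at_vertex v 0 = 0" by (auto simp: at_vertex_def fun_eq_iff)
    show "0 \<in> {\<xi>. at_vertex v \<xi> \<in> cvs.span t}" unfolding mem_Collect_eq z by (rule cvs.span_zero)
    fix x y assume "x \<in> {\<xi>. at_vertex v \<xi> \<in> cvs.span t}" "y \<in> {\<xi>. at_vertex v \<xi> \<in> cvs.span t}"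
    then have "at_vertex v x + at_vertex v y \<in> cvs.span t" by (intro cvs.span_add) auto
    moreover have "at_vertex v (x + y) = at_vertex v x + at_vertex v y" by (auto simp: at_vertex_def fun_eq_iff)
    ultimately show "x + y \<in> {\<xi>. at_vertex v \<xi> \<in> cvs.span t}" by (simp only: mem_Collect_eq)
  next
    fix c x assume "x \<in> {\<xi>. at_vertex v \<xi> \<in> cvs.span t}"
    then have "cfscale c (at_vertex v x) \<in> cvs.span t" by (intro cvs.span_scale) auto
    moreover have "at_vertex v (cfscale c x) = cfscale c (at_vertex v x)" by (auto simp: at_vertex_def fun_eq_iff)
    ultimately show "cfscale c x \<in> {\<xi>. at_vertex v \<xi> \<in> cvs.span t}" by (simp only: mem_Collect_eq)
  qed
  then have "cvs.span s \<subseteq> {\<xi>. at_vertex v \<xi> \<in> cvs.span t}" using assms(2) by (intro cvs.span_minimal) auto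
  then show ?thesis using assms(1) by blast
qed


section \<open>Solving the boundary value problem\<close>

context hyperbolic_network
begin

text \<open>The direct sum over the vertices of \<open>Y_v^\<bottom> + Y_v^(d)\<close>.\<close>

definition boundary_data :: "('v \<times> 'e \<times> nat \<Rightarrow> complex) set" where
  "boundary_data = {F. (\<forall>v\<in>net_V S. \<exists>p\<in>orth_compl (vert_idx S v) (vert_Y S v). \<exists>q\<in>vert_Yd S v. (\<lambda>j. F (v, j)) = p + q) \<and>
     (\<forall>v j. v \<notin> net_V S \<longrightarrow> F (v, j) = 0)}"

lemma boundary_op_data:
  assumes v: "v \<in> net_V S" and \<xi>: "\<xi> \<in> coord_space (vert_idx S v)"
  shows "\<exists>p\<in>orth_compl (vert_idx S v) (vert_Y S v). \<exists>q\<in>vert_Yd S v. boundary_op l v \<xi> = p + q"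
  unfolding boundary_op_def by (rule bexI[OF bexI[OF refl boundary_rest_in[OF v \<xi>]] proj_Y(2)[OF v \<xi>]])

lemma finite_W_index: "finite (W_index S a b c)"
  unfolding W_index_def using finite_V by auto

text \<open>Placing the given bases of \<open>Y_v^\<bottom>\<close>, of the range of \<open>B_v\<close> and of the kernel of its adjoint at their
  vertices gives a spanning set. In the boundary family the range of \<open>B_v\<close> is represented by its image
  under the adjoint instead, with the same number of vectors.\<close>

lemma boundary_data_spanned:
  fixes w y wK :: "'v \<Rightarrow> nat \<Rightarrow> 'e \<times> nat \<Rightarrow> complex"
  assumes w: "\<And>v. v \<in> net_V S \<Longrightarrow> basis_family (orth_compl (vert_idx S v) (vert_Y S v)) {..<a v} (w v)"
    and y: "\<And>v. v \<in> net_V S \<Longrightarrow> basis_family (vert_B S v ` vert_Y S v) {..<b v} (y v)"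
    and wK: "\<And>v. v \<in> net_V S \<Longrightarrow> basis_family {\<eta> \<in> vert_Yd S v. adj_B S v \<eta> = 0} {..<c v} (wK v)"
  shows "\<exists>t. finite t \<and> card t \<le> card (W_index S a b c) \<and> boundary_data \<subseteq> cvs.span t"
proof -
  define g where "g = (\<lambda>(v, k). at_vertex v (case k of Perp i \<Rightarrow> w v i | Ran_adj j \<Rightarrow> y v j | Ker_adj m \<Rightarrow> wK v m))"
  define t where "t = g ` W_index S a b c"
  have "F \<in> cvs.span t" if F: "F \<in> boundary_data" for F
  proof -
    have "at_vertex v (\<lambda>j. F (v, j)) \<in> cvs.span t" if v: "v \<in> net_V S" for v
    proof -
      let ?s = "w v ` {..<a v} \<union> y v ` {..<b v} \<union> wK v ` {..<c v}"
      obtain p q where pq: "p \<in> orth_compl (vert_idx S v) (vert_Y S v)" "q \<in> vert_Yd S v" "(\<lambda>j. F (v, j)) = p + q"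
        using F v unfolding boundary_data_def by blast
      obtain r k where rk: "r \<in> vert_B S v ` vert_Y S v" "k \<in> vert_Yd S v" "adj_B S v k = 0" "q = r + k"
        using range_kernel_adjoint_decomposition[OF finite_vert_idx Y_sub[OF v] Y_coord[OF v] Yd_sub[OF v] Yd_coord[OF v] B_linear[OF v] pq(2)]
        unfolding adj_B_def by blast
      have sp: "cvs.span (w v ` {..<a v}) = orth_compl (vert_idx S v) (vert_Y S v)" "cvs.span (y v ` {..<b v}) = vert_B S v ` vert_Y S v"
        "cvs.span (wK v ` {..<c v}) = {\<eta> \<in> vert_Yd S v. adj_B S v \<eta> = 0}"
        using w[OF v] y[OF v] wK[OF v] by (simp_all add: basis_family_def)
      have "p \<in> cvs.span (w v ` {..<a v})" "r \<in> cvs.span (y v ` {..<b v})" "k \<in> cvs.span (wK v ` {..<c v})"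
        unfolding sp using pq(1) rk(1-3) by simp_all
      moreover have "cvs.span s \<subseteq> cvs.span ?s" if "s \<subseteq> ?s" for s using that by (rule cvs.span_mono)
      ultimately have "p \<in> cvs.span ?s" "r \<in> cvs.span ?s" "k \<in> cvs.span ?s" by blast+
      then have "(\<lambda>j. F (v, j)) \<in> cvs.span ?s" unfolding pq(3) rk(4) by (intro cvs.span_add)
      moreover have "at_vertex v ` ?s \<subseteq> cvs.span t"
      proof (rule order_trans[OF _ cvs.span_superset])
        have 1: "g (v, Perp i) \<in> t" if "i < a v" for i using that v by (auto simp: t_def W_index_def)
        have 2: "g (v, Ran_adj i) \<in> t" if "i < b v" for i using that v by (auto simp: t_def W_index_def)
        have 3: "g (v, Ker_adj i) \<in> t" if "i < c v" for i using that v by (auto simp: t_def W_index_def)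
        show "at_vertex v ` ?s \<subseteq> t" using 1 2 3 by (auto simp: g_def)
      qed
      ultimately show ?thesis by (rule at_vertex_span)
    qed
    then have "(\<Sum>v\<in>net_V S. at_vertex v (\<lambda>j. F (v, j))) \<in> cvs.span t" by (rule cvs.span_sum)
    moreover have "(\<Sum>v\<in>net_V S. at_vertex v (\<lambda>j. F (v, j))) = F"
    proof
      fix x :: "'v \<times> 'e \<times> nat"
      have "(\<Sum>v\<in>net_V S. at_vertex v (\<lambda>j. F (v, j))) x = (\<Sum>v\<in>net_V S. if v = fst x then F x else 0)"
        unfolding sum_fun_apply by (intro sum.cong refl) (auto simp: at_vertex_def split_beta)
      also have "\<dots> = F x" using F finite_V by (cases x) (auto simp: boundary_data_def)
      finally show "(\<Sum>v\<in>net_V S. at_vertex v (\<lambda>j. F (v, j))) x = F x" .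
    qed
    ultimately show ?thesis by simp
  qed
  moreover have "finite t" "card t \<le> card (W_index S a b c)"
    unfolding t_def using finite_W_index by (auto intro: card_image_le)
  ultimately show ?thesis by blast
qed

text \<open>A solution of the homogeneous problem is an eigenvector for an eigenvalue beyond the dissipativity
  bound, so its energy vanishes; being continuous, it vanishes at every point.\<close>

lemma resolvent_injective:
  fixes l \<omega> :: real
  assumes diss: "\<And>h d z y. solves h d z y \<Longrightarrow> Re (ip_d S y z) \<le> \<omega> * Re (ip_d S z z)" and l: "\<omega> < l"
    and h: "\<And>e i. e \<in> net_E S \<Longrightarrow> i < edge_dim S e \<Longrightarrow> primitive (edge_length S e) (d (e, i)) (h (e, i))"
    and d: "\<And>e i. e \<in> net_E S \<Longrightarrow> i < edge_dim S e \<Longrightarrow> d (e, i) \<in> L2_space (edge_length S e)"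
    and eq: "\<And>e i t. e \<in> net_E S \<Longrightarrow> i < edge_dim S e \<Longrightarrow> t \<in> {0..edge_length S e} \<Longrightarrow>
      (\<Sum>j<edge_dim S e. coef_M S e t $$ (i, j) * d (e, j) t) + (\<Sum>j<edge_dim S e. coef_N S e t $$ (i, j) * h (e, j) t) = of_real l * h (e, i) t"
    and b: "\<And>v. v \<in> net_V S \<Longrightarrow> boundary_op (of_real l) v (trace_of v h) = 0"
    and e: "e \<in> net_E S" "i < edge_dim S e" "t \<in> {0..edge_length S e}"
  shows "h (e, i) t = 0"
proof -
  let ?z = "(h, \<lambda>v. proj_d S v (trace_of v h))"
  have s: "solves h d ?z (scale_d (of_real l) ?z - 0)"
  proof (rule resolvent_solves[OF L2d_zero h d])
    fix e i t assume "e \<in> net_E S" "i < edge_dim S e" "t \<in> {0..edge_length S e}"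
    from eq[OF this] show "(\<Sum>j<edge_dim S e. coef_M S e t $$ (i, j) * d (e, j) t) + (\<Sum>j<edge_dim S e. coef_N S e t $$ (i, j) * h (e, j) t)
        = of_real l * h (e, i) t - fst 0 (e, i) t" by simp
  qed (simp_all add: b)
  have z: "?z \<in> L2d S" by (rule solvesD(1)[OF s])
  have "Re (ip_d S (scale_d (of_real l) ?z) ?z) \<le> \<omega> * Re (ip_d S ?z ?z)" using diss[OF s] unfolding diff_0_right .
  then have "l * Re (ip_d S ?z ?z) \<le> \<omega> * Re (ip_d S ?z ?z)" unfolding ip_d_scale[OF z z] by simp
  then have "(l - \<omega>) * Re (ip_d S ?z ?z) \<le> 0" by (simp add: algebra_simps)
  then have "Re (ip_d S ?z ?z) = 0" using l Re_ip_d_nonneg[OF z] by (simp add: mult_le_0_iff)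
  then have "norm_d S ?z = 0" by (simp add: norm_d_def)
  then have "AE t in leb (edge_length S e). h (e, i) t = 0" unfolding norm_d_null_iff[OF z] using e(1,2) by simp
  then have "cont_rep (edge_length S e) (\<lambda>t. 0) t = h (e, i) t"
    by (intro cont_rep_eq[OF length_pos[OF e(1)] primitive_continuous[OF h[OF e(1,2)]] _ e(3)]) simp
  moreover have "cont_rep (edge_length S e) (\<lambda>t. 0) t = 0"
    by (rule cont_rep_eq[OF length_pos[OF e(1)] _ _ e(3)]) auto
  ultimately show ?thesis by simp
qed

lemma fundamental_solutions:
  fixes l :: complex
  shows "\<exists>\<Phi> \<Psi>. \<forall>e\<in>net_E S. \<forall>k. \<forall>i<edge_dim S e. primitive (edge_length S e) (\<Psi> e k i) (\<Phi> e k i) \<and> \<Psi> e k i \<in> L2_space (edge_length S e) \<and>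
     \<Phi> e k i 0 = (if k = i then 1 else 0) \<and>
     (\<forall>t\<in>{0..edge_length S e}. (\<Sum>j<edge_dim S e. coef_M S e t $$ (i, j) * \<Psi> e k j t) + (\<Sum>j<edge_dim S e. coef_N S e t $$ (i, j) * \<Phi> e k j t) = l * \<Phi> e k i t)"
proof -
  let ?P = "\<lambda>e k u d. \<forall>i<edge_dim S e. primitive (edge_length S e) (d i) (u i) \<and> d i \<in> L2_space (edge_length S e) \<and>
     u i 0 = (if k = i then 1 else 0) \<and>
     (\<forall>t\<in>{0..edge_length S e}. (\<Sum>j<edge_dim S e. coef_M S e t $$ (i, j) * d j t) + (\<Sum>j<edge_dim S e. coef_N S e t $$ (i, j) * u j t) = l * u i t)"
  have "\<exists>ud. ?P e k (fst ud) (snd ud)" if "e \<in> net_E S" for e k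
    using edge_resolvent_equation[OF that, of "\<lambda>i t. 0" "\<lambda>i. if k = i then 1 else 0" l] L2_zero by simp
  then have "\<forall>ek\<in>net_E S \<times> (UNIV :: nat set). \<exists>ud. ?P (fst ek) (snd ek) (fst ud) (snd ud)" by auto
  from bchoice[OF this] obtain f where "\<forall>ek\<in>net_E S \<times> (UNIV :: nat set). ?P (fst ek) (snd ek) (fst (f ek)) (snd (f ek))" by blast
  then show ?thesis
    by (intro exI[of _ "\<lambda>e k. fst (f (e, k))"] exI[of _ "\<lambda>e k. snd (f (e, k))"]) auto
qed

text \<open>Solutions on the edges are sums of a particular solution and of fundamental solutions with arbitrary
  initial values \<open>c\<close>. The vertex conditions become a linear equation for \<open>c\<close>, uniquely solvable by
  \<open>resolvent_injective\<close>.\<close>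

lemma resolvent_surjective:
  fixes l \<omega> :: real
  assumes diss: "\<And>h d z y. solves h d z y \<Longrightarrow> Re (ip_d S y z) \<le> \<omega> * Re (ip_d S z z)" and l: "\<omega> < l"
    and T: "finite T" "card T \<le> card (all_idx S)" "boundary_data \<subseteq> cvs.span T"
    and Z: "Z \<in> L2d S"
  shows "\<exists>h d z. solves h d z (scale_d (of_real l) z - Z)"
proof -
  let ?l = "of_real l :: complex"
  obtain \<Phi> \<Psi> where \<Phi>: "\<forall>e\<in>net_E S. \<forall>k. \<forall>i<edge_dim S e. primitive (edge_length S e) (\<Psi> e k i) (\<Phi> e k i) \<and> \<Psi> e k i \<in> L2_space (edge_length S e) \<and>
     \<Phi> e k i 0 = (if k = i then 1 else 0) \<and>
     (\<forall>t\<in>{0..edge_length S e}. (\<Sum>j<edge_dim S e. coef_M S e t $$ (i, j) * \<Psi> e k j t) + (\<Sum>j<edge_dim S e. coef_N S e t $$ (i, j) * \<Phi> e k j t) = ?l * \<Phi> e k i t)"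
    using fundamental_solutions[of ?l] by blast
  let ?P = "\<lambda>e u d. \<forall>i<edge_dim S e. primitive (edge_length S e) (d i) (u i) \<and> d i \<in> L2_space (edge_length S e) \<and> u i 0 = 0 \<and>
     (\<forall>t\<in>{0..edge_length S e}. (\<Sum>j<edge_dim S e. coef_M S e t $$ (i, j) * d j t) + (\<Sum>j<edge_dim S e. coef_N S e t $$ (i, j) * u j t) = ?l * u i t - fst Z (e, i) t)"
  have "\<forall>e\<in>net_E S. \<exists>ud. ?P e (fst ud) (snd ud)"
  proof
    fix e assume e: "e \<in> net_E S"
    have "\<exists>u d. ?P e u d" by (rule edge_resolvent_equation[OF e L2d_fst[OF Z e]])
    then show "\<exists>ud. ?P e (fst ud) (snd ud)" by simp
  qed
  from bchoice[OF this] obtain f where f: "\<forall>e\<in>net_E S. ?P e (fst (f e)) (snd (f e))" by blast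
  define u d where "u = (\<lambda>(e, i). fst (f e) i)" and "d = (\<lambda>(e, i). snd (f e) i)"
  have u: "primitive (edge_length S e) (d (e, i)) (u (e, i))" "d (e, i) \<in> L2_space (edge_length S e)"
    "\<And>t. t \<in> {0..edge_length S e} \<Longrightarrow>
      (\<Sum>j<edge_dim S e. coef_M S e t $$ (i, j) * d (e, j) t) + (\<Sum>j<edge_dim S e. coef_N S e t $$ (i, j) * u (e, j) t) = ?l * u (e, i) t - fst Z (e, i) t"
    if "e \<in> net_E S" "i < edge_dim S e" for e i
    using f that by (simp_all add: u_def d_def)
  define hc where "hc c = (\<lambda>(e, i) t. \<Sum>k<edge_dim S e. c (e, k) * \<Phi> e k i t)" for c
  define dc where "dc c = (\<lambda>(e, i) t. \<Sum>k<edge_dim S e. c (e, k) * \<Psi> e k i t)" for c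
  have hc: "primitive (edge_length S e) (dc c (e, i)) (hc c (e, i))" "dc c (e, i) \<in> L2_space (edge_length S e)" "hc c (e, i) 0 = c (e, i)"
    if e: "e \<in> net_E S" "i < edge_dim S e" for c e i
  proof -
    show "primitive (edge_length S e) (dc c (e, i)) (hc c (e, i))"
      unfolding hc_def dc_def prod.case by (intro primitive_sum primitive_cmult) (use \<Phi> e in auto)
    show "dc c (e, i) \<in> L2_space (edge_length S e)"
      unfolding dc_def prod.case by (intro L2_sum L2_cmult) (use \<Phi> e in auto)
    have "hc c (e, i) 0 = (\<Sum>k<edge_dim S e. if k = i then c (e, k) else 0)"
      unfolding hc_def prod.case using \<Phi> e by (intro sum.cong refl) auto
    then show "hc c (e, i) 0 = c (e, i)" using e by simp
  qed
  have hceq: "(\<Sum>j<edge_dim S e. coef_M S e t $$ (i, j) * dc c (e, j) t) + (\<Sum>j<edge_dim S e. coef_N S e t $$ (i, j) * hc c (e, j) t) = ?l * hc c (e, i) t"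
    if e: "e \<in> net_E S" "i < edge_dim S e" "t \<in> {0..edge_length S e}" for c e i t
  proof -
    have "(\<Sum>j<edge_dim S e. X j * (\<Sum>k<edge_dim S e. c (e, k) * G k j)) = (\<Sum>k<edge_dim S e. c (e, k) * (\<Sum>j<edge_dim S e. X j * G k j))" for X and G :: "nat \<Rightarrow> nat \<Rightarrow> complex"
      unfolding sum_distrib_left by (subst sum.swap) (simp add: mult.left_commute)
    then have "(\<Sum>j<edge_dim S e. coef_M S e t $$ (i, j) * dc c (e, j) t) + (\<Sum>j<edge_dim S e. coef_N S e t $$ (i, j) * hc c (e, j) t)
       = (\<Sum>k<edge_dim S e. c (e, k) * ((\<Sum>j<edge_dim S e. coef_M S e t $$ (i, j) * \<Psi> e k j t) + (\<Sum>j<edge_dim S e. coef_N S e t $$ (i, j) * \<Phi> e k j t)))"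
      unfolding hc_def dc_def prod.case by (simp only: distrib_left sum.distrib)
    also have "\<dots> = (\<Sum>k<edge_dim S e. c (e, k) * (?l * \<Phi> e k i t))" using \<Phi> e by (intro sum.cong refl) auto
    finally show ?thesis by (simp add: hc_def sum_distrib_left mult.left_commute)
  qed
  have hc_add: "hc (c + c') = hc c + hc c'" for c c'
    by (auto simp: hc_def fun_eq_iff distrib_right sum.distrib)
  have hc_scale: "hc (cfscale k c) = (\<lambda>j t. k * hc c j t)" for k c
    by (auto simp: hc_def fun_eq_iff sum_distrib_left mult.assoc)
  define L where "L c = (\<lambda>(v, j). if v \<in> net_V S then boundary_op ?l v (trace_of v (hc c)) j else 0)" for c
  define F where "F = (\<lambda>(v, j). if v \<in> net_V S then (snd Z v - boundary_op ?l v (trace_of v u)) j else 0)"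
  have "\<exists>c\<in>coord_space (all_idx S). L c = F"
  proof (rule injective_linear_onto[OF finite_all_idx _ _ _ _ T])
    show "L (c + c') = L c + L c'" for c c'
    proof
      fix x :: "'v \<times> 'e \<times> nat"
      obtain v j where x: "x = (v, j)" by (cases x)
      show "L (c + c') x = (L c + L c') x"
        using boundary_op_add[OF _ trace_of_coord trace_of_coord, of v ?l "hc c" "hc c'"]
        by (simp add: L_def x hc_add trace_of_add)
    qed
    show "L (cfscale k c) = cfscale k (L c)" for k c
    proof
      fix x :: "'v \<times> 'e \<times> nat"
      obtain v j where x: "x = (v, j)" by (cases x)
      show "L (cfscale k c) x = cfscale k (L c) x"
        using boundary_op_scale[OF _ trace_of_coord, of v ?l k "hc c"]
        by (simp add: L_def x hc_scale trace_of_scale)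
    qed
    show "c = 0" if c: "c \<in> coord_space (all_idx S)" and 0: "L c = 0" for c
    proof
      fix x :: "'e \<times> nat"
      obtain e i where x: "x = (e, i)" by (cases x)
      have B: "boundary_op ?l v (trace_of v (hc c)) = 0" if "v \<in> net_V S" for v
      proof
        fix j show "boundary_op ?l v (trace_of v (hc c)) j = 0 j"
          using fun_cong[OF 0, of "(v, j)"] that by (simp add: L_def)
      qed
      show "c x = 0 x"
      proof (cases "x \<in> all_idx S")
        case True
        then have e: "e \<in> net_E S" "i < edge_dim S e" by (simp_all add: x all_idx_iff)
        have "hc c (e, i) 0 = 0"
          by (rule resolvent_injective[OF _ l hc(1,2) hceq B e], erule diss) (use length_pos[OF e(1)] in auto)
        then show ?thesis using hc(3)[OF e] by (simp add: x)
      next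
        case False
        then show ?thesis using c by (simp add: coord_space_def x)
      qed
    qed
    show "L c \<in> boundary_data" for c
      unfolding boundary_data_def L_def using boundary_op_data[OF _ trace_of_coord, of _ ?l "hc c"] by simp
    show "F \<in> boundary_data"
      unfolding boundary_data_def mem_Collect_eq
    proof (intro conjI ballI allI impI)
      fix v assume v: "v \<in> net_V S"
      obtain p q where pq: "p \<in> orth_compl (vert_idx S v) (vert_Y S v)" "q \<in> vert_Yd S v" "boundary_op ?l v (trace_of v u) = p + q"
        using boundary_op_data[OF v trace_of_coord] by blast
      have "(\<lambda>j. F (v, j)) = snd Z v - (p + q)"
        unfolding pq(3)[symmetric] using v by (simp add: F_def fun_diff_def)
      also have "\<dots> = - p + (snd Z v - q)" by simp
      finally have "(\<lambda>j. F (v, j)) = - p + (snd Z v - q)" .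
      moreover have "- p \<in> orth_compl (vert_idx S v) (vert_Y S v)" by (rule cvs.subspace_neg[OF orth_compl_subspace pq(1)])
      moreover have "snd Z v - q \<in> vert_Yd S v" by (rule cvs.subspace_diff[OF Yd_sub[OF v] L2d_snd[OF Z v] pq(2)])
      ultimately show "\<exists>p\<in>orth_compl (vert_idx S v) (vert_Y S v). \<exists>q\<in>vert_Yd S v. (\<lambda>j. F (v, j)) = p + q" by (rule_tac bexI bexI)+
    qed (simp add: F_def)
  qed
  then obtain c where c: "L c = F" by blast
  let ?h = "u + hc c" and ?d = "d + dc c"
  have "solves ?h ?d (?h, \<lambda>v. proj_d S v (trace_of v ?h)) (scale_d ?l (?h, \<lambda>v. proj_d S v (trace_of v ?h)) - Z)"
  proof (rule resolvent_solves[OF Z])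
    fix e i assume e: "e \<in> net_E S" "i < edge_dim S e"
    show "primitive (edge_length S e) (?d (e, i)) (?h (e, i))"
      using primitive_add[OF u(1)[OF e] hc(1)[OF e]] by (simp add: plus_fun_def)
    show "?d (e, i) \<in> L2_space (edge_length S e)"
      unfolding plus_fun_apply by (rule L2_add[OF u(2)[OF e] hc(2)[OF e]])
    fix t assume t: "t \<in> {0..edge_length S e}"
    show "(\<Sum>j<edge_dim S e. coef_M S e t $$ (i, j) * ?d (e, j) t) + (\<Sum>j<edge_dim S e. coef_N S e t $$ (i, j) * ?h (e, j) t) = ?l * ?h (e, i) t - fst Z (e, i) t"
      using u(3)[OF e t] hceq[OF e t, of c] by (simp add: distrib_left sum.distrib) (simp add: algebra_simps)
  next
    fix v assume v: "v \<in> net_V S"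
    have "boundary_op ?l v (trace_of v (hc c)) = snd Z v - boundary_op ?l v (trace_of v u)"
    proof
      fix j show "boundary_op ?l v (trace_of v (hc c)) j = (snd Z v - boundary_op ?l v (trace_of v u)) j"
        using fun_cong[OF c, of "(v, j)"] v by (simp add: L_def F_def)
    qed
    then show "boundary_op ?l v (trace_of v ?h) = snd Z v"
      unfolding trace_of_add boundary_op_add[OF v trace_of_coord trace_of_coord] by simp
  qed
  then show ?thesis by blast
qed

text \<open>Needed because the operator acts on functions rather than on equivalence classes.\<close>

lemma op_A_single_valued:
  assumes "(z, y) \<in> net_relation" "norm_d S z = 0"
  shows "norm_d S y = 0"
proof -
  interpret semi_hilbert_space scale_d "L2d S" "norm_d S" "\<lambda>z w. Re (ip_d S z w)" by (rule semi_hilbert_L2d)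
  obtain h d where s: "solves h d z y" using assms(1) by (auto simp: net_relation_def)
  note a = solvesD[OF s]
  have "solves h d 0 y" by (rule solves_null[OF s L2d_zero _ a(2)]) (simp_all add: assms(2))
  then have y: "(0, y) \<in> net_relation" unfolding net_relation_def by blast
  have "(0, 0) \<in> net_relation" unfolding net_relation_def using solves_zero by blast
  then have n: "norm_d S (0 - op_A S 0) = 0" "norm_d S (y - op_A S 0) = 0" and z: "0 \<in> op_dom S"
    using y unfolding graph_eq_net_relation[symmetric] by auto
  have "norm_d S (y - 0) \<le> norm_d S (y - op_A S 0) + norm_d S (op_A S 0 - 0)"
    by (rule p_tri_diff[OF a(2) op_A_L2d[OF z] L2d_zero])
  also have "norm_d S (op_A S 0 - 0) = norm_d S (0 - op_A S 0)" by (rule p_commute[OF op_A_L2d[OF z] L2d_zero])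
  finally show ?thesis using n p_nonneg[OF a(2)] by simp
qed

end

theorem theorem3p3:
  fixes S :: "('v, 'e) network"
    and a b c :: "'v \<Rightarrow> nat"
    and w y wK :: "'v \<Rightarrow> nat \<Rightarrow> 'e \<times> nat \<Rightarrow> complex"
  assumes "hyperbolic_network S"
    and "\<And>v. v \<in> net_V S \<Longrightarrow> basis_family (orth_compl (vert_idx S v) (vert_Y S v)) {..<a v} (w v)"
    and "\<And>v. v \<in> net_V S \<Longrightarrow> basis_family (vert_B S v ` vert_Y S v) {..<b v} (y v)"
    and "\<And>v. v \<in> net_V S \<Longrightarrow> basis_family {\<eta> \<in> vert_Yd S v. adj_B S v \<eta> = 0} {..<c v} (wK v)"
    and "basis_family (coord_space (all_idx S)) (W_index S a b c) (W_family S w y wK)"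
    and "\<exists>\<Lambda>::real. \<Lambda> \<ge> 0 \<and> (\<forall>v\<in>net_V S. \<forall>\<xi>\<in>vert_Y S v.
           Re (vert_ip S v (vert_T S v \<xi>) \<xi>) + 2 * Re (vert_ip S v (vert_Q S v (vert_B S v \<xi>)) \<xi>)
             - \<Lambda> * Re (vert_ip S v (vert_Q S v (proj_d S v \<xi>)) (proj_d S v \<xi>)) \<le> 0)"
  shows "generates_C0_semigroup (L2d S) scale_d (norm_d S) (op_dom S) (op_A S)"
proof -
  interpret hyperbolic_network S by fact
  interpret H: semi_hilbert_space scale_d "L2d S" "norm_d S" "\<lambda>z w. Re (ip_d S z w)" by (rule semi_hilbert_L2d)
  obtain \<Lambda> :: real where \<Lambda>: "\<Lambda> \<ge> 0" "\<And>v \<xi>. v \<in> net_V S \<Longrightarrow> \<xi> \<in> vert_Y S v \<Longrightarrow>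
       Re (vert_ip S v (vert_T S v \<xi>) \<xi>) + 2 * Re (vert_ip S v (vert_Q S v (vert_B S v \<xi>)) \<xi>)
         - \<Lambda> * Re (vert_ip S v (vert_Q S v (proj_d S v \<xi>)) (proj_d S v \<xi>)) \<le> 0"
    using assms(6) by blast
  obtain \<omega> where diss: "\<And>h d z y. solves h d z y \<Longrightarrow> Re (ip_d S y z) \<le> \<omega> * Re (ip_d S z z)"
    using quasi_dissipative[OF \<Lambda>(2,1)] by blast
  have card: "card (W_index S a b c) = card (all_idx S)"
    by (rule basis_family_card[OF finite_W_index finite_all_idx assms(5)])
  obtain T where T: "finite T" "card T \<le> card (W_index S a b c)" "boundary_data \<subseteq> cvs.span T"
    using boundary_data_spanned[OF assms(2-4)] by blast
  have "\<exists>T. C0_semigroup (L2d S) scale_d (norm_d S) T \<and> generator_graph (L2d S) scale_d (norm_d S) T = net_relation"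
  proof (rule H.lumer_phillips[OF net_relation_linear])
    show "Re (ip_d S y z) \<le> \<omega> * Re (ip_d S z z)" if "(z, y) \<in> net_relation" for z y
      using that diss unfolding net_relation_def by blast
    show "norm_d S y = 0" if "(z, y) \<in> net_relation" "norm_d S z = 0" for z y
      using that by (rule op_A_single_valued)
    show "\<exists>(z, y)\<in>net_relation. norm_d S (scale_d (of_real l) z - y - Z) = 0" if Z: "Z \<in> L2d S" and l: "\<omega> < l" for Z l
    proof -
      obtain h d z where s: "solves h d z (scale_d (of_real l) z - Z)"
        using resolvent_surjective[OF _ l T(1) T(2)[unfolded card] T(3) Z] diss by blast
      have "scale_d (of_real l) z - (scale_d (of_real l) z - Z) - Z = 0" by simp
      then show ?thesis using s by (intro bexI[of _ "(z, scale_d (of_real l) z - Z)"]) (auto simp: net_relation_def)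
    qed
  qed
  then show ?thesis
    unfolding generates_C0_semigroup_def graph_eq_net_relation using op_A_L2d by blast
qed

end
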